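(* Let $H$ be a Tonelli Hamiltonian on $\mathbb T^d$ with associated Lagrangian $L$. Let $(h_n)$ be mesh sizes and $(\tau_n)$ positive time steps such that $\tau_n\to0$ and $h_n\le C_*\tau_n^2$ for some constant $C_*>0$. Assume that the continuous Mather measure is unique and that the continuous Mañé and Mather sets coincide, $\widetilde{\mathcal N}_L=\widetilde{\mathcal M}_L$. Then the fully-discrete Mather sets $\widetilde{\mathcal M}_{h_n,\tau_n}$ converge in the Kuratowski sense to $\widetilde{\mathcal M}_L$ as $n\to\infty$.
   Context: $\mathbb T^d=\mathbb R^d/\mathbb Z^d$. $H\in C^2(\mathbb T^d\times\mathbb R^d)$ is a Tonelli Hamiltonian: $D^2_{pp}H(x,p)>0$ everywhere and $H$ is superlinear in $p$. The Tonelli Lagrangian is $L(x,v)=\sup_{p\in\mathbb R^d}\{p\cdot v-H(x,p)\}$; it is of class $C^2$, strictly convex in $v$, and superlinear: for every $K>0$ there is $C(K)\in\mathbb R$ with $L(x,v)\ge K|v|-C(K)$ for all $(x,v)$. The critical value $\alpha(H)$ is the unique constant for which $H(x,Du(x))=\alpha(H)$, $x\in\mathbb T^d$, admits a viscosity solution; $\mathcal S^-$ is the set of its viscosity solutions. A probability measure $\mu$ on $\mathbb T^d\times\mathbb R^d$ is closed if $\int v\cdot D\phi(x)\,d\mu(x,v)=0$ for all $\phi\in C^1(\mathbb T^d)$. A (continuous) Mather measure is a closed probability measure minimizing $\int L\,d\mu$ among all closed probability measures (the minimum equals $-\alpha(H)$). The continuous Mather set $\widetilde{\mathcal M}_L$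 is the closure of the union of the supports of all Mather measures. A curve $\gamma:\mathbb R\to\mathbb T^d$ (absolutely continuous; such curves are then automatically $C^1$) is $(u,L,\alpha(H))$-calibrated if $u(\gamma(b))-u(\gamma(a))=\int_a^bL(\gamma(s),\dot\gamma(s))\,ds+\alpha(H)(b-a)$ for all $a\le b$. Set $\widetilde{\mathcal I}(u)=\{(\gamma(t),\dot\gamma(t)):\gamma\ (u,L,\alpha(H))\text{-calibrated},\ t\in\mathbb R\}$; the Mañé set is $\widetilde{\mathcal N}_L=\bigcup_{u\in\mathcal S^-}\widetilde{\mathcal I}(u)\subset\mathbb T^d\times\mathbb R^d$. Mesh sizes are always of the form $h=1/N$ with $N\ge1$ an integer. The grid is $\mathcal G_h=\{x_i=ih \bmod \mathbb Z^d: i\in\{0,\dots,N-1\}^d\}$, and each grid point is identified with its representative in $[0,1)^d$. For $x_i,x_j\in\mathcal G_h$, $\ell\in\mathbb Z^d$ put $v_{ij}^\ell=(x_j+\ell-x_i)/\tau$. $\mathcal H_{h,\tau}$ is the set of fully-discrete holonomic probability measures: families $\mu=(\mu_{ij}^\ell)$ indexed by $x_i,x_j\in\mathcal G_h$, $\ell\in\mathbb Z^d$, with $\mu_{ij}^\ell\ge0$, $\sum_{i,j,\ell}\mu_{ij}^\ell=1$ and $\sum_{j,\ell}\mu_{ij}^\ell=\sum_{j,\ell}\mu_{ji}^\ell$ for every $x_i\in\mathcal G_h$. A fully-discrete Mather measure is a minimizer of $\sum_{i,j,\ell}L(x_i,v_{ij}^\ell)\mu_{ij}^\ell$ over $\mathcal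 H_{h,\tau}$. The fully-discrete Mather set $\widetilde{\mathcal M}_{h,\tau}\subset\mathbb T^d\times\mathbb R^d$ is the closure of the union, over all fully-discrete Mather measures $\mu$, of $\{(x_i,v_{ij}^\ell):\mu_{ij}^\ell>0\}$. Kuratowski limits: $z\in\limsup_kA_k$ iff there are $k_j\to\infty$ and $z_{k_j}\in A_{k_j}$ with $z_{k_j}\to z$; $z\in\liminf_kA_k$ iff there are $z_k\in A_k$ with $z_k\to z$. Kuratowski convergence of $A_k$ to $A$ means $\limsup_kA_k=\liminf_kA_k=A$. *)

theory Defs
  imports "HOL-Probability.Probability"
begin

section \<open>The flat torus\<close>

definition int_cong :: "real ^ 'd::finite \<Rightarrow> real ^ 'd \<Rightarrow> bool" where
  "int_cong a b \<longleftrightarrow> (\<forall>k. a $ k - b $ k \<in> \<int>)"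

lemma equivp_int_cong: "equivp int_cong"
proof (rule equivpI)
  show "reflp int_cong" by (auto simp: reflp_def int_cong_def)
  show "symp int_cong"
    unfolding symp_def int_cong_def by (metis Ints_minus minus_diff_eq)
  show "transp int_cong"
    unfolding transp_def int_cong_def
  proof (intro allI impI)
    fix a b c :: "real ^ 'd" and k
    assume "\<forall>k. a $ k - b $ k \<in> \<int>" "\<forall>k. b $ k - c $ k \<in> \<int>"
    then have "(a $ k - b $ k) + (b $ k - c $ k) \<in> \<int>" by (intro Ints_add) auto
    then show "a $ k - c $ k \<in> \<int>" by simp
  qed
qed

quotient_type (overloaded) 'd torus = "real ^ ('d::finite)" / int_cong
  morphisms rep_torus tproj
  by (rule equivp_int_cong)

lemma tproj_eq_iff: "tproj a = tproj b \<longleftrightarrow> (\<forall>k. a $ k - b $ k \<in> \<int>)"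
  using torus.abs_eq_iff[of a b] by (simp add: int_cong_def)

lemma tproj_surj: "\<exists>a. tproj a = x"
  using Quotient3_abs_rep[OF Quotient3_torus] by blast

lemma tproj_add_diff:
  assumes "tproj a = tproj a'"
  shows "tproj (b + (a' - a)) = tproj b"
  using assms unfolding tproj_eq_iff
  by simp (metis Ints_minus minus_diff_eq)

lemma closed_fibre: "closed {a. tproj a = x}"
proof -
  obtain b where b: "tproj b = x" using tproj_surj by blast
  have "{a. tproj a = x} = (\<Inter>k. (\<lambda>a. a $ k - b $ k) -` (\<int> :: real set))"
    unfolding b[symmetric] by (auto simp: tproj_eq_iff)
  also have "closed \<dots>"
    by (intro closed_INT ballI closed_vimage closed_Ints continuous_intros)
  finally show ?thesis .
qed

text \<open>The quotient metric: the distance between two cosets of the integer lattice.\<close>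

instantiation torus :: (finite) metric_space
begin

definition dist_torus :: "'a torus \<Rightarrow> 'a torus \<Rightarrow> real" where
  "dist_torus x y = setdist {a. tproj a = x} {b. tproj b = y}"

definition uniformity_torus :: "('a torus \<times> 'a torus) filter" where
  "uniformity_torus = (INF e\<in>{0 <..}. principal {(x, y). dist x y < e})"

definition open_torus :: "'a torus set \<Rightarrow> bool" where
  "open_torus U = (\<forall>x\<in>U. eventually (\<lambda>(x', y). x' = x \<longrightarrow> y \<in> U) uniformity)"

lemma dist_torus_le: "dist (tproj a) (tproj b) \<le> dist a b"
  unfolding dist_torus_def by (rule setdist_le_dist) auto

lemma dist_torus_attained:
  "\<exists>b. tproj b = y \<and> dist (tproj a) y = dist a b"
proof -
  let ?F = "{b. tproj b = y}"
  have ne: "?F \<noteq> {}" using tproj_surj by blast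
  obtain b where b: "b \<in> ?F" "infdist a ?F = dist a b"
    using infdist_attains_inf[OF closed_fibre ne] by blast
  have "dist a b \<le> setdist {a'. tproj a' = tproj a} ?F"
  proof (rule le_setdistI)
    fix a' c assume a': "a' \<in> {a'. tproj a' = tproj a}" and c: "c \<in> ?F"
    have "tproj (c + (a - a')) = tproj c"
      using a' by (intro tproj_add_diff) simp
    with c have "c + (a - a') \<in> ?F" by simp
    then have "infdist a ?F \<le> dist a (c + (a - a'))" by (rule infdist_le)
    also have "\<dots> = dist a' c" by (simp add: dist_norm algebra_simps)
    finally show "dist a b \<le> dist a' c" using b by simp
  qed (use ne in auto)
  then show ?thesis
    using b dist_torus_le[of a b] unfolding dist_torus_def by force
qed

instance
proof
  show "uniformity = (INF e\<in>{0 <..}. principal {(x, y :: 'a torus). dist x y < e})"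
    by (rule uniformity_torus_def)
  show "open U = (\<forall>x\<in>U. eventually (\<lambda>(x', y). x' = x \<longrightarrow> y \<in> U) uniformity)"
    for U :: "'a torus set"
    by (rule open_torus_def)
  show "dist x y = 0 \<longleftrightarrow> x = y" for x y :: "'a torus"
  proof -
    obtain a where a: "tproj a = x" using tproj_surj by blast
    obtain b where b: "tproj b = y" "dist (tproj a) y = dist a b"
      using dist_torus_attained by blast
    have "dist (tproj a) (tproj a) = 0"
      using dist_torus_le[of a a] setdist_pos_le unfolding dist_torus_def by (simp add: order_antisym)
    with a b show ?thesis by auto
  qed
  show "dist x y \<le> dist x z + dist y z" for x y z :: "'a torus"
  proof -
    have sym: "dist z y = dist y z"
      unfolding dist_torus_def by (rule setdist_sym)
    obtain a where a: "tproj a = x" using tproj_surj by blast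
    obtain c where c: "tproj c = z" "dist (tproj a) z = dist a c"
      using dist_torus_attained by blast
    obtain b where b: "tproj b = y" "dist (tproj c) y = dist c b"
      using dist_torus_attained by blast
    have "dist x y \<le> dist a b" using dist_torus_le[of a b] a b by simp
    also have "\<dots> \<le> dist a c + dist c b" by (rule dist_triangle)
    finally show ?thesis using a b c sym by simp
  qed
qed

end

lemma continuous_on_tproj: "continuous_on A tproj"
  unfolding continuous_on_iff using dist_torus_le by (metis le_less_trans)

text \<open>The metric induces the quotient topology.\<close>

lemma open_torus_iff: "open U \<longleftrightarrow> open (tproj -` U)"
proof
  assume "open U"
  then show "open (tproj -` U)"
    using continuous_on_tproj[of UNIV] open_vimage by blast
next
  assume *: "open (tproj -` U)"
  show "open U"
    unfolding open_dist
  proof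
    fix x assume "x \<in> U"
    obtain a where a: "tproj a = x" using tproj_surj by blast
    with \<open>x \<in> U\<close> * obtain e where e: "e > 0" "\<And>b. dist b a < e \<Longrightarrow> tproj b \<in> U"
      unfolding open_dist by (metis vimage_eq)
    have "y \<in> U" if "dist y x < e" for y
    proof -
      obtain b where "tproj b = y" "dist (tproj a) y = dist a b"
        using dist_torus_attained by blast
      with that a e(2)[of b] show ?thesis by (simp add: dist_commute)
    qed
    with e(1) show "\<exists>e>0. \<forall>y. dist y x < e \<longrightarrow> y \<in> U" by blast
  qed
qed


section \<open>Differentiability\<close>

definition C2_derivs ::
  "('a::real_normed_vector \<Rightarrow> real) \<Rightarrow> ('a \<Rightarrow> 'a \<Rightarrow>\<^sub>L real) \<Rightarrow> ('a \<Rightarrow> 'a \<Rightarrow>\<^sub>L 'a \<Rightarrow>\<^sub>L real) \<Rightarrow> bool" where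
  "C2_derivs f f' f'' \<longleftrightarrow>
     (\<forall>z. (f has_derivative blinfun_apply (f' z)) (at z)) \<and>
     (\<forall>z. (f' has_derivative blinfun_apply (f'' z)) (at z)) \<and>
     continuous_on UNIV f''"

text \<open>\<open>\<phi>\<close> is a \<open>C\<^sup>1\<close> function on the torus with gradient field \<open>D\<phi>\<close>.\<close>

definition C1_gradient :: "('d::finite torus \<Rightarrow> real) \<Rightarrow> ('d torus \<Rightarrow> real ^ 'd) \<Rightarrow> bool" where
  "C1_gradient \<phi> D\<phi> \<longleftrightarrow>
     (\<forall>a. ((\<lambda>b. \<phi> (tproj b)) has_derivative (\<lambda>w. D\<phi> (tproj a) \<bullet> w)) (at a)) \<and>
     continuous_on UNIV D\<phi>"

text \<open>
  \<open>w\<close> is the velocity at time \<open>t\<close> of a curve in the torus.  The lift \<open>g\<close> need not be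
  continuous away from \<open>t\<close>; two lifts differentiable at \<open>t\<close> differ by a constant near \<open>t\<close>,
  so \<open>w\<close> is unique.
\<close>

definition has_velocity :: "(real \<Rightarrow> 'd::finite torus) \<Rightarrow> real ^ 'd \<Rightarrow> real \<Rightarrow> bool" where
  "has_velocity \<gamma> w t \<longleftrightarrow>
     (\<exists>g. (\<forall>s. tproj (g s) = \<gamma> s) \<and> (g has_vector_derivative w) (at t))"

definition velocity :: "(real \<Rightarrow> 'd::finite torus) \<Rightarrow> real \<Rightarrow> real ^ 'd" where
  "velocity \<gamma> t = (THE w. has_velocity \<gamma> w t)"

definition abs_cont_on :: "real \<Rightarrow> real \<Rightarrow> (real \<Rightarrow> 'a::metric_space) \<Rightarrow> bool" where
  "abs_cont_on a b \<gamma> \<longleftrightarrow>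
     (\<forall>\<epsilon>>0. \<exists>\<delta>>0. \<forall>(m::nat) s t.
        (\<forall>k<m. a \<le> s k \<and> s k \<le> t k \<and> t k \<le> b) \<and>
        (\<forall>k. Suc k < m \<longrightarrow> t k \<le> s (Suc k)) \<and>
        (\<Sum>k<m. t k - s k) < \<delta> \<longrightarrow>
        (\<Sum>k<m. dist (\<gamma> (s k)) (\<gamma> (t k))) < \<epsilon>)"


section \<open>Hamiltonian and Lagrangian\<close>

text \<open>Positive definiteness of \<open>D\<^sup>2\<^sub>p\<^sub>pH\<close> is that of the second derivative on the directions \<open>(0, w)\<close>.\<close>

definition tonelli :: "('d::finite torus \<Rightarrow> real ^ 'd \<Rightarrow> real) \<Rightarrow> bool" where
  "tonelli H \<longleftrightarrow>
     (\<exists>D D2. C2_derivs (\<lambda>(a, p). H (tproj a) p) D D2 \<and>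
        (\<forall>a p w. w \<noteq> 0 \<longrightarrow> blinfun_apply (blinfun_apply (D2 (a, p)) (0, w)) (0, w) > 0)) \<and>
     (\<forall>K>0. \<exists>C. \<forall>x p. H x p \<ge> K * norm p - C)"

definition lagrangian :: "('d::finite torus \<Rightarrow> real ^ 'd \<Rightarrow> real) \<Rightarrow> 'd torus \<Rightarrow> real ^ 'd \<Rightarrow> real" where
  "lagrangian H x v = (SUP p. p \<bullet> v - H x p)"

definition viscosity_solution ::
  "('d::finite torus \<Rightarrow> real ^ 'd \<Rightarrow> real) \<Rightarrow> real \<Rightarrow> ('d torus \<Rightarrow> real) \<Rightarrow> bool" where
  "viscosity_solution H c u \<longleftrightarrow>
     continuous_on UNIV u \<and>
     (\<forall>\<phi> D\<phi> x. C1_gradient \<phi> D\<phi> \<longrightarrow>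
        ((\<forall>\<^sub>F y in nhds x. u y - \<phi> y \<le> u x - \<phi> x) \<longrightarrow> H x (D\<phi> x) \<le> c) \<and>
        ((\<forall>\<^sub>F y in nhds x. u y - \<phi> y \<ge> u x - \<phi> x) \<longrightarrow> H x (D\<phi> x) \<ge> c))"

definition critical_value :: "('d::finite torus \<Rightarrow> real ^ 'd \<Rightarrow> real) \<Rightarrow> real" where
  "critical_value H = (THE c. \<exists>u. viscosity_solution H c u)"


section \<open>Continuous Mather and Mane sets\<close>

text \<open>\<open>has_bochner_integral\<close> includes the existence of the integral.\<close>

definition closed_measure :: "('d::finite torus \<times> (real ^ 'd)) measure \<Rightarrow> bool" where
  "closed_measure \<mu> \<longleftrightarrow>
     sets \<mu> = sets borel \<and> prob_space \<mu> \<and>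
     (\<forall>\<phi> D\<phi>. C1_gradient \<phi> D\<phi> \<longrightarrow> has_bochner_integral \<mu> (\<lambda>(x, v). v \<bullet> D\<phi> x) 0)"

text \<open>
  A Tonelli Lagrangian is continuous and bounded below, so its integral fails to be finite
  only by being \<open>+\<infinity>\<close>; the Bochner integral would return \<open>0\<close> there.  The same applies to the
  series in \<open>discrete_action\<close> below.
\<close>

definition action ::
  "('d::finite torus \<Rightarrow> real ^ 'd \<Rightarrow> real) \<Rightarrow> ('d torus \<times> (real ^ 'd)) measure \<Rightarrow> ereal" where
  "action L \<mu> =
     (if integrable \<mu> (\<lambda>(x, v). L x v) then ereal (\<integral>(x, v). L x v \<partial>\<mu>) else \<infinity>)"

definition mather_measure ::
  "('d::finite torus \<Rightarrow> real ^ 'd \<Rightarrow> real) \<Rightarrow> ('d torus \<times> (real ^ 'd)) measure \<Rightarrow> bool" where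
  "mather_measure L \<mu> \<longleftrightarrow>
     closed_measure \<mu> \<and> (\<forall>\<nu>. closed_measure \<nu> \<longrightarrow> action L \<mu> \<le> action L \<nu>)"

definition measure_support :: "'a::topological_space measure \<Rightarrow> 'a set" where
  "measure_support \<mu> = {z. \<forall>U. open U \<and> z \<in> U \<longrightarrow> emeasure \<mu> U > 0}"

definition mather_set ::
  "('d::finite torus \<Rightarrow> real ^ 'd \<Rightarrow> real) \<Rightarrow> ('d torus \<times> (real ^ 'd)) set" where
  "mather_set L = closure (\<Union>\<mu>\<in>{\<mu>. mather_measure L \<mu>}. measure_support \<mu>)"

definition calibrated ::
  "('d::finite torus \<Rightarrow> real) \<Rightarrow> ('d torus \<Rightarrow> real ^ 'd \<Rightarrow> real) \<Rightarrow> real \<Rightarrow> (real \<Rightarrow> 'd torus) \<Rightarrow> bool" where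
  "calibrated u L c \<gamma> \<longleftrightarrow>
     (\<forall>a b. a \<le> b \<longrightarrow>
        abs_cont_on a b \<gamma> \<and>
        (\<lambda>s. L (\<gamma> s) (velocity \<gamma> s)) absolutely_integrable_on {a..b} \<and>
        u (\<gamma> b) - u (\<gamma> a) = integral {a..b} (\<lambda>s. L (\<gamma> s) (velocity \<gamma> s)) + c * (b - a))"

definition mane_I ::
  "('d::finite torus \<Rightarrow> real ^ 'd \<Rightarrow> real) \<Rightarrow> ('d torus \<Rightarrow> real) \<Rightarrow> ('d torus \<times> (real ^ 'd)) set" where
  "mane_I H u =
     {(\<gamma> t, w) | \<gamma> t w. calibrated u (lagrangian H) (critical_value H) \<gamma> \<and> has_velocity \<gamma> w t}"

definition mane_set ::
  "('d::finite torus \<Rightarrow> real ^ 'd \<Rightarrow> real) \<Rightarrow> ('d torus \<times> (real ^ 'd)) set" where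
  "mane_set H = (\<Union>u\<in>{u. viscosity_solution H (critical_value H) u}. mane_I H u)"


section \<open>Fully-discrete Mather sets for the mesh size 1/N\<close>

definition grid_index :: "nat \<Rightarrow> (nat ^ 'd::finite) set" where
  "grid_index N = {i. \<forall>k. i $ k < N}"

definition grid_point :: "nat \<Rightarrow> nat ^ 'd::finite \<Rightarrow> real ^ 'd" where
  "grid_point N i = (\<chi> k. real (i $ k) / real N)"

definition discrete_velocity ::
  "nat \<Rightarrow> real \<Rightarrow> nat ^ 'd::finite \<Rightarrow> nat ^ 'd \<Rightarrow> int ^ 'd \<Rightarrow> real ^ 'd" where
  "discrete_velocity N \<tau> i j l =
     (1 / \<tau>) *\<^sub>R (grid_point N j + (\<chi> k. real_of_int (l $ k)) - grid_point N i)"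

text \<open>Families are total functions; only their values on grid indices matter.\<close>

definition holonomic ::
  "nat \<Rightarrow> (nat ^ 'd::finite \<Rightarrow> nat ^ 'd \<Rightarrow> int ^ 'd \<Rightarrow> real) \<Rightarrow> bool" where
  "holonomic N \<mu> \<longleftrightarrow>
     (\<forall>i\<in>grid_index N. \<forall>j\<in>grid_index N. \<forall>l. \<mu> i j l \<ge> 0) \<and>
     ((\<lambda>(i, j, l). \<mu> i j l) has_sum 1) (grid_index N \<times> grid_index N \<times> UNIV) \<and>
     (\<forall>i\<in>grid_index N.
        (\<Sum>\<^sub>\<infinity>(j, l)\<in>grid_index N \<times> UNIV. \<mu> i j l) = (\<Sum>\<^sub>\<infinity>(j, l)\<in>grid_index N \<times> UNIV. \<mu> j i l))"

definition discrete_action ::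
  "('d::finite torus \<Rightarrow> real ^ 'd \<Rightarrow> real) \<Rightarrow> nat \<Rightarrow> real \<Rightarrow>
     (nat ^ 'd \<Rightarrow> nat ^ 'd \<Rightarrow> int ^ 'd \<Rightarrow> real) \<Rightarrow> ereal" where
  "discrete_action L N \<tau> \<mu> =
     (let f = (\<lambda>(i, j, l). L (tproj (grid_point N i)) (discrete_velocity N \<tau> i j l) * \<mu> i j l);
          A = grid_index N \<times> grid_index N \<times> UNIV
      in if f summable_on A then ereal (infsum f A) else \<infinity>)"

definition discrete_mather_measure ::
  "('d::finite torus \<Rightarrow> real ^ 'd \<Rightarrow> real) \<Rightarrow> nat \<Rightarrow> real \<Rightarrow>
     (nat ^ 'd \<Rightarrow> nat ^ 'd \<Rightarrow> int ^ 'd \<Rightarrow> real) \<Rightarrow> bool" where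
  "discrete_mather_measure L N \<tau> \<mu> \<longleftrightarrow>
     holonomic N \<mu> \<and>
     (\<forall>\<nu>. holonomic N \<nu> \<longrightarrow> discrete_action L N \<tau> \<mu> \<le> discrete_action L N \<tau> \<nu>)"

definition discrete_mather_set ::
  "('d::finite torus \<Rightarrow> real ^ 'd \<Rightarrow> real) \<Rightarrow> nat \<Rightarrow> real \<Rightarrow> ('d torus \<times> (real ^ 'd)) set" where
  "discrete_mather_set L N \<tau> =
     closure (\<Union>\<mu>\<in>{\<mu>. discrete_mather_measure L N \<tau> \<mu>}.
       {(tproj (grid_point N i), discrete_velocity N \<tau> i j l) | i j l.
          i \<in> grid_index N \<and> j \<in> grid_index N \<and> \<mu> i j l > 0})"


section \<open>Kuratowski convergence\<close>

definition kuratowski_limsup :: "(nat \<Rightarrow> 'a::topological_space set) \<Rightarrow> 'a set" where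
  "kuratowski_limsup A =
     {z. \<exists>k w. filterlim k at_top sequentially \<and> (\<forall>j. w j \<in> A (k j)) \<and> w \<longlonglongrightarrow> z}"

definition kuratowski_liminf :: "(nat \<Rightarrow> 'a::topological_space set) \<Rightarrow> 'a set" where
  "kuratowski_liminf A = {z. \<exists>w. (\<forall>k. w k \<in> A k) \<and> w \<longlonglongrightarrow> z}"

definition kuratowski_converges :: "(nat \<Rightarrow> 'a::topological_space set) \<Rightarrow> 'a set \<Rightarrow> bool" where
  "kuratowski_converges A B \<longleftrightarrow> kuratowski_limsup A = B \<and> kuratowski_liminf A = B"

end

theory Submission
  imports Defs "HOL-Complex_Analysis.Great_Picard"
begin

text \<open>
  On the grid, weak KAM duality is a finite ergodic problem: it has a solution \<open>U\<close> with constant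
  \<open>c\<close>, and a holonomic measure is minimizing iff it charges only calibrated steps, those with
  \<open>U b - U a = \<tau> (L(a, (b - a) / \<tau>) + c)\<close>.  By holonomy each such step lies on a bi-infinite
  calibrated chain.  Moving one point of a chain by a grid vector of length of order \<open>\<tau>\<^sup>2\<close>, which
  is possible because \<open>h \<le> C \<tau>\<^sup>2\<close>, shows that consecutive velocities differ by \<open>O(\<tau>)\<close>.  Hence, along
  a subsequence, \<open>U\<close> converges to a viscosity solution \<open>u\<close>, \<open>c\<close> to the critical value, and the chains
  together with their velocities to \<open>C\<^sup>1\<close> curves calibrated by \<open>u\<close>.  So upper limits of the discrete
  Mather sets lie in the Mane set.

  Conversely, weak limits of discrete Mather measures are closed and have action minus the critical
  value, which is minimal since mollifying \<open>u\<close> yields \<open>C\<^sup>1\<close> approximate subsolutions.  By uniqueness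
  the limit is the Mather measure, and points of its support are limits of points charged by the
  discrete measures.
\<close>

section \<open>The lifted torus and the regularity of a Tonelli Hamiltonian\<close>

text \<open>The exponent in \<open>h \<le> C * \<tau>^2\<close> comes from one estimate. Moving the
  middle point of two calibrated steps by s changes the two velocities by s / \<tau> in opposite
  directions. Comparing actions bounds the jump of the conjugate momentum by a multiple of s /
  \<tau> (second-order term of the Lagrangian) plus a multiple of \<tau> (change of base point);
  this is O(\<tau>) once the grid admits displacements s = O(\<tau>^2). Momenta are compared because
  strong convexity of \<open>H\<close> on bounded sets dualizes to semiconcavity of the Lagrangian;
  the locally Lipschitz gradient \<open>Hp\<close> leads back to velocities.

  Positions, velocities and values of \<open>U\<close> then converge together, so calibration passes
  to the limit as an identity between derivatives. The functions \<open>U\<close> are Lipschitz only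
  up to an error of order \<tau>; their limit is therefore taken as continuous convergence, along
  arbitrary convergent sequences of points. Weak compactness of measures is transported from the
  real line, where Helly's theorem applies, to phase space by a space-filling curve.\<close>

definition int_vec :: "real ^ 'd::finite \<Rightarrow> bool" where
  "int_vec z \<longleftrightarrow> (\<forall>k. z $ k \<in> \<int>)"

lemma tproj_eq_int_vec: "tproj a = tproj b \<longleftrightarrow> int_vec (a - b)"
  by (simp add: tproj_eq_iff int_vec_def)

lemma int_vec_0: "int_vec 0"
  and int_vec_diff: "int_vec a \<Longrightarrow> int_vec b \<Longrightarrow> int_vec (a - b)"
  and int_vec_minus: "int_vec a \<Longrightarrow> int_vec (- a)"
  by (auto simp: int_vec_def)

lemma tproj_add_int_vec: "int_vec z \<Longrightarrow> tproj (a + z) = tproj a"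
  by (simp add: tproj_eq_int_vec)

lemma int_vec_reduce: "\<exists>z. int_vec z \<and> a - z \<in> cbox 0 (1 :: real ^ 'd::finite)"
proof -
  define z :: "real ^ 'd" where "z = (\<chi> k. of_int \<lfloor>a $ k\<rfloor>)"
  have "int_vec z" by (simp add: int_vec_def z_def)
  moreover have "a - z \<in> cbox 0 1"
    unfolding mem_box_cart z_def by (auto intro: less_imp_le simp: algebra_simps) linarith
  ultimately show ?thesis by blast
qed

lemma tproj_lift_cbox: "\<exists>a \<in> cbox 0 (1 :: real ^ 'd::finite). tproj a = x"
proof -
  obtain a where a: "tproj a = x" using tproj_surj by blast
  obtain z where z: "int_vec z" "a - z \<in> cbox 0 1" using int_vec_reduce by blast
  have "tproj (a - z) = x"
    using tproj_add_int_vec[of "- z" a] z a by (simp add: int_vec_minus)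
  with z show ?thesis by blast
qed

lemma compact_torus: "compact (UNIV :: 'd::finite torus set)"
proof -
  have "tproj ` cbox 0 (1 :: real ^ 'd) = UNIV"
    using tproj_lift_cbox[where 'd='d] by (intro set_eqI) (simp add: image_iff Bex_def eq_commute)
  then show ?thesis
    by (metis compact_cbox compact_continuous_image continuous_on_tproj)
qed

lemma dist_torus_lift: "\<exists>a b. tproj a = x \<and> tproj b = y \<and> dist x y = norm (a - b)"
  using tproj_surj[of x] dist_torus_attained[of y] by (metis dist_norm)

lemma tproj_tendsto: "(f \<longlongrightarrow> a) F \<Longrightarrow> ((\<lambda>x. tproj (f x)) \<longlongrightarrow> tproj a) F"
  by (rule continuous_on_tendsto_compose[OF continuous_on_tproj[of UNIV]]) auto

text \<open>By periodicity the position may be taken in the unit cube, where continuity and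
  compactness apply. This makes the Lipschitz constants of \<open>H\<close> and \<open>Hp\<close>
  uniform in the position, depending only on the momentum bound.\<close>

lemma bounded_periodic:
  fixes F :: "(real ^ 'd::finite) \<times> (real ^ 'd) \<Rightarrow> 'b::real_normed_vector"
  assumes cont: "continuous_on UNIV F" and per: "\<And>a p z. int_vec z \<Longrightarrow> F (a + z, p) = F (a, p)"
  obtains B where "B \<ge> 0" "\<And>a p. norm p \<le> P \<Longrightarrow> norm (F (a, p)) \<le> B"
proof -
  have "compact (F ` (cbox 0 1 \<times> cball 0 P))"
    by (intro compact_continuous_image compact_Times continuous_on_subset[OF cont]) auto
  then have "bounded (F ` (cbox 0 1 \<times> cball 0 P))" by (rule compact_imp_bounded)
  then obtain B where B: "\<And>y. y \<in> F ` (cbox 0 1 \<times> cball 0 P) \<Longrightarrow> norm y \<le> B"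
    unfolding bounded_iff by blast
  have "norm (F (a, p)) \<le> max B 0" if "norm p \<le> P" for a p
  proof -
    obtain z where z: "int_vec z" "a - z \<in> cbox 0 1" using int_vec_reduce by blast
    have "F (a, p) = F (a - z, p)" using per[OF z(1), of "a - z" p] by simp
    with B[of "F (a - z, p)"] z that show ?thesis by auto
  qed
  then show ?thesis using that[of "max B 0"] by simp
qed

section \<open>Taylor's formula and uniform constants for the Hamiltonian\<close>

lemma blinfun_quadratic:
  "blinfun_apply (blinfun_apply B (r *\<^sub>R z)) (r *\<^sub>R z) = r\<^sup>2 * blinfun_apply (blinfun_apply B z) z"
  for B :: "'a::real_normed_vector \<Rightarrow>\<^sub>L 'a \<Rightarrow>\<^sub>L real"
  by (simp add: blinfun.scaleR_right blinfun.scaleR_left power2_eq_square)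

text \<open>Along the segment \<open>c\<close>, the function \<open>k\<close> subtracts from
  \<open>f\<close> its first-order part at the start and the parabola \<open>m * t^2 / 2\<close>.
  Its derivative \<open>k1\<close> starts at 0 and is nondecreasing by \<open>low\<close>, so
  \<open>k\<close> is nondecreasing on the unit interval.\<close>

lemma second_order_lower_bound:
  fixes f :: "'a::real_normed_vector \<Rightarrow> real"
  assumes D: "\<And>z. (f has_derivative blinfun_apply (D z)) (at z)"
    and D2: "\<And>z. (D has_derivative blinfun_apply (D2 z)) (at z)"
    and low: "\<And>t. 0 \<le> t \<Longrightarrow> t \<le> 1 \<Longrightarrow> m \<le> blinfun_apply (blinfun_apply (D2 (z + t *\<^sub>R w)) w) w"
  shows "f z + blinfun_apply (D z) w + m / 2 \<le> f (z + w)"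
proof -
  define c where "c = (\<lambda>t::real. z + t *\<^sub>R w)"
  have c: "(c has_derivative (\<lambda>t. t *\<^sub>R w)) (at t)" for t
    unfolding c_def
    by (rule has_derivative_eq_rhs, rule has_derivative_add[OF has_derivative_const
          has_derivative_scaleR_left[OF has_derivative_ident]]) simp
  have fc: "((\<lambda>t. f (c t)) has_real_derivative blinfun_apply (D (c t)) w) (at t)" for t
    unfolding has_field_derivative_def
    by (rule has_derivative_eq_rhs, rule has_derivative_compose[OF c D])
      (simp add: fun_eq_iff blinfun.scaleR_right)
  have dc: "((\<lambda>t. blinfun_apply (D (c t)) w) has_real_derivative
      blinfun_apply (blinfun_apply (D2 (c t)) w) w) (at t)" for t
    unfolding has_field_derivative_def
    by (rule has_derivative_eq_rhs,
        rule blinfun.FDERIV[OF has_derivative_compose[OF c D2] has_derivative_const])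
      (simp add: fun_eq_iff blinfun.zero_right blinfun.scaleR_right blinfun.scaleR_left)
  define k1 where "k1 = (\<lambda>t. blinfun_apply (D (c t)) w - blinfun_apply (D (c 0)) w - m * t)"
  define k where "k = (\<lambda>t. f (c t) - blinfun_apply (D (c 0)) w * t - m * t\<^sup>2 / 2)"
  have k1: "k1 t \<ge> 0" if "0 \<le> t" "t \<le> 1" for t
  proof -
    have "k1 0 \<le> k1 t"
    proof (rule DERIV_nonneg_imp_nondecreasing[OF that(1)])
      fix s assume s: "0 \<le> s" "s \<le> t"
      have "(k1 has_real_derivative (blinfun_apply (blinfun_apply (D2 (c s)) w) w - m)) (at s)"
        unfolding k1_def by (auto intro!: derivative_eq_intros dc)
      moreover have "blinfun_apply (blinfun_apply (D2 (c s)) w) w \<ge> m"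
        unfolding c_def using s that by (intro low) auto
      ultimately show "\<exists>y. (k1 has_real_derivative y) (at s) \<and> 0 \<le> y" by force
    qed
    then show ?thesis by (simp add: k1_def)
  qed
  have "k 0 \<le> k 1"
  proof (rule DERIV_nonneg_imp_nondecreasing[of 0 1 k])
    fix s :: real assume s: "0 \<le> s" "s \<le> 1"
    have "(k has_real_derivative k1 s) (at s)"
      unfolding k_def k1_def by (auto intro!: derivative_eq_intros fc)
    with k1[OF s] show "\<exists>y. (k has_real_derivative y) (at s) \<and> 0 \<le> y" by blast
  qed simp
  then show ?thesis
    by (simp add: k_def c_def)
qed

text \<open>The derivatives of the lifted Hamiltonian inherit lattice periodicity from the
  uniqueness of derivatives, so their bounds over bounded momenta do not depend on the position. The
  modulus of strong convexity is half the minimum of the second derivative over unit momentum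
  directions, a minimum over a compact set.\<close>

lemma tonelli_regular:
  fixes H :: "'d::finite torus \<Rightarrow> real ^ 'd \<Rightarrow> real"
  assumes "tonelli H"
  obtains Hp :: "real ^ 'd \<Rightarrow> real ^ 'd \<Rightarrow> real ^ 'd" where
    "\<And>P. \<exists>K\<ge>0. \<forall>a b p q. norm p \<le> P \<longrightarrow> norm q \<le> P \<longrightarrow>
       \<bar>H (tproj a) p - H (tproj b) q\<bar> \<le> K * (norm (a - b) + norm (p - q)) \<and>
       norm (Hp a p - Hp b q) \<le> K * (norm (a - b) + norm (p - q))"
    "\<And>P. \<exists>m>0. \<forall>a p q. norm p \<le> P \<longrightarrow> norm q \<le> P \<longrightarrow>
       H (tproj a) q \<ge> H (tproj a) p + Hp a p \<bullet> (q - p) + m * (norm (q - p))\<^sup>2"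
    "\<And>K. K > 0 \<Longrightarrow> \<exists>C. \<forall>x p. H x p \<ge> K * norm p - C"
proof -
  define f where "f = (\<lambda>(a, p). H (tproj a) p)"
  obtain D D2 where "C2_derivs f D D2"
    and pos: "\<And>a p w. w \<noteq> 0 \<Longrightarrow> blinfun_apply (blinfun_apply (D2 (a, p)) (0, w)) (0, w) > 0"
    and sup: "\<And>K. K > 0 \<Longrightarrow> \<exists>C. \<forall>x p. H x p \<ge> K * norm p - C"
    using assms unfolding tonelli_def f_def by blast
  then have D: "\<And>z. (f has_derivative blinfun_apply (D z)) (at z)"
    and D2: "\<And>z. (D has_derivative blinfun_apply (D2 z)) (at z)"
    and cD2: "continuous_on UNIV D2"
    unfolding C2_derivs_def by auto
  have cD: "continuous_on UNIV D"
    using D2 by (intro has_derivative_continuous_on[of UNIV D "\<lambda>z. blinfun_apply (D2 z)"]) simp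
  have shift: "((\<lambda>y. y + (z, 0)) has_derivative (\<lambda>y. y)) (at x)" for z :: "real ^ 'd" and x :: "(real ^ 'd) \<times> (real ^ 'd)"
    by (rule has_derivative_eq_rhs, rule has_derivative_add[OF has_derivative_ident has_derivative_const])
      (rule ext, rule add_0_right)
  have perD: "D (a + z, p) = D (a, p)" if z: "int_vec z" for a p z
  proof -
    have "((\<lambda>y. f (y + (z, 0))) has_derivative blinfun_apply (D ((a, p) + (z, 0)))) (at (a, p))"
      by (rule has_derivative_compose[OF shift D])
    moreover have "(\<lambda>y. f (y + (z, 0))) = f"
      using tproj_add_int_vec[OF z] by (auto simp: f_def)
    ultimately have "blinfun_apply (D ((a, p) + (z, 0))) = blinfun_apply (D (a, p))"
      using D has_derivative_unique by metis
    then show ?thesis by (simp add: blinfun_apply_inject)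
  qed
  have perD2: "D2 (a + z, p) = D2 (a, p)" if z: "int_vec z" for a p z
  proof -
    have "((\<lambda>y. D (y + (z, 0))) has_derivative blinfun_apply (D2 ((a, p) + (z, 0)))) (at (a, p))"
      by (rule has_derivative_compose[OF shift D2])
    moreover have "(\<lambda>y. D (y + (z, 0))) = D"
      using perD[OF z] by auto
    ultimately have "blinfun_apply (D2 ((a, p) + (z, 0))) = blinfun_apply (D2 (a, p))"
      using D2 has_derivative_unique by metis
    then show ?thesis by (simp add: blinfun_apply_inject)
  qed
  \<comment> \<open>The Riesz vector of the momentum part of \<open>D\<close>.\<close>
  define Hp where "Hp a p = (\<Sum>b\<in>Basis. blinfun_apply (D (a, p)) (0, b) *\<^sub>R b)" for a p
  have Hp: "Hp a p \<bullet> w = blinfun_apply (D (a, p)) (0, w)" for a p w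
  proof -
    have lin: "linear (\<lambda>w. blinfun_apply (D (a, p)) (0, w))"
    proof (rule linearI)
      fix v w :: "real ^ 'd" and r :: real
      have "(0, v + w) = (0, v) + (0 :: real ^ 'd, w)" "(0, r *\<^sub>R w) = r *\<^sub>R (0 :: real ^ 'd, w)"
        by simp_all
      then show "blinfun_apply (D (a, p)) (0, v + w) = blinfun_apply (D (a, p)) (0, v) + blinfun_apply (D (a, p)) (0, w)"
        "blinfun_apply (D (a, p)) (0, r *\<^sub>R w) = r *\<^sub>R blinfun_apply (D (a, p)) (0, w)"
        by (simp_all only: blinfun.add_right blinfun.scaleR_right)
    qed
    have "Hp a p \<bullet> w = (\<Sum>b\<in>Basis. blinfun_apply (D (a, p)) (0, b) *\<^sub>R (w \<bullet> b))"
      unfolding Hp_def inner_sum_left inner_scaleR_left by (simp only: inner_commute[of w] real_scaleR_def)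
    also have "\<dots> = (\<Sum>b\<in>Basis. blinfun_apply (D (a, p)) (0, (w \<bullet> b) *\<^sub>R b))"
      by (simp only: linear_cmul[OF lin] real_scaleR_def mult.commute)
    also have "\<dots> = blinfun_apply (D (a, p)) (0, \<Sum>b\<in>Basis. (w \<bullet> b) *\<^sub>R b)"
      by (simp only: linear_sum[OF lin])
    finally show ?thesis by (simp only: euclidean_representation)
  qed
  show ?thesis
  proof (rule that[of Hp])
    fix P :: real
    obtain B1 where B1: "B1 \<ge> 0" "\<And>a p. norm p \<le> P \<Longrightarrow> norm (D (a, p)) \<le> B1"
      using bounded_periodic[OF cD perD, of P] by metis
    obtain B2 where B2: "B2 \<ge> 0" "\<And>a p. norm p \<le> P \<Longrightarrow> norm (D2 (a, p)) \<le> B2"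
      using bounded_periodic[OF cD2 perD2, of P] by metis
    let ?S = "(UNIV :: (real ^ 'd) set) \<times> cball (0 :: real ^ 'd) P"
    let ?n = "real DIM(real ^ 'd)"
    have conv: "convex ?S" by (intro convex_Times) auto
    have main: "\<bar>H (tproj a) p - H (tproj b) q\<bar> \<le> (B1 + ?n * B2) * (norm (a - b) + norm (p - q)) \<and>
          norm (Hp a p - Hp b q) \<le> (B1 + ?n * B2) * (norm (a - b) + norm (p - q))"
      if "norm p \<le> P" "norm q \<le> P" for a b p q
    proof -
      have "norm (f (a, p) - f (b, q)) \<le> B1 * norm ((a, p) - (b, q))"
        by (rule differentiable_bound[OF conv, of f "\<lambda>z. blinfun_apply (D z)"])
          (use that B1 D in \<open>auto simp flip: norm_blinfun.rep_eq intro: has_derivative_at_withinI\<close>)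
      also have "\<dots> \<le> B1 * (norm (a - b) + norm (p - q))"
        using B1(1) norm_Pair_le[of "a - b" "p - q"] by (intro mult_left_mono) auto
      finally have 1: "\<bar>H (tproj a) p - H (tproj b) q\<bar> \<le> B1 * (norm (a - b) + norm (p - q))"
        by (simp add: f_def)
      have "norm (D (a, p) - D (b, q)) \<le> B2 * norm ((a, p) - (b, q))"
        by (rule differentiable_bound[OF conv, of D "\<lambda>z. blinfun_apply (D2 z)"])
          (use that B2 D2 in \<open>auto simp flip: norm_blinfun.rep_eq intro: has_derivative_at_withinI\<close>)
      also have "\<dots> \<le> B2 * (norm (a - b) + norm (p - q))"
        using B2(1) norm_Pair_le[of "a - b" "p - q"] by (intro mult_left_mono) auto
      finally have 2: "norm (D (a, p) - D (b, q)) \<le> B2 * (norm (a - b) + norm (p - q))" .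
      have "norm (Hp a p - Hp b q) = norm (\<Sum>i\<in>Basis. blinfun_apply (D (a, p) - D (b, q)) (0, i) *\<^sub>R i)"
        by (simp add: Hp_def sum_subtractf algebra_simps blinfun.diff_left)
      also have "\<dots> \<le> (\<Sum>i\<in>(Basis :: (real ^ 'd) set). norm (D (a, p) - D (b, q)))"
      proof (rule sum_norm_le)
        fix i :: "real ^ 'd" assume i: "i \<in> Basis"
        have "norm (blinfun_apply (D (a, p) - D (b, q)) (0, i)) \<le> norm (D (a, p) - D (b, q)) * norm ((0 :: real ^ 'd), i)"
          by (rule norm_blinfun)
        then show "norm (blinfun_apply (D (a, p) - D (b, q)) (0, i) *\<^sub>R i) \<le> norm (D (a, p) - D (b, q))"
          using i by (simp add: norm_Pair)
      qed
      also have "\<dots> = ?n * norm (D (a, p) - D (b, q))" by simp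
      also have "\<dots> \<le> ?n * (B2 * (norm (a - b) + norm (p - q)))"
        using 2 by (intro mult_left_mono) auto
      finally have 3: "norm (Hp a p - Hp b q) \<le> (?n * B2) * (norm (a - b) + norm (p - q))" by simp
      have "B1 * (norm (a - b) + norm (p - q)) \<le> (B1 + ?n * B2) * (norm (a - b) + norm (p - q))"
        "(?n * B2) * (norm (a - b) + norm (p - q)) \<le> (B1 + ?n * B2) * (norm (a - b) + norm (p - q))"
        using B1 B2 by (intro mult_right_mono; simp)+
      with 1 3 show ?thesis by linarith
    qed
    show "\<exists>K\<ge>0. \<forall>a b p q. norm p \<le> P \<longrightarrow> norm q \<le> P \<longrightarrow>
       \<bar>H (tproj a) p - H (tproj b) q\<bar> \<le> K * (norm (a - b) + norm (p - q)) \<and>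
       norm (Hp a p - Hp b q) \<le> K * (norm (a - b) + norm (p - q))"
      using main B1(1) B2(1) by (intro exI[of _ "B1 + ?n * B2"]) auto
  next
    fix P :: real
    \<comment> \<open>\<open>P\<close> may be negative; the maximum with 0 keeps the compact set
      \<open>?S\<close> nonempty, so that the minimum below is attained.\<close>
    define Q where "Q = max P 0"
    let ?S = "cbox 0 (1 :: real ^ 'd) \<times> cball (0 :: real ^ 'd) Q \<times> sphere (0 :: real ^ 'd) 1"
    let ?g = "\<lambda>(a, p, w). blinfun_apply (blinfun_apply (D2 (a, p)) (0, w)) (0, w)"
    have "compact ?S" by (intro compact_Times) auto
    moreover have "(0, 0, axis undefined 1) \<in> ?S"
      by (simp add: Q_def mem_box_cart)
    then have "?S \<noteq> {}" by blast
    moreover have "continuous_on ?S ?g"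
      unfolding case_prod_unfold
      by (intro continuous_intros continuous_on_compose2[OF cD2]) auto
    ultimately obtain s where s: "s \<in> ?S" "\<And>y. y \<in> ?S \<Longrightarrow> ?g s \<le> ?g y"
      using continuous_attains_inf[of ?S ?g] by blast
    define m where "m = ?g s"
    have m: "m > 0"
    proof -
      obtain a p w where apw: "s = (a, p, w)" by (metis surj_pair)
      with s(1) have "w \<noteq> 0" by auto
      with pos show ?thesis by (simp only: m_def apw case_prod_conv)
    qed
    have low: "blinfun_apply (blinfun_apply (D2 (a, p)) (0, w)) (0, w) \<ge> m * (norm w)\<^sup>2"
      if "norm p \<le> P" for a p w
    proof (cases "w = 0")
      case True then show ?thesis by (simp add: blinfun.zero_right flip: zero_prod_def)
    next
      case False
      obtain z where z: "int_vec z" "a - z \<in> cbox 0 1" using int_vec_reduce by blast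
      define e where "e = w /\<^sub>R norm w"
      have we: "w = norm w *\<^sub>R e" using False by (simp add: e_def)
      have "m \<le> ?g (a - z, p, e)"
        unfolding m_def using z that False by (intro s(2)) (auto simp: Q_def e_def)
      then have "m \<le> blinfun_apply (blinfun_apply (D2 (a, p)) (0, e)) (0, e)"
        using perD2[OF z(1), of "a - z" p] by simp
      then have "m * (norm w)\<^sup>2 \<le> (norm w)\<^sup>2 * blinfun_apply (blinfun_apply (D2 (a, p)) (0, e)) (0, e)"
        by (simp only: mult.commute[of m] mult_left_mono zero_le_power2)
      also have "\<dots> = blinfun_apply (blinfun_apply (D2 (a, p)) (norm w *\<^sub>R (0, e))) (norm w *\<^sub>R (0, e))"
        by (simp only: blinfun_quadratic)
      also have "norm w *\<^sub>R ((0 :: real ^ 'd), e) = (0, w)"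
        by (simp flip: we)
      finally show ?thesis .
    qed
    have key: "H (tproj a) q \<ge> H (tproj a) p + Hp a p \<bullet> (q - p) + m / 2 * (norm (q - p))\<^sup>2"
      if pq: "norm p \<le> P" "norm q \<le> P" for a p q
    proof -
      have "f (a, p) + blinfun_apply (D (a, p)) (0, q - p) + m * (norm (q - p))\<^sup>2 / 2 \<le> f ((a, p) + (0, q - p))"
      proof (rule second_order_lower_bound[OF D D2])
        fix t :: real assume t: "0 \<le> t" "t \<le> 1"
        have "(1 - t) *\<^sub>R p + t *\<^sub>R q \<in> cball 0 P"
          using t pq by (intro convexD[OF convex_cball]) auto
        moreover have "(1 - t) *\<^sub>R p + t *\<^sub>R q = p + t *\<^sub>R (q - p)" by (simp add: algebra_simps)
        ultimately have "norm (p + t *\<^sub>R (q - p)) \<le> P" by simp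
        from low[OF this, of "q - p" a]
        show "m * (norm (q - p))\<^sup>2
            \<le> blinfun_apply (blinfun_apply (D2 ((a, p) + t *\<^sub>R (0, q - p))) (0, q - p)) (0, q - p)"
          by (simp only: scaleR_Pair add_Pair scaleR_zero_right add_0_right)
      qed
      then show ?thesis by (simp add: f_def Hp)
    qed
    show "\<exists>m>0. \<forall>a p q. norm p \<le> P \<longrightarrow> norm q \<le> P \<longrightarrow>
       H (tproj a) q \<ge> H (tproj a) p + Hp a p \<bullet> (q - p) + m * (norm (q - p))\<^sup>2"
    proof (intro exI[of _ "m / 2"] conjI allI impI)
      show "0 < m / 2" using m by simp
    qed (rule key)
  qed (rule sup)
qed

section \<open>The Lagrangian\<close>

lemma norm_axis_abs: "norm (axis k r :: real ^ 'd::finite) = \<bar>r\<bar>"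
  by (simp add: norm_eq_sqrt_inner inner_axis_axis)

text \<open>The Tonelli condition as inequalities on lifted points, with constants depending only on
  a momentum bound. \<open>Hp a p\<close> is the gradient of \<open>H\<close> in the momentum; the
  axioms characterize it through the convexity inequality, as a subgradient that is locally
  Lipschitz.\<close>

locale tonelli_lift =
  fixes H :: "'d::finite torus \<Rightarrow> real ^ 'd \<Rightarrow> real"
    and Hp :: "real ^ 'd \<Rightarrow> real ^ 'd \<Rightarrow> real ^ 'd"
  assumes H_lipschitz: "\<And>P. \<exists>K\<ge>0. \<forall>a b p q. norm p \<le> P \<longrightarrow> norm q \<le> P \<longrightarrow>
       \<bar>H (tproj a) p - H (tproj b) q\<bar> \<le> K * (norm (a - b) + norm (p - q)) \<and>
       norm (Hp a p - Hp b q) \<le> K * (norm (a - b) + norm (p - q))"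
    and H_strongly_convex: "\<And>P. \<exists>m>0. \<forall>a p q. norm p \<le> P \<longrightarrow> norm q \<le> P \<longrightarrow>
       H (tproj a) q \<ge> H (tproj a) p + Hp a p \<bullet> (q - p) + m * (norm (q - p))\<^sup>2"
    and H_superlinear: "\<And>K. K > 0 \<Longrightarrow> \<exists>C. \<forall>x p. H x p \<ge> K * norm p - C"
begin

abbreviation L :: "'d torus \<Rightarrow> real ^ 'd \<Rightarrow> real" where
  "L \<equiv> lagrangian H"

lemma cbox_norm_bound: "\<exists>r\<ge>0. \<forall>a \<in> cbox 0 (1 :: real ^ 'd). norm a \<le> r"
  by (metis bounded_cbox bounded_pos less_imp_le)

lemma H_bounded: "\<exists>B\<ge>0. \<forall>x p. norm p \<le> P \<longrightarrow> \<bar>H x p\<bar> \<le> B"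
proof -
  obtain r where r: "r \<ge> 0" "\<forall>a \<in> cbox 0 (1 :: real ^ 'd). norm a \<le> r"
    using cbox_norm_bound by blast
  define Q where "Q = max P 0"
  obtain K where K: "K \<ge> 0" "\<And>a b p q. norm p \<le> Q \<Longrightarrow> norm q \<le> Q \<Longrightarrow>
       \<bar>H (tproj a) p - H (tproj b) q\<bar> \<le> K * (norm (a - b) + norm (p - q))"
    using H_lipschitz[of Q] by meson
  have "\<bar>H x p\<bar> \<le> \<bar>H (tproj 0) 0\<bar> + K * (r + Q)" if "norm p \<le> P" for x p
  proof -
    obtain a where a: "a \<in> cbox 0 1" "tproj a = x" using tproj_lift_cbox by blast
    have "\<bar>H (tproj a) p - H (tproj 0) 0\<bar> \<le> K * (norm (a - 0) + norm (p - 0))"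
      by (rule K(2)) (use that in \<open>auto simp: Q_def\<close>)
    also have "\<dots> \<le> K * (r + Q)"
      using K(1) r(2) a that by (intro mult_left_mono add_mono) (auto simp: Q_def)
    finally show ?thesis using a(2) by simp
  qed
  then show ?thesis
    using K(1) r(1) by (intro exI[of _ "\<bar>H (tproj 0) 0\<bar> + K * (r + Q)"]) (auto simp: Q_def)
qed

lemma H_convex: "H (tproj a) q \<ge> H (tproj a) p + Hp a p \<bullet> (q - p)"
proof -
  obtain m where m: "m > 0"
    "H (tproj a) q \<ge> H (tproj a) p + Hp a p \<bullet> (q - p) + m * (norm (q - p))\<^sup>2"
    using H_strongly_convex[of "max (norm p) (norm q)"] by (metis max.cobounded1 max.cobounded2)
  have "m * (norm (q - p))\<^sup>2 \<ge> 0" using m(1) by simp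
  with m(2) show ?thesis by linarith
qed

lemma continuous_on_H_snd: "continuous_on S (H x)"
proof -
  obtain a where a: "tproj a = x" using tproj_surj by blast
  have "isCont (H x) p" for p
  proof -
    obtain K where K: "K \<ge> 0" "\<And>q. norm q \<le> norm p + 1 \<Longrightarrow> \<bar>H (tproj a) q - H (tproj a) p\<bar> \<le> K * norm (q - p)"
      using H_lipschitz[of "norm p + 1"]
      by (metis add.left_neutral cancel_comm_monoid_add_class.diff_cancel le_add_same_cancel1 norm_zero zero_le_one)
    have "\<forall>\<^sub>F q in at p. norm (H x q - H x p) \<le> K * norm (q - p)"
      unfolding eventually_at
    proof (intro exI[of _ 1] conjI ballI impI)
      fix q assume "q \<noteq> p \<and> dist q p < 1"
      then have "norm q \<le> norm p + 1"
        using norm_triangle_ineq[of "q - p" p] by (simp add: dist_norm)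
      from K(2)[OF this] a show "norm (H x q - H x p) \<le> K * norm (q - p)" by simp
    qed simp
    moreover have "((\<lambda>q. K * norm (q - p)) \<longlongrightarrow> 0) (at p)"
      by (rule tendsto_eq_intros | simp)+
    ultimately have "((\<lambda>q. H x q - H x p) \<longlongrightarrow> 0) (at p)"
      by (rule Lim_null_comparison)
    then show ?thesis unfolding isCont_def by (rule LIM_zero_cancel)
  qed
  then show ?thesis by (simp add: continuous_at_imp_continuous_on)
qed

text \<open>The first-order condition is derived from inequalities alone. With
  \<open>w = v - Hp a p\<close>, compare the maximizer \<open>p\<close> with
  \<open>q = p + t *\<^sub>R w\<close>: maximality and convexity at \<open>q\<close> give
  \<open>w \<bullet> v \<le> Hp a q \<bullet> w\<close>, and the Lipschitz bound turns this into
  |w|^2 \<le> K t |w|^2 with K t < 1, so \<open>w = 0\<close>.\<close>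

lemma maximizer_gradient:
  assumes "\<And>q. q \<bullet> v - H (tproj a) q \<le> p \<bullet> v - H (tproj a) p"
  shows "Hp a p = v"
proof -
  define w where "w = v - Hp a p"
  obtain K where K: "K \<ge> 0" "\<And>q. norm q \<le> norm p + norm w \<Longrightarrow> norm (Hp a q - Hp a p) \<le> K * norm (q - p)"
    using H_lipschitz[of "norm p + norm w"]
    by (metis add.left_neutral cancel_comm_monoid_add_class.diff_cancel le_add_same_cancel1 norm_zero norm_ge_zero)
  define t where "t = min 1 (1 / (K + 1))"
  have t: "0 < t" "t \<le> 1" "K * t < 1"
  proof -
    show "0 < t" "t \<le> 1" using K(1) by (auto simp: t_def)
    have "K * t \<le> K * (1 / (K + 1))" using K(1) by (intro mult_left_mono) (auto simp: t_def)
    also have "\<dots> < 1" using K(1) by (simp add: field_simps)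
    finally show "K * t < 1" .
  qed
  define q where "q = p + t *\<^sub>R w"
  have nq: "norm q \<le> norm p + norm w"
  proof -
    have "norm q \<le> norm p + t * norm w" using norm_triangle_ineq[of p "t *\<^sub>R w"] t by (simp add: q_def)
    also have "\<dots> \<le> norm p + 1 * norm w" using t by (intro add_left_mono mult_right_mono) auto
    finally show ?thesis by simp
  qed
  have "t * (w \<bullet> v) \<le> H (tproj a) q - H (tproj a) p"
    using assms[of q] by (simp add: q_def inner_add_left)
  also have "\<dots> \<le> t * (Hp a q \<bullet> w)"
    using H_convex[of a q p] by (simp add: q_def)
  finally have "w \<bullet> v \<le> Hp a q \<bullet> w" using t(1) by simp
  then have "w \<bullet> w \<le> (Hp a q - Hp a p) \<bullet> w"
    by (simp add: w_def inner_diff_left inner_diff_right inner_commute)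
  also have "\<dots> \<le> norm (Hp a q - Hp a p) * norm w" by (rule norm_cauchy_schwarz)
  also have "\<dots> \<le> (K * norm (q - p)) * norm w"
    using K(2)[OF nq] by (intro mult_right_mono) auto
  also have "\<dots> = (K * t) * (w \<bullet> w)"
    using t(1) by (simp add: q_def dot_square_norm power2_eq_square)
  finally have "(1 - K * t) * (w \<bullet> w) \<le> 0" by (simp add: algebra_simps)
  then have "w \<bullet> w \<le> 0" using t(3) by (simp add: mult_le_0_iff)
  then have "w = 0" by (metis antisym inner_eq_zero_iff inner_ge_zero)
  then show ?thesis by (simp add: w_def)
qed

text \<open>A Hamiltonian growing with slope \<open>R' + 1\<close> beats the linear term of slope at
  most \<open>R'\<close>, so the supremum is attained in a ball whose radius depends only on the
  velocity bound. This bound on conjugate momenta converts estimates for \<open>H\<close> on bounded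
  momenta into estimates for the Lagrangian on bounded velocities.\<close>

lemma L_attained:
  "\<exists>P\<ge>0. \<forall>a v. norm v \<le> R \<longrightarrow> (\<exists>p. norm p \<le> P \<and> Hp a p = v \<and> L (tproj a) v = p \<bullet> v - H (tproj a) p \<and>
     (\<forall>q. q \<bullet> v - H (tproj a) q \<le> L (tproj a) v))"
proof -
  define R' where "R' = max R 0"
  obtain C where C: "\<And>x p. H x p \<ge> (R' + 1) * norm p - C"
  proof -
    have "R' + 1 > 0" by (simp add: R'_def)
    then show ?thesis using H_superlinear[of "R' + 1"] that by blast
  qed
  obtain B where B: "B \<ge> 0" "\<And>x. \<bar>H x 0\<bar> \<le> B"
    using H_bounded[of 0] by auto
  \<comment> \<open>For \<open>norm q > P\<close> the function \<open>g\<close> below is at most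
    \<open>C - norm q\<close>, which is less than \<open>- B\<close> and hence less than its value
    at 0.\<close>
  define P where "P = max 0 (C + B + 1)"
  show ?thesis
  proof (intro exI[of _ P] conjI allI impI)
    show "0 \<le> P" by (simp add: P_def)
    fix a v :: "real ^ 'd" assume v: "norm v \<le> R"
    define g where "g q = q \<bullet> v - H (tproj a) q" for q
    have "continuous_on (cball 0 P) g"
      unfolding g_def by (intro continuous_intros continuous_on_H_snd)
    moreover have "cball (0 :: real ^ 'd) P \<noteq> {}" by (simp add: P_def)
    ultimately have "\<exists>p\<in>cball 0 P. \<forall>q\<in>cball 0 P. g q \<le> g p"
      by (intro continuous_attains_sup compact_cball)
    then obtain p where p: "p \<in> cball 0 P" "\<And>q. q \<in> cball 0 P \<Longrightarrow> g q \<le> g p"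
      by blast
    have glob: "g q \<le> g p" for q
    proof (cases "norm q \<le> P")
      case True then show ?thesis using p by simp
    next
      case False
      have "q \<bullet> v \<le> norm q * norm v" by (rule norm_cauchy_schwarz)
      also have "\<dots> \<le> norm q * R'" using v by (intro mult_left_mono) (auto simp: R'_def)
      finally have "q \<bullet> v \<le> norm q * R'" .
      moreover have "(R' + 1) * norm q - C \<le> H (tproj a) q" by (rule C)
      ultimately have "g q \<le> C - norm q"
        by (auto simp: g_def algebra_simps)
      also have "\<dots> \<le> - B" using False by (simp add: P_def)
      also have "\<dots> \<le> g 0" using B(2)[of "tproj a"] by (simp add: g_def abs_le_iff)
      also have "\<dots> \<le> g p" using p by (simp add: P_def)
      finally show ?thesis .
    qed
    have "L (tproj a) v = g p"
      unfolding lagrangian_def g_def[symmetric] by (rule cSup_eq_maximum) (use glob in auto)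
    with glob p(1) maximizer_gradient[of v a p]
    show "\<exists>p. norm p \<le> P \<and> Hp a p = v \<and> L (tproj a) v = p \<bullet> v - H (tproj a) p \<and>
     (\<forall>q. q \<bullet> v - H (tproj a) q \<le> L (tproj a) v)"
      by (intro exI[of _ p]) (simp add: g_def)
  qed
qed

section \<open>Duality, growth, Lipschitz and semiconcavity bounds for the Lagrangian\<close>

lemma fenchel: "q \<bullet> v - H x q \<le> L x v"
  using L_attained[of "norm v"] tproj_surj[of x] by blast

lemma L_dual: "L (tproj a) (Hp a p) = p \<bullet> Hp a p - H (tproj a) p"
proof (rule antisym)
  obtain q where "L (tproj a) (Hp a p) = q \<bullet> Hp a p - H (tproj a) q"
    using L_attained[of "norm (Hp a p)"] by blast
  with H_convex[of a p q] show "L (tproj a) (Hp a p) \<le> p \<bullet> Hp a p - H (tproj a) p"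
    by (simp add: inner_diff_right inner_diff_left inner_commute)
qed (rule fenchel)

lemma L_superlinear: "K > 0 \<Longrightarrow> \<exists>C. \<forall>x v. L x v \<ge> K * norm v - C"
proof -
  assume K: "K > 0"
  obtain B where B: "B \<ge> 0" "\<And>x p. norm p \<le> K \<Longrightarrow> \<bar>H x p\<bar> \<le> B"
    using H_bounded[of K] by blast
  have "L x v \<ge> K * norm v - B" for x v
  proof -
    \<comment> \<open>For \<open>v = 0\<close> division by zero yields \<open>q = 0\<close>, and
      \<open>q \<bullet> v = K * norm v\<close> still holds.\<close>
    define q where "q = (K / norm v) *\<^sub>R v"
    have "norm q \<le> K" using K by (simp add: q_def)
    moreover have "q \<bullet> v = K * norm v"
      by (cases "v = 0") (simp_all add: q_def dot_square_norm power2_eq_square)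
    ultimately show ?thesis using fenchel[of q v x] B(2)[of q x] by (simp add: abs_le_iff)
  qed
  then show ?thesis by blast
qed

text \<open>The maximizing momentum at one point is a competitor in the supremum at the other point.
  Maximizers stay below \<open>P\<close>, which becomes the Lipschitz constant in the velocity,
  while the constant in the position is that of \<open>H\<close>.\<close>

lemma L_lipschitz:
  "\<exists>K\<ge>0. \<forall>a b v w. norm v \<le> R \<longrightarrow> norm w \<le> R \<longrightarrow>
     \<bar>L (tproj a) v - L (tproj b) w\<bar> \<le> K * (norm (a - b) + norm (v - w))"
proof -
  obtain P where P: "P \<ge> 0" "\<And>a v. norm v \<le> R \<Longrightarrow> \<exists>p. norm p \<le> P \<and> L (tproj a) v = p \<bullet> v - H (tproj a) p"
    using L_attained[of R] by blast
  obtain K where K: "K \<ge> 0" "\<And>a b p q. norm p \<le> P \<Longrightarrow> norm q \<le> P \<Longrightarrow>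
       \<bar>H (tproj a) p - H (tproj b) q\<bar> \<le> K * (norm (a - b) + norm (p - q))"
    using H_lipschitz[of P] by meson
  have half: "L (tproj a) v - L (tproj b) w \<le> (K + P) * (norm (a - b) + norm (v - w))"
    if vw: "norm v \<le> R" "norm w \<le> R" for a b v w
  proof -
    obtain p where p: "norm p \<le> P" "L (tproj a) v = p \<bullet> v - H (tproj a) p"
      using P(2)[OF vw(1)] by blast
    have "L (tproj a) v - L (tproj b) w \<le> p \<bullet> (v - w) + (H (tproj b) p - H (tproj a) p)"
      using p(2) fenchel[of p w "tproj b"] by (simp add: inner_diff_right)
    also have "\<dots> \<le> P * norm (v - w) + K * norm (a - b)"
    proof (rule add_mono)
      have "p \<bullet> (v - w) \<le> norm p * norm (v - w)" by (rule norm_cauchy_schwarz)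
      also have "\<dots> \<le> P * norm (v - w)" using p(1) by (intro mult_right_mono) auto
      finally show "p \<bullet> (v - w) \<le> P * norm (v - w)" .
      show "H (tproj b) p - H (tproj a) p \<le> K * norm (a - b)"
        using K(2)[OF p(1) p(1), of b a] by (simp add: norm_minus_commute abs_le_iff)
    qed
    also have "\<dots> \<le> (K + P) * (norm (a - b) + norm (v - w))"
      using P(1) K(1) by (simp add: algebra_simps add_mono)
    finally show ?thesis .
  qed
  have "\<bar>L (tproj a) v - L (tproj b) w\<bar> \<le> (K + P) * (norm (a - b) + norm (v - w))"
    if vw: "norm v \<le> R" "norm w \<le> R" for a b v w
    using half[OF vw, of a b] half[OF vw(2) vw(1), of b a]
    by (simp add: abs_le_iff norm_minus_commute)
  then show ?thesis using P(1) K(1) by (intro exI[of _ "K + P"]) auto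
qed

lemma L_bounded: "\<exists>B\<ge>0. \<forall>x v. norm v \<le> R \<longrightarrow> \<bar>L x v\<bar> \<le> B"
proof -
  obtain P where P: "P \<ge> 0" "\<And>a v. norm v \<le> R \<Longrightarrow> \<exists>p. norm p \<le> P \<and> L (tproj a) v = p \<bullet> v - H (tproj a) p"
    using L_attained[of R] by blast
  obtain B where B: "B \<ge> 0" "\<And>x p. norm p \<le> P \<Longrightarrow> \<bar>H x p\<bar> \<le> B"
    using H_bounded[of P] by blast
  have "\<bar>L x v\<bar> \<le> P * \<bar>R\<bar> + B" if v: "norm v \<le> R" for x v
  proof -
    obtain a where a: "tproj a = x" using tproj_surj by blast
    obtain p where p: "norm p \<le> P" "L (tproj a) v = p \<bullet> v - H (tproj a) p"
      using P(2)[OF v] by blast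
    have "\<bar>p \<bullet> v\<bar> \<le> norm p * norm v" by (rule Cauchy_Schwarz_ineq2)
    also have "\<dots> \<le> P * \<bar>R\<bar>" using p(1) v P(1) by (intro mult_mono) auto
    finally show ?thesis using p(2) B(2)[OF p(1), of x] a by (simp add: abs_le_iff)
  qed
  then show ?thesis using P(1) B(1) by (intro exI[of _ "P * \<bar>R\<bar> + B"]) auto
qed

text \<open>Legendre dual of strong convexity. For the conjugate momenta \<open>p\<close> and
  \<open>q\<close> of \<open>v\<close> and \<open>v + e\<close>, with
  \<open>s = norm (q - p)\<close>, the excess over the linear expansion is at most
  \<open>s * norm e - m * s^2\<close>. The maximum of this over \<open>s\<close> is
  \<open>(norm e)^2 / (4 * m)\<close>, whence the constant.\<close>

lemma L_semiconcave:
  "\<exists>P\<ge>0. \<exists>K\<ge>0. \<forall>a v. norm v \<le> R \<longrightarrow> (\<exists>p. norm p \<le> P \<and> Hp a p = v \<and>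
     (\<forall>e. norm (v + e) \<le> R \<longrightarrow> L (tproj a) (v + e) \<le> L (tproj a) v + p \<bullet> e + K * (norm e)\<^sup>2))"
proof -
  obtain P where P: "P \<ge> 0" "\<And>a v. norm v \<le> R \<Longrightarrow> \<exists>p. norm p \<le> P \<and> Hp a p = v \<and> L (tproj a) v = p \<bullet> v - H (tproj a) p"
    using L_attained[of R] by blast
  obtain m where m: "m > 0" "\<And>a p q. norm p \<le> P \<Longrightarrow> norm q \<le> P \<Longrightarrow>
       H (tproj a) q \<ge> H (tproj a) p + Hp a p \<bullet> (q - p) + m * (norm (q - p))\<^sup>2"
    using H_strongly_convex[of P] by blast
  have main: "\<exists>p. norm p \<le> P \<and> Hp a p = v \<and>
     (\<forall>e. norm (v + e) \<le> R \<longrightarrow> L (tproj a) (v + e) \<le> L (tproj a) v + p \<bullet> e + (1 / (4 * m)) * (norm e)\<^sup>2)"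
    if v: "norm v \<le> R" for a v
  proof -
    obtain p where p: "norm p \<le> P" "Hp a p = v" "L (tproj a) v = p \<bullet> v - H (tproj a) p"
      using P(2)[OF v] by blast
    have "L (tproj a) (v + e) \<le> L (tproj a) v + p \<bullet> e + (1 / (4 * m)) * (norm e)\<^sup>2"
      if e: "norm (v + e) \<le> R" for e
    proof -
      obtain q where q: "norm q \<le> P" "L (tproj a) (v + e) = q \<bullet> (v + e) - H (tproj a) q"
        using P(2)[OF e] by blast
      define s where "s = norm (q - p)"
      have "L (tproj a) (v + e) \<le> L (tproj a) v + p \<bullet> e + (q - p) \<bullet> e - m * s\<^sup>2"
        using q(2) p(3) m(2)[OF p(1) q(1), of a] p(2)
        by (simp add: s_def inner_add_right inner_diff_left inner_diff_right inner_commute)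
      moreover have "(q - p) \<bullet> e \<le> s * norm e" unfolding s_def by (rule norm_cauchy_schwarz)
      moreover have "s * norm e \<le> m * s\<^sup>2 + (1 / (4 * m)) * (norm e)\<^sup>2"
      proof -
        have "0 \<le> (2 * m * s - norm e)\<^sup>2 / (4 * m)" using m(1) by simp
        also have "\<dots> = m * s\<^sup>2 + (1 / (4 * m)) * (norm e)\<^sup>2 - s * norm e"
          using m(1) by (simp add: field_simps power2_eq_square)
        finally show ?thesis by simp
      qed
      ultimately show ?thesis by linarith
    qed
    with p show ?thesis by blast
  qed
  show ?thesis
    using P(1) m(1) main by (intro exI[of _ P] conjI exI[of _ "1 / (4 * m)"]) auto
qed

text \<open>The hypothesis says that the action of two consecutive steps does not decrease when the
  middle point moves by a multiple of \<open>h\<close> along an axis. A move by s changes the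
  velocities by s / \<tau> and - s / \<tau>: semiconcavity costs 2 K1 (s / \<tau>)^2, the shifted
  base point costs KL s, and the linear term contains the difference of the conjugate momenta.
  Dividing by s / \<tau> and using both directions on each axis makes the momenta differ by
  O(\<tau>), and \<open>Hp\<close> carries this over to the velocities.\<close>

lemma velocity_lipschitz:
  assumes R: "R \<ge> 0" and C: "C \<ge> 0"
  shows "\<exists>K\<ge>0. \<forall>a v w \<tau> h. norm v \<le> R \<longrightarrow> norm w \<le> R \<longrightarrow> 0 < \<tau> \<longrightarrow> \<tau> \<le> 1 \<longrightarrow> 0 < h \<longrightarrow> h \<le> C * \<tau>\<^sup>2 \<longrightarrow>
     (\<forall>k (m::int). L (tproj a) v + L (tproj (a + \<tau> *\<^sub>R v)) w
        \<le> L (tproj a) (v + axis k (of_int m * h / \<tau>))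
          + L (tproj (a + \<tau> *\<^sub>R v + axis k (of_int m * h))) (w - axis k (of_int m * h / \<tau>)))
     \<longrightarrow> norm (v - w) \<le> K * \<tau>"
proof -
  \<comment> \<open>Radius that still contains the velocities after the move, since s / \<tau> is at
    most \<open>1 + C\<close>.\<close>
  define R2 where "R2 = R + (1 + C)"
  obtain P K1 where P: "P \<ge> 0" "K1 \<ge> 0" "\<And>a v. norm v \<le> R2 \<Longrightarrow> \<exists>p. norm p \<le> P \<and> Hp a p = v \<and>
     (\<forall>e. norm (v + e) \<le> R2 \<longrightarrow> L (tproj a) (v + e) \<le> L (tproj a) v + p \<bullet> e + K1 * (norm e)\<^sup>2)"
    using L_semiconcave[of R2] by blast
  obtain KL where KL: "KL \<ge> 0" "\<And>a b v w. norm v \<le> R2 \<Longrightarrow> norm w \<le> R2 \<Longrightarrow>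
     \<bar>L (tproj a) v - L (tproj b) w\<bar> \<le> KL * (norm (a - b) + norm (v - w))"
    using L_lipschitz[of R2] by meson
  obtain KH where KH: "KH \<ge> 0" "\<And>a b p q. norm p \<le> P \<Longrightarrow> norm q \<le> P \<Longrightarrow>
       norm (Hp a p - Hp b q) \<le> KH * (norm (a - b) + norm (p - q))"
    using H_lipschitz[of P] by meson
  define K2 where "K2 = 2 * K1 * (1 + C) + KL"
  define K where "K = KH * (R + real CARD('d) * K2)"
  have K2: "K2 \<ge> 0" using P KL C by (simp add: K2_def)
  have main: "norm (v - w) \<le> K * \<tau>"
    if v: "norm v \<le> R" and w: "norm w \<le> R" and \<tau>: "0 < \<tau>" "\<tau> \<le> 1" and h: "0 < h" "h \<le> C * \<tau>\<^sup>2"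
      and opt: "\<And>k (m::int). L (tproj a) v + L (tproj (a + \<tau> *\<^sub>R v)) w
        \<le> L (tproj a) (v + axis k (of_int m * h / \<tau>))
          + L (tproj (a + \<tau> *\<^sub>R v + axis k (of_int m * h))) (w - axis k (of_int m * h / \<tau>))"
    for a v w \<tau> h
  proof -
    define b where "b = a + \<tau> *\<^sub>R v"
    have v2: "norm v \<le> R2" and w2: "norm w \<le> R2" using v w C by (auto simp: R2_def)
    obtain p where p: "norm p \<le> P" "Hp a p = v"
      "\<And>e. norm (v + e) \<le> R2 \<Longrightarrow> L (tproj a) (v + e) \<le> L (tproj a) v + p \<bullet> e + K1 * (norm e)\<^sup>2"
      using P(3)[OF v2] by blast
    obtain q where q: "norm q \<le> P" "Hp b q = w"
      "\<And>e. norm (w + e) \<le> R2 \<Longrightarrow> L (tproj b) (w + e) \<le> L (tproj b) w + q \<bullet> e + K1 * (norm e)\<^sup>2"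
      using P(3)[OF w2] by blast
    \<comment> \<open>The first multiple \<open>s\<close> of \<open>h\<close> not below \<tau>^2. As
      \<open>h \<le> C * \<tau>^2\<close>, it overshoots by at most
      \<open>C * \<tau>^2\<close>.\<close>
    define M :: int where "M = \<lceil>\<tau>\<^sup>2 / h\<rceil>"
    define s where "s = of_int M * h"
    have s: "\<tau>\<^sup>2 \<le> s" "s \<le> (1 + C) * \<tau>\<^sup>2"
    proof -
      have "\<tau>\<^sup>2 / h \<le> of_int M" "of_int M \<le> \<tau>\<^sup>2 / h + 1"
        unfolding M_def by linarith+
      then show "\<tau>\<^sup>2 \<le> s" "s \<le> (1 + C) * \<tau>\<^sup>2"
        using h by (auto simp: s_def field_simps)
    qed
    have spos: "s > 0" using s(1) \<tau>(1) by (smt (verit) zero_less_power)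
    have st: "s / \<tau> \<le> (1 + C) * \<tau>"
      using s(2) \<tau>(1) by (simp add: field_simps power2_eq_square)
    have st1: "s / \<tau> \<le> 1 + C"
    proof -
      have "(1 + C) * \<tau> \<le> (1 + C) * 1" using C \<tau> by (intro mult_left_mono) auto
      with st show ?thesis by simp
    qed
    \<comment> \<open>The sign \<open>\<sigma>\<close> is also available as an integer
      \<open>\<sigma>'\<close>, because the displacement has to be an integer multiple of
      \<open>h\<close>; the two signs together bound the absolute value.\<close>
    have comp: "\<sigma> * (q $ k - p $ k) \<le> K2 * \<tau>" if \<sigma>: "\<bar>\<sigma>\<bar> = 1" "\<sigma> = of_int \<sigma>'" for k \<sigma> and \<sigma>' :: int
    proof -
      define r where "r = \<sigma> * s / \<tau>"
      have ar: "\<bar>r\<bar> = s / \<tau>" using \<sigma> spos \<tau> by (simp add: r_def abs_mult)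
      have mr: "of_int (\<sigma>' * M) * h / \<tau> = r" "of_int (\<sigma>' * M) * h = \<sigma> * s"
        by (simp_all add: r_def s_def \<sigma>(2) mult_ac)
      have ne: "norm (axis k r :: real ^ 'd) = s / \<tau>"
        using ar by (simp add: norm_axis_abs)
      have n1: "norm (v + axis k r) \<le> R2"
        using norm_triangle_ineq[of v "axis k r"] v ne st1 by (simp add: R2_def)
      have n2: "norm (w - axis k r) \<le> R2"
        using norm_triangle_ineq4[of w "axis k r"] w ne st1 by (simp add: R2_def)
      have "L (tproj a) v + L (tproj b) w \<le> L (tproj a) (v + axis k r) + L (tproj (b + axis k (\<sigma> * s))) (w - axis k r)"
        using opt[of k "\<sigma>' * M"] unfolding mr(2) b_def r_def .
      moreover have "L (tproj a) (v + axis k r) \<le> L (tproj a) v + r * p $ k + K1 * (s / \<tau>)\<^sup>2"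
        using p(3)[OF n1] ne by (simp add: inner_axis mult.commute)
      moreover have "L (tproj b) (w - axis k r) \<le> L (tproj b) w - r * q $ k + K1 * (s / \<tau>)\<^sup>2"
        using q(3)[of "- axis k r"] n2 ne by (simp add: inner_axis mult.commute)
      moreover have "L (tproj (b + axis k (\<sigma> * s))) (w - axis k r) \<le> L (tproj b) (w - axis k r) + KL * s"
      proof -
        have "norm (axis k (\<sigma> * s) :: real ^ 'd) = s"
          using \<sigma>(1) spos by (simp add: norm_axis_abs abs_mult)
        then show ?thesis
          using KL(2)[OF n2 n2, of "b + axis k (\<sigma> * s)" b] by (simp add: abs_le_iff)
      qed
      ultimately have "r * (q $ k - p $ k) \<le> 2 * K1 * (s / \<tau>)\<^sup>2 + KL * s"
        by (simp add: algebra_simps)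
      then have "(s / \<tau>) * (\<sigma> * (q $ k - p $ k)) \<le> (s / \<tau>) * (2 * K1 * (s / \<tau>) + KL * \<tau>)"
        using \<tau>(1) by (simp add: r_def algebra_simps power2_eq_square)
      then have "\<sigma> * (q $ k - p $ k) \<le> 2 * K1 * (s / \<tau>) + KL * \<tau>"
        by (rule mult_left_le_imp_le) (use spos \<tau>(1) in simp)
      also have "\<dots> \<le> 2 * K1 * ((1 + C) * \<tau>) + KL * \<tau>"
        using st P(2) by (intro add_right_mono mult_left_mono) auto
      finally show ?thesis by (simp add: K2_def algebra_simps)
    qed
    have "\<bar>(p - q) $ k\<bar> \<le> K2 * \<tau>" for k
    proof -
      have "1 * (q $ k - p $ k) \<le> K2 * \<tau>" by (rule comp[where \<sigma>' = 1]) simp_all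
      moreover have "(-1) * (q $ k - p $ k) \<le> K2 * \<tau>" by (rule comp[where \<sigma>' = "-1"]) simp_all
      ultimately show ?thesis by simp
    qed
    then have "(\<Sum>k\<in>UNIV. \<bar>(p - q) $ k\<bar>) \<le> (\<Sum>k\<in>(UNIV :: 'd set). K2 * \<tau>)"
      by (intro sum_mono)
    then have npq: "norm (p - q) \<le> real CARD('d) * K2 * \<tau>"
      using norm_le_l1_cart[of "p - q"] by simp
    have "norm (v - w) \<le> KH * (norm (a - b) + norm (p - q))"
      using KH(2)[OF p(1) q(1), of a b] p(2) q(2) by simp
    also have "\<dots> \<le> KH * (\<tau> * R + real CARD('d) * K2 * \<tau>)"
    proof (intro mult_left_mono add_mono npq KH(1))
      show "norm (a - b) \<le> \<tau> * R" using v \<tau>(1) by (simp add: b_def)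
    qed
    finally show ?thesis by (simp add: K_def algebra_simps)
  qed
  have "K \<ge> 0" using KH(1) R K2 by (simp add: K_def)
  then show ?thesis
    by (intro exI[of _ K] conjI allI impI main) (assumption | elim allE)+
qed

end

section \<open>An ergodic problem on a finite set\<close>

text \<open>Vanishing discount. The equation \<open>w j = Min ((1 - d) * w i + A i j)\<close> has a
  solution for every discount \<open>d\<close>. Its oscillation and the product of \<open>d\<close>
  with its values are bounded independently of \<open>d\<close>, so normalized solutions and these
  products converge along some sequence of discounts tending to 0. The constant \<open>c\<close> is
  minus the limit of the products.\<close>

lemma finite_ergodic_problem:
  fixes A :: "'i \<Rightarrow> 'i \<Rightarrow> real"
  assumes fin: "finite G" and ne: "G \<noteq> {}"
  obtains u :: "'i \<Rightarrow> real" and c :: real where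
    "\<And>i j. i \<in> G \<Longrightarrow> j \<in> G \<Longrightarrow> u j \<le> u i + A i j + c"
    "\<And>j. j \<in> G \<Longrightarrow> \<exists>i\<in>G. u j = u i + A i j + c"
proof -
  obtain j0 where j0: "j0 \<in> G" using ne by blast
  define B where "B = (\<Sum>i\<in>G. \<Sum>j\<in>G. \<bar>A i j\<bar>)"
  have AB: "\<bar>A i j\<bar> \<le> B" if "i \<in> G" "j \<in> G" for i j
  proof -
    have "\<bar>A i j\<bar> \<le> (\<Sum>j\<in>G. \<bar>A i j\<bar>)" using fin that by (intro member_le_sum) auto
    also have "\<dots> \<le> B" unfolding B_def
      by (rule member_le_sum[of i G "\<lambda>i. \<Sum>j\<in>G. \<bar>A i j\<bar>"]) (use fin that in \<open>auto intro: sum_nonneg\<close>)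
    finally show ?thesis .
  qed
  have B0: "B \<ge> 0" unfolding B_def by (intro sum_nonneg) auto
  have Min_le: "Min (f ` G) \<le> f i" if "i \<in> G" for f :: "'i \<Rightarrow> real" and i
    using fin that by (intro Min_le) auto
  have Min_ex: "\<exists>i\<in>G. Min (f ` G) = f i" for f :: "'i \<Rightarrow> real"
  proof -
    have "Min (f ` G) \<in> f ` G" by (rule Min_in) (use fin ne in simp_all)
    then show ?thesis by blast
  qed
  have Min_ge: "x \<le> Min (f ` G)" if "\<And>i. i \<in> G \<Longrightarrow> x \<le> f i" for f :: "'i \<Rightarrow> real" and x
    using fin ne that by (intro Min.boundedI) auto
  have disc: "\<exists>w. \<forall>j\<in>G. w j = Min ((\<lambda>i. (1 - d) * w i + A i j) ` G)"
    if d: "0 < d" "d < 1" for d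
  proof -
    define T where "T w j = Min ((\<lambda>i. (1 - d) * w i + A i j) ` G)" for w j
    \<comment> \<open>Monotone iteration from the constant \<open>- B / d\<close>, which is a
      subsolution of the discounted equation; \<open>B / d\<close> bounds all iterates from
      above.\<close>
    define W where "W n = (T ^^ n) (\<lambda>_. - B / d)" for n
    have WS: "W (Suc n) j = T (W n) j" for n j by (simp add: W_def)
    have mono: "T w j \<le> T w' j" if "\<And>i. i \<in> G \<Longrightarrow> w i \<le> w' i" for w w' j
    proof -
      obtain i where i: "i \<in> G" "T w' j = (1 - d) * w' i + A i j" using Min_ex unfolding T_def by blast
      have "T w j \<le> (1 - d) * w i + A i j" unfolding T_def by (rule Min_le) fact
      also have "\<dots> \<le> (1 - d) * w' i + A i j" using that[OF i(1)] d by (intro add_right_mono mult_left_mono) auto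
      finally show ?thesis using i(2) by simp
    qed
    have inc: "j \<in> G \<Longrightarrow> W n j \<le> W (Suc n) j" for n j
    proof (induction n arbitrary: j)
      case 0
      have "- B / d \<le> (1 - d) * (- B / d) + A i j" if "i \<in> G" for i
      proof -
        have "d * (- B) \<le> d * A i j" using AB[OF that 0] d by (intro mult_left_mono) (auto simp: abs_le_iff)
        then show ?thesis using d by (simp add: field_simps)
      qed
      then have "- B / d \<le> T (\<lambda>_. - B / d) j" unfolding T_def by (intro Min_ge)
      then show ?case by (simp add: W_def)
    next
      case (Suc n)
      then show ?case by (simp only: WS[of "Suc n"] WS[of n]) (metis WS mono)
    qed
    have upp: "j \<in> G \<Longrightarrow> W n j \<le> B / d" for n j
    proof (induction n arbitrary: j)
      case 0
      then show ?case using B0 d by (simp add: W_def field_simps)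
    next
      case (Suc n)
      have "W (Suc n) j \<le> (1 - d) * W n j0 + A j0 j"
        unfolding WS T_def by (rule Min_le) fact
      also have "\<dots> \<le> (1 - d) * (B / d) + B"
        using Suc.IH[OF j0] AB[OF j0 Suc.prems] d by (intro add_mono mult_left_mono) auto
      also have "\<dots> = B / d" using d by (simp add: field_simps)
      finally show ?case .
    qed
    have "\<exists>l. (\<lambda>n. W n j) \<longlonglongrightarrow> l" if "j \<in> G" for j
    proof -
      have "incseq (\<lambda>n. W n j)" using inc[OF that] by (rule incseq_SucI)
      then show ?thesis using upp[OF that] incseq_convergent by blast
    qed
    then obtain w where w: "\<And>j. j \<in> G \<Longrightarrow> (\<lambda>n. W n j) \<longlonglongrightarrow> w j" by metis
    have "w j = Min ((\<lambda>i. (1 - d) * w i + A i j) ` G)" if j: "j \<in> G" for j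
    proof (rule antisym)
      show "w j \<le> Min ((\<lambda>i. (1 - d) * w i + A i j) ` G)"
      proof (rule Min_ge)
        fix i assume i: "i \<in> G"
        show "w j \<le> (1 - d) * w i + A i j"
        proof (rule LIMSEQ_le)
          show "(\<lambda>n. W (Suc n) j) \<longlonglongrightarrow> w j" using w[OF j] by (rule LIMSEQ_Suc)
          show "(\<lambda>n. (1 - d) * W n i + A i j) \<longlonglongrightarrow> (1 - d) * w i + A i j"
            by (intro tendsto_intros w i)
          show "\<exists>N. \<forall>n\<ge>N. W (Suc n) j \<le> (1 - d) * W n i + A i j"
            unfolding WS T_def by (intro exI allI impI Min_le i)
        qed
      qed
      have le: "W n i \<le> w i" if "i \<in> G" for n i
        using incseq_le[OF incseq_SucI w[OF that]] inc[OF that] by blast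
      show "Min ((\<lambda>i. (1 - d) * w i + A i j) ` G) \<le> w j"
      proof (rule field_le_epsilon)
        fix e :: real assume e: "e > 0"
        have "\<forall>\<^sub>F n in sequentially. \<forall>i\<in>G. w i - e < W n i"
          using fin w e by (intro eventually_ball_finite ballI order_tendstoD(1)) auto
        then obtain n where n: "\<And>i. i \<in> G \<Longrightarrow> w i - e < W n i"
          by (auto simp: eventually_sequentially)
        obtain i where i: "i \<in> G" "W (Suc n) j = (1 - d) * W n i + A i j"
          using Min_ex unfolding WS T_def by blast
        have "Min ((\<lambda>i. (1 - d) * w i + A i j) ` G) \<le> (1 - d) * w i + A i j"
          by (rule Min_le) fact
        also have "\<dots> \<le> (1 - d) * (W n i + e) + A i j"
          using n[OF i(1)] d by (intro add_right_mono mult_left_mono) auto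
        also have "\<dots> = W (Suc n) j + (1 - d) * e" using i by (simp add: algebra_simps)
        also have "\<dots> \<le> w j + 1 * e"
          using le[OF j] d e by (intro add_mono mult_right_mono) auto
        finally show "Min ((\<lambda>i. (1 - d) * w i + A i j) ` G) \<le> w j + e" by simp
      qed
    qed
    then show ?thesis by blast
  qed
  define d where "d n = 1 / (real n + 2)" for n
  have d: "0 < d n" "d n < 1" for n by (auto simp: d_def)
  obtain w where w: "\<And>n j. j \<in> G \<Longrightarrow> w n j = Min ((\<lambda>i. (1 - d n) * w n i + A i j) ` G)"
    using disc[OF d] by metis
  \<comment> \<open>The minimizer for \<open>k\<close> is a competitor for \<open>j\<close>; the two
    values then differ only in the cost of the last step, so the discount does not enter.\<close>
  have osc: "w n j \<le> w n k + 2 * B" if jk: "j \<in> G" "k \<in> G" for n j k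
  proof -
    obtain i where i: "i \<in> G" "w n k = (1 - d n) * w n i + A i k"
    proof -
      have "\<exists>i\<in>G. w n k = (1 - d n) * w n i + A i k" by (subst w[OF jk(2)]) (rule Min_ex)
      then show ?thesis using that by blast
    qed
    have "w n j \<le> (1 - d n) * w n i + A i j"
      by (subst w[OF jk(1)]) (rule Min_le, fact)
    then show ?thesis using i AB[OF i(1) jk(1)] AB[OF i(1) jk(2)] by linarith
  qed
  have dw: "\<bar>d n * w n j0\<bar> \<le> 3 * B" for n
  proof -
    obtain i where i: "i \<in> G" "w n j0 = (1 - d n) * w n i + A i j0"
    proof -
      have "\<exists>i\<in>G. w n j0 = (1 - d n) * w n i + A i j0" by (subst w[OF j0]) (rule Min_ex)
      then show ?thesis using that by blast
    qed
    have "w n j0 \<le> (1 - d n) * w n j0 + A j0 j0"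
      by (subst w[OF j0]) (rule Min_le, fact j0)
    then have 1: "d n * w n j0 \<le> B" using AB[OF j0 j0] by (simp add: algebra_simps)
    have "(1 - d n) * (w n j0 - w n i) \<le> (1 - d n) * (2 * B)"
      using osc[OF j0 i(1), of n] d[of n] by (intro mult_left_mono) auto
    also have "\<dots> \<le> 1 * (2 * B)"
      using d[of n] B0 by (intro mult_right_mono) auto
    finally have "(1 - d n) * (w n j0 - w n i) \<le> 2 * B" by simp
    moreover have "d n * w n j0 = A i j0 - (1 - d n) * (w n j0 - w n i)"
      using i(2) by algebra
    ultimately have 2: "d n * w n j0 \<ge> - 3 * B" using AB[OF i(1) j0] by linarith
    from 1 2 B0 show ?thesis by (simp add: abs_le_iff)
  qed
  \<comment> \<open>The slot \<open>None\<close> carries the discounted value and the slots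
    \<open>Some j\<close> the normalized solution, so that one extraction treats both.\<close>
  define f where "f n x = (case x of None \<Rightarrow> d n * w n j0 | Some j \<Rightarrow> w n j - w n j0)" for n x
  have fb: "norm (f n x) \<le> 3 * B" if "x \<in> insert None (Some ` G)" for n x
  proof (cases x)
    case None then show ?thesis using dw by (simp add: f_def)
  next
    case (Some j)
    then have "j \<in> G" using that by auto
    then show ?thesis using osc[OF _ j0, of j n] osc[OF j0, of j n] B0 Some by (simp add: f_def abs_le_iff)
  qed
  have "countable (insert None (Some ` G))" using fin by (simp add: countable_finite)
  from function_convergent_subsequence[OF this, of f "3 * B"] fb obtain r where r: "strict_mono r"
    "\<And>x. x \<in> insert None (Some ` G) \<Longrightarrow> \<exists>l. (\<lambda>n. f (r n) x) \<longlonglongrightarrow> l" by blast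
  obtain c where c: "(\<lambda>n. d (r n) * w (r n) j0) \<longlonglongrightarrow> c"
    using r(2)[of None] by (auto simp: f_def)
  have "\<exists>l. (\<lambda>n. w (r n) j - w (r n) j0) \<longlonglongrightarrow> l" if "j \<in> G" for j
    using r(2)[of "Some j"] that by (auto simp: f_def)
  then obtain u where u: "\<And>j. j \<in> G \<Longrightarrow> (\<lambda>n. w (r n) j - w (r n) j0) \<longlonglongrightarrow> u j" by metis
  have "(\<lambda>n. d n) \<longlonglongrightarrow> 0"
    unfolding d_def using LIMSEQ_ignore_initial_segment[OF lim_1_over_n[where 'a = real], of 2] by (simp add: add.commute)
  then have dr: "(\<lambda>n. d (r n)) \<longlonglongrightarrow> 0"
    using LIMSEQ_subseq_LIMSEQ[OF _ r(1)] by (auto simp: o_def)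
  have rhs: "(\<lambda>n. (1 - d (r n)) * (w (r n) i - w (r n) j0) + A i j - d (r n) * w (r n) j0) \<longlonglongrightarrow> u i + A i j + - c"
    if "i \<in> G" for i j
  proof -
    have "(\<lambda>n. (1 - d (r n)) * (w (r n) i - w (r n) j0) + A i j - d (r n) * w (r n) j0)
        \<longlonglongrightarrow> (1 - 0) * u i + A i j - c"
      by (intro tendsto_intros dr c u that)
    then show ?thesis by simp
  qed
  show ?thesis
  proof (rule that[of u "- c"])
    fix i j assume ij: "i \<in> G" "j \<in> G"
    show "u j \<le> u i + A i j + - c"
    proof (rule LIMSEQ_le[OF u[OF ij(2)] rhs[OF ij(1)]])
      have "w n j \<le> (1 - d n) * w n i + A i j" for n
        by (subst w[OF ij(2)]) (rule Min_le, fact)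
      then show "\<exists>N. \<forall>n\<ge>N. w (r n) j - w (r n) j0
          \<le> (1 - d (r n)) * (w (r n) i - w (r n) j0) + A i j - d (r n) * w (r n) j0"
        by (intro exI[of _ 0]) (simp add: algebra_simps)
    qed
  next
    fix j assume j: "j \<in> G"
    have "\<exists>i\<in>G. w n j = (1 - d n) * w n i + A i j" for n
      by (subst w[OF j]) (rule Min_ex)
    then obtain p where p: "\<And>n. p n \<in> G" "\<And>n. w n j = (1 - d n) * w n (p n) + A (p n) j" by metis
    \<comment> \<open>The minimizer depends on the discount, but one of the finitely many indices
      occurs infinitely often, and along those discounts the equality passes to the limit.\<close>
    have "\<exists>i\<in>G. \<exists>\<^sub>F n in sequentially. p (r n) = i"
      using fin p(1) frequently_bex_finite[of G "\<lambda>n i. p (r n) = i" sequentially] by auto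
    then obtain i where i: "i \<in> G" "\<exists>\<^sub>F n in sequentially. p (r n) = i" by blast
    have "infinite {n. p (r n) = i}" using i(2) by (simp add: frequently_cofinite flip: cofinite_eq_sequentially)
    then obtain s :: "nat \<Rightarrow> nat" where s: "strict_mono s" "\<And>n. p (r (s n)) = i"
      using infinite_enumerate by blast
    have "u j = u i + A i j + - c"
    proof (rule LIMSEQ_unique)
      show "(\<lambda>n. w (r (s n)) j - w (r (s n)) j0) \<longlonglongrightarrow> u j"
        using LIMSEQ_subseq_LIMSEQ[OF u[OF j] s(1)] by (simp add: o_def)
      have "w (r (s n)) j - w (r (s n)) j0
          = (1 - d (r (s n))) * (w (r (s n)) i - w (r (s n)) j0) + A i j - d (r (s n)) * w (r (s n)) j0" for n
        using p(2)[of "r (s n)"] s(2)[of n] by (simp add: algebra_simps)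
      then show "(\<lambda>n. w (r (s n)) j - w (r (s n)) j0) \<longlonglongrightarrow> u i + A i j + - c"
        using LIMSEQ_subseq_LIMSEQ[OF rhs[OF i(1), of j] s(1)] by (simp add: o_def)
    qed
    with i(1) show "\<exists>i\<in>G. u j = u i + A i j + - c" by blast
  qed
qed

section \<open>Compactness of almost Lipschitz sequences\<close>

text \<open>Arzela-Ascoli for maps that are Lipschitz up to an error tending to 0. Convergence on a
  countable dense set spreads to all points. The error also absorbs a moving argument, hence
  continuous convergence: later the arguments are grid points that change with
  \<open>n\<close>.\<close>

lemma almost_lipschitz_subsequence:
  fixes f :: "nat \<Rightarrow> 'a::euclidean_space \<Rightarrow> 'b::euclidean_space"
  assumes lip: "\<And>n a b. norm (f n a - f n b) \<le> K * (norm (a - b) + e n)"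
    and e: "e \<longlonglongrightarrow> 0" and K: "K \<ge> 0" and bd: "\<And>n. norm (f n 0) \<le> B"
  obtains r g where "strict_mono (r :: nat \<Rightarrow> nat)"
    "\<And>s a. s \<longlonglongrightarrow> a \<Longrightarrow> (\<lambda>n. f (r n) (s n)) \<longlonglongrightarrow> g a"
    "\<And>a b. norm (g a - g b) \<le> K * norm (a - b)"
proof -
  obtain E where E: "\<And>n. \<bar>e n\<bar> \<le> E" using convergent_imp_Bseq[of e] e by (auto simp: convergent_def Bseq_def)
  obtain S :: "'a set" where S: "countable S" "closure S = UNIV"
    using separable by (metis subset_UNIV top.extremum_unique)
  \<comment> \<open>The weight makes the values bounded uniformly over the whole space, as the
    extraction requires; it is removed again pointwise.\<close>
  define F where "F n a = f n a /\<^sub>R (1 + norm a)" for n a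
  have Fb: "norm (F n a) \<le> B + K + K * E" for n a
  proof -
    have "norm (f n a) \<le> norm (f n 0) + norm (f n a - f n 0)" by (metis add.commute norm_triangle_sub)
    also have "\<dots> \<le> B + K * (norm a + E)"
    proof (rule add_mono[OF bd])
      have "norm (f n a - f n 0) \<le> K * (norm a + e n)" using lip[of n a 0] by simp
      also have "\<dots> \<le> K * (norm a + E)" using E[of n] K by (intro mult_left_mono) auto
      finally show "norm (f n a - f n 0) \<le> K * (norm a + E)" .
    qed
    also have "\<dots> \<le> (B + K + K * E) * (1 + norm a)"
    proof -
      have "B \<ge> 0" using bd[of 0] norm_ge_zero[of "f 0 0"] by linarith
      moreover have "E \<ge> 0" using E[of 0] by linarith
      ultimately have "0 \<le> B * norm a + K + K * E * norm a" using K by simp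
      then show ?thesis by (simp add: algebra_simps)
    qed
    finally show ?thesis by (simp add: F_def field_simps add_pos_nonneg)
  qed
  obtain r where r: "strict_mono (r :: nat \<Rightarrow> nat)" "\<And>a. a \<in> S \<Longrightarrow> \<exists>l. (\<lambda>n. F (r n) a) \<longlonglongrightarrow> l"
    using function_convergent_subsequence[OF S(1), of F] Fb by blast
  have fS: "\<exists>l. (\<lambda>n. f (r n) a) \<longlonglongrightarrow> l" if a: "a \<in> S" for a
  proof -
    obtain l where "(\<lambda>n. F (r n) a) \<longlonglongrightarrow> l" using r(2)[OF a] by blast
    then have "(\<lambda>n. (1 + norm a) *\<^sub>R F (r n) a) \<longlonglongrightarrow> (1 + norm a) *\<^sub>R l" by (intro tendsto_intros)
    moreover have "(1 + norm a) \<noteq> 0" using norm_ge_zero[of a] by linarith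
    ultimately show ?thesis by (auto simp: F_def)
  qed
  have er: "(\<lambda>n. e (r n)) \<longlonglongrightarrow> 0" using LIMSEQ_subseq_LIMSEQ[OF e r(1)] by (simp add: o_def)
  have "\<exists>l. (\<lambda>n. f (r n) a) \<longlonglongrightarrow> l" for a
  proof -
    have "Cauchy (\<lambda>n. f (r n) a)"
    proof (rule metric_CauchyI)
      fix \<epsilon> :: real assume \<epsilon>: "\<epsilon> > 0"
      define \<eta> where "\<eta> = \<epsilon> / (6 * (K + 1))"
      have \<eta>: "\<eta> > 0" "K * (2 * \<eta>) \<le> \<epsilon> / 3" using \<epsilon> K by (auto simp: \<eta>_def field_simps)
      obtain b where b: "b \<in> S" "dist b a < \<eta>"
        using S(2) \<eta>(1) closure_approachable by blast
      have "Cauchy (\<lambda>n. f (r n) b)" using fS[OF b(1)] by (simp add: Cauchy_convergent_iff convergent_def)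
      then obtain M1 where M1: "\<And>m n. m \<ge> M1 \<Longrightarrow> n \<ge> M1 \<Longrightarrow> dist (f (r m) b) (f (r n) b) < \<epsilon> / 3"
        using metric_CauchyD[of _ "\<epsilon> / 3"] \<epsilon> by (metis zero_less_divide_iff zero_less_numeral)
      obtain M2 where M2: "\<And>n. n \<ge> M2 \<Longrightarrow> \<bar>e (r n)\<bar> < \<eta>"
        using LIMSEQ_D[OF er \<eta>(1)] by auto
      have close: "dist (f (r n) a) (f (r n) b) \<le> \<epsilon> / 3" if "n \<ge> M2" for n
      proof -
        have "dist (f (r n) a) (f (r n) b) \<le> K * (norm (a - b) + e (r n))"
          using lip[of "r n" a b] by (simp add: dist_norm)
        also have "\<dots> \<le> K * (2 * \<eta>)"
          using b(2) M2[OF that] K by (intro mult_left_mono) (auto simp: dist_norm norm_minus_commute)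
        finally show ?thesis using \<eta>(2) by linarith
      qed
      show "\<exists>M. \<forall>m\<ge>M. \<forall>n\<ge>M. dist (f (r m) a) (f (r n) a) < \<epsilon>"
      proof (intro exI[of _ "max M1 M2"] allI impI)
        fix m n assume "max M1 M2 \<le> m" "max M1 M2 \<le> n"
        then have "dist (f (r m) a) (f (r m) b) \<le> \<epsilon> / 3" "dist (f (r n) a) (f (r n) b) \<le> \<epsilon> / 3"
          "dist (f (r m) b) (f (r n) b) < \<epsilon> / 3" using close M1 by auto
        then show "dist (f (r m) a) (f (r n) a) < \<epsilon>"
          using dist_triangle[of "f (r m) a" "f (r n) a" "f (r m) b"]
            dist_triangle[of "f (r m) b" "f (r n) a" "f (r n) b"] by (simp add: dist_commute)
      qed
    qed
    then show ?thesis by (simp add: Cauchy_convergent_iff convergent_def)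
  qed
  then obtain g where g: "\<And>a. (\<lambda>n. f (r n) a) \<longlonglongrightarrow> g a" by metis
  show ?thesis
  proof (rule that[OF r(1), of g])
    fix s and a :: 'a assume s: "s \<longlonglongrightarrow> a"
    have "(\<lambda>n. K * (norm (s n - a) + e (r n))) \<longlonglongrightarrow> K * (norm (a - a) + 0)"
      by (intro tendsto_intros s er)
    then have "(\<lambda>n. K * (norm (s n - a) + e (r n))) \<longlonglongrightarrow> 0" by simp
    then have "(\<lambda>n. f (r n) (s n) - f (r n) a) \<longlonglongrightarrow> 0"
      by (rule Lim_null_comparison[rotated]) (intro always_eventually allI lip)
    from tendsto_add[OF this g[of a]] show "(\<lambda>n. f (r n) (s n)) \<longlonglongrightarrow> g a" by simp
  next
    fix a b :: 'a
    show "norm (g a - g b) \<le> K * norm (a - b)"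
    proof (rule LIMSEQ_le)
      show "(\<lambda>n. norm (f (r n) a - f (r n) b)) \<longlonglongrightarrow> norm (g a - g b)" by (intro tendsto_intros g)
      have "(\<lambda>n. K * (norm (a - b) + e (r n))) \<longlonglongrightarrow> K * (norm (a - b) + 0)"
        by (intro tendsto_intros er)
      then show "(\<lambda>n. K * (norm (a - b) + e (r n))) \<longlonglongrightarrow> K * norm (a - b)" by simp
      show "\<exists>N. \<forall>n\<ge>N. norm (f (r n) a - f (r n) b) \<le> K * (norm (a - b) + e (r n))" using lip by blast
    qed
  qed
qed

section \<open>Schoenberg's space-filling curve\<close>

text \<open>
  The coordinate functions of Schoenberg's space-filling curve: the value at
  \<open>2 \<Sum>\<^sub>j b\<^sub>j / 3 ^ (j + 1)\<close> of the \<open>i\<close>-th one is the binary expansion with the digits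
  \<open>b\<^bsub>mk+i\<^esub>\<close>.
\<close>

definition schoenberg_wave :: "real \<Rightarrow> real" where
  "schoenberg_wave t = max 0 (min 1 (3 * \<bar>t - 2 * of_int \<lfloor>(t + 1) / 2\<rfloor>\<bar> - 1))"

definition schoenberg :: "nat \<Rightarrow> nat \<Rightarrow> real \<Rightarrow> real" where
  "schoenberg m i t = (\<Sum>k. schoenberg_wave (3 ^ (m * k + i) * t) / 2 ^ (k + 1))"

lemma schoenberg_wave_bounds: "0 \<le> schoenberg_wave t" "schoenberg_wave t \<le> 1"
  by (auto simp: schoenberg_wave_def)

lemma schoenberg_wave_shift: "schoenberg_wave (t + 2 * of_int n) = schoenberg_wave t"
proof -
  have eq: "(t + 2 * of_int n + 1) / 2 = (t + 1) / 2 + of_int n" by (simp add: field_simps)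
  have "\<lfloor>(t + 2 * of_int n + 1) / 2\<rfloor> = \<lfloor>(t + 1) / 2\<rfloor> + n"
    by (metis floor_add_int[of "(t + 1) / 2" n] eq)
  then show ?thesis by (simp add: schoenberg_wave_def)
qed

text \<open>The wave is a function of the distance to the nearest even integer: 0 up to 1/3, 1 from
  2/3 on, linear in between. At odd integers two even integers are equally near, and both give the
  value 1.\<close>

lemma schoenberg_wave_dist: "schoenberg_wave t = max 0 (min 1 (3 * \<bar>t - 2 * of_int n\<bar> - 1))"
  if "\<bar>t - 2 * of_int n\<bar> \<le> 1"
proof -
  define x where "x = t - 2 * of_int n"
  have x: "\<bar>x\<bar> \<le> 1" using that by (simp add: x_def)
  have "schoenberg_wave t = schoenberg_wave x"
    using schoenberg_wave_shift[of x n] by (simp add: x_def)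
  also have "\<dots> = max 0 (min 1 (3 * \<bar>x\<bar> - 1))"
  proof (cases "x = 1")
    case True
    then show ?thesis by (simp add: schoenberg_wave_def)
  next
    case False
    then have "\<lfloor>(x + 1) / 2\<rfloor> = 0" using x by (simp add: floor_eq_iff abs_le_iff)
    then show ?thesis by (simp add: schoenberg_wave_def)
  qed
  finally show ?thesis by (simp add: x_def)
qed

lemma schoenberg_wave_near: "\<exists>n. \<bar>t - 2 * of_int n\<bar> \<le> (1 :: real)"
proof (intro exI)
  show "\<bar>t - 2 * of_int \<lfloor>(t + 1) / 2\<rfloor>\<bar> \<le> 1"
    using of_int_floor_le[of "(t + 1) / 2"] floor_correct[of "(t + 1) / 2"] by (simp add: abs_le_iff field_simps)
qed

lemma isCont_schoenberg_wave: "isCont schoenberg_wave t"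
proof -
  have half: "schoenberg_wave s \<ge> schoenberg_wave t - 3 * \<bar>s - t\<bar>" if st: "\<bar>s - t\<bar> < 1 / 3" for s t
  proof -
    obtain n where n: "\<bar>s - 2 * of_int n\<bar> \<le> 1" using schoenberg_wave_near by blast
    show ?thesis
    proof (cases "\<bar>t - 2 * of_int n\<bar> \<le> 1")
      case True
      then show ?thesis using schoenberg_wave_dist[OF n] schoenberg_wave_dist[OF True] by (auto simp: max_def min_def abs_if)
    next
      case False
      \<comment> \<open>\<open>s\<close> has distance more than 2/3 from
        \<open>2 * of_int n\<close>, because \<open>t\<close> has distance more than 1 and is less
        than 1/3 away.\<close>
      then have "schoenberg_wave s = 1" using schoenberg_wave_dist[OF n] st n by (auto simp: max_def min_def abs_if split: if_splits)
      moreover have "schoenberg_wave t - 3 * \<bar>s - t\<bar> \<le> 1 - 0"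
        using schoenberg_wave_bounds(2)[of t] by (intro diff_mono) auto
      ultimately show ?thesis by simp
    qed
  qed
  have "\<forall>\<^sub>F s in at t. norm (schoenberg_wave s - schoenberg_wave t) \<le> 3 * \<bar>s - t\<bar>"
    unfolding eventually_at
  proof (intro exI[of _ "1 / 3"] conjI ballI impI)
    fix s assume "s \<noteq> t \<and> dist s t < 1 / 3"
    then have "\<bar>s - t\<bar> < 1 / 3" "\<bar>t - s\<bar> < 1 / 3" by (simp_all add: dist_real_def abs_minus_commute)
    from half[OF this(1)] half[OF this(2)]
    show "norm (schoenberg_wave s - schoenberg_wave t) \<le> 3 * \<bar>s - t\<bar>" by (simp add: abs_le_iff abs_minus_commute)
  qed simp
  moreover have "((\<lambda>s. 3 * \<bar>s - t\<bar>) \<longlongrightarrow> 3 * \<bar>t - t\<bar>) (at t)" by (intro tendsto_intros)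
  then have "((\<lambda>s. 3 * \<bar>s - t\<bar>) \<longlongrightarrow> 0) (at t)" by simp
  ultimately have "((\<lambda>s. schoenberg_wave s - schoenberg_wave t) \<longlongrightarrow> 0) (at t)"
    by (rule Lim_null_comparison)
  then show ?thesis unfolding isCont_def by (rule LIM_zero_cancel)
qed

lemma summable_half: "summable (\<lambda>k. 1 / 2 ^ (k + 1) :: real)" "(\<Sum>k. 1 / 2 ^ (k + 1) :: real) = 1"
proof -
  have "(\<lambda>k. (1 / 2) ^ Suc k :: real) sums 1" by (rule power_half_series)
  then have "(\<lambda>k. 1 / 2 ^ (k + 1) :: real) sums 1" by (simp add: power_divide)
  then show "summable (\<lambda>k. 1 / 2 ^ (k + 1) :: real)" "(\<Sum>k. 1 / 2 ^ (k + 1) :: real) = 1"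
    by (auto simp: sums_iff)
qed

lemma schoenberg_term_bound: "norm (schoenberg_wave s / 2 ^ (k + 1)) \<le> 1 / 2 ^ (k + 1)"
  using schoenberg_wave_bounds[of s] by (simp add: divide_right_mono)

lemma continuous_on_schoenberg: "continuous_on A (schoenberg m i)"
proof -
  have "uniform_limit UNIV (\<lambda>n t. \<Sum>k<n. schoenberg_wave (3 ^ (m * k + i) * t) / 2 ^ (k + 1))
     (schoenberg m i) sequentially"
    unfolding schoenberg_def[abs_def]
    by (rule Weierstrass_m_test[OF schoenberg_term_bound summable_half(1)])
  then have "continuous_on UNIV (schoenberg m i)"
  proof (rule uniform_limit_theorem[rotated])
    have "continuous_on UNIV schoenberg_wave"
      by (intro continuous_at_imp_continuous_on ballI isCont_schoenberg_wave)
    then have "continuous_on UNIV (\<lambda>t. schoenberg_wave (3 ^ j * t))" for j :: nat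
      by (rule continuous_on_compose2) (intro continuous_intros, simp)
    then show "\<forall>\<^sub>F n in sequentially. continuous_on UNIV (\<lambda>t. \<Sum>k<n. schoenberg_wave (3 ^ (m * k + i) * t) / 2 ^ (k + 1))"
      by (intro always_eventually allI continuous_on_sum continuous_on_divide continuous_on_const) auto
  qed simp
  then show ?thesis by (rule continuous_on_subset) simp
qed

lemma schoenberg_range: "schoenberg m i t \<in> {0..1}"
proof -
  have sm: "summable (\<lambda>k. schoenberg_wave (3 ^ (m * k + i) * t) / 2 ^ (k + 1))"
    by (rule summable_comparison_test'[OF summable_half(1)]) (rule schoenberg_term_bound)
  have "0 \<le> schoenberg m i t"
    unfolding schoenberg_def by (intro suminf_nonneg sm) (simp add: schoenberg_wave_bounds)
  moreover have "schoenberg m i t \<le> (\<Sum>k. 1 / 2 ^ (k + 1))"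
    unfolding schoenberg_def
    by (rule suminf_le[OF _ sm summable_half(1)]) (intro divide_right_mono schoenberg_wave_bounds, simp)
  ultimately show ?thesis using summable_half(2) by simp
qed

text \<open>After multiplication by 3^n the digits before position \<open>n\<close> contribute an
  even integer, which periodicity removes. Digit \<open>n\<close> contributes 0 or 2/3 and the
  remaining ones a number \<open>T / 3\<close> in [0, 1/3]. The argument therefore lies in [0, 1/3]
  or [2/3, 1], the two plateaus of the wave.\<close>

lemma schoenberg_wave_digits:
  fixes b :: "nat \<Rightarrow> nat"
  assumes b: "\<And>j. b j \<le> 1"
  shows "schoenberg_wave (3 ^ n * (\<Sum>j. 2 * real (b j) / 3 ^ (j + 1))) = real (b n)"
proof -
  define a where "a j = 2 * real (b j) / 3 ^ (j + 1)" for j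
  have geo: "(\<lambda>j. 2 / 3 ^ (j + 1) :: real) sums 1"
  proof -
    have "(\<lambda>j. 2 / 3 * (1 / 3) ^ j :: real) sums (2 / 3 * (1 / (1 - 1 / 3)))"
      by (intro sums_mult geometric_sums) simp
    then show ?thesis by (simp add: power_divide)
  qed
  have le: "a j \<le> 2 / 3 ^ (j + 1)" "0 \<le> a j" for j
    using b[of j] by (simp_all add: a_def divide_right_mono)
  have sa: "summable a"
    by (rule summable_comparison_test'[OF sums_summable[OF geo]]) (use le in simp)
  define T where "T = (\<Sum>j. a (j + Suc n) * 3 ^ (Suc n))"
  have aS: "a (j + Suc n) * 3 ^ (Suc n) = 2 * real (b (j + Suc n)) / 3 ^ (j + 1)" for j
    by (simp add: a_def power_add)
  have st: "summable (\<lambda>j. a (j + Suc n) * 3 ^ (Suc n))"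
    by (intro summable_mult2 summable_ignore_initial_segment sa)
  have T: "0 \<le> T" "T \<le> 1"
  proof -
    show "0 \<le> T" unfolding T_def by (intro suminf_nonneg st) (use le in simp)
    have "T \<le> (\<Sum>j. 2 / 3 ^ (j + 1))"
      unfolding T_def using b
      by (intro suminf_le st sums_summable[OF geo]) (simp only: aS, simp add: divide_right_mono)
    then show "T \<le> 1" using geo by (simp add: sums_iff)
  qed
  have "\<exists>N::int. (\<Sum>j<n. a j) * 3 ^ n = 2 * of_int N"
  proof -
    have "(\<Sum>j<n. a j) * 3 ^ n = (\<Sum>j<n. 2 * of_int (int (b j) * 3 ^ (n - j - 1)))"
      unfolding sum_distrib_right
    proof (rule sum.cong)
      fix j assume "j \<in> {..<n}"
      then have "n = (n - j - 1) + (j + 1)" by simp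
      then have "(3::real) ^ n = 3 ^ (n - j - 1) * 3 ^ (j + 1)" by (metis power_add)
      then show "a j * 3 ^ n = 2 * of_int (int (b j) * 3 ^ (n - j - 1))" by (simp add: a_def)
    qed simp
    also have "\<dots> = 2 * of_int (\<Sum>j<n. int (b j) * 3 ^ (n - j - 1))"
      by (simp add: sum_distrib_left)
    finally show ?thesis by blast
  qed
  then obtain N :: int where N: "(\<Sum>j<n. a j) * 3 ^ n = 2 * of_int N" by blast
  have tail: "(\<Sum>j. a (j + Suc n)) * 3 ^ (Suc n) = T"
    unfolding T_def by (rule suminf_mult2) (intro summable_ignore_initial_segment sa)
  have "3 ^ n * (\<Sum>j. a j) = 3 ^ n * ((\<Sum>j. a (j + Suc n)) + (\<Sum>j<Suc n. a j))"
    using suminf_split_initial_segment[OF sa, of "Suc n"] by simp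
  also have "\<dots> = T / 3 + 2 * of_int N + 2 * real (b n) / 3"
    using N tail by (simp add: a_def algebra_simps)
  finally have eq: "3 ^ n * (\<Sum>j. a j) = (2 * real (b n) / 3 + T / 3) + 2 * of_int N" by simp
  have "schoenberg_wave (3 ^ n * (\<Sum>j. a j)) = schoenberg_wave (2 * real (b n) / 3 + T / 3)"
    unfolding eq by (rule schoenberg_wave_shift)
  also have "\<dots> = real (b n)"
  proof -
    have "b n = 0 \<or> b n = 1" using b[of n] by linarith
    then show ?thesis
      using T schoenberg_wave_dist[of "2 * real (b n) / 3 + T / 3" 0] by (auto simp: max_def min_def)
  qed
  finally show ?thesis by (simp add: a_def)
qed

lemma binary_expansion:
  assumes "0 \<le> x" "x \<le> (1 :: real)"
  obtains b :: "nat \<Rightarrow> nat" where "\<And>k. b k \<le> 1" "(\<lambda>k. real (b k) / 2 ^ (k + 1)) sums x"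
proof (cases "x = 1")
  \<comment> \<open>The number 1 is expanded with all digits 1; the floors used in the other case
    start from \<open>c 0 = 0\<close> only for \<open>x < 1\<close>.\<close>
  case True
  have "(\<lambda>k. real 1 / 2 ^ (k + 1) :: real) sums 1" using summable_half by (simp add: sums_iff)
  then show ?thesis using that[of "\<lambda>_. 1"] True by simp
next
  case False
  define c where "c k = \<lfloor>2 ^ k * x\<rfloor>" for k :: nat
  define b where "b k = nat (c (Suc k) - 2 * c k)" for k
  have bc: "0 \<le> c (Suc k) - 2 * c k" "c (Suc k) - 2 * c k \<le> 1" for k
    unfolding c_def power_Suc mult.assoc by linarith+
  have "c 0 = 0" using assms False by (simp add: c_def floor_eq_iff)
  have part: "(\<Sum>k<n. real (b k) / 2 ^ (k + 1)) = of_int (c n) / 2 ^ n" for n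
  proof (induction n)
    case (Suc n)
    then show ?case using bc[of n] by (simp add: b_def field_simps)
  qed (simp add: \<open>c 0 = 0\<close>)
  have "(\<lambda>n. of_int (c n) / 2 ^ n) \<longlonglongrightarrow> x"
  proof (rule real_tendsto_sandwich)
    show "\<forall>\<^sub>F n in sequentially. x - (1 / 2) ^ n \<le> of_int (c n) / 2 ^ n"
    proof (intro always_eventually allI)
      fix n
      have "2 ^ n * x - 1 \<le> of_int (c n)" unfolding c_def by linarith
      then have "(2 ^ n * x - 1) / 2 ^ n \<le> of_int (c n) / 2 ^ n" by (intro divide_right_mono) auto
      then show "x - (1 / 2) ^ n \<le> of_int (c n) / 2 ^ n" by (simp add: diff_divide_distrib power_divide)
    qed
    show "\<forall>\<^sub>F n in sequentially. of_int (c n) / 2 ^ n \<le> x"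
      by (intro always_eventually allI) (simp add: c_def field_simps)
    have "(\<lambda>n. x - (1 / 2) ^ n) \<longlonglongrightarrow> x - 0" by (intro tendsto_intros LIMSEQ_realpow_zero) auto
    then show "(\<lambda>n. x - (1 / 2) ^ n) \<longlonglongrightarrow> x" by simp
  qed simp
  then have "(\<lambda>k. real (b k) / 2 ^ (k + 1)) sums x" unfolding sums_def part .
  moreover have "b k \<le> 1" for k using bc[of k] by (simp add: b_def)
  ultimately show ?thesis using that by blast
qed

lemma schoenberg_surj:
  assumes m: "m > 0" and x: "\<And>i. i < m \<Longrightarrow> 0 \<le> x i \<and> x i \<le> 1"
  shows "\<exists>t\<in>{0..1}. \<forall>i<m. schoenberg m i t = x i"
proof -
  have "\<forall>i. \<exists>b :: nat \<Rightarrow> nat. i < m \<longrightarrow> (\<forall>k. b k \<le> 1) \<and> (\<lambda>k. real (b k) / 2 ^ (k + 1)) sums x i"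
  proof
    fix i
    show "\<exists>b :: nat \<Rightarrow> nat. i < m \<longrightarrow> (\<forall>k. b k \<le> 1) \<and> (\<lambda>k. real (b k) / 2 ^ (k + 1)) sums x i"
    proof (cases "i < m")
      case True
      then have "0 \<le> x i" "x i \<le> 1" using x by auto
      then show ?thesis by (rule binary_expansion) blast
    qed simp
  qed
  from choice[OF this] obtain b where b: "\<And>i k. i < m \<Longrightarrow> b i k \<le> (1::nat)"
    "\<And>i. i < m \<Longrightarrow> (\<lambda>k. real (b i k) / 2 ^ (k + 1)) sums x i" by blast
  define B where "B j = b (j mod m) (j div m)" for j
  have B: "B j \<le> 1" for j using b(1) m by (simp add: B_def)
  define t where "t = (\<Sum>j. 2 * real (B j) / 3 ^ (j + 1))"
  have geo: "(\<lambda>j. 2 / 3 ^ (j + 1) :: real) sums 1"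
  proof -
    have "(\<lambda>j. 2 / 3 * (1 / 3) ^ j :: real) sums (2 / 3 * (1 / (1 - 1 / 3)))"
      by (intro sums_mult geometric_sums) simp
    then show ?thesis by (simp add: power_divide)
  qed
  have le: "2 * real (B j) / 3 ^ (j + 1) \<le> 2 / 3 ^ (j + 1)" for j
    using B[of j] by (simp add: divide_right_mono)
  have sB: "summable (\<lambda>j. 2 * real (B j) / 3 ^ (j + 1))"
    by (rule summable_comparison_test'[OF sums_summable[OF geo]]) (use le in simp)
  have "0 \<le> t" unfolding t_def by (intro suminf_nonneg sB) simp
  moreover have "t \<le> 1"
    using suminf_le[OF le sB sums_summable[OF geo]] geo by (simp add: t_def sums_iff)
  moreover have "schoenberg m i t = x i" if i: "i < m" for i
  proof -
    have "schoenberg_wave (3 ^ (m * k + i) * t) = real (b i k)" for k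
      using schoenberg_wave_digits[OF B, of "m * k + i"] i by (simp add: t_def B_def)
    then show ?thesis using b(2)[OF i] by (simp add: schoenberg_def sums_iff)
  qed
  ultimately show ?thesis by (intro bexI[of _ t]) auto
qed

section \<open>Weak limits of discrete measures on phase space\<close>

text \<open>The first \<open>n\<close> coordinate functions give the position modulo the lattice,
  the last \<open>n\<close>, rescaled to [-R, R], the velocity. Since the parameter interval covers
  all states of speed at most \<open>R\<close>, measures on such states can be carried by the line.
  \<open>K\<close> contains the image of the whole line, so continuous functions are bounded along
  the curve.\<close>

lemma phase_space_curve:
  fixes R :: real
  assumes R: "R > 0"
  obtains \<Phi> :: "real \<Rightarrow> 'd::finite torus \<times> (real ^ 'd)" and K where
    "continuous_on UNIV \<Phi>" "compact K" "range \<Phi> \<subseteq> K"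
    "\<And>x v. norm v \<le> R \<Longrightarrow> (x, v) \<in> \<Phi> ` {0..1}"
proof -
  define n where "n = CARD('d)"
  obtain h where h: "bij_betw h (UNIV :: 'd set) {0..<n}"
    using ex_bij_betw_finite_nat[of "UNIV :: 'd set"] by (auto simp: n_def)
  have hn: "h k < n" for k using bij_betw_apply[OF h, of k] by simp
  have inj: "h k = h k' \<longleftrightarrow> k = k'" for k k' using h by (auto simp: bij_betw_def inj_on_def)
  have n: "n > 0" by (simp add: n_def)
  define S where "S i t = schoenberg (2 * n) i t" for i t
  define \<Phi> :: "real \<Rightarrow> 'd torus \<times> (real ^ 'd)" where
    "\<Phi> t = (tproj (\<chi> k. S (h k) t), \<chi> k. R * (2 * S (n + h k) t - 1))" for t
  have cS: "continuous_on A (S i)" for A i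
    using continuous_on_schoenberg unfolding S_def[abs_def] .
  have "continuous_on UNIV (\<lambda>t. tproj (\<chi> k. S (h k) t) :: 'd torus)"
    by (rule continuous_on_compose2[OF continuous_on_tproj[of UNIV]])
      (intro continuous_on_vec_lambda cS, simp)
  moreover have "continuous_on UNIV (\<lambda>t. (\<chi> k. R * (2 * S (n + h k) t - 1)) :: real ^ 'd)"
    by (intro continuous_on_vec_lambda continuous_on_mult continuous_on_diff continuous_on_const cS)
  ultimately have c\<Phi>: "continuous_on UNIV \<Phi>"
    unfolding \<Phi>_def[abs_def] by (rule continuous_on_Pair)
  define K where "K = (UNIV :: 'd torus set) \<times> cbox ((\<chi> k. - R) :: real ^ 'd) (\<chi> k. R)"
  have "compact K" unfolding K_def by (intro compact_Times compact_torus compact_cbox)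
  moreover have "range \<Phi> \<subseteq> K"
  proof clarify
    fix x v t assume "(x, v) = \<Phi> t"
    then have v: "v $ k = R * (2 * S (n + h k) t - 1)" for k by (simp add: \<Phi>_def)
    have "- R \<le> v $ k \<and> v $ k \<le> R" for k
    proof -
      have s: "0 \<le> S (n + h k) t" "S (n + h k) t \<le> 1" using schoenberg_range by (auto simp: S_def)
      have "R * (- 1) \<le> v $ k" unfolding v using s R by (intro mult_left_mono) auto
      moreover have "v $ k \<le> R * 1" unfolding v using s R by (intro mult_left_mono) auto
      ultimately show ?thesis by simp
    qed
    then show "(x, v) \<in> K" by (simp add: K_def mem_box_cart)
  qed
  moreover have "(x, v) \<in> \<Phi> ` {0..1}" if v: "norm v \<le> R" for x v
  proof -
    obtain a :: "real ^ 'd" where a: "a \<in> cbox 0 1" "tproj a = x" using tproj_lift_cbox by blast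
    define k where "k i = the_inv h i" for i
    have kh: "k (h j) = j" for j
      using h by (simp add: k_def the_inv_f_f bij_betw_def)
    define y where "y i = (if i < n then a $ k i else (v $ k (i - n) / R + 1) / 2)" for i
    have y: "0 \<le> y i \<and> y i \<le> 1" for i
    proof (cases "i < n")
      case True
      then show ?thesis using a(1) by (auto simp: y_def mem_box_cart)
    next
      case False
      have "\<bar>v $ k (i - n)\<bar> \<le> R" using v component_le_norm_cart[of v] order_trans by blast
      then have "- 1 \<le> v $ k (i - n) / R" "v $ k (i - n) / R \<le> 1" using R by (auto simp: field_simps abs_le_iff)
      then show ?thesis using False by (simp add: y_def)
    qed
    have "\<exists>t\<in>{0..1}. \<forall>i<2 * n. schoenberg (2 * n) i t = y i"
      by (rule schoenberg_surj) (use n y in auto)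
    then obtain t where t: "t \<in> {0..1}" "\<And>i. i < 2 * n \<Longrightarrow> S i t = y i" by (auto simp: S_def)
    have "S (h j) t = a $ j" for j using t(2)[of "h j"] hn[of j] by (simp add: y_def kh)
    moreover have "R * (2 * S (n + h j) t - 1) = v $ j" for j
    proof -
      have "S (n + h j) t = (v $ j / R + 1) / 2" using t(2)[of "n + h j"] hn[of j] by (simp add: y_def kh)
      then show ?thesis using R by (simp add: field_simps)
    qed
    ultimately have "\<Phi> t = (x, v)" using a(2) by (simp add: \<Phi>_def)
    with t(1) show ?thesis by force
  qed
  ultimately show ?thesis using that c\<Phi> by blast
qed

text \<open>Choose a parameter in [0, 1] for every atom. The laws of the parameters are tight on the
  line, Helly's selection theorem gives a weak limit there, and its image under
  \<open>\<Phi>\<close> is the limit on phase space.\<close>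

lemma pmf_weak_limit:
  fixes p :: "nat \<Rightarrow> 'e pmf" and f :: "nat \<Rightarrow> 'e \<Rightarrow> 'x::metric_space" and \<Phi> :: "real \<Rightarrow> 'x"
  assumes c\<Phi>: "continuous_on UNIV \<Phi>" and K: "compact K" "range \<Phi> \<subseteq> K"
    and f: "\<And>n e. e \<in> set_pmf (p n) \<Longrightarrow> f n e \<in> \<Phi> ` {0..1}"
  obtains r and \<mu> :: "'x measure" where "strict_mono (r :: nat \<Rightarrow> nat)" "prob_space \<mu>" "sets \<mu> = sets borel"
    "\<And>g :: 'x \<Rightarrow> real. continuous_on UNIV g \<Longrightarrow> integrable \<mu> g"
    "\<And>g :: 'x \<Rightarrow> real. continuous_on UNIV g \<Longrightarrow>
       (\<lambda>n. \<integral>e. g (f (r n) e) \<partial>measure_pmf (p (r n))) \<longlonglongrightarrow> (\<integral>z. g z \<partial>\<mu>)"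
proof -
  define t where "t n e = (SOME s. s \<in> {0..1} \<and> \<Phi> s = f n e)" for n e
  have t: "t n e \<in> {0..1}" "\<Phi> (t n e) = f n e" if "e \<in> set_pmf (p n)" for n e
  proof -
    have "\<exists>s. s \<in> {0..1} \<and> \<Phi> s = f n e" using f[OF that] by (metis imageE)
    from someI_ex[OF this] show "t n e \<in> {0..1}" "\<Phi> (t n e) = f n e" by (simp_all add: t_def)
  qed
  define \<mu>s where "\<mu>s n = distr (measure_pmf (p n)) borel (t n)" for n
  have rd: "real_distribution (\<mu>s n)" for n
    unfolding \<mu>s_def by (rule prob_space.real_distribution_distr[OF prob_space_measure_pmf]) simp
  have "tight \<mu>s"
    unfolding tight_def
  proof (intro conjI allI impI rd)
    fix \<epsilon> :: real assume \<epsilon>: "\<epsilon> > 0"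
    \<comment> \<open>Tightness is stated with half-open intervals; starting at -1 keeps the
      parameter 0 inside.\<close>
    have "measure (\<mu>s n) {-1<..1} = 1" for n
    proof -
      have "measure (\<mu>s n) {-1<..1} = measure (measure_pmf (p n)) (t n -` {-1<..1} \<inter> space (measure_pmf (p n)))"
        unfolding \<mu>s_def by (rule measure_distr) auto
      also have "\<dots> = 1"
        by (rule prob_space.prob_eq_1[OF prob_space_measure_pmf, THEN iffD2])
          (use t(1) in \<open>force simp: AE_measure_pmf_iff\<close>)+
      finally show ?thesis .
    qed
    then show "\<exists>a b. a < b \<and> (\<forall>n. 1 - \<epsilon> < measure (\<mu>s n) {a<..b})"
      using \<epsilon> by (intro exI[of _ "-1"] exI[of _ 1]) simp
  qed
  from tight_imp_convergent_subsubsequence[OF this strict_mono_id]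
  obtain r M where r: "strict_mono (r :: nat \<Rightarrow> nat)" and M: "real_distribution M" and w: "weak_conv_m (\<mu>s \<circ> r) M"
    by (auto simp: o_def)
  interpret M: real_distribution M by fact
  have m\<Phi>: "\<Phi> \<in> borel_measurable borel" using c\<Phi> by (rule borel_measurable_continuous_onI)
  have m\<Phi>M: "\<Phi> \<in> measurable M borel" using m\<Phi> by (simp add: measurable_def)
  define \<mu> where "\<mu> = distr M borel \<Phi>"
  have gB: "\<exists>B. \<forall>s. norm (g (\<Phi> s)) \<le> B" if "continuous_on UNIV g" for g :: "'x \<Rightarrow> real"
  proof -
    have "compact (g ` K)" using K(1) continuous_on_subset[OF that] by (intro compact_continuous_image) auto
    then have "bounded (g ` K)" by (rule compact_imp_bounded)
    then obtain B where "\<forall>x\<in>g ` K. norm x \<le> B" unfolding bounded_iff by blast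
    then show ?thesis using K(2) by (intro exI[of _ B]) blast
  qed
  have mg: "g \<in> borel_measurable borel" if "continuous_on UNIV g" for g :: "'x \<Rightarrow> real"
    using that by (rule borel_measurable_continuous_onI)
  show ?thesis
  proof (rule that[OF r, of \<mu>])
    show "prob_space \<mu>" unfolding \<mu>_def by (rule M.prob_space_distr[OF m\<Phi>M])
    show "sets \<mu> = sets borel" by (simp add: \<mu>_def)
  next
    fix g :: "'x \<Rightarrow> real" assume g: "continuous_on UNIV g"
    obtain B where B: "\<And>s. norm (g (\<Phi> s)) \<le> B" using gB[OF g] by blast
    have mgM: "(\<lambda>s. g (\<Phi> s)) \<in> borel_measurable M"
      using measurable_compose[OF m\<Phi>M mg[OF g]] .
    have "integrable M (\<lambda>s. g (\<Phi> s))"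
      by (rule M.integrable_const_bound[of _ B]) (use B mgM in auto)
    then show "integrable \<mu> g"
      unfolding \<mu>_def by (subst integrable_distr_eq[OF m\<Phi>M mg[OF g]])
    have eq: "(\<integral>e. g (f n e) \<partial>measure_pmf (p n)) = (\<integral>s. g (\<Phi> s) \<partial>\<mu>s n)" for n
    proof -
      have "(\<integral>s. g (\<Phi> s) \<partial>\<mu>s n) = (\<integral>e. g (\<Phi> (t n e)) \<partial>measure_pmf (p n))"
        unfolding \<mu>s_def by (rule integral_distr) (use measurable_compose[OF m\<Phi> mg[OF g]] in auto)
      also have "\<dots> = (\<integral>e. g (f n e) \<partial>measure_pmf (p n))"
        by (rule integral_cong_AE) (use t(2) in \<open>auto simp: AE_measure_pmf_iff\<close>)
      finally show ?thesis by simp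
    qed
    have "(\<lambda>n. \<integral>s. g (\<Phi> s) \<partial>(\<mu>s \<circ> r) n) \<longlonglongrightarrow> (\<integral>s. g (\<Phi> s) \<partial>M)"
    proof (rule weak_conv_imp_integral_bdd_continuous_conv[OF _ M w])
      show "real_distribution ((\<mu>s \<circ> r) n)" for n using rd by simp
      have "continuous_on UNIV (\<lambda>s. g (\<Phi> s))"
        by (rule continuous_on_compose2[OF g c\<Phi>]) simp
      then show "isCont (\<lambda>s. g (\<Phi> s)) x" for x by (simp add: continuous_on_eq_continuous_at)
    qed (rule B)
    moreover have "(\<integral>s. g (\<Phi> s) \<partial>M) = (\<integral>z. g z \<partial>\<mu>)"
      unfolding \<mu>_def by (rule integral_distr[OF m\<Phi>M mg[OF g], symmetric])
    ultimately show "(\<lambda>n. \<integral>e. g (f (r n) e) \<partial>measure_pmf (p (r n))) \<longlonglongrightarrow> (\<integral>z. g z \<partial>\<mu>)"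
      by (simp add: eq)
  qed
qed

section \<open>Weak KAM solutions on the grid\<close>

text \<open>The grid lifted to the whole of \<open>real ^ 'd\<close>. A pair of lifted points stands
  for an edge with its lattice vector already absorbed, so its velocity is just the difference
  divided by \<tau>.\<close>

definition grid :: "nat \<Rightarrow> (real ^ 'd::finite) set" where
  "grid N = {a. \<forall>k. real N * a $ k \<in> \<int>}"

definition index :: "nat \<Rightarrow> real ^ 'd::finite \<Rightarrow> nat ^ 'd" where
  "index N a = (\<chi> k. nat (\<lfloor>real N * a $ k\<rfloor> mod int N))"

definition round_down :: "nat \<Rightarrow> real ^ 'd::finite \<Rightarrow> real ^ 'd" where
  "round_down N a = (\<chi> k. of_int \<lfloor>real N * a $ k\<rfloor> / real N)"

abbreviation lattice_vec :: "int ^ 'd::finite \<Rightarrow> real ^ 'd" where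
  "lattice_vec l \<equiv> (\<chi> k. real_of_int (l $ k))"

section \<open>Arithmetic of the lifted grid\<close>

lemma int_vec_lattice_vec: "int_vec (lattice_vec l)"
  by (simp add: int_vec_def)

lemma grid_add: "a \<in> grid N \<Longrightarrow> b \<in> grid N \<Longrightarrow> a + b \<in> grid N"
  by (auto simp: grid_def algebra_simps)

lemma int_vec_grid: "int_vec z \<Longrightarrow> z \<in> grid N"
  by (auto simp: grid_def int_vec_def)

lemma grid_point_grid: "N \<ge> 1 \<Longrightarrow> grid_point N i \<in> grid N"
  by (auto simp: grid_def grid_point_def)

lemma round_down_grid: "N \<ge> 1 \<Longrightarrow> round_down N a \<in> grid N"
  by (auto simp: grid_def round_down_def)

lemma round_down_of_grid: "N \<ge> 1 \<Longrightarrow> a \<in> grid N \<Longrightarrow> round_down N a = a"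
  by (auto simp: grid_def round_down_def vec_eq_iff field_simps)

lemma round_down_dist: "N \<ge> 1 \<Longrightarrow> norm (round_down N a - a) \<le> real CARD('d) / real N"
  for a :: "real ^ 'd::finite"
proof -
  assume N: "N \<ge> 1"
  have "\<bar>(round_down N a - a) $ k\<bar> \<le> 1 / real N" for k
  proof -
    have "\<bar>of_int \<lfloor>real N * a $ k\<rfloor> - real N * a $ k\<bar> \<le> 1" by linarith
    then have "\<bar>of_int \<lfloor>real N * a $ k\<rfloor> - real N * a $ k\<bar> / real N \<le> 1 / real N"
      by (rule divide_right_mono) simp
    moreover have "(round_down N a - a) $ k = (of_int \<lfloor>real N * a $ k\<rfloor> - real N * a $ k) / real N"
      using N by (simp add: round_down_def field_simps)
    ultimately show ?thesis by simp
  qed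
  then have "(\<Sum>k\<in>UNIV. \<bar>(round_down N a - a) $ k\<bar>) \<le> (\<Sum>k\<in>(UNIV::'d set). 1 / real N)"
    by (intro sum_mono)
  then show ?thesis using norm_le_l1_cart[of "round_down N a - a"] by simp
qed

lemma index_grid_index: "N \<ge> 1 \<Longrightarrow> index N a \<in> grid_index N"
  by (auto simp: index_def grid_index_def nat_less_iff)

lemma index_periodic:
  assumes N: "N \<ge> 1" and z: "int_vec z" shows "index N (a + z) = index N a"
proof -
  have "\<lfloor>real N * (a + z) $ k\<rfloor> mod int N = \<lfloor>real N * a $ k\<rfloor> mod int N" for k
  proof -
    obtain m where m: "z $ k = of_int m" using z by (auto simp: int_vec_def Ints_def)
    have "real N * (a + z) $ k = real N * a $ k + of_int (int N * m)" by (simp add: m algebra_simps)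
    then have "\<lfloor>real N * (a + z) $ k\<rfloor> = \<lfloor>real N * a $ k\<rfloor> + int N * m"
      by (metis floor_add_int)
    then show ?thesis by simp
  qed
  then show ?thesis by (simp add: index_def)
qed

lemma index_grid_point: "N \<ge> 1 \<Longrightarrow> i \<in> grid_index N \<Longrightarrow> index N (grid_point N i) = i"
  by (auto simp: index_def grid_point_def grid_index_def vec_eq_iff simp flip: of_nat_mod zmod_int)

lemma grid_point_index:
  assumes N: "N \<ge> 1" and a: "a \<in> grid N"
  obtains l where "a = grid_point N (index N a) + lattice_vec l"
proof -
  have "\<exists>m. a $ k = grid_point N (index N a) $ k + of_int m" for k
  proof -
    obtain n where n: "real N * a $ k = of_int n" using a by (auto simp: grid_def Ints_def)
    have fl: "\<lfloor>real N * a $ k\<rfloor> = n" using n by simp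
    have "grid_point N (index N a) $ k = real (nat (n mod int N)) / real N"
      by (simp only: grid_point_def index_def vec_lambda_beta fl)
    moreover have "real (nat (n mod int N)) = of_int (n mod int N)" using N by simp
    moreover have "of_int n = real N * of_int (n div int N) + real_of_int (n mod int N)"
      by (metis mult_div_mod_eq of_int_add of_int_mult of_int_of_nat_eq)
    ultimately have "real N * a $ k = real N * (grid_point N (index N a) $ k + of_int (n div int N))"
      using N by (simp add: n distrib_left)
    then have "a $ k = grid_point N (index N a) $ k + of_int (n div int N)" using N by simp
    then show ?thesis by blast
  qed
  then obtain m where m: "\<And>k. a $ k = grid_point N (index N a) $ k + of_int (m k)" by metis
  have "a = grid_point N (index N a) + lattice_vec (\<chi> k. m k)"
    by (simp only: vec_eq_iff vector_add_component vec_lambda_beta m) simp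
  then show ?thesis by (rule that)
qed

lemma finite_grid_index: "finite (grid_index N :: (nat ^ 'd::finite) set)"
proof -
  have "vec_nth ` (grid_index N :: (nat ^ 'd) set) \<subseteq> PiE UNIV (\<lambda>_. {..<N})"
    by (auto simp: grid_index_def)
  then have "finite (vec_nth ` (grid_index N :: (nat ^ 'd) set))"
    by (rule finite_subset) (intro finite_PiE, auto)
  then show ?thesis by (rule finite_imageD) (auto simp: inj_on_def vec_nth_inject)
qed

lemma grid_index_nonempty: "N \<ge> 1 \<Longrightarrow> grid_index N \<noteq> {}"
  using index_grid_index by blast

lemma finite_lattice_ball: "finite {l :: int ^ 'd::finite. norm (lattice_vec l + w) \<le> r}"
proof -
  define M where "M = \<lceil>r + norm w\<rceil>"
  have "vec_nth ` {l :: int ^ 'd. norm (lattice_vec l + w) \<le> r} \<subseteq> PiE UNIV (\<lambda>_. {-M..M})"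
  proof -
    have "l $ k \<in> {-M..M}" if l: "norm (lattice_vec l + w) \<le> r" for l :: "int ^ 'd" and k
    proof -
      have "\<bar>real_of_int (l $ k)\<bar> \<le> norm (lattice_vec l)"
        using component_le_norm_cart[of "lattice_vec l" k] by simp
      also have "\<dots> \<le> r + norm w"
        using norm_triangle_ineq4[of "lattice_vec l + w" w] l by simp
      finally have "\<bar>l $ k\<bar> \<le> M" unfolding M_def by linarith
      then show ?thesis by auto
    qed
    then show ?thesis by blast
  qed
  then have "finite (vec_nth ` {l :: int ^ 'd. norm (lattice_vec l + w) \<le> r})"
    by (rule finite_subset) (intro finite_PiE, auto)
  then show ?thesis by (rule finite_imageD) (auto simp: inj_on_def vec_nth_inject)
qed

text \<open>A periodic fixed point, up to the additive constant, of the backward Lax-Oleinik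
  operator on the lifted grid: domination along all steps, and a calibrated step arriving at each
  point. The minimum point in the last clause serves to bound \<open>c\<close> from above.\<close>

definition weak_kam_grid ::
  "('d::finite torus \<Rightarrow> real ^ 'd \<Rightarrow> real) \<Rightarrow> nat \<Rightarrow> real \<Rightarrow> real \<Rightarrow> (real ^ 'd \<Rightarrow> real) \<Rightarrow> bool" where
  "weak_kam_grid L N \<tau> c U \<longleftrightarrow>
     (\<forall>a z. int_vec z \<longrightarrow> U (a + z) = U a) \<and>
     (\<forall>a\<in>grid N. \<forall>b\<in>grid N. U b - U a \<le> \<tau> * (L (tproj a) ((b - a) /\<^sub>R \<tau>) + c)) \<and>
     (\<forall>b\<in>grid N. \<exists>a\<in>grid N. U b - U a = \<tau> * (L (tproj a) ((b - a) /\<^sub>R \<tau>) + c)) \<and>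
     (\<exists>b\<in>grid N. \<forall>a\<in>grid N. U b \<le> U a)"

lemma discrete_velocity_eq:
  "discrete_velocity N \<tau> i j l = (grid_point N j + lattice_vec l - grid_point N i) /\<^sub>R \<tau>"
  by (simp add: discrete_velocity_def divide_inverse_commute)

context tonelli_lift
begin

text \<open>Superlinearity leaves finitely many relevant lattice vectors between two given grid
  points, so an optimal one \<open>l0 i j\<close> exists. The cost \<tau> L of that optimal edge
  makes the problem finite, and dividing its ergodic constant by \<tau> gives the constant per unit
  of time.\<close>

lemma weak_kam_grid_exists:
  assumes N: "N \<ge> 1" and \<tau>: "\<tau> > 0"
  shows "\<exists>c U. weak_kam_grid L N \<tau> c U"
proof -
  define G where "G = (grid_index N :: (nat ^ 'd) set)"
  define V where "V i j l = discrete_velocity N \<tau> i j l" for i j :: "nat ^ 'd" and l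
  define X where "X i = (tproj (grid_point N i) :: 'd torus)" for i
  obtain C where C: "\<And>x v. L x v \<ge> norm v - C" using L_superlinear[of 1] by auto
  have "\<exists>l0. \<forall>l. L (X i) (V i j l0) \<le> L (X i) (V i j l)" for i j
  proof -
    define F where "F = {l. L (X i) (V i j l) \<le> L (X i) (V i j 0)}"
    have "F \<subseteq> {l. norm (lattice_vec l + (grid_point N j - grid_point N i)) \<le> \<tau> * (L (X i) (V i j 0) + C)}"
    proof
      fix l assume "l \<in> F"
      then have "norm (V i j l) \<le> L (X i) (V i j 0) + C" using C[of "V i j l" "X i"] by (simp add: F_def)
      moreover have "norm (V i j l) = norm (lattice_vec l + (grid_point N j - grid_point N i)) / \<tau>"
      proof -
        have "grid_point N j + lattice_vec l - grid_point N i = lattice_vec l + (grid_point N j - grid_point N i)"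
          by simp
        then have "V i j l = (lattice_vec l + (grid_point N j - grid_point N i)) /\<^sub>R \<tau>"
          by (simp only: V_def discrete_velocity_eq)
        then show ?thesis using \<tau> by (simp only: norm_scaleR) (simp add: divide_inverse_commute)
      qed
      ultimately show "l \<in> {l. norm (lattice_vec l + (grid_point N j - grid_point N i)) \<le> \<tau> * (L (X i) (V i j 0) + C)}"
        using \<tau> by (simp add: field_simps)
    qed
    then have fin: "finite F" using finite_lattice_ball finite_subset by blast
    have "0 \<in> F" by (simp add: F_def)
    define l0 where "l0 = arg_min_on (\<lambda>l. L (X i) (V i j l)) F"
    have "l0 \<in> F" using arg_min_if_finite(1)[OF fin] \<open>0 \<in> F\<close> unfolding l0_def by blast
    have "L (X i) (V i j l0) \<le> L (X i) (V i j l)" for l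
    proof (cases "l \<in> F")
      case True
      then show ?thesis unfolding l0_def by (intro arg_min_least[OF fin]) auto
    next
      case False
      then show ?thesis using \<open>l0 \<in> F\<close> by (simp add: F_def)
    qed
    then show ?thesis by blast
  qed
  then obtain l0 where l0: "\<And>i j l. L (X i) (V i j (l0 i j)) \<le> L (X i) (V i j l)" by metis
  have fG: "finite G" and neG: "G \<noteq> {}"
    using finite_grid_index grid_index_nonempty[OF N] by (simp_all add: G_def)
  obtain u c where u: "\<And>i j. i \<in> G \<Longrightarrow> j \<in> G \<Longrightarrow> u j \<le> u i + \<tau> * L (X i) (V i j (l0 i j)) + c"
    "\<And>j. j \<in> G \<Longrightarrow> \<exists>i\<in>G. u j = u i + \<tau> * L (X i) (V i j (l0 i j)) + c"
  proof -
    define A where "A i j = \<tau> * L (X i) (V i j (l0 i j))" for i j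
    obtain u c where "\<And>i j. i \<in> G \<Longrightarrow> j \<in> G \<Longrightarrow> u j \<le> u i + A i j + c"
      "\<And>j. j \<in> G \<Longrightarrow> \<exists>i\<in>G. u j = u i + A i j + c"
      using finite_ergodic_problem[OF fG neG, of A] by blast
    then show ?thesis using that unfolding A_def by blast
  qed
  define U where "U a = u (index N a)" for a
  have per: "U (a + z) = U a" if "int_vec z" for a z
    using index_periodic[OF N that] by (simp add: U_def)
  have iG: "index N a \<in> G" for a using index_grid_index[OF N] by (simp add: G_def)
  have "weak_kam_grid L N \<tau> (c / \<tau>) U"
    unfolding weak_kam_grid_def
  proof (intro conjI ballI allI impI per)
    fix a b :: "real ^ 'd" assume ab: "a \<in> grid N" "b \<in> grid N"
    obtain la where la: "a = grid_point N (index N a) + lattice_vec la" using grid_point_index[OF N ab(1)] .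
    obtain lb where lb: "b = grid_point N (index N b) + lattice_vec lb" using grid_point_index[OF N ab(2)] .
    have "(b - a) /\<^sub>R \<tau> = V (index N a) (index N b) (lb - la)"
    proof -
      have "b - a = grid_point N (index N b) + lattice_vec (lb - la) - grid_point N (index N a)"
        by (subst la, subst lb) (simp add: vec_eq_iff)
      then show ?thesis by (simp add: V_def discrete_velocity_eq)
    qed
    moreover have "tproj a = X (index N a)"
      using tproj_add_int_vec[OF int_vec_lattice_vec] la unfolding X_def by metis
    ultimately have "L (tproj a) ((b - a) /\<^sub>R \<tau>) \<ge> L (X (index N a)) (V (index N a) (index N b) (l0 (index N a) (index N b)))"
      using l0 by simp
    then have "\<tau> * L (tproj a) ((b - a) /\<^sub>R \<tau>) \<ge> \<tau> * L (X (index N a)) (V (index N a) (index N b) (l0 (index N a) (index N b)))"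
      using \<tau> by simp
    with u(1)[OF iG iG, of b a] have "U b - U a \<le> \<tau> * L (tproj a) ((b - a) /\<^sub>R \<tau>) + c"
      unfolding U_def by linarith
    also have "\<dots> = \<tau> * (L (tproj a) ((b - a) /\<^sub>R \<tau>) + c / \<tau>)"
      using \<tau> by (simp add: distrib_left)
    finally show "U b - U a \<le> \<tau> * (L (tproj a) ((b - a) /\<^sub>R \<tau>) + c / \<tau>)" .
  next
    fix b :: "real ^ 'd" assume b: "b \<in> grid N"
    obtain lb where lb: "b = grid_point N (index N b) + lattice_vec lb" using grid_point_index[OF N b] .
    obtain i where i: "i \<in> G" "u (index N b) = u i + \<tau> * L (X i) (V i (index N b) (l0 i (index N b))) + c"
      using u(2)[OF iG] by blast
    \<comment> \<open>The lift of the optimal predecessor is shifted so that the edge from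
      \<open>a\<close> to \<open>b\<close> has exactly the lattice vector \<open>l0\<close>.\<close>
    define a where "a = grid_point N i + lattice_vec (lb - l0 i (index N b))"
    have "a \<in> grid N"
      unfolding a_def by (intro grid_add grid_point_grid N int_vec_grid int_vec_lattice_vec)
    moreover have "index N a = i"
      using i(1) unfolding a_def G_def
      by (simp only: index_periodic[OF N int_vec_lattice_vec] index_grid_point[OF N])
    moreover have "tproj a = X i"
      unfolding a_def X_def by (rule tproj_add_int_vec[OF int_vec_lattice_vec])
    moreover have "(b - a) /\<^sub>R \<tau> = V i (index N b) (l0 i (index N b))"
    proof -
      have "b - a = grid_point N (index N b) + lattice_vec (l0 i (index N b)) - grid_point N i"
        by (subst lb) (simp add: vec_eq_iff a_def)
      then show ?thesis by (simp add: V_def discrete_velocity_eq)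
    qed
    ultimately show "\<exists>a\<in>grid N. U b - U a = \<tau> * (L (tproj a) ((b - a) /\<^sub>R \<tau>) + c / \<tau>)"
      using i(2) \<tau> by (intro bexI[of _ a]) (simp_all add: U_def distrib_left)
  next
    have "finite (u ` G)" "u ` G \<noteq> {}" using finite_grid_index grid_index_nonempty[OF N] by (auto simp: G_def)
    then have "Min (u ` G) \<in> u ` G" by (rule Min_in)
    then obtain i where i: "i \<in> G" "u i = Min (u ` G)" by auto
    have "U (grid_point N i) \<le> U a" for a
      using i Min_le[OF \<open>finite (u ` G)\<close>, of "U a"] iG[of a] index_grid_point[OF N, of i] by (simp add: U_def G_def)
    then show "\<exists>b\<in>grid N. \<forall>a\<in>grid N. U b \<le> U a"
      using grid_point_grid[OF N] by blast
  qed
  then show ?thesis by blast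
qed

end

section \<open>Discrete Mather measures\<close>

lemma has_sum_finite_sum:
  fixes f :: "'i \<Rightarrow> 'a \<Rightarrow> real"
  assumes "finite I" "\<And>i. i \<in> I \<Longrightarrow> (f i has_sum s i) A"
  shows "((\<lambda>x. \<Sum>i\<in>I. f i x) has_sum (\<Sum>i\<in>I. s i)) A"
  using assms by (induction I rule: finite_induct) (auto intro: has_sum_add)

lemma has_sum_single:
  fixes w :: real
  assumes "a \<in> A" shows "((\<lambda>x. if x = a then w else 0) has_sum w) A"
proof -
  have "((\<lambda>x. if x = a then w else 0) has_sum w) {a}" by (rule has_sum_finiteI) auto
  then show ?thesis using assms by (subst has_sum_cong_neutral[where T = "{a}" and g = "\<lambda>x. if x = a then w else 0"]) auto
qed

abbreviation edges :: "nat \<Rightarrow> ((nat ^ 'd::finite) \<times> (nat ^ 'd) \<times> (int ^ 'd)) set" where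
  "edges N \<equiv> grid_index N \<times> grid_index N \<times> UNIV"

lemma holonomic_marginals:
  assumes h: "holonomic N \<mu>" and k: "k \<in> grid_index N"
  shows "((\<lambda>(j, l). \<mu> k j l) has_sum (\<Sum>\<^sub>\<infinity>(j, l)\<in>grid_index N \<times> UNIV. \<mu> k j l)) (grid_index N \<times> UNIV)"
    and "((\<lambda>(j, l). \<mu> j k l) has_sum (\<Sum>\<^sub>\<infinity>(j, l)\<in>grid_index N \<times> UNIV. \<mu> j k l)) (grid_index N \<times> UNIV)"
proof -
  have s: "(\<lambda>(i, j, l). \<mu> i j l) summable_on edges N"
    using h by (auto simp: holonomic_def summable_on_def)
  have "(\<lambda>(i, j, l). \<mu> i j l) summable_on ((\<lambda>(j, l). (k, j, l)) ` (grid_index N \<times> UNIV))"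
    by (rule summable_on_subset_banach[OF s]) (use k in auto)
  then have "(\<lambda>(j, l). \<mu> k j l) summable_on grid_index N \<times> UNIV"
    by (subst (asm) summable_on_reindex) (auto simp: inj_on_def o_def case_prod_unfold)
  then show "((\<lambda>(j, l). \<mu> k j l) has_sum (\<Sum>\<^sub>\<infinity>(j, l)\<in>grid_index N \<times> UNIV. \<mu> k j l)) (grid_index N \<times> UNIV)"
    by (rule has_sum_infsum)
  have "(\<lambda>(i, j, l). \<mu> i j l) summable_on ((\<lambda>(j, l). (j, k, l)) ` (grid_index N \<times> UNIV))"
    by (rule summable_on_subset_banach[OF s]) (use k in auto)
  then have "(\<lambda>(j, l). \<mu> j k l) summable_on grid_index N \<times> UNIV"
    by (subst (asm) summable_on_reindex) (auto simp: inj_on_def o_def case_prod_unfold)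
  then show "((\<lambda>(j, l). \<mu> j k l) has_sum (\<Sum>\<^sub>\<infinity>(j, l)\<in>grid_index N \<times> UNIV. \<mu> j k l)) (grid_index N \<times> UNIV)"
    by (rule has_sum_infsum)
qed

lemma holonomic_nonneg:
  "holonomic N \<mu> \<Longrightarrow> i \<in> grid_index N \<Longrightarrow> j \<in> grid_index N \<Longrightarrow> \<mu> i j l \<ge> 0"
  by (simp add: holonomic_def)

text \<open>Both sums equal the mean of \<open>V\<close> under the common marginal \<open>m\<close>.
  This is closedness in discrete form; it is applied to the weak KAM potential and to test
  functions.\<close>

lemma holonomic_flow:
  fixes \<mu> :: "nat ^ 'd::finite \<Rightarrow> nat ^ 'd \<Rightarrow> int ^ 'd \<Rightarrow> real"
  assumes h: "holonomic N \<mu>"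
  obtains S where "((\<lambda>(i, j, l). V i * \<mu> i j l) has_sum S) (edges N)"
    "((\<lambda>(i, j, l). V j * \<mu> i j l) has_sum S) (edges N)"
proof -
  define G where "G = (grid_index N :: (nat ^ 'd) set)"
  define m where "m k = (\<Sum>\<^sub>\<infinity>(j, l)\<in>G \<times> UNIV. \<mu> k j l)" for k
  have m: "((\<lambda>(j, l). \<mu> k j l) has_sum m k) (G \<times> UNIV)" "((\<lambda>(j, l). \<mu> j k l) has_sum m k) (G \<times> UNIV)"
    if "k \<in> G" for k
  proof -
    have "m k = (\<Sum>\<^sub>\<infinity>(j, l)\<in>G \<times> UNIV. \<mu> j k l)"
      using h that by (simp add: m_def holonomic_def G_def)
    then show "((\<lambda>(j, l). \<mu> j k l) has_sum m k) (G \<times> UNIV)"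
      using holonomic_marginals(2)[OF h, of k] that unfolding G_def by simp
    show "((\<lambda>(j, l). \<mu> k j l) has_sum m k) (G \<times> UNIV)"
      using holonomic_marginals(1)[OF h, of k] that unfolding G_def m_def by simp
  qed
  have 1: "((\<lambda>(i, j, l). if i = k then \<mu> i j l else 0) has_sum m k) (G \<times> G \<times> UNIV)" if k: "k \<in> G" for k
  proof -
    have "((\<lambda>(i, j, l). \<mu> i j l) has_sum m k) ((\<lambda>(j, l). (k, j, l)) ` (G \<times> UNIV))"
      using m(1)[OF k] by (subst has_sum_reindex) (auto simp: inj_on_def o_def case_prod_unfold)
    then show ?thesis
      by (subst has_sum_cong_neutral[where T = "(\<lambda>(j, l). (k, j, l)) ` (G \<times> UNIV)" and g = "\<lambda>(i, j, l). \<mu> i j l"])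
        (use k in \<open>auto split: if_splits simp: image_iff\<close>)
  qed
  have 2: "((\<lambda>(i, j, l). if j = k then \<mu> i j l else 0) has_sum m k) (G \<times> G \<times> UNIV)" if k: "k \<in> G" for k
  proof -
    have "((\<lambda>(i, j, l). \<mu> i j l) has_sum m k) ((\<lambda>(j, l). (j, k, l)) ` (G \<times> UNIV))"
      using m(2)[OF k] by (subst has_sum_reindex) (auto simp: inj_on_def o_def case_prod_unfold)
    then show ?thesis
      by (subst has_sum_cong_neutral[where T = "(\<lambda>(j, l). (j, k, l)) ` (G \<times> UNIV)" and g = "\<lambda>(i, j, l). \<mu> i j l"])
        (use k in \<open>auto split: if_splits simp: image_iff\<close>)
  qed
  have fin: "finite G" using finite_grid_index by (simp add: G_def)
  have "((\<lambda>x. \<Sum>k\<in>G. V k * (case x of (i, j, l) \<Rightarrow> if i = k then \<mu> i j l else 0)) has_sum (\<Sum>k\<in>G. V k * m k)) (G \<times> G \<times> UNIV)"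
    by (intro has_sum_finite_sum fin has_sum_cmult_right 1)
  moreover have "(\<Sum>k\<in>G. V k * (case x of (i, j, l) \<Rightarrow> if i = k then \<mu> i j l else 0)) = (case x of (i, j, l) \<Rightarrow> V i * \<mu> i j l)"
    if "x \<in> G \<times> G \<times> UNIV" for x
    using that fin by (auto simp: sum.delta' if_distrib[of "\<lambda>y. V _ * y"] cong: if_cong)
  ultimately have A: "((\<lambda>(i, j, l). V i * \<mu> i j l) has_sum (\<Sum>k\<in>G. V k * m k)) (G \<times> G \<times> UNIV)"
    using has_sum_cong by (metis (no_types, lifting))
  have "((\<lambda>x. \<Sum>k\<in>G. V k * (case x of (i, j, l) \<Rightarrow> if j = k then \<mu> i j l else 0)) has_sum (\<Sum>k\<in>G. V k * m k)) (G \<times> G \<times> UNIV)"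
    by (intro has_sum_finite_sum fin has_sum_cmult_right 2)
  moreover have "(\<Sum>k\<in>G. V k * (case x of (i, j, l) \<Rightarrow> if j = k then \<mu> i j l else 0)) = (case x of (i, j, l) \<Rightarrow> V j * \<mu> i j l)"
    if "x \<in> G \<times> G \<times> UNIV" for x
    using that fin by (auto simp: sum.delta' if_distrib[of "\<lambda>y. V _ * y"] cong: if_cong)
  ultimately have B: "((\<lambda>(i, j, l). V j * \<mu> i j l) has_sum (\<Sum>k\<in>G. V k * m k)) (G \<times> G \<times> UNIV)"
    using has_sum_cong by (metis (no_types, lifting))
  from A B that show ?thesis unfolding G_def by blast
qed

text \<open>Conservation of mass: the edge gives positive inflow at \<open>j\<close>, hence positive
  outflow, and positive outflow at \<open>i\<close>, hence positive inflow.\<close>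

lemma holonomic_successor:
  fixes \<mu> :: "nat ^ 'd::finite \<Rightarrow> nat ^ 'd \<Rightarrow> int ^ 'd \<Rightarrow> real"
  assumes h: "holonomic N \<mu>" and ij: "i \<in> grid_index N" "j \<in> grid_index N" and pos: "\<mu> i j l > 0"
  shows "\<exists>k\<in>grid_index N. \<exists>m. \<mu> j k m > 0" "\<exists>k\<in>grid_index N. \<exists>m. \<mu> k i m > 0"
proof -
  have eq: "(\<Sum>\<^sub>\<infinity>(k, m)\<in>grid_index N \<times> UNIV. \<mu> n k m) = (\<Sum>\<^sub>\<infinity>(k, m)\<in>grid_index N \<times> UNIV. \<mu> k n m)"
    if "n \<in> grid_index N" for n using h that by (simp add: holonomic_def)
  have nn: "0 \<le> (case x of (k, m) \<Rightarrow> \<mu> k n m)" "0 \<le> (case x of (k, m) \<Rightarrow> \<mu> n k m)"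
    if "n \<in> grid_index N" "x \<in> grid_index N \<times> UNIV" for n x
    using that holonomic_nonneg[OF h] by auto
  show "\<exists>k\<in>grid_index N. \<exists>m. \<mu> j k m > 0"
  proof (rule ccontr)
    assume no: "\<not> ?thesis"
    have "(\<Sum>\<^sub>\<infinity>(k, m)\<in>grid_index N \<times> UNIV. \<mu> j k m) = 0"
    proof (rule infsum_0, clarify)
      fix k :: "nat ^ 'd" and m assume "k \<in> grid_index N"
      then have "\<mu> j k m \<ge> 0" "\<not> \<mu> j k m > 0" using no ij by (auto intro: holonomic_nonneg[OF h])
      then show "\<mu> j k m = 0" by simp
    qed
    then have "((\<lambda>(k, m). \<mu> k j m) has_sum 0) (grid_index N \<times> UNIV)"
      using holonomic_marginals(2)[OF h ij(2)] eq[OF ij(2)] by simp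
    from nonneg_has_sum_le_0D[OF this order_refl nn(1)[OF ij(2)], of "(i, l)"] ij pos
    show False by simp
  qed
  show "\<exists>k\<in>grid_index N. \<exists>m. \<mu> k i m > 0"
  proof (rule ccontr)
    assume no: "\<not> ?thesis"
    have "(\<Sum>\<^sub>\<infinity>(k, m)\<in>grid_index N \<times> UNIV. \<mu> k i m) = 0"
    proof (rule infsum_0, clarify)
      fix k :: "nat ^ 'd" and m assume "k \<in> grid_index N"
      then have "\<mu> k i m \<ge> 0" "\<not> \<mu> k i m > 0" using no ij by (auto intro: holonomic_nonneg[OF h])
      then show "\<mu> k i m = 0" by simp
    qed
    then have "((\<lambda>(k, m). \<mu> i k m) has_sum 0) (grid_index N \<times> UNIV)"
      using holonomic_marginals(1)[OF h ij(1)] eq[OF ij(1)] by simp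
    from nonneg_has_sum_le_0D[OF this order_refl nn(2)[OF ij(1)], of "(j, l)"] ij pos
    show False by simp
  qed
qed

text \<open>A cycle of calibrated edges exists because the set of grid points is finite; it carries the optimal measure.\<close>

lemma calibrated_cycle_measure:
  fixes L :: "'d::finite torus \<Rightarrow> real ^ 'd \<Rightarrow> real"
  assumes N: "N \<ge> 1" and \<tau>: "\<tau> > 0" and wk: "weak_kam_grid L N \<tau> c U"
  shows "\<exists>\<nu>. holonomic N \<nu> \<and>
    ((\<lambda>(i, j, l). L (tproj (grid_point N i)) (discrete_velocity N \<tau> i j l) * \<nu> i j l) has_sum (- c)) (edges N)"
proof -
  define G where "G = (grid_index N :: (nat ^ 'd) set)"
  define X where "X i = (grid_point N i :: real ^ 'd)" for i
  define W where "W i j l = L (tproj (X i)) (discrete_velocity N \<tau> i j l)" for i j l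
  have "\<exists>i\<in>G. \<exists>l. U (X j) - U (X i) = \<tau> * (W i j l + c)" for j
  proof -
    obtain a where a: "a \<in> grid N" "U (X j) - U a = \<tau> * (L (tproj a) ((X j - a) /\<^sub>R \<tau>) + c)"
      using wk grid_point_grid[OF N] unfolding weak_kam_grid_def X_def by blast
    obtain l where l: "a = X (index N a) + lattice_vec l"
      using grid_point_index[OF N a(1)] unfolding X_def by blast
    have "U a = U (X (index N a))"
      using wk l int_vec_lattice_vec[of l] unfolding weak_kam_grid_def by metis
    moreover have "tproj a = tproj (X (index N a))"
      using tproj_add_int_vec[OF int_vec_lattice_vec[of l]] l by metis
    moreover have "(X j - a) /\<^sub>R \<tau> = discrete_velocity N \<tau> (index N a) j (- l)"
    proof -
      have "X j - a = X j + lattice_vec (- l) - X (index N a)"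
        by (subst l) (simp add: vec_eq_iff)
      then show ?thesis by (simp add: discrete_velocity_eq X_def)
    qed
    ultimately show ?thesis
      using a(2) index_grid_index[OF N, of a] by (intro bexI[of _ "index N a"] exI[of _ "- l"]) (simp_all add: W_def G_def)
  qed
  then obtain p q where pq: "\<And>j. p j \<in> G" "\<And>j. U (X j) - U (X (p j)) = \<tau> * (W (p j) j (q j) + c)" by metis
  obtain j0 where j0: "j0 \<in> G" using grid_index_nonempty[OF N] by (auto simp: G_def)
  \<comment> \<open>The orbit of the predecessor map runs backwards in time, so the edge
    \<open>e k\<close> below leads from \<open>s (Suc k)\<close> to \<open>s k\<close>.\<close>
  define s where "s k = (p ^^ k) j0" for k
  have sG: "s k \<in> G" for k using j0 pq(1) by (cases k) (auto simp: s_def)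
  have fin: "finite G" using finite_grid_index by (simp add: G_def)
  have "\<not> inj s"
  proof
    assume "inj s"
    then have "infinite (range s)" by (rule range_inj_infinite)
    moreover have "range s \<subseteq> G" using sG by blast
    ultimately show False using fin finite_subset by blast
  qed
  then obtain a b where ab: "a < b" "s a = s b" unfolding inj_def by (metis linorder_neqE_nat)
  define e where "e k = (s (Suc k), s k, q (s k))" for k
  define M where "M = real (b - a)"
  have M: "M > 0" using ab by (simp add: M_def)
  \<comment> \<open>The interval from \<open>a\<close> to \<open>b\<close> need not be a shortest
    period; the sum counts repeated edges with multiplicity.\<close>
  define \<nu> where "\<nu> i j l = (\<Sum>k=a..<b. if (i, j, l) = e k then 1 / M else 0)" for i j l
  have shift: "(\<Sum>k=a..<b. \<phi> (s (Suc k))) = (\<Sum>k=a..<b. \<phi> (s k))" for \<phi> :: "nat ^ 'd \<Rightarrow> real"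
    using sum_Suc_diff'[of a b "\<lambda>k. \<phi> (s k)"] ab by (simp add: sum_subtractf)
  have hs: "((\<lambda>x. \<Sum>k=a..<b. if x = e k then w k / M else 0) has_sum (\<Sum>k=a..<b. w k / M)) (edges N)"
    for w :: "nat \<Rightarrow> real"
    by (intro has_sum_finite_sum has_sum_single) (use sG in \<open>auto simp: e_def G_def\<close>)
  have "holonomic N \<nu>"
    unfolding holonomic_def
  proof (intro conjI ballI allI)
    show "0 \<le> \<nu> i j l" for i j l unfolding \<nu>_def using M by (intro sum_nonneg) auto
    have "(\<lambda>(i, j, l). \<nu> i j l) = (\<lambda>x. \<Sum>k=a..<b. if x = e k then 1 / M else 0)"
      by (auto simp: \<nu>_def)
    moreover have "(\<Sum>k=a..<b. 1 / M) = 1" using M by (simp add: M_def)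
    ultimately show "((\<lambda>(i, j, l). \<nu> i j l) has_sum 1) (edges N)" using hs[of "\<lambda>_. 1"] by (simp only:)
  next
    fix i :: "nat ^ 'd" assume i: "i \<in> grid_index N"
    have "((\<lambda>x. \<Sum>k=a..<b. if (i, x) = e k then 1 / M else 0) has_sum (\<Sum>k=a..<b. if s (Suc k) = i then 1 / M else 0)) (G \<times> UNIV)"
    proof (intro has_sum_finite_sum)
      fix k
      show "((\<lambda>x. if (i, x) = e k then 1 / M else 0) has_sum (if s (Suc k) = i then 1 / M else 0)) (G \<times> UNIV)"
        using has_sum_single[of "(s k, q (s k))" "G \<times> UNIV" "1 / M"] sG by (auto simp: e_def)
    qed simp
    moreover have "(\<lambda>(j, l). \<nu> i j l) = (\<lambda>x. \<Sum>k=a..<b. if (i, x) = e k then 1 / M else 0)"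
      by (auto simp: \<nu>_def)
    ultimately have 1: "(\<Sum>\<^sub>\<infinity>(j, l)\<in>G \<times> UNIV. \<nu> i j l) = (\<Sum>k=a..<b. if s (Suc k) = i then 1 / M else 0)"
      by (simp add: infsumI)
    have "((\<lambda>x. \<Sum>k=a..<b. if (fst x, i, snd x) = e k then 1 / M else 0) has_sum (\<Sum>k=a..<b. if s k = i then 1 / M else 0)) (G \<times> UNIV)"
    proof (intro has_sum_finite_sum)
      fix k
      have "(\<lambda>x. if (fst x, i, snd x) = e k then 1 / M else 0) =
          (\<lambda>x. if x = (s (Suc k), q (s k)) then (if s k = i then 1 / M else 0) else 0)"
        by (auto simp: e_def)
      then show "((\<lambda>x. if (fst x, i, snd x) = e k then 1 / M else 0) has_sum (if s k = i then 1 / M else 0)) (G \<times> UNIV)"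
        using has_sum_single[of "(s (Suc k), q (s k))" "G \<times> UNIV" "if s k = i then 1 / M else 0"] sG by simp
    qed simp
    moreover have "(\<lambda>(j, l). \<nu> j i l) = (\<lambda>x. \<Sum>k=a..<b. if (fst x, i, snd x) = e k then 1 / M else 0)"
      by (auto simp: \<nu>_def)
    ultimately have 2: "(\<Sum>\<^sub>\<infinity>(j, l)\<in>G \<times> UNIV. \<nu> j i l) = (\<Sum>k=a..<b. if s k = i then 1 / M else 0)"
      by (simp add: infsumI)
    show "(\<Sum>\<^sub>\<infinity>(j, l)\<in>grid_index N \<times> UNIV. \<nu> i j l) = (\<Sum>\<^sub>\<infinity>(j, l)\<in>grid_index N \<times> UNIV. \<nu> j i l)"
      using 1 2 shift[of "\<lambda>y. if y = i then 1 / M else 0"] unfolding G_def by simp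
  qed
  moreover have "((\<lambda>(i, j, l). W i j l * \<nu> i j l) has_sum (- c)) (edges N)"
  proof -
    define w where "w k = W (s (Suc k)) (s k) (q (s k))" for k
    have "U (X (s k)) - U (X (s (Suc k))) = \<tau> * (w k + c)" for k
      using pq(2)[of "s k"] by (simp add: s_def w_def)
    then have "(\<Sum>k=a..<b. \<tau> * (w k + c)) = (\<Sum>k=a..<b. U (X (s k)) - U (X (s (Suc k))))" by simp
    also have "\<dots> = 0" using shift[of "\<lambda>y. U (X y)"] by (simp add: sum_subtractf)
    finally have "\<tau> * (\<Sum>k=a..<b. w k + c) = 0" by (simp only: sum_distrib_left)
    then have "(\<Sum>k=a..<b. w k + c) = 0" using \<tau> by simp
    moreover have "(\<Sum>k=a..<b. w k + c) = (\<Sum>k=a..<b. w k) + M * c" by (simp add: sum.distrib M_def)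
    ultimately have "(\<Sum>k=a..<b. w k) = - c * M" by algebra
    then have "(\<Sum>k=a..<b. w k / M) = - c" using M by (simp flip: sum_divide_distrib)
    moreover have "(\<lambda>(i, j, l). W i j l * \<nu> i j l) = (\<lambda>x. \<Sum>k=a..<b. if x = e k then w k / M else 0)"
    proof (rule ext, clarify)
      fix i j l
      show "W i j l * \<nu> i j l = (\<Sum>k=a..<b. if (i, j, l) = e k then w k / M else 0)"
        unfolding \<nu>_def sum_distrib_left by (rule sum.cong) (auto simp: e_def w_def)
    qed
    ultimately show ?thesis using hs[of w] by simp
  qed
  ultimately show ?thesis unfolding W_def X_def by blast
qed

text \<open>Complementary slackness. The reduced cost \<open>w\<close> is nonnegative by domination,
  and holonomy cancels the potential \<open>V\<close>, so the mean of \<open>w\<close> is the action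
  plus \<open>c\<close>. Hence \<open>- c\<close> bounds the action from below, the calibrated cycle
  attains it, and at a minimizer \<open>w\<close> vanishes on every charged edge. This holds for
  every grid solution \<open>U\<close>.\<close>

lemma discrete_mather_structure:
  fixes L :: "'d::finite torus \<Rightarrow> real ^ 'd \<Rightarrow> real"
  assumes N: "N \<ge> 1" and \<tau>: "\<tau> > 0" and wk: "weak_kam_grid L N \<tau> c U"
  shows discrete_mather_exists: "\<exists>\<mu>. discrete_mather_measure L N \<tau> \<mu>"
    and discrete_mather_action: "discrete_mather_measure L N \<tau> \<mu> \<Longrightarrow>
      ((\<lambda>(i, j, l). L (tproj (grid_point N i)) (discrete_velocity N \<tau> i j l) * \<mu> i j l) has_sum (- c)) (edges N)"
    and discrete_mather_calibrated: "discrete_mather_measure L N \<tau> \<mu> \<Longrightarrow> i \<in> grid_index N \<Longrightarrow> j \<in> grid_index N \<Longrightarrow>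
      \<mu> i j l > 0 \<Longrightarrow>
      U (grid_point N j) - U (grid_point N i) = \<tau> * (L (tproj (grid_point N i)) (discrete_velocity N \<tau> i j l) + c)"
proof -
  define W where "W i j l = L (tproj (grid_point N i)) (discrete_velocity N \<tau> i j l)" for i j l
  define V where "V i = U (grid_point N i) / \<tau>" for i
  define w where "w i j l = W i j l + c - (V j - V i)" for i j l
  have w0: "w i j l \<ge> 0" for i j l
  proof -
    have g: "grid_point N i \<in> grid N" "grid_point N j + lattice_vec l \<in> grid N"
      by (intro grid_add grid_point_grid N int_vec_grid int_vec_lattice_vec)+
    have "U (grid_point N j + lattice_vec l) - U (grid_point N i) \<le>
        \<tau> * (L (tproj (grid_point N i)) ((grid_point N j + lattice_vec l - grid_point N i) /\<^sub>R \<tau>) + c)"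
      using wk g unfolding weak_kam_grid_def by blast
    moreover have "U (grid_point N j + lattice_vec l) = U (grid_point N j)"
      using wk int_vec_lattice_vec[of l] unfolding weak_kam_grid_def by blast
    ultimately have "U (grid_point N j) - U (grid_point N i) \<le> \<tau> * (W i j l + c)"
      by (simp only: W_def discrete_velocity_eq)
    then show ?thesis using \<tau> by (simp add: w_def V_def field_simps)
  qed
  have key: "((\<lambda>(i, j, l). w i j l * \<mu> i j l) has_sum (S + c)) (edges N)"
    if h: "holonomic N \<mu>" and S: "((\<lambda>(i, j, l). W i j l * \<mu> i j l) has_sum S) (edges N)" for \<mu> S
  proof -
    have 1: "((\<lambda>(i, j, l). \<mu> i j l) has_sum 1) (edges N)" using h by (simp add: holonomic_def)
    obtain T where T: "((\<lambda>(i, j, l). V i * \<mu> i j l) has_sum T) (edges N)"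
      "((\<lambda>(i, j, l). V j * \<mu> i j l) has_sum T) (edges N)" using holonomic_flow[OF h] by blast
    have "((\<lambda>x. (case x of (i, j, l) \<Rightarrow> W i j l * \<mu> i j l) + c * (case x of (i, j, l) \<Rightarrow> \<mu> i j l)
       + ((case x of (i, j, l) \<Rightarrow> V i * \<mu> i j l) + (- 1) * (case x of (i, j, l) \<Rightarrow> V j * \<mu> i j l)))
       has_sum (S + c * 1 + (T + (- 1) * T))) (edges N)"
      by (intro has_sum_add has_sum_cmult_right S 1 T)
    moreover have "(\<lambda>x. (case x of (i, j, l) \<Rightarrow> W i j l * \<mu> i j l) + c * (case x of (i, j, l) \<Rightarrow> \<mu> i j l)
       + ((case x of (i, j, l) \<Rightarrow> V i * \<mu> i j l) + (- 1) * (case x of (i, j, l) \<Rightarrow> V j * \<mu> i j l)))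
       = (\<lambda>(i, j, l). w i j l * \<mu> i j l)"
      by (auto simp: w_def algebra_simps)
    ultimately show ?thesis by simp
  qed
  have wnn: "0 \<le> (case x of (i, j, l) \<Rightarrow> w i j l * \<mu> i j l)" if "holonomic N \<mu>" "x \<in> edges N" for \<mu> x
    using that w0 holonomic_nonneg[OF that(1)] by auto
  have act: "discrete_action L N \<tau> \<mu> = (if (\<lambda>(i, j, l). W i j l * \<mu> i j l) summable_on edges N
      then ereal (infsum (\<lambda>(i, j, l). W i j l * \<mu> i j l) (edges N)) else \<infinity>)" for \<mu>
    by (simp add: discrete_action_def W_def Let_def)
  have low: "ereal (- c) \<le> discrete_action L N \<tau> \<mu>" if h: "holonomic N \<mu>" for \<mu>
  proof (cases "(\<lambda>(i, j, l). W i j l * \<mu> i j l) summable_on edges N")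
    case True
    from has_sum_nonneg[OF key[OF h has_sum_infsum[OF True]] wnn[OF h]]
    show ?thesis using True by (simp add: act)
  qed (simp add: act)
  obtain \<nu> where \<nu>: "holonomic N \<nu>" "((\<lambda>(i, j, l). W i j l * \<nu> i j l) has_sum (- c)) (edges N)"
    using calibrated_cycle_measure[OF N \<tau> wk] unfolding W_def by blast
  have \<nu>a: "discrete_action L N \<tau> \<nu> = ereal (- c)"
    using \<nu>(2) by (auto simp: act summable_on_def infsumI)
  show "\<exists>\<mu>. discrete_mather_measure L N \<tau> \<mu>"
    using \<nu>(1) low \<nu>a unfolding discrete_mather_measure_def by auto
  have a: "((\<lambda>(i, j, l). W i j l * \<mu> i j l) has_sum (- c)) (edges N)" if "discrete_mather_measure L N \<tau> \<mu>" for \<mu>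
  proof -
    have h: "holonomic N \<mu>" using that by (simp add: discrete_mather_measure_def)
    have "discrete_action L N \<tau> \<mu> \<le> ereal (- c)"
      using that \<nu>(1) \<nu>a unfolding discrete_mather_measure_def by metis
    with low[OF h] have eq: "discrete_action L N \<tau> \<mu> = ereal (- c)" by simp
    then have s: "(\<lambda>(i, j, l). W i j l * \<mu> i j l) summable_on edges N" by (auto simp: act split: if_splits)
    with eq have "infsum (\<lambda>(i, j, l). W i j l * \<mu> i j l) (edges N) = - c" by (simp add: act)
    with has_sum_infsum[OF s] show ?thesis by simp
  qed
  then show "discrete_mather_measure L N \<tau> \<mu> \<Longrightarrow>
      ((\<lambda>(i, j, l). L (tproj (grid_point N i)) (discrete_velocity N \<tau> i j l) * \<mu> i j l) has_sum (- c)) (edges N)"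
    unfolding W_def by blast
  assume m: "discrete_mather_measure L N \<tau> \<mu>" and ij: "i \<in> grid_index N" "j \<in> grid_index N" and pos: "\<mu> i j l > 0"
  have h: "holonomic N \<mu>" using m by (simp add: discrete_mather_measure_def)
  have "((\<lambda>(i, j, l). w i j l * \<mu> i j l) has_sum 0) (edges N)" using key[OF h a[OF m]] by simp
  from nonneg_has_sum_le_0D[OF this order_refl wnn[OF h], of "(i, j, l)"] ij
  have "w i j l * \<mu> i j l = 0" by simp
  with pos have "w i j l = 0" by simp
  then have "V j - V i = W i j l + c" by (simp add: w_def)
  then show "U (grid_point N j) - U (grid_point N i) = \<tau> * (L (tproj (grid_point N i)) (discrete_velocity N \<tau> i j l) + c)"
    using \<tau> by (simp add: V_def W_def field_simps)
qed

section \<open>A priori estimates\<close>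

definition calibrated_step ::
  "('d::finite torus \<Rightarrow> real ^ 'd \<Rightarrow> real) \<Rightarrow> real \<Rightarrow> real \<Rightarrow> (real ^ 'd \<Rightarrow> real) \<Rightarrow> real ^ 'd \<Rightarrow> real ^ 'd \<Rightarrow> bool" where
  "calibrated_step L \<tau> c U a b \<longleftrightarrow> U b - U a = \<tau> * (L (tproj a) ((b - a) /\<^sub>R \<tau>) + c)"

lemma weak_kam_grid_dominated:
  "weak_kam_grid L N \<tau> c U \<Longrightarrow> a \<in> grid N \<Longrightarrow> b \<in> grid N \<Longrightarrow>
    U b - U a \<le> \<tau> * (L (tproj a) ((b - a) /\<^sub>R \<tau>) + c)"
  and weak_kam_grid_predecessor:
  "weak_kam_grid L N \<tau> c U \<Longrightarrow> b \<in> grid N \<Longrightarrow> \<exists>a\<in>grid N. calibrated_step L \<tau> c U a b"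
  and weak_kam_grid_periodic: "weak_kam_grid L N \<tau> c U \<Longrightarrow> int_vec z \<Longrightarrow> U (a + z) = U a"
  unfolding weak_kam_grid_def calibrated_step_def by blast+

lemma axis_grid: "N \<ge> 1 \<Longrightarrow> axis k (of_int m / real N) \<in> grid N"
  by (auto simp: grid_def axis_def)

text \<open>Each endpoint is rounded by at most d / N in dimension d, and division by \<tau>
  magnifies the two errors. The bound tends to 0 because the mesh is of order \<tau>^2.\<close>

lemma round_down_path_velocity:
  fixes a v :: "real ^ 'd::finite"
  assumes N: "N \<ge> 1" and \<tau>: "\<tau> > 0"
  shows "norm ((round_down N (a + (real (Suc k) * \<tau>) *\<^sub>R v) - round_down N (a + (real k * \<tau>) *\<^sub>R v)) /\<^sub>R \<tau> - v)
    \<le> 2 * real CARD('d) / (real N * \<tau>)"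
proof -
  define x where "x k = a + (real k * \<tau>) *\<^sub>R v" for k
  have x: "x (Suc k) - x k = \<tau> *\<^sub>R v" by (simp add: x_def algebra_simps)
  have "(round_down N (x (Suc k)) - round_down N (x k)) /\<^sub>R \<tau> - v
      = ((round_down N (x (Suc k)) - x (Suc k)) - (round_down N (x k) - x k)) /\<^sub>R \<tau>"
  proof -
    have "v = (x (Suc k) - x k) /\<^sub>R \<tau>" using \<tau> by (simp add: x)
    then show ?thesis by (simp add: algebra_simps)
  qed
  also have "norm \<dots> = norm ((round_down N (x (Suc k)) - x (Suc k)) - (round_down N (x k) - x k)) / \<tau>"
    using \<tau> by (simp add: divide_inverse_commute)
  also have "\<dots> \<le> (real CARD('d) / real N + real CARD('d) / real N) / \<tau>"
    using \<tau> by (intro divide_right_mono order_trans[OF norm_triangle_ineq4] add_mono round_down_dist N) auto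
  finally show ?thesis by (simp add: x_def field_simps)
qed

lemma weak_kam_grid_path:
  fixes a v :: "real ^ 'd::finite"
  assumes N: "N \<ge> 1" and wk: "weak_kam_grid L N \<tau> c U" and \<tau>: "\<tau> > 0"
    and bound: "\<And>k. k < m \<Longrightarrow> L (tproj (round_down N (a + (real k * \<tau>) *\<^sub>R v)))
      ((round_down N (a + (real (Suc k) * \<tau>) *\<^sub>R v) - round_down N (a + (real k * \<tau>) *\<^sub>R v)) /\<^sub>R \<tau>) \<le> \<Lambda>"
  shows "U (round_down N (a + (real m * \<tau>) *\<^sub>R v)) - U (round_down N a) \<le> real m * \<tau> * (\<Lambda> + c)"
  using bound
proof (induction m)
  case 0
  then show ?case by simp
next
  case (Suc m)
  let ?x = "\<lambda>k. round_down N (a + (real k * \<tau>) *\<^sub>R v)"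
  have "U (?x (Suc m)) - U (?x m) \<le> \<tau> * (L (tproj (?x m)) ((?x (Suc m) - ?x m) /\<^sub>R \<tau>) + c)"
    by (intro weak_kam_grid_dominated[OF wk] round_down_grid N)
  also have "\<dots> \<le> \<tau> * (\<Lambda> + c)"
    using Suc.prems[of m] \<tau> by (intro mult_left_mono add_right_mono) auto
  finally have "U (?x (Suc m)) - U (?x m) \<le> \<tau> * (\<Lambda> + c)" .
  moreover have "U (?x m) - U (round_down N a) \<le> real m * \<tau> * (\<Lambda> + c)"
    by (rule Suc.IH) (rule Suc.prems, simp)
  ultimately show ?case by (simp add: algebra_simps)
qed

context tonelli_lift
begin

text \<open>A resting step bounds \<open>c\<close> from below. The calibrated step into a minimum
  point of \<open>U\<close> does not increase \<open>U\<close>, so its Lagrangian plus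
  \<open>c\<close> is nonpositive, which bounds \<open>c\<close> from above.\<close>

lemma weak_kam_constant_bounded:
  "\<exists>B\<ge>0. \<forall>N \<tau> c U. N \<ge> 1 \<longrightarrow> \<tau> > 0 \<longrightarrow> weak_kam_grid L N \<tau> c U \<longrightarrow> \<bar>c\<bar> \<le> B"
proof -
  obtain B where B: "B \<ge> 0" "\<And>x v. norm v \<le> 0 \<Longrightarrow> \<bar>L x v\<bar> \<le> B" using L_bounded[of 0] by blast
  obtain C where C: "\<And>x v. L x v \<ge> 1 * norm v - C" using L_superlinear[of 1] by auto
  have "\<bar>c\<bar> \<le> max B \<bar>C\<bar>" if N: "N \<ge> 1" and \<tau>: "\<tau> > 0" and wk: "weak_kam_grid L N \<tau> c U" for N \<tau> c U
  proof -
    have "0 \<in> grid N" by (rule int_vec_grid[OF int_vec_0])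
    from weak_kam_grid_dominated[OF wk this this] have "0 \<le> L (tproj 0) 0 + c"
      using \<tau> by (simp add: zero_le_mult_iff)
    then have 1: "- B \<le> c" using B(2)[of 0 "tproj 0"] by (simp add: abs_le_iff)
    obtain b where b: "b \<in> grid N" "\<forall>a\<in>grid N. U b \<le> U a"
      using wk unfolding weak_kam_grid_def by blast
    obtain a where a: "a \<in> grid N" "calibrated_step L \<tau> c U a b"
      using weak_kam_grid_predecessor[OF wk b(1)] by blast
    have "\<tau> * (L (tproj a) ((b - a) /\<^sub>R \<tau>) + c) \<le> 0"
      using a b unfolding calibrated_step_def by (metis diff_le_0_iff_le)
    then have "L (tproj a) ((b - a) /\<^sub>R \<tau>) + c \<le> 0" using \<tau> by (simp add: mult_le_0_iff)
    moreover have "L (tproj a) ((b - a) /\<^sub>R \<tau>) \<ge> - C"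
      using C[of "(b - a) /\<^sub>R \<tau>" "tproj a"] norm_ge_zero[of "(b - a) /\<^sub>R \<tau>"] by linarith
    ultimately have "c \<le> C" by linarith
    with 1 show ?thesis by (auto simp: abs_le_iff)
  qed
  then show ?thesis using B(1) by (intro exI[of _ "max B \<bar>C\<bar>"]) auto
qed

text \<open>Join the points by a rounded segment of speed at most 1. The time spent is at least one
  step, whence the additional \<tau> on the right: the estimate is Lipschitz only up to an error of
  order \<tau>.\<close>

lemma weak_kam_grid_lipschitz:
  "\<exists>K\<ge>0. \<forall>N \<tau> c U. N \<ge> 1 \<longrightarrow> \<tau> > 0 \<longrightarrow> 1 / real N \<le> \<tau> \<longrightarrow> weak_kam_grid L N \<tau> c U \<longrightarrow>
     (\<forall>a b. \<bar>U (round_down N a) - U (round_down N b)\<bar> \<le> K * (norm (a - b) + \<tau>))"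
proof -
  define R where "R = 1 + 2 * real CARD('d)"
  obtain Bc where Bc: "Bc \<ge> 0" "\<And>N \<tau> c U. N \<ge> 1 \<Longrightarrow> \<tau> > 0 \<Longrightarrow> weak_kam_grid L N \<tau> c U \<Longrightarrow> \<bar>c\<bar> \<le> Bc"
    using weak_kam_constant_bounded by blast
  obtain B where B: "B \<ge> 0" "\<And>x v. norm v \<le> R \<Longrightarrow> \<bar>L x v\<bar> \<le> B" using L_bounded[of R] by blast
  have half: "U (round_down N b) - U (round_down N a) \<le> 2 * (B + Bc) * (norm (a - b) + \<tau>)"
    if N: "N \<ge> 1" and \<tau>: "\<tau> > 0" "1 / real N \<le> \<tau>" and wk: "weak_kam_grid L N \<tau> c U" for N \<tau> c U and a b :: "real ^ 'd"
  proof -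
    \<comment> \<open>The extra 1 guarantees a step even when the points coincide, so that dividing
      by \<open>real m * \<tau>\<close> is legitimate.\<close>
    define m where "m = nat \<lceil>norm (a - b) / \<tau>\<rceil> + 1"
    have m: "norm (a - b) / \<tau> \<le> real m" "real m \<le> norm (a - b) / \<tau> + 2"
    proof -
      have "norm (a - b) / \<tau> \<ge> 0" using \<tau> by simp
      then show "norm (a - b) / \<tau> \<le> real m" "real m \<le> norm (a - b) / \<tau> + 2"
        unfolding m_def by linarith+
    qed
    have m0: "real m > 0" by (simp add: m_def)
    define v where "v = (b - a) /\<^sub>R (real m * \<tau>)"
    have v: "norm v \<le> 1"
    proof -
      have "norm v = norm (a - b) / (real m * \<tau>)"
        using \<tau>(1) by (simp add: v_def norm_minus_commute divide_inverse_commute)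
      moreover have "norm (a - b) \<le> real m * \<tau>" using m(1) \<tau>(1) by (simp add: pos_divide_le_eq)
      ultimately show ?thesis using \<tau>(1) m0 by (simp add: divide_le_eq_1)
    qed
    have ne: "real m * \<tau> \<noteq> 0" using m0 \<tau>(1) by simp
    have "(real m * \<tau>) *\<^sub>R v = b - a"
      by (simp only: v_def scaleR_scaleR right_inverse[OF ne] scaleR_one)
    then have end': "a + (real m * \<tau>) *\<^sub>R v = b" by simp
    have "U (round_down N (a + (real m * \<tau>) *\<^sub>R v)) - U (round_down N a) \<le> real m * \<tau> * (B + c)"
    proof (rule weak_kam_grid_path[OF N wk \<tau>(1)])
      fix k
      let ?w = "(round_down N (a + (real (Suc k) * \<tau>) *\<^sub>R v) - round_down N (a + (real k * \<tau>) *\<^sub>R v)) /\<^sub>R \<tau>"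
      have "1 / (real N * \<tau>) \<le> 1" using \<tau> N by (simp add: field_simps)
      then have "2 * real CARD('d) * (1 / (real N * \<tau>)) \<le> 2 * real CARD('d) * 1" by (intro mult_left_mono) auto
      then have "norm (?w - v) \<le> 2 * real CARD('d)"
        using round_down_path_velocity[OF N \<tau>(1), of a k v] by simp
      then have "norm ?w \<le> R" using v norm_triangle_ineq[of "?w - v" v] by (simp add: R_def)
      from B(2)[OF this] show "L (tproj (round_down N (a + (real k * \<tau>) *\<^sub>R v))) ?w \<le> B"
        by (simp add: abs_le_iff)
    qed
    also have "\<dots> \<le> real m * \<tau> * (B + Bc)"
      using Bc(2)[OF N \<tau>(1) wk] \<tau>(1) by (intro mult_left_mono) (auto simp: abs_le_iff)
    also have "\<dots> \<le> (2 * (norm (a - b) + \<tau>)) * (B + Bc)"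
    proof (rule mult_right_mono)
      have "real m * \<tau> \<le> (norm (a - b) / \<tau> + 2) * \<tau>" using m(2) \<tau>(1) by (intro mult_right_mono) auto
      also have "\<dots> = norm (a - b) + 2 * \<tau>" using \<tau>(1) by (simp add: field_simps)
      also have "\<dots> \<le> 2 * (norm (a - b) + \<tau>)" by simp
      finally show "real m * \<tau> \<le> 2 * (norm (a - b) + \<tau>)" .
    qed (use B(1) Bc(1) in simp)
    finally show ?thesis unfolding end' by (simp only: mult_ac)
  qed
  have "\<bar>U (round_down N a) - U (round_down N b)\<bar> \<le> 2 * (B + Bc) * (norm (a - b) + \<tau>)"
    if N: "N \<ge> 1" and \<tau>: "\<tau> > 0" "1 / real N \<le> \<tau>" and wk: "weak_kam_grid L N \<tau> c U" for N \<tau> c U and a b :: "real ^ 'd"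
    using half[OF N \<tau> wk, of a b] half[OF N \<tau> wk, of b a] by (simp add: abs_le_iff norm_minus_commute)
  then show ?thesis using B(1) Bc(1) by (intro exI[of _ "2 * (B + Bc)"]) auto
qed

text \<open>Along a calibrated step \<open>U\<close> grows at most with the constant
  \<open>K\<close>, while the Lagrangian grows in the speed with slope \<open>K + 1\<close>; the
  difference of the slopes bounds the speed.\<close>

lemma calibrated_step_bounded:
  "\<exists>R>0. \<forall>N \<tau> c U. N \<ge> 1 \<longrightarrow> \<tau> > 0 \<longrightarrow> 1 / real N \<le> \<tau> \<longrightarrow> weak_kam_grid L N \<tau> c U \<longrightarrow>
     (\<forall>a\<in>grid N. \<forall>b\<in>grid N. calibrated_step L \<tau> c U a b \<longrightarrow> norm ((b - a) /\<^sub>R \<tau>) \<le> R)"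
proof -
  obtain Bc where Bc: "Bc \<ge> 0" "\<And>N \<tau> c U. N \<ge> 1 \<Longrightarrow> \<tau> > 0 \<Longrightarrow> weak_kam_grid L N \<tau> c U \<Longrightarrow> \<bar>c\<bar> \<le> Bc"
    using weak_kam_constant_bounded by blast
  obtain K where K: "K \<ge> 0" "\<And>N \<tau> c U a b. N \<ge> 1 \<Longrightarrow> \<tau> > 0 \<Longrightarrow> 1 / real N \<le> \<tau> \<Longrightarrow> weak_kam_grid L N \<tau> c U \<Longrightarrow>
     \<bar>U (round_down N a) - U (round_down N b)\<bar> \<le> K * (norm (a - b) + \<tau>)"
    using weak_kam_grid_lipschitz by blast
  obtain C where C: "\<And>x v. L x v \<ge> (K + 1) * norm v - C" using L_superlinear[of "K + 1"] K(1) by auto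
  have "norm ((b - a) /\<^sub>R \<tau>) \<le> \<bar>K + C + Bc\<bar> + 1"
    if N: "N \<ge> 1" and \<tau>: "\<tau> > 0" "1 / real N \<le> \<tau>" and wk: "weak_kam_grid L N \<tau> c U"
      and ab: "a \<in> grid N" "b \<in> grid N" and cal: "calibrated_step L \<tau> c U a b" for N \<tau> c U a b
  proof -
    define v where "v = (b - a) /\<^sub>R \<tau>"
    have nv: "norm (b - a) = \<tau> * norm v" using \<tau>(1) by (simp add: v_def)
    have "\<tau> * (L (tproj a) v + c) = U b - U a" using cal by (simp add: calibrated_step_def v_def)
    also have "\<dots> \<le> K * (norm (b - a) + \<tau>)"
      using K(2)[OF N \<tau> wk, of b a]
      by (simp add: round_down_of_grid[OF N ab(1)] round_down_of_grid[OF N ab(2)] abs_le_iff)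
    also have "\<dots> = \<tau> * (K * (norm v + 1))" by (simp add: nv algebra_simps)
    finally have "L (tproj a) v + c \<le> K * (norm v + 1)" using \<tau>(1) by simp
    moreover have "K * (norm v + 1) = K * norm v + K" "(K + 1) * norm v = K * norm v + norm v"
      by (simp_all add: algebra_simps)
    ultimately have "norm v \<le> K + C + Bc"
      using C[of v "tproj a"] Bc(2)[OF N \<tau>(1) wk] by linarith
    then show ?thesis unfolding v_def[symmetric] by linarith
  qed
  then show ?thesis by (intro exI[of _ "\<bar>K + C + Bc\<bar> + 1"]) auto
qed

text \<open>Domination along the detour through the shifted middle point \<open>b + d\<close>, set
  against calibration of the two steps, is precisely the minimality that
  \<open>velocity_lipschitz\<close> assumes; the values of \<open>U\<close> cancel.\<close>

lemma calibrated_velocity_lipschitz: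
  assumes C: "C \<ge> 0"
  shows "\<exists>M\<ge>0. \<forall>N \<tau> c U. N \<ge> 1 \<longrightarrow> \<tau> > 0 \<longrightarrow> \<tau> \<le> 1 \<longrightarrow> 1 / real N \<le> \<tau> \<longrightarrow> 1 / real N \<le> C * \<tau>\<^sup>2 \<longrightarrow>
     weak_kam_grid L N \<tau> c U \<longrightarrow>
     (\<forall>a\<in>grid N. \<forall>b\<in>grid N. \<forall>e\<in>grid N. calibrated_step L \<tau> c U a b \<longrightarrow> calibrated_step L \<tau> c U b e \<longrightarrow>
       norm ((b - a) /\<^sub>R \<tau> - (e - b) /\<^sub>R \<tau>) \<le> M * \<tau>)"
proof -
  obtain R where R: "R > 0" "\<And>N \<tau> c U a b. N \<ge> 1 \<Longrightarrow> \<tau> > 0 \<Longrightarrow> 1 / real N \<le> \<tau> \<Longrightarrow> weak_kam_grid L N \<tau> c U \<Longrightarrow>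
     a \<in> grid N \<Longrightarrow> b \<in> grid N \<Longrightarrow> calibrated_step L \<tau> c U a b \<Longrightarrow> norm ((b - a) /\<^sub>R \<tau>) \<le> R"
    using calibrated_step_bounded by blast
  obtain M where M: "M \<ge> 0" "\<And>a v w \<tau> h. norm v \<le> R \<Longrightarrow> norm w \<le> R \<Longrightarrow> 0 < \<tau> \<Longrightarrow> \<tau> \<le> 1 \<Longrightarrow> 0 < h \<Longrightarrow> h \<le> C * \<tau>\<^sup>2 \<Longrightarrow>
     (\<forall>k (m::int). L (tproj a) v + L (tproj (a + \<tau> *\<^sub>R v)) w
        \<le> L (tproj a) (v + axis k (of_int m * h / \<tau>))
          + L (tproj (a + \<tau> *\<^sub>R v + axis k (of_int m * h))) (w - axis k (of_int m * h / \<tau>)))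
     \<Longrightarrow> norm (v - w) \<le> M * \<tau>"
    using velocity_lipschitz[of R C] R(1) C by (metis less_imp_le)
  have "norm ((b - a) /\<^sub>R \<tau> - (e - b) /\<^sub>R \<tau>) \<le> M * \<tau>"
    if N: "N \<ge> 1" and \<tau>: "\<tau> > 0" "\<tau> \<le> 1" "1 / real N \<le> \<tau>" "1 / real N \<le> C * \<tau>\<^sup>2"
      and wk: "weak_kam_grid L N \<tau> c U" and g: "a \<in> grid N" "b \<in> grid N" "e \<in> grid N"
      and cal: "calibrated_step L \<tau> c U a b" "calibrated_step L \<tau> c U b e" for N \<tau> c U a b e
  proof -
    define v where "v = (b - a) /\<^sub>R \<tau>"
    define w where "w = (e - b) /\<^sub>R \<tau>"
    have b: "a + \<tau> *\<^sub>R v = b" using \<tau>(1) by (simp add: v_def)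
    have vR: "norm v \<le> R" unfolding v_def by (rule R(2)[OF N \<tau>(1,3) wk g(1,2) cal(1)])
    have wR: "norm w \<le> R" unfolding w_def by (rule R(2)[OF N \<tau>(1,3) wk g(2,3) cal(2)])
    have h: "0 < 1 / real N" using N by simp
    have "L (tproj a) v + L (tproj b) w \<le> L (tproj a) (v + axis k (of_int m * (1 / real N) / \<tau>))
          + L (tproj (b + axis k (of_int m * (1 / real N)))) (w - axis k (of_int m * (1 / real N) / \<tau>))" for k and m :: int
    proof -
      define d :: "real ^ 'd" where "d = axis k (of_int m / real N)"
      have d: "axis k (of_int m * (1 / real N)) = d" "axis k (of_int m * (1 / real N) / \<tau>) = d /\<^sub>R \<tau>"
        by (simp_all add: d_def axis_def vec_eq_iff field_simps)
      have bd: "b + d \<in> grid N" unfolding d_def by (intro grid_add g axis_grid N)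
      have "U (b + d) - U a \<le> \<tau> * (L (tproj a) (v + d /\<^sub>R \<tau>) + c)"
        using weak_kam_grid_dominated[OF wk g(1) bd] by (simp add: v_def algebra_simps)
      moreover have "U e - U (b + d) \<le> \<tau> * (L (tproj (b + d)) (w - d /\<^sub>R \<tau>) + c)"
        using weak_kam_grid_dominated[OF wk bd g(3)] by (simp add: w_def algebra_simps)
      moreover have "U b - U a = \<tau> * (L (tproj a) v + c)" "U e - U b = \<tau> * (L (tproj b) w + c)"
        using cal by (simp_all add: calibrated_step_def v_def w_def)
      ultimately have "\<tau> * (L (tproj a) v + L (tproj b) w) \<le> \<tau> * (L (tproj a) (v + d /\<^sub>R \<tau>) + L (tproj (b + d)) (w - d /\<^sub>R \<tau>))"
        by (simp add: distrib_left)
      then show ?thesis unfolding d using \<tau>(1) by simp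
    qed
    then show ?thesis
      unfolding v_def[symmetric] w_def[symmetric]
      by (intro M(2)[OF vR wR \<tau>(1,2) h \<tau>(4), of a]) (simp only: b, blast)
  qed
  then show ?thesis using M(1) by (intro exI[of _ M]) blast
qed

end

section \<open>Limits of discrete weak KAM solutions\<close>

text \<open>The hypothesis speaks of full sequences, while \<open>t\<close> is given only along
  \<open>q\<close>. The gaps are filled by \<open>t (\<nu> k)\<close>, where \<open>\<nu> k\<close>
  is the first position whose index under \<open>q\<close> reaches \<open>k\<close>; at the indices
  \<open>q n\<close> this returns \<open>t n\<close>.\<close>

lemma continuous_convergence_subseq:
  assumes cc: "\<And>s. s \<longlonglongrightarrow> a \<Longrightarrow> (\<lambda>n. F n (s n)) \<longlonglongrightarrow> g"
    and q: "strict_mono (q :: nat \<Rightarrow> nat)" and t: "t \<longlonglongrightarrow> a"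
  shows "(\<lambda>n. F (q n) (t n)) \<longlonglongrightarrow> g"
proof -
  define \<nu> where "\<nu> k = (LEAST i. k \<le> q i)" for k
  have \<nu>q: "\<nu> (q n) = n" for n
    unfolding \<nu>_def by (rule Least_equality) (use strict_mono_less_eq[OF q] in auto)
  have "k \<le> q (\<nu> k)" for k
    unfolding \<nu>_def by (rule LeastI[of _ k]) (rule seq_suble[OF q])
  then have "Z \<le> \<nu> k" if "q Z \<le> k" for Z k
    using that strict_mono_less_eq[OF q] order_trans by blast
  then have "filterlim \<nu> at_top sequentially"
    unfolding filterlim_at_top eventually_sequentially by blast
  then have "(\<lambda>k. t (\<nu> k)) \<longlonglongrightarrow> a" using t filterlim_compose by blast
  from LIMSEQ_subseq_LIMSEQ[OF cc[OF this] q] show ?thesis by (simp add: o_def \<nu>q)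
qed

lemma round_down_add_int_vec:
  assumes N: "N \<ge> 1" and z: "int_vec z" shows "round_down N (a + z) = round_down N a + z"
proof -
  have "of_int \<lfloor>real N * (a + z) $ k\<rfloor> / real N = of_int \<lfloor>real N * a $ k\<rfloor> / real N + z $ k" for k
  proof -
    obtain m where m: "z $ k = of_int m" using z by (auto simp: int_vec_def Ints_def)
    have "real N * (a + z) $ k = real N * a $ k + of_int (int N * m)" by (simp add: m algebra_simps)
    then have "\<lfloor>real N * (a + z) $ k\<rfloor> = \<lfloor>real N * a $ k\<rfloor> + int N * m"
      by (metis floor_add_int)
    then show ?thesis using N by (simp add: m field_simps)
  qed
  then show ?thesis by (simp add: round_down_def vec_eq_iff)
qed

lemma floor_multiple_tendsto:
  assumes \<tau>: "\<And>n. \<tau> n > 0" "\<tau> \<longlonglongrightarrow> 0" and s: "s \<ge> (0 :: real)"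
  shows "(\<lambda>n. real (nat \<lfloor>s / \<tau> n\<rfloor>) * \<tau> n) \<longlonglongrightarrow> s"
    and "real (nat \<lfloor>s / \<tau> n\<rfloor>) * \<tau> n \<le> s"
proof -
  have b: "s - \<tau> n \<le> real (nat \<lfloor>s / \<tau> n\<rfloor>) * \<tau> n \<and> real (nat \<lfloor>s / \<tau> n\<rfloor>) * \<tau> n \<le> s" for n
  proof -
    have "0 \<le> s / \<tau> n" using s \<tau>(1)[of n] by simp
    then have "s / \<tau> n - 1 \<le> real (nat \<lfloor>s / \<tau> n\<rfloor>)" "real (nat \<lfloor>s / \<tau> n\<rfloor>) \<le> s / \<tau> n" by linarith+
    then show ?thesis using \<tau>(1)[of n] by (simp add: field_simps)
  qed
  then show "real (nat \<lfloor>s / \<tau> n\<rfloor>) * \<tau> n \<le> s" by blast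
  have "(\<lambda>n. s - \<tau> n) \<longlonglongrightarrow> s - 0" by (intro tendsto_intros \<tau>)
  then have "(\<lambda>n. s - \<tau> n) \<longlonglongrightarrow> s" by simp
  from real_tendsto_sandwich[OF _ _ this tendsto_const]
  show "(\<lambda>n. real (nat \<lfloor>s / \<tau> n\<rfloor>) * \<tau> n) \<longlonglongrightarrow> s" using b by simp
qed

locale weak_kam_sequence = tonelli_lift H Hp
  for H :: "'d::finite torus \<Rightarrow> real ^ 'd \<Rightarrow> real" and Hp +
  fixes N :: "nat \<Rightarrow> nat" and \<tau> c :: "nat \<Rightarrow> real" and U :: "nat \<Rightarrow> real ^ 'd \<Rightarrow> real" and C :: real
  assumes N: "\<And>n. N n \<ge> 1" and \<tau>_pos: "\<And>n. \<tau> n > 0" and \<tau>_le_1: "\<And>n. \<tau> n \<le> 1" and \<tau>_lim: "\<tau> \<longlonglongrightarrow> 0"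
    and mesh: "\<And>n. 1 / real (N n) \<le> \<tau> n" and mesh2: "\<And>n. 1 / real (N n) \<le> C * (\<tau> n)\<^sup>2" and C: "C \<ge> 0"
    and wk: "\<And>n. weak_kam_grid L (N n) (\<tau> n) (c n) (U n)"
begin

lemma mesh_lim: "(\<lambda>n. 1 / real (N n)) \<longlonglongrightarrow> 0"
  by (rule real_tendsto_sandwich[OF _ _ tendsto_const \<tau>_lim]) (use mesh in auto)

lemma mesh_ratio_lim: "(\<lambda>n. 1 / (real (N n) * \<tau> n)) \<longlonglongrightarrow> 0"
proof (rule real_tendsto_sandwich[OF _ _ tendsto_const])
  show "\<forall>\<^sub>F n in sequentially. 0 \<le> 1 / (real (N n) * \<tau> n)"
    using \<tau>_pos by (intro always_eventually allI) (simp add: less_imp_le)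
  show "\<forall>\<^sub>F n in sequentially. 1 / (real (N n) * \<tau> n) \<le> C * \<tau> n"
  proof (intro always_eventually allI)
    fix n
    have "(1 / real (N n)) / \<tau> n \<le> (C * (\<tau> n)\<^sup>2) / \<tau> n"
      using mesh2[of n] \<tau>_pos[of n] by (intro divide_right_mono) auto
    then show "1 / (real (N n) * \<tau> n) \<le> C * \<tau> n" using \<tau>_pos[of n] by (simp add: power2_eq_square)
  qed
  have "(\<lambda>n. C * \<tau> n) \<longlonglongrightarrow> C * 0" by (intro tendsto_intros \<tau>_lim)
  then show "(\<lambda>n. C * \<tau> n) \<longlonglongrightarrow> 0" by simp
qed

lemma round_down_lim: "(s :: nat \<Rightarrow> real ^ 'd) \<longlonglongrightarrow> a \<Longrightarrow> (\<lambda>n. round_down (N n) (s n)) \<longlonglongrightarrow> a"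
proof -
  assume s: "s \<longlonglongrightarrow> a"
  have "(\<lambda>n. real CARD('d) * (1 / real (N n))) \<longlonglongrightarrow> real CARD('d) * 0" by (intro tendsto_intros mesh_lim)
  then have "(\<lambda>n. real CARD('d) / real (N n)) \<longlonglongrightarrow> 0" by simp
  then have "(\<lambda>n. round_down (N n) (s n) - s n) \<longlonglongrightarrow> 0"
    by (rule Lim_null_comparison[rotated]) (intro always_eventually allI round_down_dist N)
  from tendsto_add[OF this s] show ?thesis by simp
qed

end

text \<open>Convergence of the grid solutions is required along every convergent sequence of points,
  after normalization at the rounded origin. This form admits points that depend on
  \<open>n\<close>, such as the members of a calibrated chain.\<close>

locale weak_kam_limit = weak_kam_sequence H Hp N \<tau> c U C
  for H :: "'d::finite torus \<Rightarrow> real ^ 'd \<Rightarrow> real" and Hp N \<tau> c U C +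
  fixes u :: "'d torus \<Rightarrow> real" and \<alpha> :: real
  assumes c_lim: "c \<longlonglongrightarrow> \<alpha>"
    and U_lim: "\<And>s a. s \<longlonglongrightarrow> a \<Longrightarrow>
      (\<lambda>n. U n (round_down (N n) (s n)) - U n (round_down (N n) 0)) \<longlonglongrightarrow> u (tproj a)"
    and u_lipschitz: "\<exists>K\<ge>0. \<forall>a b. \<bar>u (tproj a) - u (tproj b)\<bar> \<le> K * norm (a - b)"

lemma (in weak_kam_sequence) weak_kam_limit_exists:
  "\<exists>r u \<alpha>. strict_mono r \<and> weak_kam_limit H Hp (N \<circ> r) (\<tau> \<circ> r) (c \<circ> r) (U \<circ> r) C u \<alpha>"
proof -
  obtain B where B: "B \<ge> 0" "\<And>N \<tau> c U. N \<ge> 1 \<Longrightarrow> \<tau> > 0 \<Longrightarrow> weak_kam_grid L N \<tau> c U \<Longrightarrow> \<bar>c\<bar> \<le> B"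
    using weak_kam_constant_bounded by blast
  obtain K where K: "K \<ge> 0" "\<And>N \<tau> c U a b. N \<ge> 1 \<Longrightarrow> \<tau> > 0 \<Longrightarrow> 1 / real N \<le> \<tau> \<Longrightarrow> weak_kam_grid L N \<tau> c U \<Longrightarrow>
     \<bar>U (round_down N a) - U (round_down N b)\<bar> \<le> K * (norm (a - b) + \<tau>)"
    using weak_kam_grid_lipschitz by blast
  \<comment> \<open>The constant \<open>c n\<close> is carried as a second component, so that one
    extraction yields both limits.\<close>
  define f where "f n a = (U n (round_down (N n) a) - U n (round_down (N n) 0), c n)" for n a
  have lip: "norm (f n a - f n b) \<le> K * (norm (a - b) + \<tau> n)" for n a b
    using K(2)[OF N[of n] \<tau>_pos[of n] mesh[of n] wk[of n], of a b] by (simp add: f_def norm_Pair)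
  have bd: "norm (f n 0) \<le> B" for n
    using B(2)[OF N[of n] \<tau>_pos[of n] wk[of n]] by (simp add: f_def norm_Pair)
  obtain r g where r: "strict_mono (r :: nat \<Rightarrow> nat)"
    and cc: "\<And>s a. s \<longlonglongrightarrow> a \<Longrightarrow> (\<lambda>n. f (r n) (s n)) \<longlonglongrightarrow> g a"
    and glip: "\<And>a b. norm (g a - g b) \<le> K * norm (a - b)"
    using almost_lipschitz_subsequence[OF lip \<tau>_lim K(1) bd] by blast
  have per: "fst (g a) = fst (g b)" if "tproj a = tproj b" for a b
  proof -
    have z: "int_vec (b - a)" using that tproj_eq_int_vec by metis
    have "f n b = f n a" for n
      using round_down_add_int_vec[OF N[of n] z, of a] weak_kam_grid_periodic[OF wk[of n] z]
      by (simp add: f_def)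
    then have "(\<lambda>n. f (r n) a) \<longlonglongrightarrow> g b" using cc[OF tendsto_const[of b]] by simp
    then have "g a = g b" using cc[OF tendsto_const[of a]] LIMSEQ_unique by blast
    then show ?thesis by simp
  qed
  define u where "u x = fst (g (SOME a. tproj a = x))" for x
  have u: "u (tproj a) = fst (g a)" for a
    unfolding u_def by (rule per) (rule someI[of "\<lambda>b. tproj b = tproj a" a], rule refl)
  define \<alpha> where "\<alpha> = snd (g 0)"
  have "weak_kam_limit H Hp (N \<circ> r) (\<tau> \<circ> r) (c \<circ> r) (U \<circ> r) C u \<alpha>"
  proof unfold_locales
    show "(\<tau> \<circ> r) \<longlonglongrightarrow> 0" using LIMSEQ_subseq_LIMSEQ[OF \<tau>_lim r] by (simp add: o_def)
    show "(c \<circ> r) \<longlonglongrightarrow> \<alpha>"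
      using tendsto_snd[OF cc[OF tendsto_const[of 0]]] by (simp add: f_def \<alpha>_def o_def)
    show "(\<lambda>n. (U \<circ> r) n (round_down ((N \<circ> r) n) (s n)) - (U \<circ> r) n (round_down ((N \<circ> r) n) 0)) \<longlonglongrightarrow> u (tproj a)"
      if "s \<longlonglongrightarrow> a" for s a
      using tendsto_fst[OF cc[OF that]] by (simp add: f_def u)
    have "\<bar>u (tproj a) - u (tproj b)\<bar> \<le> K * norm (a - b)" for a b
    proof -
      have "norm (fst (g a - g b)) \<le> norm (g a - g b)" by (metis prod.collapse norm_fst_le)
      also have "\<dots> \<le> K * norm (a - b)" by (rule glip)
      finally show ?thesis by (simp add: u)
    qed
    then show "\<exists>K\<ge>0. \<forall>a b. \<bar>u (tproj a) - u (tproj b)\<bar> \<le> K * norm (a - b)" using K(1) by blast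
  qed (use N \<tau>_pos \<tau>_le_1 mesh mesh2 C wk in auto)
  with r show ?thesis by blast
qed

context weak_kam_limit
begin

text \<open>A segment with velocity \<open>v\<close> is followed by rounded steps. The cost of each
  differs from \<open>L (tproj b) v\<close> by the rounding of the points, the rounding of the
  velocity, and the distance travelled, at most about \<open>s * norm v\<close>. Only the last one
  survives in the limit and gives the quadratic term, harmless once divided by
  \<open>s\<close>.\<close>

lemma subsolution_estimate:
  "\<exists>K\<ge>0. \<forall>b s. s \<ge> 0 \<longrightarrow>
     u (tproj (b + s *\<^sub>R v)) - u (tproj b) \<le> s * (L (tproj b) v + \<alpha>) + K * s\<^sup>2"
proof -
  define d where "d = real CARD('d)"
  define R where "R = norm v + 2 * d"
  obtain K where K: "K \<ge> 0" "\<And>a b v w. norm v \<le> R \<Longrightarrow> norm w \<le> R \<Longrightarrow>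
     \<bar>L (tproj a) v - L (tproj b) w\<bar> \<le> K * (norm (a - b) + norm (v - w))"
    using L_lipschitz[of R] by meson
  have d0: "d \<ge> 0" by (simp add: d_def)
  have "u (tproj (b + s *\<^sub>R v)) - u (tproj b) \<le> s * (L (tproj b) v + \<alpha>) + (K * norm v) * s\<^sup>2"
    if s: "s \<ge> 0" for b s
  proof -
    define m where "m n = nat \<lfloor>s / \<tau> n\<rfloor>" for n
    define t where "t n = real (m n) * \<tau> n" for n
    have t: "t \<longlonglongrightarrow> s" using floor_multiple_tendsto(1)[OF \<tau>_pos \<tau>_lim s] by (simp add: t_def[abs_def] m_def)
    define \<Lambda> where "\<Lambda> n = L (tproj b) v + K * (d * (1 / real (N n)) + t n * norm v + 2 * d * (1 / (real (N n) * \<tau> n)))" for n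
    have le: "U n (round_down (N n) (b + t n *\<^sub>R v)) - U n (round_down (N n) b) \<le> t n * (\<Lambda> n + c n)" for n
      unfolding t_def
    proof (rule weak_kam_grid_path[OF N wk \<tau>_pos])
      fix k assume k: "k < m n"
      let ?x = "\<lambda>k. round_down (N n) (b + (real k * \<tau> n) *\<^sub>R v)"
      let ?w = "(?x (Suc k) - ?x k) /\<^sub>R \<tau> n"
      have w: "norm (?w - v) \<le> 2 * d * (1 / (real (N n) * \<tau> n))"
        using round_down_path_velocity[OF N[of n] \<tau>_pos[of n], of b k v] by (simp add: d_def)
      have "1 / (real (N n) * \<tau> n) \<le> 1" using mesh[of n] \<tau>_pos[of n] N[of n] by (simp add: field_simps)
      then have "2 * d * (1 / (real (N n) * \<tau> n)) \<le> 2 * d * 1" using d0 by (intro mult_left_mono) auto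
      then have wR: "norm ?w \<le> R" using w norm_triangle_ineq[of "?w - v" v] by (simp add: R_def)
      have vR: "norm v \<le> R" using d0 by (simp add: R_def)
      have "norm (?x k - b) \<le> norm (?x k - (b + (real k * \<tau> n) *\<^sub>R v)) + norm ((real k * \<tau> n) *\<^sub>R v)"
        using norm_triangle_ineq[of "?x k - (b + (real k * \<tau> n) *\<^sub>R v)" "(real k * \<tau> n) *\<^sub>R v"] by simp
      also have "\<dots> \<le> d * (1 / real (N n)) + t n * norm v"
      proof (rule add_mono)
        show "norm (?x k - (b + (real k * \<tau> n) *\<^sub>R v)) \<le> d * (1 / real (N n))"
          using round_down_dist[OF N] by (simp add: d_def)
        have "real k * \<tau> n \<le> t n" unfolding t_def using k \<tau>_pos[of n] by (intro mult_right_mono) auto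
        then show "norm ((real k * \<tau> n) *\<^sub>R v) \<le> t n * norm v"
          using \<tau>_pos[of n] by (simp add: mult_right_mono)
      qed
      finally have x: "norm (?x k - b) \<le> d * (1 / real (N n)) + t n * norm v" .
      have "L (tproj (?x k)) ?w \<le> L (tproj b) v + K * (norm (?x k - b) + norm (?w - v))"
        using K(2)[OF wR vR, of "?x k" b] by (simp add: abs_le_iff)
      also have "\<dots> \<le> \<Lambda> n"
        unfolding \<Lambda>_def using x w K(1) by (intro add_left_mono mult_left_mono) auto
      finally show "L (tproj (?x k)) ?w \<le> \<Lambda> n" .
    qed
    have \<Lambda>: "\<Lambda> \<longlonglongrightarrow> L (tproj b) v + K * (d * 0 + s * norm v + 2 * d * 0)"
      unfolding \<Lambda>_def by (intro tendsto_intros t mesh_lim mesh_ratio_lim)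
    have "u (tproj (b + s *\<^sub>R v)) - u (tproj b) \<le> s * (L (tproj b) v + K * (d * 0 + s * norm v + 2 * d * 0) + \<alpha>)"
    proof (rule LIMSEQ_le)
      have "(\<lambda>n. b + t n *\<^sub>R v) \<longlonglongrightarrow> b + s *\<^sub>R v" by (intro tendsto_intros t)
      from tendsto_diff[OF U_lim[OF this] U_lim[OF tendsto_const[of b]]]
      show "(\<lambda>n. U n (round_down (N n) (b + t n *\<^sub>R v)) - U n (round_down (N n) b)) \<longlonglongrightarrow> u (tproj (b + s *\<^sub>R v)) - u (tproj b)"
        by simp
      show "(\<lambda>n. t n * (\<Lambda> n + c n)) \<longlonglongrightarrow> s * (L (tproj b) v + K * (d * 0 + s * norm v + 2 * d * 0) + \<alpha>)"
        by (intro tendsto_intros t \<Lambda> c_lim)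
      show "\<exists>M. \<forall>n\<ge>M. U n (round_down (N n) (b + t n *\<^sub>R v)) - U n (round_down (N n) b) \<le> t n * (\<Lambda> n + c n)"
        using le by blast
    qed
    then show ?thesis by (simp add: algebra_simps power2_eq_square)
  qed
  then show ?thesis using K(1) by (intro exI[of _ "K * norm v"]) auto
qed

text \<open>From \<open>b\<close> calibrated predecessors are followed backwards for about
  \<open>s / \<tau>\<close> steps, and the Lagrangian of each step is bounded below by Fenchel's
  inequality with the fixed momentum \<open>p\<close>. The radius \<open>R\<close> is the speed
  bound of calibrated steps, hence common to all \<open>p\<close>.\<close>

lemma supersolution_estimate:
  "\<exists>R>0. \<forall>p. \<exists>K\<ge>0. \<forall>b s. s > 0 \<longrightarrow> (\<exists>a. norm (b - a) \<le> R * s \<and>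
     p \<bullet> (b - a) + s * (\<alpha> - H (tproj b) p) - K * s\<^sup>2 \<le> u (tproj b) - u (tproj a))"
proof -
  obtain R where R: "R > 0" "\<And>N \<tau> c U a b. N \<ge> 1 \<Longrightarrow> \<tau> > 0 \<Longrightarrow> 1 / real N \<le> \<tau> \<Longrightarrow> weak_kam_grid L N \<tau> c U \<Longrightarrow>
     a \<in> grid N \<Longrightarrow> b \<in> grid N \<Longrightarrow> calibrated_step L \<tau> c U a b \<Longrightarrow> norm ((b - a) /\<^sub>R \<tau>) \<le> R"
    using calibrated_step_bounded by blast
  define d where "d = real CARD('d)"
  have "\<exists>K\<ge>0. \<forall>b s. s > 0 \<longrightarrow> (\<exists>a. norm (b - a) \<le> R * s \<and>
     p \<bullet> (b - a) + s * (\<alpha> - H (tproj b) p) - K * s\<^sup>2 \<le> u (tproj b) - u (tproj a))" for p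
  proof -
    obtain K where K: "K \<ge> 0" "\<And>a b. \<bar>H (tproj a) p - H (tproj b) p\<bar> \<le> K * norm (a - b)"
      using H_lipschitz[of "norm p"] by (metis add.right_neutral cancel_comm_monoid_add_class.diff_cancel norm_zero order_refl)
    have "\<exists>a. norm (b - a) \<le> R * s \<and>
       p \<bullet> (b - a) + s * (\<alpha> - H (tproj b) p) - (K * R) * s\<^sup>2 \<le> u (tproj b) - u (tproj a)" if s: "s > 0" for b s
    proof -
      have s0: "s \<ge> 0" using s by simp
      define m where "m n = nat \<lfloor>s / \<tau> n\<rfloor>" for n
      define t where "t n = real (m n) * \<tau> n" for n
      have t: "t \<longlonglongrightarrow> s" using floor_multiple_tendsto(1)[OF \<tau>_pos \<tau>_lim s0] by (simp add: t_def[abs_def] m_def)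
      have ts: "t n \<le> s" for n unfolding t_def m_def by (rule floor_multiple_tendsto(2)[OF \<tau>_pos \<tau>_lim s0])
      \<comment> \<open>Bound for the change of \<open>H\<close> in the position: the backward chain
        stays within the rounding error plus \<open>R * s\<close> of \<open>b\<close>.\<close>
      define E where "E n = K * (d * (1 / real (N n)) + R * s)" for n
      have chain: "k \<le> m n \<Longrightarrow> \<exists>a\<in>grid (N n). norm (round_down (N n) b - a) \<le> R * (real k * \<tau> n) \<and>
          p \<bullet> (round_down (N n) b - a) + (real k * \<tau> n) * (c n - H (tproj b) p - E n) \<le> U n (round_down (N n) b) - U n a" for n k
      proof (induction k)
        case 0
        show ?case using round_down_grid[OF N] by (intro bexI[of _ "round_down (N n) b"]) auto
      next
        case (Suc k)
        then obtain a where a: "a \<in> grid (N n)" "norm (round_down (N n) b - a) \<le> R * (real k * \<tau> n)"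
          "p \<bullet> (round_down (N n) b - a) + (real k * \<tau> n) * (c n - H (tproj b) p - E n) \<le> U n (round_down (N n) b) - U n a"
          by auto
        obtain a' where a': "a' \<in> grid (N n)" "calibrated_step L (\<tau> n) (c n) (U n) a' a"
          using weak_kam_grid_predecessor[OF wk a(1)] by blast
        define v where "v = (a - a') /\<^sub>R \<tau> n"
        have v: "norm v \<le> R" unfolding v_def by (rule R(2)[OF N \<tau>_pos mesh wk a'(1) a(1) a'(2)])
        have aa': "a - a' = \<tau> n *\<^sub>R v" using \<tau>_pos[of n] by (simp add: v_def)
        have dist: "norm (round_down (N n) b - a') \<le> R * (real (Suc k) * \<tau> n)"
        proof -
          have "norm (round_down (N n) b - a') \<le> norm (round_down (N n) b - a) + norm (a - a')"
            using norm_triangle_ineq[of "round_down (N n) b - a" "a - a'"] by simp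
          also have "norm (a - a') \<le> \<tau> n * R" using v \<tau>_pos[of n] by (simp add: aa')
          finally show ?thesis using a(2) by (simp add: algebra_simps)
        qed
        have "norm (a' - b) \<le> d * (1 / real (N n)) + R * s"
        proof -
          have "norm (a' - b) \<le> norm (round_down (N n) b - a') + norm (round_down (N n) b - b)"
            using norm_triangle_ineq4[of "round_down (N n) b - b" "round_down (N n) b - a'"] by simp
          also have "norm (round_down (N n) b - b) \<le> d * (1 / real (N n))"
            using round_down_dist[OF N] by (simp add: d_def)
          also have "norm (round_down (N n) b - a') \<le> R * s"
          proof (rule order_trans[OF dist], intro mult_left_mono)
            have "real (Suc k) * \<tau> n \<le> t n" unfolding t_def using Suc.prems \<tau>_pos[of n] by (intro mult_right_mono) auto
            then show "real (Suc k) * \<tau> n \<le> s" using ts[of n] by linarith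
          qed (use R(1) in simp)
          finally show ?thesis by simp
        qed
        then have "K * norm (a' - b) \<le> E n" unfolding E_def using K(1) by (intro mult_left_mono)
        then have "H (tproj a') p \<le> H (tproj b) p + E n" using K(2)[of a' b] by (simp add: abs_le_iff)
        then have "p \<bullet> v - H (tproj b) p - E n \<le> L (tproj a') v" using fenchel[of p v "tproj a'"] by linarith
        then have "\<tau> n * (p \<bullet> v - H (tproj b) p - E n + c n) \<le> \<tau> n * (L (tproj a') v + c n)"
          using \<tau>_pos[of n] by (intro mult_left_mono) auto
        also have "\<dots> = U n a - U n a'" using a'(2) by (simp add: calibrated_step_def v_def)
        finally have "p \<bullet> (a - a') + \<tau> n * (c n - H (tproj b) p - E n) \<le> U n a - U n a'"
          by (simp add: aa' algebra_simps)
        moreover have "p \<bullet> (round_down (N n) b - a') = p \<bullet> (round_down (N n) b - a) + p \<bullet> (a - a')"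
          by (simp add: inner_diff_right)
        moreover have "real (Suc k) * \<tau> n * (c n - H (tproj b) p - E n)
            = (real k * \<tau> n) * (c n - H (tproj b) p - E n) + \<tau> n * (c n - H (tproj b) p - E n)"
          by (simp add: algebra_simps)
        ultimately have "p \<bullet> (round_down (N n) b - a') + (real (Suc k) * \<tau> n) * (c n - H (tproj b) p - E n)
            \<le> U n (round_down (N n) b) - U n a'" using a(3) by linarith
        with dist a'(1) show ?case by blast
      qed
      have "\<exists>a\<in>grid (N n). norm (round_down (N n) b - a) \<le> R * t n \<and>
          p \<bullet> (round_down (N n) b - a) + t n * (c n - H (tproj b) p - E n) \<le> U n (round_down (N n) b) - U n a" for n
        using chain[OF order_refl, of n] by (simp add: t_def)
      then obtain a where a: "\<And>n. a n \<in> grid (N n)" "\<And>n. norm (round_down (N n) b - a n) \<le> R * t n"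
        "\<And>n. p \<bullet> (round_down (N n) b - a n) + t n * (c n - H (tproj b) p - E n) \<le> U n (round_down (N n) b) - U n (a n)"
        by metis
      have rb: "(\<lambda>n. round_down (N n) b) \<longlonglongrightarrow> b" by (rule round_down_lim[OF tendsto_const])
      have "round_down (N n) b - a n \<in> cball 0 (R * s)" for n
        using order_trans[OF a(2)[of n] mult_left_mono[OF ts[of n], of R]] R(1) by simp
      then have "bounded (range (\<lambda>n. round_down (N n) b - a n))"
        by (intro boundedI[of _ "R * s"]) auto
      then obtain z q where q: "strict_mono (q :: nat \<Rightarrow> nat)" "((\<lambda>n. round_down (N n) b - a n) \<circ> q) \<longlonglongrightarrow> z"
        using bounded_imp_convergent_subsequence by blast
      have lim_q: "(\<lambda>n. X (q n)) \<longlonglongrightarrow> x" if "X \<longlonglongrightarrow> x" for X :: "nat \<Rightarrow> 'x::topological_space" and x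
        using LIMSEQ_subseq_LIMSEQ[OF that q(1)] by (simp add: o_def)
      have z: "(\<lambda>n. round_down (N (q n)) b - a (q n)) \<longlonglongrightarrow> z" using q(2) by (simp add: o_def)
      have aq: "(\<lambda>n. a (q n)) \<longlonglongrightarrow> b - z"
        using tendsto_diff[OF lim_q[OF rb] z] by simp
      have "(\<lambda>n. U (q n) (round_down (N (q n)) (a (q n))) - U (q n) (round_down (N (q n)) 0)) \<longlonglongrightarrow> u (tproj (b - z))"
        using continuous_convergence_subseq[OF U_lim q(1) aq] .
      then have Ua: "(\<lambda>n. U (q n) (a (q n)) - U (q n) (round_down (N (q n)) 0)) \<longlonglongrightarrow> u (tproj (b - z))"
        by (simp add: round_down_of_grid[OF N a(1)])
      have Ub: "(\<lambda>n. U (q n) (round_down (N (q n)) b) - U (q n) (round_down (N (q n)) 0)) \<longlonglongrightarrow> u (tproj b)"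
        by (rule lim_q[OF U_lim[OF tendsto_const]])
      have E: "E \<longlonglongrightarrow> K * (d * 0 + R * s)" unfolding E_def by (intro tendsto_intros mesh_lim)
      have "p \<bullet> z + s * (\<alpha> - H (tproj b) p - K * (d * 0 + R * s)) \<le> u (tproj b) - u (tproj (b - z))"
      proof (rule LIMSEQ_le)
        show "(\<lambda>n. p \<bullet> (round_down (N (q n)) b - a (q n)) + t (q n) * (c (q n) - H (tproj b) p - E (q n)))
            \<longlonglongrightarrow> p \<bullet> z + s * (\<alpha> - H (tproj b) p - K * (d * 0 + R * s))"
          by (intro tendsto_intros z lim_q[OF t] lim_q[OF c_lim] lim_q[OF E])
        show "(\<lambda>n. U (q n) (round_down (N (q n)) b) - U (q n) (a (q n))) \<longlonglongrightarrow> u (tproj b) - u (tproj (b - z))"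
          using tendsto_diff[OF Ub Ua] by simp
        show "\<exists>M. \<forall>n\<ge>M. p \<bullet> (round_down (N (q n)) b - a (q n)) + t (q n) * (c (q n) - H (tproj b) p - E (q n))
            \<le> U (q n) (round_down (N (q n)) b) - U (q n) (a (q n))" using a(3) by blast
      qed
      moreover have "norm z \<le> R * s"
        by (rule LIMSEQ_le[OF tendsto_norm[OF z] lim_q[OF tendsto_mult[OF tendsto_const[of R] t]]]) (use a(2) in blast)
      ultimately show ?thesis
        by (intro exI[of _ "b - z"]) (simp add: algebra_simps power2_eq_square)
    qed
    then show ?thesis using K(1) R(1) by (intro exI[of _ "K * R"]) auto
  qed
  then show ?thesis using R(1) by blast
qed

end

section \<open>Uniqueness of the critical value\<close>

lemma tproj_rep_torus: "tproj (rep_torus x) = x"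
  by (rule Quotient3_abs_rep[OF Quotient3_torus])

lemma continuous_on_torus:
  fixes f :: "'d::finite torus \<Rightarrow> 'b::topological_space"
  assumes "continuous_on UNIV (\<lambda>a. f (tproj a))"
  shows "continuous_on UNIV f"
  unfolding continuous_on_open_vimage[OF open_UNIV]
proof (intro allI impI)
  fix B :: "'b set" assume "open B"
  then have "open ((\<lambda>a. f (tproj a)) -` B)"
    using assms continuous_on_open_vimage[OF open_UNIV] by (metis Int_UNIV_right)
  moreover have "(\<lambda>a. f (tproj a)) -` B = tproj -` (f -` B)" by auto
  ultimately show "open (f -` B \<inter> UNIV)" by (simp add: open_torus_iff)
qed

text \<open>A smooth lattice-periodic substitute for the squared norm. It vanishes exactly on the
  integer lattice, so it separates the points of the torus.\<close>

definition periodic_well :: "real ^ 'd::finite \<Rightarrow> real" where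
  "periodic_well w = (\<Sum>k\<in>UNIV. 1 - cos (2 * pi * w $ k))"

definition periodic_well_grad :: "real ^ 'd::finite \<Rightarrow> real ^ 'd" where
  "periodic_well_grad w = (\<chi> k. 2 * pi * sin (2 * pi * w $ k))"

lemma periodic_well_derivative:
  "(periodic_well has_derivative (\<lambda>h. periodic_well_grad w \<bullet> h)) (at w)"
proof -
  have "((\<lambda>w. 1 - cos (2 * pi * w $ k)) has_derivative (\<lambda>h. 2 * pi * sin (2 * pi * w $ k) * h $ k)) (at w)" for k
  proof -
    have 1: "((\<lambda>w. 2 * pi * w $ k) has_derivative (\<lambda>h. 2 * pi * h $ k)) (at w)"
      by (rule bounded_linear_imp_has_derivative) (intro bounded_linear_const_mult bounded_linear_vec_nth)
    have 2: "((\<lambda>x. 1 - cos x) has_derivative (\<lambda>y. sin (2 * pi * w $ k) * y)) (at (2 * pi * w $ k))"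
      using DERIV_diff[OF DERIV_const DERIV_cos] unfolding has_field_derivative_def by simp
    show ?thesis
      by (rule has_derivative_eq_rhs, rule has_derivative_compose[OF 1 2]) (simp add: fun_eq_iff)
  qed
  then have "((\<lambda>w. \<Sum>k\<in>UNIV. 1 - cos (2 * pi * w $ k)) has_derivative
      (\<lambda>h. \<Sum>k\<in>UNIV. 2 * pi * sin (2 * pi * w $ k) * h $ k)) (at w)"
    by (intro has_derivative_sum)
  then show ?thesis
    unfolding periodic_well_def[abs_def] periodic_well_grad_def inner_vec_def by simp
qed

lemma periodic_well_periodic:
  assumes "int_vec z"
  shows "periodic_well (w + z) = periodic_well w" "periodic_well_grad (w + z) = periodic_well_grad w"
proof -
  have "cos (2 * pi * (w + z) $ k) = cos (2 * pi * w $ k) \<and> sin (2 * pi * (w + z) $ k) = sin (2 * pi * w $ k)" for k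
  proof -
    obtain m where m: "z $ k = of_int m" using assms by (auto simp: int_vec_def Ints_def)
    have "2 * pi * (w + z) $ k = 2 * pi * w $ k + 2 * pi * of_int m" by (simp add: m algebra_simps)
    then show ?thesis by (simp add: sin_add cos_add sin_int_2pin cos_int_2pin)
  qed
  then show "periodic_well (w + z) = periodic_well w" "periodic_well_grad (w + z) = periodic_well_grad w"
    by (simp_all add: periodic_well_def periodic_well_grad_def)
qed

lemma periodic_well_zero: "periodic_well w \<le> 0 \<Longrightarrow> int_vec w"
  unfolding int_vec_def
proof
  fix k assume "periodic_well w \<le> 0"
  moreover have nn: "0 \<le> 1 - cos (2 * pi * w $ k)" for k by simp
  ultimately have "periodic_well w = 0" unfolding periodic_well_def by (intro antisym sum_nonneg)
  then have "1 - cos (2 * pi * w $ k) = 0"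
    using nn by (simp add: periodic_well_def sum_nonneg_eq_0_iff)
  then obtain n :: int where "2 * pi * w $ k = of_int n * 2 * pi" using cos_one_2pi_int by force
  then have "w $ k = of_int n" by simp
  then show "w $ k \<in> \<int>" by simp
qed

lemma continuous_on_periodic_well:
  "continuous_on S periodic_well" "continuous_on S periodic_well_grad"
  unfolding periodic_well_def[abs_def] periodic_well_grad_def[abs_def]
  by (intro continuous_intros)+

text \<open>Periodicity makes the choice of representative immaterial, so the lift is smooth
  although \<open>rep_torus\<close> is not continuous. The sign of the second function is chosen so
  that at a maximum of the doubled functional both test functions have the same gradient.\<close>

lemma C1_gradient_periodic_well:
  fixes b :: "real ^ 'd::finite"
  shows "C1_gradient (\<lambda>x. \<kappa> * periodic_well (rep_torus x - b)) (\<lambda>x. \<kappa> *\<^sub>R periodic_well_grad (rep_torus x - b))"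
    and "C1_gradient (\<lambda>x. - \<kappa> * periodic_well (b - rep_torus x)) (\<lambda>x. \<kappa> *\<^sub>R periodic_well_grad (b - rep_torus x))"
    and periodic_well_rep: "periodic_well (rep_torus (tproj a) - b) = periodic_well (a - b)"
      "periodic_well (b - rep_torus (tproj a)) = periodic_well (b - a)"
      "periodic_well_grad (rep_torus (tproj a) - b) = periodic_well_grad (a - b)"
      "periodic_well_grad (b - rep_torus (tproj a)) = periodic_well_grad (b - a)"
proof -
  have z: "int_vec (rep_torus (tproj a) - a)" "int_vec (a - rep_torus (tproj a))" for a :: "real ^ 'd"
    using tproj_rep_torus tproj_eq_int_vec by metis+
  have 1: "periodic_well (rep_torus (tproj a) - b) = periodic_well (a - b)"
      "periodic_well (b - rep_torus (tproj a)) = periodic_well (b - a)"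
      "periodic_well_grad (rep_torus (tproj a) - b) = periodic_well_grad (a - b)"
      "periodic_well_grad (b - rep_torus (tproj a)) = periodic_well_grad (b - a)" for a b :: "real ^ 'd"
    using periodic_well_periodic[OF z(1)[of a], of "a - b"] periodic_well_periodic[OF z(2)[of a], of "b - a"] by simp_all
  then show "periodic_well (rep_torus (tproj a) - b) = periodic_well (a - b)"
      "periodic_well (b - rep_torus (tproj a)) = periodic_well (b - a)"
      "periodic_well_grad (rep_torus (tproj a) - b) = periodic_well_grad (a - b)"
      "periodic_well_grad (b - rep_torus (tproj a)) = periodic_well_grad (b - a)" by blast+
  have s1: "((\<lambda>a. a - b) has_derivative (\<lambda>h. h)) (at a)" and s2: "((\<lambda>a. b - a) has_derivative (\<lambda>h. - h)) (at a)"
    for a :: "real ^ 'd"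
    using has_derivative_diff[OF has_derivative_ident has_derivative_const[of b]]
      has_derivative_diff[OF has_derivative_const[of b] has_derivative_ident] by simp_all
  show "C1_gradient (\<lambda>x. \<kappa> * periodic_well (rep_torus x - b)) (\<lambda>x. \<kappa> *\<^sub>R periodic_well_grad (rep_torus x - b))"
    unfolding C1_gradient_def
  proof (intro conjI allI continuous_on_torus)
    fix a :: "real ^ 'd"
    have "((\<lambda>a. \<kappa> * periodic_well (a - b)) has_derivative (\<lambda>h. \<kappa> * (periodic_well_grad (a - b) \<bullet> h))) (at a)"
      by (rule has_derivative_mult_right[OF has_derivative_compose[OF s1 periodic_well_derivative]])
    then show "((\<lambda>c. \<kappa> * periodic_well (rep_torus (tproj c) - b)) has_derivative
        (\<lambda>w. \<kappa> *\<^sub>R periodic_well_grad (rep_torus (tproj a) - b) \<bullet> w)) (at a)"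
      by (simp add: 1)
    show "continuous_on UNIV (\<lambda>a. \<kappa> *\<^sub>R periodic_well_grad (rep_torus (tproj a) - b))"
      unfolding 1 by (intro continuous_on_scaleR continuous_on_const
          continuous_on_compose2[OF continuous_on_periodic_well(2)[of UNIV]] continuous_on_diff continuous_on_id) auto
  qed
  show "C1_gradient (\<lambda>x. - \<kappa> * periodic_well (b - rep_torus x)) (\<lambda>x. \<kappa> *\<^sub>R periodic_well_grad (b - rep_torus x))"
    unfolding C1_gradient_def
  proof (intro conjI allI continuous_on_torus)
    fix a :: "real ^ 'd"
    have "((\<lambda>a. - \<kappa> * periodic_well (b - a)) has_derivative (\<lambda>h. - \<kappa> * (periodic_well_grad (b - a) \<bullet> (- h)))) (at a)"
      by (rule has_derivative_mult_right[OF has_derivative_compose[OF s2 periodic_well_derivative]])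
    then show "((\<lambda>c. - \<kappa> * periodic_well (b - rep_torus (tproj c))) has_derivative
        (\<lambda>w. \<kappa> *\<^sub>R periodic_well_grad (b - rep_torus (tproj a)) \<bullet> w)) (at a)"
      by (simp add: 1)
    show "continuous_on UNIV (\<lambda>a. \<kappa> *\<^sub>R periodic_well_grad (b - rep_torus (tproj a)))"
      unfolding 1 by (intro continuous_on_scaleR continuous_on_const
          continuous_on_compose2[OF continuous_on_periodic_well(2)[of UNIV]] continuous_on_diff continuous_on_id) auto
  qed
qed

context tonelli_lift
begin

lemma H_tendsto:
  assumes "a \<longlonglongrightarrow> a'" "p \<longlonglongrightarrow> p'" "\<And>n. norm (p n) \<le> P"
  shows "(\<lambda>n. H (tproj (a n)) (p n)) \<longlonglongrightarrow> H (tproj a') p'"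
proof -
  have P': "norm p' \<le> P" by (rule LIMSEQ_le_const2[OF tendsto_norm[OF assms(2)]]) (use assms(3) in blast)
  obtain K where K: "K \<ge> 0" "\<And>a b p q. norm p \<le> P \<Longrightarrow> norm q \<le> P \<Longrightarrow>
       \<bar>H (tproj a) p - H (tproj b) q\<bar> \<le> K * (norm (a - b) + norm (p - q))"
    using H_lipschitz[of P] by meson
  have "(\<lambda>n. K * (norm (a n - a') + norm (p n - p'))) \<longlonglongrightarrow> K * (norm (a' - a') + norm (p' - p'))"
    by (intro tendsto_intros assms)
  then have "(\<lambda>n. K * (norm (a n - a') + norm (p n - p'))) \<longlonglongrightarrow> 0" by simp
  then have "(\<lambda>n. H (tproj (a n)) (p n) - H (tproj a') p') \<longlonglongrightarrow> 0"
    by (rule Lim_null_comparison[rotated]) (use K(2)[OF assms(3) P'] in simp)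
  then show ?thesis by (rule LIM_zero_cancel)
qed

text \<open>Doubling of variables with the penalty \<open>n * periodic_well (x - y)\<close>.\<close>

lemma viscosity_comparison:
  assumes u: "viscosity_solution H c u" and u': "viscosity_solution H c' u'"
  shows "c' \<le> c"
proof -
  have cu: "continuous_on UNIV u" "continuous_on UNIV u'" using u u' by (auto simp: viscosity_solution_def)
  define \<Theta> where "\<Theta> n x = u (tproj (fst x)) - u' (tproj (snd x)) - real n * periodic_well (fst x - snd x)"
    for n and x :: "(real ^ 'd) \<times> (real ^ 'd)"
  let ?Q = "cbox 0 (1 :: real ^ 'd) \<times> cbox 0 (1 :: real ^ 'd)"
  have cQ: "compact ?Q" by (intro compact_Times compact_cbox)
  have c\<Theta>: "continuous_on ?Q (\<Theta> n)" for n
    unfolding \<Theta>_def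
    by (intro continuous_on_diff continuous_on_mult continuous_on_const
        continuous_on_compose2[OF cu(1)] continuous_on_compose2[OF cu(2)]
        continuous_on_compose2[OF continuous_on_tproj[of UNIV]]
        continuous_on_compose2[OF continuous_on_periodic_well(1)[of UNIV]]
        continuous_on_fst continuous_on_snd continuous_on_id) auto
  have "(0, 0) \<in> ?Q" by (simp add: mem_box_cart)
  then have ne: "?Q \<noteq> {}" by blast
  have "\<exists>x\<in>?Q. \<forall>y\<in>?Q. \<Theta> n y \<le> \<Theta> n x" for n
    by (rule continuous_attains_sup[OF cQ ne c\<Theta>])
  then obtain X where X: "\<And>n. X n \<in> ?Q" "\<And>n y. y \<in> ?Q \<Longrightarrow> \<Theta> n y \<le> \<Theta> n (X n)" by metis
  define a where "a n = fst (X n)" for n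
  define b where "b n = snd (X n)" for n
  \<comment> \<open>The functional is periodic in each variable separately, so the maximum over the
    compact cubes is a global one.\<close>
  have glob: "\<Theta> n (a', b') \<le> \<Theta> n (a n, b n)" for n a' b'
  proof -
    obtain y where y: "int_vec y" "a' - y \<in> cbox 0 1" using int_vec_reduce by blast
    obtain z where z: "int_vec z" "b' - z \<in> cbox 0 1" using int_vec_reduce by blast
    have "tproj a' = tproj (a' - y)" "tproj b' = tproj (b' - z)"
      using y z by (simp_all add: tproj_eq_int_vec)
    moreover have "periodic_well (a' - b') = periodic_well ((a' - y) - (b' - z))"
      using periodic_well_periodic(1)[OF int_vec_diff[OF y(1) z(1)], of "(a' - y) - (b' - z)"]
      by (simp add: algebra_simps)
    ultimately have "\<Theta> n (a', b') = \<Theta> n (a' - y, b' - z)" by (simp add: \<Theta>_def)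
    also have "\<dots> \<le> \<Theta> n (X n)" using y z by (intro X(2)) auto
    finally show ?thesis by (simp add: a_def b_def)
  qed
  \<comment> \<open>Common gradient of the two test functions. The subsolution inequality at
    \<open>a n\<close> and the supersolution inequality at \<open>b n\<close> thus involve the same
    momentum.\<close>
  define p where "p n = real n *\<^sub>R periodic_well_grad (a n - b n)" for n
  have Ha: "H (tproj (a n)) (p n) \<le> c" for n
  proof -
    define \<phi> where "\<phi> x = real n * periodic_well (rep_torus x - b n)" for x
    define D\<phi> where "D\<phi> x = real n *\<^sub>R periodic_well_grad (rep_torus x - b n)" for x
    have C1: "C1_gradient \<phi> D\<phi>" unfolding \<phi>_def[abs_def] D\<phi>_def[abs_def] by (rule C1_gradient_periodic_well(1))
    have "u y - \<phi> y \<le> u (tproj (a n)) - \<phi> (tproj (a n))" for y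
    proof -
      obtain a' where "tproj a' = y" using tproj_surj by blast
      then show ?thesis using glob[of n a' "b n"] periodic_well_rep(1)[of a' "b n"] periodic_well_rep(1)[of "a n" "b n"]
        by (auto simp: \<Theta>_def \<phi>_def)
    qed
    then have "H (tproj (a n)) (D\<phi> (tproj (a n))) \<le> c"
      using u C1 unfolding viscosity_solution_def by (meson always_eventually)
    then show ?thesis by (simp add: D\<phi>_def p_def periodic_well_rep)
  qed
  have Hb: "H (tproj (b n)) (p n) \<ge> c'" for n
  proof -
    define \<phi> where "\<phi> x = - real n * periodic_well (a n - rep_torus x)" for x
    define D\<phi> where "D\<phi> x = real n *\<^sub>R periodic_well_grad (a n - rep_torus x)" for x
    have C1: "C1_gradient \<phi> D\<phi>" unfolding \<phi>_def[abs_def] D\<phi>_def[abs_def] by (rule C1_gradient_periodic_well(2))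
    have "u' y - \<phi> y \<ge> u' (tproj (b n)) - \<phi> (tproj (b n))" for y
    proof -
      obtain b' where "tproj b' = y" using tproj_surj by blast
      then show ?thesis using glob[of n "a n" b'] periodic_well_rep(2)[of "a n" b'] periodic_well_rep(2)[of "a n" "b n"]
        by (auto simp: \<Theta>_def \<phi>_def)
    qed
    then have "H (tproj (b n)) (D\<phi> (tproj (b n))) \<ge> c'"
      using u' C1 unfolding viscosity_solution_def by (meson always_eventually)
    then show ?thesis by (simp add: D\<phi>_def p_def periodic_well_rep)
  qed
  \<comment> \<open>Coercivity turns the subsolution inequality into a bound for the momenta, which
    gives a convergent subsequence.\<close>
  obtain C where C: "\<And>x p. H x p \<ge> 1 * norm p - C" using H_superlinear[of 1] by auto
  have pP: "norm (p n) \<le> c + C" for n using C[of "p n" "tproj (a n)"] Ha[of n] by linarith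
  have "bounded (?Q \<times> cball (0 :: real ^ 'd) (c + C))" by (intro bounded_Times bounded_cbox bounded_cball)
  then have "bounded (range (\<lambda>n. (X n, p n)))"
    by (rule bounded_subset) (intro image_subsetI SigmaI X(1), simp add: pP)
  then obtain l r where r: "strict_mono (r :: nat \<Rightarrow> nat)" "((\<lambda>n. (X n, p n)) \<circ> r) \<longlonglongrightarrow> l"
    using bounded_imp_convergent_subsequence by blast
  obtain a0 b0 p0 where l: "l = ((a0, b0), p0)" by (metis surj_pair)
  have lim: "(\<lambda>n. a (r n)) \<longlonglongrightarrow> a0" "(\<lambda>n. b (r n)) \<longlonglongrightarrow> b0" "(\<lambda>n. p (r n)) \<longlonglongrightarrow> p0"
    using tendsto_fst[OF tendsto_fst[OF r(2)]] tendsto_snd[OF tendsto_fst[OF r(2)]] tendsto_snd[OF r(2)]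
    by (simp_all add: l o_def a_def b_def)
  have "periodic_well (a0 - b0) \<le> 0"
  proof -
    have "compact (u' ` UNIV)" by (rule compact_continuous_image[OF cu(2) compact_torus])
    then have "bounded (range u')" by (rule compact_imp_bounded)
    then obtain B where B: "\<And>x. \<bar>u' x\<bar> \<le> B" unfolding bounded_iff by auto
    \<comment> \<open>Compared with the diagonal point, where the penalty vanishes, the maximum
      forces the penalty below the oscillation of \<open>u'\<close>.\<close>
    have le: "periodic_well (a n - b n) \<le> 2 * B * (1 / real n)" if "n \<ge> 1" for n
    proof -
      have p0: "periodic_well (0 :: real ^ 'd) = 0" by (simp add: periodic_well_def)
      have "real n * periodic_well (a n - b n) \<le> u' (tproj (a n)) - u' (tproj (b n))"
        using glob[of n "a n" "a n"] p0 by (simp add: \<Theta>_def)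
      also have "\<dots> \<le> 2 * B" using B[of "tproj (a n)"] B[of "tproj (b n)"] by (simp add: abs_le_iff)
      finally show ?thesis using that by (simp add: field_simps)
    qed
    have "(\<lambda>n. periodic_well (a (r n) - b (r n))) \<longlonglongrightarrow> periodic_well (a0 - b0)"
      by (rule continuous_on_tendsto_compose[OF continuous_on_periodic_well(1)[of UNIV]])
        (auto intro!: tendsto_intros lim)
    moreover have "(\<lambda>n. 2 * B * (1 / real (r n))) \<longlonglongrightarrow> 2 * B * 0"
      using LIMSEQ_subseq_LIMSEQ[OF lim_1_over_n[where 'a = real] r(1)] by (intro tendsto_intros) (simp add: o_def)
    moreover have "\<exists>N. \<forall>n\<ge>N. periodic_well (a (r n) - b (r n)) \<le> 2 * B * (1 / real (r n))"
      using le seq_suble[OF r(1)] order_trans by blast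
    ultimately have "periodic_well (a0 - b0) \<le> 2 * B * 0" by (rule LIMSEQ_le)
    then show ?thesis by simp
  qed
  then have eq: "tproj a0 = tproj b0" using periodic_well_zero tproj_eq_int_vec by metis
  have "c' \<le> H (tproj b0) p0"
    by (rule LIMSEQ_le_const[OF H_tendsto[OF lim(2) lim(3) pP]]) (use Hb in blast)
  also have "\<dots> = H (tproj a0) p0" by (simp add: eq)
  also have "\<dots> \<le> c"
    by (rule LIMSEQ_le_const2[OF H_tendsto[OF lim(1) lim(3) pP]]) (use Ha in blast)
  finally show ?thesis .
qed

lemma critical_value_eq:
  assumes "viscosity_solution H c u" shows "critical_value H = c"
  unfolding critical_value_def
  by (rule the_equality) (use assms viscosity_comparison in \<open>blast intro: antisym\<close>)+

end

section \<open>The limit is a viscosity solution\<close>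

context weak_kam_limit
begin

lemma continuous_on_u: "continuous_on S u"
proof -
  obtain K where K: "K \<ge> 0" "\<And>a b. \<bar>u (tproj a) - u (tproj b)\<bar> \<le> K * norm (a - b)"
    using u_lipschitz by blast
  have "K-lipschitz_on UNIV u"
  proof (rule lipschitz_onI)
    fix x y :: "'d torus"
    obtain a b where "tproj a = x" "tproj b = y" "dist x y = norm (a - b)" using dist_torus_lift by blast
    with K(2)[of a b] show "dist (u x) (u y) \<le> K * dist x y" by (simp add: dist_real_def)
  qed (rule K(1))
  then show ?thesis using lipschitz_on_continuous_on continuous_on_subset by blast
qed

text \<open>For \<open>v = Hp b p\<close>, with \<open>p\<close> the gradient of the test function,
  Fenchel's inequality is an equality. Comparing with the points \<open>b - s *\<^sub>R v\<close>
  behind \<open>b\<close> and dividing by \<open>s\<close> gives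
  \<open>p \<bullet> v \<le> L x v + \<alpha>\<close>, that is
  \<open>H x p \<le> \<alpha>\<close>.\<close>

lemma u_subsolution:
  assumes C1: "C1_gradient \<phi> D\<phi>" and max: "\<forall>\<^sub>F y in nhds x. u y - \<phi> y \<le> u x - \<phi> x"
  shows "H x (D\<phi> x) \<le> \<alpha>"
proof -
  obtain b where b: "tproj b = x" using tproj_surj by blast
  define p where "p = D\<phi> x"
  define v where "v = Hp b p"
  obtain K where K: "K \<ge> 0" "\<And>b s. s \<ge> 0 \<Longrightarrow>
     u (tproj (b + s *\<^sub>R v)) - u (tproj b) \<le> s * (L (tproj b) v + \<alpha>) + K * s\<^sup>2"
    using subsolution_estimate by blast
  obtain KL where KL: "KL \<ge> 0" "\<And>a b. \<bar>L (tproj a) v - L (tproj b) v\<bar> \<le> KL * norm (a - b)"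
    using L_lipschitz[of "norm v"] by (metis add.right_neutral diff_self norm_zero order_refl)
  have dphi: "((\<lambda>a. \<phi> (tproj a)) has_derivative (\<lambda>w. p \<bullet> w)) (at b)"
    using C1 b unfolding C1_gradient_def p_def by metis
  have "((\<lambda>s. b - s *\<^sub>R v) has_derivative (\<lambda>s. - (s *\<^sub>R v))) (at (0 :: real))"
    by (rule has_derivative_eq_rhs, rule has_derivative_diff[OF has_derivative_const
          has_derivative_scaleR_left[OF has_derivative_ident]]) simp
  note line = this
  have "((\<lambda>a. \<phi> (tproj a)) has_derivative (\<lambda>w. p \<bullet> w)) (at (b - 0 *\<^sub>R v))" using dphi by simp
  from has_derivative_compose[OF line this]
  have "((\<lambda>s. \<phi> (tproj (b - s *\<^sub>R v))) has_real_derivative (- (p \<bullet> v))) (at 0)"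
    unfolding has_field_derivative_def by (rule has_derivative_eq_rhs) (simp add: fun_eq_iff)
  then have "((\<lambda>s. (\<phi> (tproj (b - s *\<^sub>R v)) - \<phi> (tproj b)) / s) \<longlongrightarrow> - (p \<bullet> v)) (at 0)"
    unfolding DERIV_def by simp
  then have "((\<lambda>s. (\<phi> (tproj (b - s *\<^sub>R v)) - \<phi> (tproj b)) / s) \<longlongrightarrow> - (p \<bullet> v)) (at_right 0)"
    by (rule tendsto_within_subset) simp
  from tendsto_minus[OF this]
  have lim1: "((\<lambda>s. - ((\<phi> (tproj (b - s *\<^sub>R v)) - \<phi> (tproj b)) / s)) \<longlongrightarrow> p \<bullet> v) (at_right 0)" by simp
  have lim2: "((\<lambda>s. L x v + \<alpha> + (KL * norm v + K) * s) \<longlongrightarrow> L x v + \<alpha> + (KL * norm v + K) * 0) (at_right 0)"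
    by (intro tendsto_intros)
  have "((\<lambda>s. b - s *\<^sub>R v) \<longlongrightarrow> b - 0 *\<^sub>R v) (at_right (0 :: real))" by (intro tendsto_intros)
  then have "((\<lambda>s. tproj (b - s *\<^sub>R v)) \<longlongrightarrow> x) (at_right (0 :: real))"
    using tproj_tendsto[of "\<lambda>s. b - s *\<^sub>R v" b "at_right 0"] b by simp
  from filterlim_iff[THEN iffD1, OF this] max
  have ev: "\<forall>\<^sub>F s in at_right 0. u (tproj (b - s *\<^sub>R v)) - \<phi> (tproj (b - s *\<^sub>R v)) \<le> u x - \<phi> x" by blast
  have "p \<bullet> v \<le> L x v + \<alpha> + (KL * norm v + K) * 0"
  proof (rule tendsto_le[OF _ lim2 lim1])
    show "\<forall>\<^sub>F s in at_right 0. - ((\<phi> (tproj (b - s *\<^sub>R v)) - \<phi> (tproj b)) / s) \<le> L x v + \<alpha> + (KL * norm v + K) * s"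
      using ev eventually_at_right_less[of "0 :: real"]
    proof eventually_elim
      fix s :: real assume m: "u (tproj (b - s *\<^sub>R v)) - \<phi> (tproj (b - s *\<^sub>R v)) \<le> u x - \<phi> x" and s: "0 < s"
      have "L (tproj (b - s *\<^sub>R v)) v \<le> L x v + KL * (s * norm v)"
        using KL(2)[of "b - s *\<^sub>R v" b] s b by (simp add: abs_le_iff)
      then have "s * (L (tproj (b - s *\<^sub>R v)) v + \<alpha>) \<le> s * (L x v + KL * (s * norm v) + \<alpha>)"
        using s by (intro mult_left_mono) auto
      moreover have "u x - u (tproj (b - s *\<^sub>R v)) \<le> s * (L (tproj (b - s *\<^sub>R v)) v + \<alpha>) + K * s\<^sup>2"
        using K(2)[of s "b - s *\<^sub>R v"] s b by simp
      ultimately have "\<phi> (tproj b) - \<phi> (tproj (b - s *\<^sub>R v)) \<le> s * (L x v + KL * (s * norm v) + \<alpha>) + K * s\<^sup>2"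
        using m b by simp
      also have "\<dots> = s * (L x v + \<alpha> + (KL * norm v + K) * s)" by (simp add: algebra_simps power2_eq_square)
      finally have "(\<phi> (tproj b) - \<phi> (tproj (b - s *\<^sub>R v))) / s \<le> L x v + \<alpha> + (KL * norm v + K) * s"
        using s by (simp add: pos_divide_le_eq mult.commute)
      then show "- ((\<phi> (tproj (b - s *\<^sub>R v)) - \<phi> (tproj b)) / s) \<le> L x v + \<alpha> + (KL * norm v + K) * s"
        by (simp add: diff_divide_distrib)
    qed
  qed simp
  then show ?thesis using L_dual[of b p] b by (simp add: v_def p_def)
qed

text \<open>The backward estimate is used with \<open>p\<close> equal to the gradient of the test
  function. The expansion of the latter cancels \<open>p \<bullet> (b - a)\<close>, and after
  division by \<open>s\<close> only errors below \<open>e\<close> remain.\<close>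

lemma u_supersolution:
  assumes C1: "C1_gradient \<phi> D\<phi>" and min: "\<forall>\<^sub>F y in nhds x. u y - \<phi> y \<ge> u x - \<phi> x"
  shows "\<alpha> \<le> H x (D\<phi> x)"
proof (rule field_le_epsilon)
  fix e :: real assume e: "e > 0"
  obtain b where b: "tproj b = x" using tproj_surj by blast
  define p where "p = D\<phi> x"
  obtain R where R: "R > 0" "\<And>p. \<exists>K\<ge>0. \<forall>b s. s > 0 \<longrightarrow> (\<exists>a. norm (b - a) \<le> R * s \<and>
     p \<bullet> (b - a) + s * (\<alpha> - H (tproj b) p) - K * s\<^sup>2 \<le> u (tproj b) - u (tproj a))"
    using supersolution_estimate by blast
  obtain K where K: "K \<ge> 0" "\<And>b s. s > 0 \<Longrightarrow> \<exists>a. norm (b - a) \<le> R * s \<and>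
     p \<bullet> (b - a) + s * (\<alpha> - H (tproj b) p) - K * s\<^sup>2 \<le> u (tproj b) - u (tproj a)"
    using R(2)[of p] by blast
  define \<epsilon> where "\<epsilon> = e / (2 * R)"
  have \<epsilon>: "\<epsilon> > 0" using e R by (simp add: \<epsilon>_def)
  have dphi: "((\<lambda>a. \<phi> (tproj a)) has_derivative (\<lambda>w. p \<bullet> w)) (at b)"
    using C1 b unfolding C1_gradient_def p_def by metis
  then obtain d1 where d1: "d1 > 0" "\<And>y. norm (y - b) < d1 \<Longrightarrow>
      norm (\<phi> (tproj y) - \<phi> (tproj b) - p \<bullet> (y - b)) \<le> \<epsilon> * norm (y - b)"
    using \<epsilon> unfolding has_derivative_at_alt by blast
  obtain d2 where d2: "d2 > 0" "\<And>y. dist y x < d2 \<Longrightarrow> u y - \<phi> y \<ge> u x - \<phi> x"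
    using min unfolding eventually_nhds_metric by blast
  \<comment> \<open>Small enough that the backward endpoint, at distance at most
    \<open>R * s\<close>, lies in both neighbourhoods and that the quadratic term contributes at
    most \<open>e / 2\<close> after division by \<open>s\<close>.\<close>
  define s where "s = min (min d1 d2 / (2 * R)) (e / (2 * (K + 1)))"
  have s: "s > 0" using d1(1) d2(1) R(1) e K(1) by (simp add: s_def)
  have sR: "R * s < d1" "R * s < d2"
  proof -
    have "R * s \<le> R * (min d1 d2 / (2 * R))" using R(1) by (intro mult_left_mono) (auto simp: s_def)
    also have "\<dots> = min d1 d2 / 2" using R(1) by simp
    finally show "R * s < d1" "R * s < d2" using d1(1) d2(1) by auto
  qed
  have Ks: "K * s \<le> e / 2"
  proof -
    have "K * s \<le> (K + 1) * s" using s by simp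
    also have "\<dots> \<le> (K + 1) * (e / (2 * (K + 1)))" using K(1) by (intro mult_left_mono) (auto simp: s_def)
    also have "\<dots> = ((K + 1) * e) / ((K + 1) * 2)" by (simp add: mult.commute)
    also have "\<dots> = e / 2" by (rule mult_divide_mult_cancel_left) (use K(1) in simp)
    finally show ?thesis .
  qed
  obtain a where a: "norm (b - a) \<le> R * s"
    "p \<bullet> (b - a) + s * (\<alpha> - H (tproj b) p) - K * s\<^sup>2 \<le> u (tproj b) - u (tproj a)"
    using K(2)[OF s] by blast
  have na: "norm (a - b) \<le> R * s" using a(1) by (simp add: norm_minus_commute)
  have "dist (tproj a) x < d2" using dist_torus_le[of a b] na sR(2) b by (simp add: dist_norm)
  from d2(2)[OF this] have "u (tproj b) - u (tproj a) \<le> \<phi> (tproj b) - \<phi> (tproj a)" using b by simp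
  moreover have "\<phi> (tproj b) - \<phi> (tproj a) \<le> p \<bullet> (b - a) + \<epsilon> * (R * s)"
  proof -
    have "\<bar>\<phi> (tproj a) - \<phi> (tproj b) - p \<bullet> (a - b)\<bar> \<le> \<epsilon> * norm (a - b)"
      using d1(2)[of a] na sR(1) by simp
    also have "\<dots> \<le> \<epsilon> * (R * s)" using na \<epsilon> by (intro mult_left_mono) auto
    finally show ?thesis by (simp add: abs_le_iff inner_diff_right)
  qed
  ultimately have "s * (\<alpha> - H (tproj b) p) \<le> \<epsilon> * (R * s) + K * s\<^sup>2" using a(2) by linarith
  also have "\<dots> = s * (\<epsilon> * R + K * s)" by (simp add: algebra_simps power2_eq_square)
  finally have "\<alpha> - H (tproj b) p \<le> \<epsilon> * R + K * s" using s by simp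
  also have "\<dots> \<le> e / 2 + e / 2" using Ks R(1) by (intro add_mono) (auto simp: \<epsilon>_def)
  finally show "\<alpha> \<le> H x (D\<phi> x) + e" using b by (simp add: p_def)
qed

lemma viscosity_solution_u: "viscosity_solution H \<alpha> u"
  unfolding viscosity_solution_def
  using continuous_on_u u_subsolution u_supersolution by blast

lemma critical_value_u: "critical_value H = \<alpha>"
  by (rule critical_value_eq[OF viscosity_solution_u])

end

section \<open>Mollification\<close>

lemma lborel_integral_shift:
  fixes g :: "real ^ 'd::finite \<Rightarrow> 'b::{banach, second_countable_topology}"
  assumes "g \<in> borel_measurable borel"
  shows "(\<integral>z. g z \<partial>lborel) = (\<integral>y. g (c + y) \<partial>lborel)"
proof -
  have "(\<integral>z. g z \<partial>lborel) = (\<integral>z. g z \<partial>distr lborel borel ((+) c))"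
    by (simp add: lborel_distr_plus)
  also have "\<dots> = (\<integral>y. g (c + y) \<partial>lborel)"
    by (rule integral_distr) (use assms in auto)
  finally show ?thesis .
qed

lemma compact_support_integrable:
  fixes g :: "real ^ 'd::finite \<Rightarrow> 'b::{banach, second_countable_topology}"
  assumes "continuous_on UNIV g" "\<And>y. y \<notin> cball x r \<Longrightarrow> g y = 0"
  shows "integrable lborel g"
proof -
  have "compact (g ` cball x r)"
    by (intro compact_continuous_image continuous_on_subset[OF assms(1)] compact_cball) auto
  then have "bounded (g ` cball x r)" by (rule compact_imp_bounded)
  then obtain B where B: "\<And>y. y \<in> cball x r \<Longrightarrow> norm (g y) \<le> B" unfolding bounded_iff by blast
  show ?thesis
  proof (rule integrableI_bounded_set[where A = "cball x r" and B = B])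
    show "g \<in> borel_measurable lborel" using borel_measurable_continuous_onI[OF assms(1)] by simp
    show "emeasure lborel (cball x r) < \<infinity>" by (rule emeasure_bounded_finite) simp
  qed (use B assms(2) in auto)
qed

text \<open>The squared positive part has derivative \<open>2 * max 0 t\<close>, with a remainder
  quadratic across the kink. This makes the bump below differentiable with a uniform quadratic
  error.\<close>

lemma squared_plus_expansion:
  fixes t t' :: real
  shows "\<bar>(max 0 t')\<^sup>2 - (max 0 t)\<^sup>2 - 2 * max 0 t * (t' - t)\<bar> \<le> (t' - t)\<^sup>2"
proof -
  consider "t \<ge> 0" "t' \<ge> 0" | "t \<ge> 0" "t' < 0" | "t < 0" "t' \<ge> 0" | "t < 0" "t' < 0" by linarith
  then show ?thesis
  proof cases
    case 1
    then have "(max 0 t')\<^sup>2 - (max 0 t)\<^sup>2 - 2 * max 0 t * (t' - t) = (t' - t)\<^sup>2"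
      by (simp add: power2_eq_square algebra_simps)
    then show ?thesis by simp
  next
    case 2
    have "(max 0 t')\<^sup>2 - (max 0 t)\<^sup>2 - 2 * max 0 t * (t' - t) = t\<^sup>2 - 2 * (t * t')"
      using 2 by (simp add: power2_eq_square algebra_simps)
    moreover have "0 \<le> t\<^sup>2 - 2 * (t * t')"
    proof -
      have "2 * (t * t') \<le> 0" using 2 by (simp add: mult_nonneg_nonpos)
      also have "0 \<le> t\<^sup>2" by simp
      finally show ?thesis by simp
    qed
    moreover have "t\<^sup>2 - 2 * (t * t') \<le> (t' - t)\<^sup>2" by (simp add: power2_diff)
    ultimately show ?thesis by simp
  next
    case 3
    have "t'\<^sup>2 \<le> (t' - t)\<^sup>2" using 3 by (intro power_mono) auto
    then show ?thesis using 3 by simp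
  next
    case 4
    then show ?thesis by simp
  qed
qed

text \<open>Convolution with the \<open>C\<^sup>1\<close> bump \<open>(max 0 (\<epsilon>\<^sup>2 - \<bar>y\<bar>\<^sup>2))\<^sup>2\<close>.\<close>

lemma mollification:
  fixes u :: "'d::finite torus \<Rightarrow> real"
  assumes lip: "\<And>a b. \<bar>u (tproj a) - u (tproj b)\<bar> \<le> K * norm (a - b)" and \<epsilon>: "\<epsilon> > 0"
  obtains \<phi> D\<phi> where "C1_gradient \<phi> D\<phi>"
    "\<And>a v M \<kappa>. (\<And>y s. norm y \<le> \<epsilon> \<Longrightarrow> 0 \<le> s \<Longrightarrow>
        u (tproj (a + y + s *\<^sub>R v)) - u (tproj (a + y)) \<le> s * M + \<kappa> * s\<^sup>2) \<Longrightarrow> D\<phi> (tproj a) \<bullet> v \<le> M"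
proof -
  define w where "w a = u (tproj a)" for a
  have wlip: "\<bar>w a - w b\<bar> \<le> K * norm (a - b)" for a b using lip by (simp add: w_def)
  have K: "K \<ge> 0"
  proof -
    have "norm (axis undefined 1 - 0 :: real ^ 'd) = 1" by (simp add: norm_axis_abs)
    then show ?thesis using wlip[of "axis undefined 1" 0] by simp
  qed
  have cw: "continuous_on UNIV w"
  proof (rule lipschitz_on_continuous_on)
    show "K-lipschitz_on UNIV w" by (rule lipschitz_onI) (use wlip K in \<open>auto simp: dist_norm\<close>)
  qed
  have per: "w (a + z) = w a" if "int_vec z" for a z using tproj_add_int_vec[OF that] by (simp add: w_def)
  obtain W where W: "\<And>a. \<bar>w a\<bar> \<le> W"
  proof -
    have "continuous_on UNIV u"
      by (rule continuous_on_torus) (use cw in \<open>simp add: w_def[abs_def]\<close>)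
    then have "compact (range u)" by (rule compact_continuous_image[OF _ compact_torus])
    then have "bounded (range u)" by (rule compact_imp_bounded)
    then obtain B where "\<And>x. \<bar>u x\<bar> \<le> B" unfolding bounded_iff by auto
    then show ?thesis using that[of B] by (simp add: w_def)
  qed
  have W0: "W \<ge> 0" using W[of 0] by linarith
  define m where "m y = max 0 (\<epsilon>\<^sup>2 - (norm y)\<^sup>2)" for y :: "real ^ 'd"
  define \<rho> where "\<rho> y = (m y)\<^sup>2" for y
  \<comment> \<open>Minus the gradient of the kernel \<open>\<rho>\<close>, so that shifting the
    kernel by \<open>h\<close> changes it to first order by
    \<open>\<gamma> y \<bullet> h\<close>.\<close>
  define \<gamma> where "\<gamma> y = (4 * m y) *\<^sub>R y" for y
  have m0: "m y = 0" if "norm y \<ge> \<epsilon>" for y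
    using that \<epsilon> power_mono[of \<epsilon> "norm y" 2] by (simp add: m_def)
  have mb: "0 \<le> m y" "m y \<le> \<epsilon>\<^sup>2" for y by (auto simp: m_def)
  have cm: "continuous_on UNIV m" unfolding m_def[abs_def] by (intro continuous_intros)
  have c\<rho>: "continuous_on UNIV \<rho>" and c\<gamma>: "continuous_on UNIV \<gamma>"
    unfolding \<rho>_def[abs_def] \<gamma>_def[abs_def] by (intro continuous_intros cm)+
  have c\<rho>s: "continuous_on UNIV (\<lambda>z. \<rho> (z - a))" and c\<gamma>s: "continuous_on UNIV (\<lambda>z. \<gamma> (z - a))"
    and cws: "continuous_on UNIV (\<lambda>y. w (a + y))" for a
    by (rule continuous_on_compose2[OF c\<rho>] continuous_on_compose2[OF c\<gamma>] continuous_on_compose2[OF cw],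
        intro continuous_intros, simp)+
  have i\<rho>: "integrable lborel \<rho>"
    by (rule compact_support_integrable[OF c\<rho>, of 0 \<epsilon>]) (use m0 in \<open>auto simp: \<rho>_def\<close>)
  have i\<rho>w: "integrable lborel (\<lambda>y. \<rho> y * w (a + y))" for a
    by (rule compact_support_integrable[OF continuous_on_mult[OF c\<rho> cws], of 0 \<epsilon>])
      (use m0 in \<open>auto simp: \<rho>_def\<close>)
  have i\<rho>w': "integrable lborel (\<lambda>z. \<rho> (z - a) * w z)" for a
    by (rule compact_support_integrable[OF continuous_on_mult[OF c\<rho>s cw], of a \<epsilon>])
      (use m0 in \<open>auto simp: \<rho>_def dist_norm norm_minus_commute\<close>)
  have i\<gamma>w: "integrable lborel (\<lambda>y. w (a + y) *\<^sub>R \<gamma> y)" for a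
    by (rule compact_support_integrable[OF continuous_on_scaleR[OF cws c\<gamma>], of 0 \<epsilon>])
      (use m0 in \<open>auto simp: \<gamma>_def\<close>)
  have i\<gamma>w': "integrable lborel (\<lambda>z. w z *\<^sub>R \<gamma> (z - a))" for a
    by (rule compact_support_integrable[OF continuous_on_scaleR[OF cw c\<gamma>s], of a \<epsilon>])
      (use m0 in \<open>auto simp: \<gamma>_def dist_norm norm_minus_commute\<close>)
  have in\<gamma>: "integrable lborel (\<lambda>y. norm (\<gamma> y))"
    by (rule compact_support_integrable[OF continuous_on_norm[OF c\<gamma>], of 0 \<epsilon>])
      (use m0 in \<open>auto simp: \<gamma>_def\<close>)
  define Z where "Z = (\<integral>y. \<rho> y \<partial>lborel)"
  have Z: "Z > 0"
  proof -
    have b: "indicator (ball (0 :: real ^ 'd) (\<epsilon> / 2)) y *\<^sub>R (\<epsilon>\<^sup>2 / 2)\<^sup>2 \<le> \<rho> y" for y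
    proof (cases "y \<in> ball 0 (\<epsilon> / 2)")
      case True
      then have "(norm y)\<^sup>2 \<le> (\<epsilon> / 2)\<^sup>2" by (intro power_mono) auto
      then have "4 * (norm y)\<^sup>2 \<le> \<epsilon>\<^sup>2" by (simp add: power_divide)
      moreover have "2 * (norm y)\<^sup>2 \<le> 4 * (norm y)\<^sup>2" by simp
      ultimately have "2 * (norm y)\<^sup>2 \<le> \<epsilon>\<^sup>2" by (rule order_trans[rotated])
      then have "\<epsilon>\<^sup>2 / 2 \<le> \<epsilon>\<^sup>2 - (norm y)\<^sup>2" by (simp add: field_simps)
      then have "\<epsilon>\<^sup>2 / 2 \<le> m y" unfolding m_def by (rule max.coboundedI2)
      then have "(\<epsilon>\<^sup>2 / 2)\<^sup>2 \<le> \<rho> y" unfolding \<rho>_def by (intro power_mono) auto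
      with True show ?thesis by simp
    next
      case False
      then show ?thesis by (simp add: \<rho>_def)
    qed
    have fin: "emeasure lborel (ball (0 :: real ^ 'd) (\<epsilon> / 2)) < \<infinity>" by (rule emeasure_bounded_finite) simp
    have "0 < measure lborel (ball (0 :: real ^ 'd) (\<epsilon> / 2)) * (\<epsilon>\<^sup>2 / 2)\<^sup>2"
      using content_ball_pos[of "\<epsilon> / 2" "0 :: real ^ 'd"] \<epsilon> by simp
    also have "\<dots> = (\<integral>y. indicator (ball (0 :: real ^ 'd) (\<epsilon> / 2)) y *\<^sub>R (\<epsilon>\<^sup>2 / 2)\<^sup>2 \<partial>lborel)"
      using fin by simp
    also have "\<dots> \<le> Z"
      unfolding Z_def by (rule integral_mono[OF _ i\<rho> b]) (use fin in simp)
    finally show ?thesis .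
  qed
  define F where "F a = (\<integral>y. \<rho> y * w (a + y) \<partial>lborel)" for a
  define G where "G a = (\<integral>y. w (a + y) *\<^sub>R \<gamma> y \<partial>lborel)" for a
  \<comment> \<open>After the shift the dependence on \<open>a\<close> sits in the kernel alone;
    differentiation never touches \<open>w\<close>, which is only Lipschitz.\<close>
  have F': "F a = (\<integral>z. \<rho> (z - a) * w z \<partial>lborel)" for a
    unfolding F_def
    by (subst lborel_integral_shift[of "\<lambda>z. \<rho> (z - a) * w z" a])
      (auto intro!: borel_measurable_continuous_onI continuous_on_mult c\<rho>s cw)
  have G': "G a = (\<integral>z. w z *\<^sub>R \<gamma> (z - a) \<partial>lborel)" for a
    unfolding G_def
    by (subst lborel_integral_shift[of "\<lambda>z. w z *\<^sub>R \<gamma> (z - a)" a])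
      (auto intro!: borel_measurable_continuous_onI continuous_on_scaleR c\<gamma>s cw)
  \<comment> \<open>The first summand comes from
    \<open>\<bar>t' - t\<bar> \<le> (2 * (\<epsilon> + 1) + 1) * norm h\<close>, valid on the ball
    of radius \<open>\<epsilon> + 1\<close> that contains both supports, the second from
    \<open>m y \<le> \<epsilon>^2\<close>.\<close>
  define \<kappa> where "\<kappa> = (2 * (\<epsilon> + 1) + 1)\<^sup>2 + 2 * \<epsilon>\<^sup>2"
  have \<kappa>0: "\<kappa> \<ge> 0" by (simp add: \<kappa>_def)
  have point: "\<bar>\<rho> (y - h) - \<rho> y - \<gamma> y \<bullet> h\<bar> \<le> indicator (cball 0 (\<epsilon> + 1)) y * (\<kappa> * (norm h)\<^sup>2)" if h: "norm h \<le> 1" for y h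
  proof (cases "norm y \<le> \<epsilon> + 1")
    case False
    then have "norm (y - h) \<ge> \<epsilon>" "norm y \<ge> \<epsilon>" using norm_triangle_ineq2[of y h] h by linarith+
    then show ?thesis using False m0 by (simp add: \<rho>_def \<gamma>_def)
  next
    case True
    define t where "t = \<epsilon>\<^sup>2 - (norm y)\<^sup>2"
    define t' where "t' = \<epsilon>\<^sup>2 - (norm (y - h))\<^sup>2"
    have tt: "t' - t = 2 * (y \<bullet> h) - (norm h)\<^sup>2"
      by (simp add: t_def t'_def power2_norm_eq_inner inner_diff_left inner_diff_right inner_commute)
    have "\<rho> (y - h) - \<rho> y - \<gamma> y \<bullet> h = ((max 0 t')\<^sup>2 - (max 0 t)\<^sup>2 - 2 * max 0 t * (t' - t)) - 2 * m y * (norm h)\<^sup>2"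
      by (simp add: \<rho>_def \<gamma>_def m_def t_def[symmetric] t'_def[symmetric] tt algebra_simps)
    then have "\<bar>\<rho> (y - h) - \<rho> y - \<gamma> y \<bullet> h\<bar> \<le> (t' - t)\<^sup>2 + 2 * m y * (norm h)\<^sup>2"
      using squared_plus_expansion[of t' t] mb(1)[of y] abs_triangle_ineq4 by (smt (verit) mult_nonneg_nonneg zero_le_power2)
    also have "\<dots> \<le> ((2 * (\<epsilon> + 1) + 1) * norm h)\<^sup>2 + 2 * \<epsilon>\<^sup>2 * (norm h)\<^sup>2"
    proof (rule add_mono)
      have "\<bar>t' - t\<bar> \<le> 2 * \<bar>y \<bullet> h\<bar> + (norm h)\<^sup>2" unfolding tt
        using abs_triangle_ineq4[of "2 * (y \<bullet> h)" "(norm h)\<^sup>2"] by (simp add: abs_mult)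
      also have "\<dots> \<le> 2 * ((\<epsilon> + 1) * norm h) + 1 * norm h"
      proof (intro add_mono mult_left_mono)
        show "\<bar>y \<bullet> h\<bar> \<le> (\<epsilon> + 1) * norm h"
          using order_trans[OF Cauchy_Schwarz_ineq2 mult_right_mono[OF True norm_ge_zero]] .
        show "(norm h)\<^sup>2 \<le> 1 * norm h" using h by (simp add: power2_eq_square mult_left_le_one_le)
      qed simp
      also have "\<dots> = (2 * (\<epsilon> + 1) + 1) * norm h" by (simp add: algebra_simps)
      finally show "(t' - t)\<^sup>2 \<le> ((2 * (\<epsilon> + 1) + 1) * norm h)\<^sup>2"
        by (rule power2_le_iff_abs_le[THEN iffD2, rotated]) (use \<epsilon> in simp)
      show "2 * m y * (norm h)\<^sup>2 \<le> 2 * \<epsilon>\<^sup>2 * (norm h)\<^sup>2" using mb(2)[of y] by (intro mult_right_mono) auto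
    qed
    also have "\<dots> = \<kappa> * (norm h)\<^sup>2" unfolding \<kappa>_def power_mult_distrib by (rule distrib_right[symmetric])
    finally show ?thesis using True by simp
  qed
  define V where "V = measure lborel (cball (0 :: real ^ 'd) (\<epsilon> + 1))"
  have diffF: "\<bar>F (a + h) - F a - G a \<bullet> h\<bar> \<le> \<kappa> * W * V * (norm h)\<^sup>2" if h: "norm h \<le> 1" for a h
  proof -
    have fin: "emeasure lborel (cball a (\<epsilon> + 1)) < \<infinity>" by (rule emeasure_bounded_finite) simp
    have Va: "measure lborel (cball a (\<epsilon> + 1)) = V" unfolding V_def using \<epsilon> by (simp add: content_cball)
    have 2: "integrable lborel (\<lambda>z. (w z *\<^sub>R \<gamma> (z - a)) \<bullet> h)"
      by (rule integrable_inner_left) (rule i\<gamma>w')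
    have "F (a + h) - F a - G a \<bullet> h = (\<integral>z. \<rho> (z - (a + h)) * w z - \<rho> (z - a) * w z - (w z *\<^sub>R \<gamma> (z - a)) \<bullet> h \<partial>lborel)"
    proof -
      have 1: "(\<integral>z. w z *\<^sub>R \<gamma> (z - a) \<partial>lborel) \<bullet> h = (\<integral>z. (w z *\<^sub>R \<gamma> (z - a)) \<bullet> h \<partial>lborel)"
        by (rule integral_inner_left[symmetric]) (rule i\<gamma>w')
      show ?thesis
        by (simp only: F' G' 1 Bochner_Integration.integral_diff[OF Bochner_Integration.integrable_diff[OF i\<rho>w' i\<rho>w'] 2]
            Bochner_Integration.integral_diff[OF i\<rho>w' i\<rho>w'])
    qed
    also have "\<bar>\<dots>\<bar> \<le> (\<integral>z. indicator (cball a (\<epsilon> + 1)) z *\<^sub>R (\<kappa> * (norm h)\<^sup>2 * W) \<partial>lborel)"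
    proof (rule order_trans[OF integral_abs_bound], rule integral_mono)
      show "integrable lborel (\<lambda>z. \<bar>\<rho> (z - (a + h)) * w z - \<rho> (z - a) * w z - (w z *\<^sub>R \<gamma> (z - a)) \<bullet> h\<bar>)"
        by (intro integrable_abs Bochner_Integration.integrable_diff i\<rho>w' 2)
      show "integrable lborel (\<lambda>z. indicator (cball a (\<epsilon> + 1)) z *\<^sub>R (\<kappa> * (norm h)\<^sup>2 * W))"
        using fin by simp
      fix z
      have "\<rho> (z - (a + h)) * w z - \<rho> (z - a) * w z - (w z *\<^sub>R \<gamma> (z - a)) \<bullet> h
          = (\<rho> ((z - a) - h) - \<rho> (z - a) - \<gamma> (z - a) \<bullet> h) * w z"
        by (simp add: algebra_simps)
      then have "\<bar>\<rho> (z - (a + h)) * w z - \<rho> (z - a) * w z - (w z *\<^sub>R \<gamma> (z - a)) \<bullet> h\<bar>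
          \<le> indicator (cball 0 (\<epsilon> + 1)) (z - a) * (\<kappa> * (norm h)\<^sup>2) * W"
        using point[OF h, of "z - a"] W[of z] \<kappa>0 by (simp only: abs_mult) (intro mult_mono, auto)
      also have "indicator (cball 0 (\<epsilon> + 1)) (z - a) = (indicator (cball a (\<epsilon> + 1)) z :: real)"
        by (simp add: indicator_def dist_norm norm_minus_commute)
      finally show "\<bar>\<rho> (z - (a + h)) * w z - \<rho> (z - a) * w z - (w z *\<^sub>R \<gamma> (z - a)) \<bullet> h\<bar>
          \<le> indicator (cball a (\<epsilon> + 1)) z *\<^sub>R (\<kappa> * (norm h)\<^sup>2 * W)" by (simp add: mult_ac)
    qed
    also have "\<dots> = \<kappa> * W * V * (norm h)\<^sup>2" using fin Va by simp
    finally show ?thesis .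
  qed
  define B where "B = \<kappa> * W * V"
  have B0: "B \<ge> 0" using \<kappa>0 W0 by (simp add: B_def V_def)
  have dF: "(F has_derivative (\<lambda>h. G a \<bullet> h)) (at a)" for a
    unfolding has_derivative_at_alt
  proof (intro conjI allI impI)
    show "bounded_linear ((\<bullet>) (G a))" by (rule bounded_linear_inner_right)
    fix e :: real assume e: "e > 0"
    show "\<exists>d>0. \<forall>y. norm (y - a) < d \<longrightarrow> norm (F y - F a - G a \<bullet> (y - a)) \<le> e * norm (y - a)"
    proof (intro exI[of _ "min 1 (e / (B + 1))"] conjI allI impI)
      show "0 < min 1 (e / (B + 1))" using e B0 by simp
      fix y assume y: "norm (y - a) < min 1 (e / (B + 1))"
      have "\<bar>F y - F a - G a \<bullet> (y - a)\<bar> \<le> B * norm (y - a) * norm (y - a)"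
        using diffF[of "y - a" a] y by (simp add: B_def power2_eq_square mult_ac)
      also have "\<dots> \<le> e * norm (y - a)"
      proof (rule mult_right_mono)
        have "B * norm (y - a) \<le> (B + 1) * norm (y - a)" by (intro mult_right_mono) auto
        also have "\<dots> \<le> (B + 1) * (e / (B + 1))" using y B0 by (intro mult_left_mono) auto
        finally show "B * norm (y - a) \<le> e" using B0 by simp
      qed simp
      finally show "norm (F y - F a - G a \<bullet> (y - a)) \<le> e * norm (y - a)" by simp
    qed
  qed
  have Glip: "norm (G a - G b) \<le> (K * (\<integral>y. norm (\<gamma> y) \<partial>lborel)) * norm (a - b)" for a b
  proof -
    have "G a - G b = (\<integral>y. (w (a + y) - w (b + y)) *\<^sub>R \<gamma> y \<partial>lborel)"
      unfolding G_def using i\<gamma>w by (simp add: scaleR_left_diff_distrib)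
    also have "norm \<dots> \<le> (\<integral>y. (K * norm (a - b)) * norm (\<gamma> y) \<partial>lborel)"
    proof (rule order_trans[OF integral_norm_bound], rule integral_mono)
      show "integrable lborel (\<lambda>y. norm ((w (a + y) - w (b + y)) *\<^sub>R \<gamma> y))"
        unfolding scaleR_left_diff_distrib
        by (intro integrable_norm Bochner_Integration.integrable_diff i\<gamma>w)
      show "integrable lborel (\<lambda>y. (K * norm (a - b)) * norm (\<gamma> y))" using in\<gamma> by simp
      fix y
      have "\<bar>w (a + y) - w (b + y)\<bar> \<le> K * norm (a - b)" using wlip[of "a + y" "b + y"] by simp
      then show "norm ((w (a + y) - w (b + y)) *\<^sub>R \<gamma> y) \<le> (K * norm (a - b)) * norm (\<gamma> y)"
        by (simp add: mult_right_mono)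
    qed
    also have "\<dots> = (K * (\<integral>y. norm (\<gamma> y) \<partial>lborel)) * norm (a - b)" by simp
    finally show ?thesis .
  qed
  have Gcont: "continuous_on UNIV G"
  proof (rule lipschitz_on_continuous_on)
    show "(K * (\<integral>y. norm (\<gamma> y) \<partial>lborel))-lipschitz_on UNIV G"
      by (rule lipschitz_onI) (use Glip K in \<open>auto simp: dist_norm intro!: mult_nonneg_nonneg integral_nonneg_AE\<close>)
  qed
  have rep: "F (rep_torus (tproj a)) = F a" "G (rep_torus (tproj a)) = G a" for a
  proof -
    have z: "int_vec (rep_torus (tproj a) - a)" using tproj_rep_torus tproj_eq_int_vec by metis
    have "w (rep_torus (tproj a) + y) = w (a + y)" for y
      using per[OF z, of "a + y"] by (simp add: algebra_simps)
    then show "F (rep_torus (tproj a)) = F a" "G (rep_torus (tproj a)) = G a" by (simp_all add: F_def G_def)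
  qed
  show ?thesis
  proof (rule that[of "\<lambda>x. F (rep_torus x) / Z" "\<lambda>x. G (rep_torus x) /\<^sub>R Z"])
    show "C1_gradient (\<lambda>x. F (rep_torus x) / Z) (\<lambda>x. G (rep_torus x) /\<^sub>R Z)"
      unfolding C1_gradient_def
    proof (intro conjI allI continuous_on_torus)
      fix a
      have "((\<lambda>b. inverse Z * F b) has_derivative (\<lambda>h. inverse Z * (G a \<bullet> h))) (at a)"
        by (rule has_derivative_mult_right[OF dF])
      then show "((\<lambda>b. F (rep_torus (tproj b)) / Z) has_derivative (\<lambda>h. (G (rep_torus (tproj a)) /\<^sub>R Z) \<bullet> h)) (at a)"
        by (simp add: rep divide_inverse_commute)
      show "continuous_on UNIV (\<lambda>a. G (rep_torus (tproj a)) /\<^sub>R Z)"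
        unfolding rep by (intro continuous_intros Gcont)
    qed
  next
    fix a v M \<kappa>'
    assume est: "\<And>y s. norm y \<le> \<epsilon> \<Longrightarrow> 0 \<le> s \<Longrightarrow>
        u (tproj (a + y + s *\<^sub>R v)) - u (tproj (a + y)) \<le> s * M + \<kappa>' * s\<^sup>2"
    \<comment> \<open>The one-sided estimate holds at every translate by \<open>y\<close> of length
      at most \<open>\<epsilon>\<close> and is averaged against the kernel; the factor
      \<open>Z\<close> is its total mass.\<close>
    have Fs: "F (a + s *\<^sub>R v) - F a \<le> (s * M + \<kappa>' * s\<^sup>2) * Z" if s: "0 \<le> s" for s
    proof -
      have "F (a + s *\<^sub>R v) - F a = (\<integral>y. \<rho> y * (w (a + s *\<^sub>R v + y) - w (a + y)) \<partial>lborel)"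
        unfolding F_def using i\<rho>w by (simp add: right_diff_distrib)
      also have "\<dots> \<le> (\<integral>y. (s * M + \<kappa>' * s\<^sup>2) * \<rho> y \<partial>lborel)"
      proof (rule integral_mono)
        show "integrable lborel (\<lambda>y. \<rho> y * (w (a + s *\<^sub>R v + y) - w (a + y)))"
          using i\<rho>w by (simp add: right_diff_distrib)
        show "integrable lborel (\<lambda>y. (s * M + \<kappa>' * s\<^sup>2) * \<rho> y)" using i\<rho> by simp
        fix y
        show "\<rho> y * (w (a + s *\<^sub>R v + y) - w (a + y)) \<le> (s * M + \<kappa>' * s\<^sup>2) * \<rho> y"
        proof (cases "norm y \<le> \<epsilon>")
          case True
          have "w (a + s *\<^sub>R v + y) - w (a + y) \<le> s * M + \<kappa>' * s\<^sup>2"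
            using est[OF True s] by (simp add: w_def add_ac)
          then have "\<rho> y * (w (a + s *\<^sub>R v + y) - w (a + y)) \<le> \<rho> y * (s * M + \<kappa>' * s\<^sup>2)"
            by (intro mult_left_mono) (simp_all add: \<rho>_def)
          then show ?thesis by (simp add: mult.commute)
        next
          case False
          then show ?thesis using m0[of y] by (simp add: \<rho>_def)
        qed
      qed
      also have "\<dots> = (s * M + \<kappa>' * s\<^sup>2) * Z" by (simp add: Z_def)
      finally show ?thesis .
    qed
    have lim: "((\<lambda>s. (F (a + s *\<^sub>R v) - F a) / s) \<longlongrightarrow> G a \<bullet> v) (at_right 0)"
    proof -
      have line: "((\<lambda>s. a + s *\<^sub>R v) has_derivative (\<lambda>s. s *\<^sub>R v)) (at (0 :: real))"
        by (rule has_derivative_eq_rhs, rule has_derivative_add[OF has_derivative_const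
              has_derivative_scaleR_left[OF has_derivative_ident]]) simp
      have "(F has_derivative (\<lambda>h. G a \<bullet> h)) (at (a + 0 *\<^sub>R v))" using dF by simp
      from has_derivative_compose[OF line this]
      have "((\<lambda>s. F (a + s *\<^sub>R v)) has_real_derivative (G a \<bullet> v)) (at 0)"
        unfolding has_field_derivative_def by (rule has_derivative_eq_rhs) (simp add: fun_eq_iff)
      then have "((\<lambda>s. (F (a + (0 + s) *\<^sub>R v) - F (a + 0 *\<^sub>R v)) / s) \<longlongrightarrow> G a \<bullet> v) (at 0)"
        unfolding DERIV_def .
      then have "((\<lambda>s. (F (a + s *\<^sub>R v) - F a) / s) \<longlongrightarrow> G a \<bullet> v) (at 0)" by simp
      then show ?thesis by (rule tendsto_within_subset) simp
    qed
    have lim2: "((\<lambda>s. (M + \<kappa>' * s) * Z) \<longlongrightarrow> (M + \<kappa>' * 0) * Z) (at_right 0)" by (intro tendsto_intros)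
    have "G a \<bullet> v \<le> (M + \<kappa>' * 0) * Z"
    proof (rule tendsto_le[OF _ lim2 lim])
      show "\<forall>\<^sub>F s in at_right 0. (F (a + s *\<^sub>R v) - F a) / s \<le> (M + \<kappa>' * s) * Z"
        using eventually_at_right_less[of "0 :: real"]
      proof (rule eventually_mono)
        fix s :: real assume s: "0 < s"
        have "(F (a + s *\<^sub>R v) - F a) / s \<le> ((s * M + \<kappa>' * s\<^sup>2) * Z) / s"
          using Fs[of s] s by (intro divide_right_mono) auto
        also have "\<dots> = (M + \<kappa>' * s) * Z" using s by (simp add: field_simps power2_eq_square)
        finally show "(F (a + s *\<^sub>R v) - F a) / s \<le> (M + \<kappa>' * s) * Z" .
      qed
    qed simp
    then have "inverse Z * (G a \<bullet> v) \<le> inverse Z * (M * Z)" using Z by (intro mult_left_mono) auto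
    also have "\<dots> = M" using Z by simp
    finally show "(G (rep_torus (tproj a)) /\<^sub>R Z) \<bullet> v \<le> M" by (simp add: rep)
  qed
qed

section \<open>Calibrated curves as limits of discrete chains\<close>

text \<open>
  Chains whose velocities vary slowly converge together with their velocities, so the limit curve
  is \<open>C\<^sup>1\<close> without any regularity theory.
\<close>

lemma difference_chain_limit:
  fixes Y W :: "nat \<Rightarrow> int \<Rightarrow> 'a::euclidean_space"
  assumes \<tau>: "\<And>n. \<tau> n > 0" "\<tau> \<longlonglongrightarrow> 0"
    and step: "\<And>n k. Y n (k + 1) = Y n k + \<tau> n *\<^sub>R W n k"
    and R: "\<And>n k. norm (W n k) \<le> R"
    and M: "M \<ge> 0" "\<And>n k. norm (W n (k + 1) - W n k) \<le> M * \<tau> n"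
  obtains r y w where "strict_mono (r :: nat \<Rightarrow> nat)"
    "\<And>t. (\<lambda>n. Y (r n) \<lfloor>t / \<tau> (r n)\<rfloor> - Y (r n) 0) \<longlonglongrightarrow> y t"
    "\<And>t. (\<lambda>n. W (r n) \<lfloor>t / \<tau> (r n)\<rfloor>) \<longlonglongrightarrow> w t"
    "\<And>t. (y has_vector_derivative w t) (at t)" "continuous_on UNIV w"
proof -
  have R0: "R \<ge> 0" using R[of 0 0] norm_ge_zero order_trans by blast
  have Wm: "norm (W n (j + int m) - W n j) \<le> real m * (M * \<tau> n)" for n j m
  proof (induction m)
    case (Suc m)
    have "norm (W n (j + int (Suc m)) - W n j) \<le> norm (W n (j + int m + 1) - W n (j + int m)) + norm (W n (j + int m) - W n j)"
      using norm_triangle_ineq[of "W n (j + int m + 1) - W n (j + int m)" "W n (j + int m) - W n j"] by (simp add: add_ac)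
    also have "\<dots> \<le> M * \<tau> n + real m * (M * \<tau> n)" by (intro add_mono M(2) Suc.IH)
    finally show ?case by (simp add: algebra_simps)
  qed simp
  \<comment> \<open>Discrete Taylor formula: with velocities drifting by at most
    \<open>M * \<tau> n\<close> per step, the motion deviates only quadratically from a uniform one.
    The induction rests on \<open>m^2 + m \<le> (m + 1)^2\<close>.\<close>
  have Ym: "norm (Y n (j + int m) - Y n j - (real m * \<tau> n) *\<^sub>R W n j) \<le> M * (real m * \<tau> n)\<^sup>2" for n j m
  proof (induction m)
    case (Suc m)
    have "Y n (j + int (Suc m)) = Y n (j + int m) + \<tau> n *\<^sub>R W n (j + int m)"
      using step[of n "j + int m"] by (simp add: add_ac)
    then have "Y n (j + int (Suc m)) - Y n j - (real (Suc m) * \<tau> n) *\<^sub>R W n j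
        = (Y n (j + int m) - Y n j - (real m * \<tau> n) *\<^sub>R W n j) + \<tau> n *\<^sub>R (W n (j + int m) - W n j)"
      by (simp add: algebra_simps)
    also have "norm \<dots> \<le> M * (real m * \<tau> n)\<^sup>2 + \<tau> n * (real m * (M * \<tau> n))"
      using Wm[of n j m] \<tau>(1)[of n] by (intro order_trans[OF norm_triangle_ineq] add_mono Suc.IH) simp
    also have "\<dots> = M * (\<tau> n)\<^sup>2 * ((real m)\<^sup>2 + real m)" by (simp add: algebra_simps power2_eq_square)
    also have "\<dots> \<le> M * (\<tau> n)\<^sup>2 * (real (Suc m))\<^sup>2"
      using M(1) by (intro mult_left_mono) (simp_all add: algebra_simps power2_eq_square)
    also have "\<dots> = M * (real (Suc m) * \<tau> n)\<^sup>2" by (simp add: power_mult_distrib mult_ac)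
    finally show ?case .
  qed simp
  have Yb: "norm (Y n (j + int m) - Y n j) \<le> real m * \<tau> n * R" for n j m
  proof (induction m)
    case (Suc m)
    have "Y n (j + int (Suc m)) - Y n j = (Y n (j + int m) - Y n j) + \<tau> n *\<^sub>R W n (j + int m)"
      using step[of n "j + int m"] by (simp add: add_ac)
    also have "norm \<dots> \<le> real m * \<tau> n * R + \<tau> n * R"
      using R[of n "j + int m"] \<tau>(1)[of n] by (intro order_trans[OF norm_triangle_ineq] add_mono Suc.IH) simp
    finally show ?case by (simp add: algebra_simps)
  qed simp
  \<comment> \<open>Number of the step at time \<open>t\<close>, negative times included;
    \<open>m n s t\<close> counts the steps between two times, which matches the elapsed time up to
    one step.\<close>
  define k where "k n t = \<lfloor>t / \<tau> n\<rfloor>" for n t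
  define m where "m n s t = nat (k n t - k n s)" for n s t
  have km: "k n t = k n s + int (m n s t)" if "s \<le> t" for n s t
  proof -
    have "s / \<tau> n \<le> t / \<tau> n" using that \<tau>(1)[of n] by (intro divide_right_mono) auto
    then have "k n s \<le> k n t" unfolding k_def by (rule floor_mono)
    then show ?thesis by (simp add: m_def)
  qed
  have mt: "\<bar>real (m n s t) * \<tau> n - (t - s)\<bar> \<le> \<tau> n" if "s \<le> t" for n s t
  proof -
    have "real (m n s t) = of_int (k n t) - of_int (k n s)" using km[OF that, of n] by simp
    then have "\<bar>real (m n s t) - (t / \<tau> n - s / \<tau> n)\<bar> \<le> 1" unfolding k_def by linarith
    then have "\<bar>real (m n s t) - (t / \<tau> n - s / \<tau> n)\<bar> * \<tau> n \<le> 1 * \<tau> n"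
      using \<tau>(1)[of n] by (intro mult_right_mono) auto
    moreover have "\<bar>real (m n s t) - (t / \<tau> n - s / \<tau> n)\<bar> * \<tau> n = \<bar>(real (m n s t) - (t / \<tau> n - s / \<tau> n)) * \<tau> n\<bar>"
      using \<tau>(1)[of n] by (simp add: abs_mult)
    moreover have "(real (m n s t) - (t / \<tau> n - s / \<tau> n)) * \<tau> n = real (m n s t) * \<tau> n - (t - s)"
      using \<tau>(1)[of n] by (simp add: field_simps)
    ultimately show ?thesis by simp
  qed
  \<comment> \<open>Positions and velocities are extracted together, so that the limit of the
    velocities is available as the candidate derivative.\<close>
  define f where "f n t = (Y n (k n t) - Y n 0, W n (k n t))" for n t
  have half: "norm (f n t - f n s) \<le> (R + M) * (norm (t - s) + \<tau> n)" if st: "s \<le> t" for n s t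
  proof -
    have mts: "real (m n s t) * \<tau> n \<le> (t - s) + \<tau> n" using mt[OF st, of n] by (simp add: abs_le_iff)
    have "norm (f n t - f n s) \<le> norm (Y n (k n t) - Y n (k n s)) + norm (W n (k n t) - W n (k n s))"
      using norm_Pair_le[of "Y n (k n t) - Y n (k n s)" "W n (k n t) - W n (k n s)"] by (simp add: f_def)
    also have "\<dots> \<le> real (m n s t) * \<tau> n * R + real (m n s t) * (M * \<tau> n)"
      unfolding km[OF st] by (intro add_mono Yb Wm)
    also have "\<dots> = (R + M) * (real (m n s t) * \<tau> n)" by (simp add: algebra_simps)
    also have "\<dots> \<le> (R + M) * (norm (t - s) + \<tau> n)"
      using mts st R0 M(1) by (intro mult_left_mono) auto
    finally show ?thesis .
  qed
  have lip: "norm (f n t - f n s) \<le> (R + M) * (norm (t - s) + \<tau> n)" for n s t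
    using half[of s t n] half[of t s n] by (cases "s \<le> t") (auto simp: norm_minus_commute abs_minus_commute)
  have bd: "norm (f n 0) \<le> R" for n using R[of n 0] by (simp add: f_def k_def norm_Pair)
  have RM: "R + M \<ge> 0" using R0 M(1) by simp
  obtain r g where r: "strict_mono (r :: nat \<Rightarrow> nat)"
    and cc: "\<And>s a. s \<longlonglongrightarrow> a \<Longrightarrow> (\<lambda>n. f (r n) (s n)) \<longlonglongrightarrow> g a"
    and glip: "\<And>a b. norm (g a - g b) \<le> (R + M) * norm (a - b)"
    using almost_lipschitz_subsequence[OF lip \<tau>(2) RM bd] by blast
  define y where "y t = fst (g t)" for t
  define w where "w t = snd (g t)" for t
  have ylim: "(\<lambda>n. Y (r n) (k (r n) t) - Y (r n) 0) \<longlonglongrightarrow> y t" for t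
    using tendsto_fst[OF cc[OF tendsto_const[of t]]] by (simp add: f_def y_def)
  have wlim: "(\<lambda>n. W (r n) (k (r n) t)) \<longlonglongrightarrow> w t" for t
    using tendsto_snd[OF cc[OF tendsto_const[of t]]] by (simp add: f_def w_def)
  have \<tau>r: "(\<lambda>n. \<tau> (r n)) \<longlonglongrightarrow> 0" using LIMSEQ_subseq_LIMSEQ[OF \<tau>(2) r] by (simp add: o_def)
  have mlim: "(\<lambda>n. real (m (r n) s t) * \<tau> (r n)) \<longlonglongrightarrow> t - s" if "s \<le> t" for s t
  proof -
    have "(\<lambda>n. real (m (r n) s t) * \<tau> (r n) - (t - s)) \<longlonglongrightarrow> 0"
      by (rule Lim_null_comparison[OF _ \<tau>r]) (use mt[OF that] in simp)
    then show ?thesis by (rule LIM_zero_cancel)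
  qed
  have fwd: "norm (y t - y s - (t - s) *\<^sub>R w s) \<le> M * (t - s)\<^sup>2" if st: "s \<le> t" for s t
  proof (rule LIMSEQ_le)
    show "(\<lambda>n. norm ((Y (r n) (k (r n) t) - Y (r n) 0) - (Y (r n) (k (r n) s) - Y (r n) 0)
        - (real (m (r n) s t) * \<tau> (r n)) *\<^sub>R W (r n) (k (r n) s))) \<longlonglongrightarrow> norm (y t - y s - (t - s) *\<^sub>R w s)"
      by (intro tendsto_intros ylim wlim mlim[OF st])
    show "(\<lambda>n. M * (real (m (r n) s t) * \<tau> (r n))\<^sup>2) \<longlonglongrightarrow> M * (t - s)\<^sup>2"
      by (intro tendsto_intros mlim[OF st])
    show "\<exists>N. \<forall>n\<ge>N. norm ((Y (r n) (k (r n) t) - Y (r n) 0) - (Y (r n) (k (r n) s) - Y (r n) 0)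
        - (real (m (r n) s t) * \<tau> (r n)) *\<^sub>R W (r n) (k (r n) s)) \<le> M * (real (m (r n) s t) * \<tau> (r n))\<^sup>2"
      using Ym by (simp add: km[OF st])
  qed
  have wM: "norm (w t - w s) \<le> M * (t - s)" if st: "s \<le> t" for s t
  proof (rule LIMSEQ_le)
    show "(\<lambda>n. norm (W (r n) (k (r n) t) - W (r n) (k (r n) s))) \<longlonglongrightarrow> norm (w t - w s)"
      by (intro tendsto_intros wlim)
    show "(\<lambda>n. M * (real (m (r n) s t) * \<tau> (r n))) \<longlonglongrightarrow> M * (t - s)"
      by (intro tendsto_intros mlim[OF st])
    have "norm (W n (k n t) - W n (k n s)) \<le> M * (real (m n s t) * \<tau> n)" for n
      using Wm[of n "k n s" "m n s t"] by (simp add: km[OF st] mult_ac)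
    then show "\<exists>N. \<forall>n\<ge>N. norm (W (r n) (k (r n) t) - W (r n) (k (r n) s)) \<le> M * (real (m (r n) s t) * \<tau> (r n))"
      by blast
  qed
  \<comment> \<open>For \<open>t < s\<close> the expansion at \<open>t\<close> is read backwards and
    the velocity is moved from \<open>t\<close> to \<open>s\<close>, which doubles the constant.
    Both sides are required for a two-sided derivative.\<close>
  have est: "norm (y t - y s - (t - s) *\<^sub>R w s) \<le> 2 * M * (t - s)\<^sup>2" for s t
  proof (cases "s \<le> t")
    case True
    have "M * (t - s)\<^sup>2 \<le> 2 * M * (t - s)\<^sup>2" using M(1) by simp
    then show ?thesis using fwd[OF True] by linarith
  next
    case False
    then have ts: "t \<le> s" by simp
    have "y t - y s - (t - s) *\<^sub>R w s = - (y s - y t - (s - t) *\<^sub>R w t) + (s - t) *\<^sub>R (w s - w t)"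
      by (simp add: algebra_simps)
    also have "norm \<dots> \<le> M * (s - t)\<^sup>2 + (s - t) * (M * (s - t))"
    proof (rule order_trans[OF norm_triangle_ineq add_mono])
      show "norm (- (y s - y t - (s - t) *\<^sub>R w t)) \<le> M * (s - t)\<^sup>2"
        unfolding norm_minus_cancel by (rule fwd[OF ts])
      show "norm ((s - t) *\<^sub>R (w s - w t)) \<le> (s - t) * (M * (s - t))"
        using wM[OF ts] ts by (simp add: mult_left_mono)
    qed
    also have "\<dots> = 2 * M * (t - s)\<^sup>2" by (simp add: power2_eq_square algebra_simps)
    finally show ?thesis .
  qed
  show ?thesis
  proof (rule that[OF r, of y w])
    show "(\<lambda>n. Y (r n) \<lfloor>t / \<tau> (r n)\<rfloor> - Y (r n) 0) \<longlonglongrightarrow> y t" for t using ylim[of t] by (simp add: k_def)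
    show "(\<lambda>n. W (r n) \<lfloor>t / \<tau> (r n)\<rfloor>) \<longlonglongrightarrow> w t" for t using wlim[of t] by (simp add: k_def)
    show "(y has_vector_derivative w t) (at t)" for t
      unfolding has_vector_derivative_def has_derivative_at_alt
    proof (intro conjI allI impI)
      show "bounded_linear (\<lambda>x. x *\<^sub>R w t)" by (rule bounded_linear_scaleR_left)
      fix e :: real assume e: "e > 0"
      show "\<exists>d>0. \<forall>s. norm (s - t) < d \<longrightarrow> norm (y s - y t - (s - t) *\<^sub>R w t) \<le> e * norm (s - t)"
      proof (intro exI[of _ "e / (2 * M + 1)"] conjI allI impI)
        show "0 < e / (2 * M + 1)" using e M(1) by simp
        fix s assume s: "norm (s - t) < e / (2 * M + 1)"
        then have "(2 * M + 1) * \<bar>s - t\<bar> \<le> e" using M(1) by (simp add: field_simps)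
        moreover have "2 * M * \<bar>s - t\<bar> \<le> (2 * M + 1) * \<bar>s - t\<bar>" by (intro mult_right_mono) auto
        ultimately have le: "2 * M * \<bar>s - t\<bar> \<le> e" by linarith
        have "norm (y s - y t - (s - t) *\<^sub>R w t) \<le> 2 * M * \<bar>s - t\<bar> * \<bar>s - t\<bar>"
          using est[of s t] by (simp add: power2_eq_square mult.assoc)
        also have "\<dots> \<le> e * \<bar>s - t\<bar>" using le by (intro mult_right_mono) auto
        finally show "norm (y s - y t - (s - t) *\<^sub>R w t) \<le> e * norm (s - t)" by simp
      qed
    qed
    have "continuous_on UNIV g"
      by (rule lipschitz_on_continuous_on[of "R + M"], rule lipschitz_onI) (use glip RM in \<open>auto simp: dist_norm\<close>)
    then show "continuous_on UNIV w" unfolding w_def[abs_def] by (intro continuous_intros)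
  qed
qed

section \<open>Velocities of curves and bi-infinite chains\<close>

lemma has_velocity_unique:
  assumes "has_velocity \<gamma> v t" "has_velocity \<gamma> w t"
  shows "v = w"
proof -
  obtain g1 where g1: "\<And>s. tproj (g1 s) = \<gamma> s" "(g1 has_vector_derivative v) (at t)"
    using assms(1) unfolding has_velocity_def by blast
  obtain g2 where g2: "\<And>s. tproj (g2 s) = \<gamma> s" "(g2 has_vector_derivative w) (at t)"
    using assms(2) unfolding has_velocity_def by blast
  define \<delta> where "\<delta> s = g1 s - g2 s" for s
  have iv: "int_vec (\<delta> s)" for s using g1(1)[of s] g2(1)[of s] tproj_eq_int_vec by (metis \<delta>_def)
  have d: "(\<delta> has_vector_derivative (v - w)) (at t)"
    unfolding \<delta>_def[abs_def] by (intro has_vector_derivative_diff g1 g2)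
  have "isCont \<delta> t" using has_vector_derivative_continuous[OF d] by (simp add: continuous_at)
  then obtain e where e: "e > 0" "\<And>s. dist s t < e \<Longrightarrow> dist (\<delta> s) (\<delta> t) < 1"
    unfolding continuous_at_eps_delta by (metis zero_less_one)
  have const: "\<delta> s = \<delta> t" if "dist s t < e" for s
  proof -
    have "(\<delta> s - \<delta> t) $ k = 0" for k
    proof -
      have "\<bar>(\<delta> s - \<delta> t) $ k\<bar> < 1"
        using component_le_norm_cart[of "\<delta> s - \<delta> t" k] e(2)[OF that] by (simp add: dist_norm)
      moreover have "(\<delta> s - \<delta> t) $ k \<in> \<int>" using int_vec_diff[OF iv iv] by (simp add: int_vec_def)
      ultimately show ?thesis by (rule Ints_nonzero_abs_less1[rotated])
    qed
    then show ?thesis by (simp add: vec_eq_iff)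
  qed
  have "((\<lambda>_. \<delta> t) has_vector_derivative (v - w)) (at t)"
    by (rule has_vector_derivative_transform_within[OF d e(1)]) (use const in auto)
  then have "v - w = 0" using vector_derivative_unique_at has_vector_derivative_const by blast
  then show ?thesis by simp
qed

text \<open>Chosen successors are iterated from \<open>b\<close> for indices from 1 on, chosen
  predecessors from \<open>a\<close> for indices up to 0; the given pair is the seam.\<close>

lemma bi_infinite_chain:
  assumes succ: "\<And>a b. Q a b \<Longrightarrow> \<exists>e. Q b e" and pred: "\<And>a b. Q a b \<Longrightarrow> \<exists>e. Q e a" and ab: "Q a b"
  shows "\<exists>x :: int \<Rightarrow> 'a. (\<forall>k. Q (x k) (x (k + 1))) \<and> x 0 = a \<and> x 1 = b"
proof -
  define S where "S b = (SOME e. Q b e)" for b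
  define P where "P a = (SOME e. Q e a)" for a
  have S: "Q b (S b)" if "Q a b" for a b unfolding S_def by (rule someI_ex[OF succ[OF that]])
  have P: "Q (P a) a" if "Q a b" for a b unfolding P_def by (rule someI_ex[OF pred[OF that]])
  define F where "F n = (S ^^ n) b" for n
  define B where "B n = (P ^^ n) a" for n
  define x where "x k = (if k \<ge> 1 then F (nat (k - 1)) else B (nat (- k)))" for k :: int
  have F: "\<exists>e. Q e (F n)" for n by (induction n) (use ab S in \<open>auto simp: F_def\<close>)
  have B: "\<exists>e. Q (B n) e" for n by (induction n) (use ab P in \<open>auto simp: B_def\<close>)
  have "Q (x k) (x (k + 1))" for k
  proof -
    consider "k \<ge> 1" | "k = 0" | "k < 0" by linarith
    then show ?thesis
    proof cases
      case 1
      then have "nat (k + 1 - 1) = Suc (nat (k - 1))" by simp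
      then have "x (k + 1) = S (x k)" using 1 by (simp add: x_def F_def)
      moreover obtain e where "Q e (x k)" using F[of "nat (k - 1)"] 1 by (auto simp: x_def)
      ultimately show ?thesis using S by metis
    next
      case 2
      then show ?thesis using ab by (simp add: x_def F_def B_def)
    next
      case 3
      then have "nat (- k) = Suc (nat (- (k + 1)))" by simp
      then have "x k = P (x (k + 1))" using 3 by (simp add: x_def B_def)
      moreover obtain e where "Q (x (k + 1)) e" using B[of "nat (- (k + 1))"] 3 by (auto simp: x_def)
      ultimately show ?thesis using P by metis
    qed
  qed
  moreover have "x 0 = a" "x 1 = b" by (simp_all add: x_def F_def B_def)
  ultimately show ?thesis by blast
qed

lemma discrete_mather_chain:
  fixes L :: "'d::finite torus \<Rightarrow> real ^ 'd \<Rightarrow> real"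
  assumes N: "N \<ge> 1" and \<tau>: "\<tau> > 0" and wk: "weak_kam_grid L N \<tau> c U"
    and m: "discrete_mather_measure L N \<tau> \<mu>"
    and ij: "i \<in> grid_index N" "j \<in> grid_index N" and pos: "\<mu> i j l > 0"
  shows "\<exists>x :: int \<Rightarrow> real ^ 'd. (\<forall>k. x k \<in> grid N) \<and> (\<forall>k. calibrated_step L \<tau> c U (x k) (x (k + 1))) \<and>
    x 0 = grid_point N i \<and> x 1 = grid_point N j + lattice_vec l"
proof -
  have h: "holonomic N \<mu>" using m by (simp add: discrete_mather_measure_def)
  \<comment> \<open>Charged edges, translated by arbitrary lattice vectors. The translation is
    essential: the next edge starts at the representative of \<open>j\<close> in the unit cube and
    has to be moved to the lifted endpoint of the previous one.\<close>
  define Q where "Q a b \<longleftrightarrow> (\<exists>i\<in>grid_index N. \<exists>j\<in>grid_index N. \<exists>l z. \<mu> i j l > 0 \<and>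
    a = grid_point N i + lattice_vec z \<and> b = grid_point N j + lattice_vec l + lattice_vec z)" for a b :: "real ^ 'd"
  have lv: "lattice_vec l + lattice_vec z = lattice_vec (l + z)" "lattice_vec z - lattice_vec l = lattice_vec (z - l)" for l z :: "int ^ 'd"
    by (simp_all add: vec_eq_iff)
  have "\<exists>e. Q b e" if Qab: "Q a b" for a b
  proof -
    obtain i j l z where q: "i \<in> grid_index N" "j \<in> grid_index N" "\<mu> i j l > 0"
      "b = grid_point N j + lattice_vec l + lattice_vec z" using Qab unfolding Q_def by blast
    obtain k n where "k \<in> grid_index N" "\<mu> j k n > 0" using holonomic_successor(1)[OF h q(1-3)] by blast
    moreover have "b = grid_point N j + lattice_vec (l + z)" using q(4) by (simp only: add.assoc lv)
    ultimately show ?thesis using q(2) unfolding Q_def by blast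
  qed
  moreover have "\<exists>e. Q e a" if Qab: "Q a b" for a b
  proof -
    obtain i j l z where q: "i \<in> grid_index N" "j \<in> grid_index N" "\<mu> i j l > 0"
      "a = grid_point N i + lattice_vec z" using Qab unfolding Q_def by blast
    obtain k n where "k \<in> grid_index N" "\<mu> k i n > 0" using holonomic_successor(2)[OF h q(1-3)] by blast
    moreover have "a = grid_point N i + lattice_vec n + lattice_vec (z - n)"
      using q(4) by (simp add: vec_eq_iff)
    ultimately show ?thesis using q(1) unfolding Q_def by blast
  qed
  moreover have "Q (grid_point N i) (grid_point N j + lattice_vec l)"
    unfolding Q_def by (intro bexI[of _ i] bexI[of _ j] exI[of _ l] exI[of _ 0] conjI pos ij) (simp_all add: vec_eq_iff)
  ultimately obtain x :: "int \<Rightarrow> real ^ 'd" where x: "\<And>k. Q (x k) (x (k + 1))" "x 0 = grid_point N i" "x 1 = grid_point N j + lattice_vec l"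
    using bi_infinite_chain[of Q "grid_point N i" "grid_point N j + lattice_vec l"] by blast
  have Qc: "a \<in> grid N \<and> calibrated_step L \<tau> c U a b" if Qab: "Q a b" for a b
  proof -
    obtain i j l z where q: "i \<in> grid_index N" "j \<in> grid_index N" "\<mu> i j l > 0"
      "a = grid_point N i + lattice_vec z" "b = grid_point N j + lattice_vec l + lattice_vec z"
      using Qab unfolding Q_def by blast
    have "b - a = grid_point N j + lattice_vec l - grid_point N i" by (simp add: q)
    then have v: "(b - a) /\<^sub>R \<tau> = discrete_velocity N \<tau> i j l" by (simp only: discrete_velocity_eq)
    have t: "tproj a = tproj (grid_point N i)" unfolding q(4) by (rule tproj_add_int_vec[OF int_vec_lattice_vec])
    have "U a = U (grid_point N i)" unfolding q(4) by (rule weak_kam_grid_periodic[OF wk int_vec_lattice_vec])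
    moreover have "U b = U (grid_point N j)"
      unfolding q(5) using weak_kam_grid_periodic[OF wk int_vec_lattice_vec] by metis
    ultimately have "calibrated_step L \<tau> c U a b"
      using discrete_mather_calibrated[OF N \<tau> wk m q(1-3)] by (simp add: calibrated_step_def v t)
    moreover have "a \<in> grid N" unfolding q(4) by (intro grid_add grid_point_grid N int_vec_grid int_vec_lattice_vec)
    ultimately show ?thesis by simp
  qed
  show ?thesis using x Qc by blast
qed

context tonelli_lift
begin

lemma L_lipschitz_torus:
  "\<exists>K\<ge>0. \<forall>x y v w. norm v \<le> R \<longrightarrow> norm w \<le> R \<longrightarrow> \<bar>L x v - L y w\<bar> \<le> K * (dist x y + norm (v - w))"
proof -
  obtain K where K: "K \<ge> 0" "\<And>a b v w. norm v \<le> R \<Longrightarrow> norm w \<le> R \<Longrightarrow>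
     \<bar>L (tproj a) v - L (tproj b) w\<bar> \<le> K * (norm (a - b) + norm (v - w))"
    using L_lipschitz[of R] by meson
  have "\<bar>L x v - L y w\<bar> \<le> K * (dist x y + norm (v - w))" if "norm v \<le> R" "norm w \<le> R" for x y v w
    using dist_torus_lift[of x y] K(2)[OF that] by metis
  then show ?thesis using K(1) by blast
qed

lemma L_tendsto:
  assumes "x \<longlonglongrightarrow> x'" "v \<longlonglongrightarrow> v'"
  shows "(\<lambda>n. L (x n) (v n)) \<longlonglongrightarrow> L x' v'"
proof -
  obtain R where R: "\<And>n. norm (v n) \<le> R"
    using convergent_imp_bounded[OF assms(2)] unfolding bounded_iff by auto
  have R': "norm v' \<le> R" by (rule LIMSEQ_le_const2[OF tendsto_norm[OF assms(2)]]) (use R in blast)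
  obtain K where K: "K \<ge> 0" "\<And>x y v w. norm v \<le> R \<Longrightarrow> norm w \<le> R \<Longrightarrow> \<bar>L x v - L y w\<bar> \<le> K * (dist x y + norm (v - w))"
    using L_lipschitz_torus[of R] by meson
  have "(\<lambda>n. K * (dist (x n) x' + norm (v n - v'))) \<longlonglongrightarrow> K * (dist x' x' + norm (v' - v'))"
    by (intro tendsto_intros assms)
  then have "(\<lambda>n. K * (dist (x n) x' + norm (v n - v'))) \<longlonglongrightarrow> 0" by simp
  then have "(\<lambda>n. L (x n) (v n) - L x' v') \<longlonglongrightarrow> 0"
    by (rule Lim_null_comparison[rotated]) (use K(2)[OF R R'] in simp)
  then show ?thesis by (rule LIM_zero_cancel)
qed

text \<open>The derivative of \<open>u\<close> along the curve is prescribed pointwise, so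
  calibration is the fundamental theorem of calculus. Uniqueness of velocities identifies the
  \<open>velocity\<close> in the definition with \<open>V\<close>.\<close>

lemma calibrated_C1_curve:
  assumes g: "\<And>t. (g has_vector_derivative V t) (at t)" and cV: "continuous_on UNIV V"
    and R: "\<And>t. norm (V t) \<le> R"
    and du: "\<And>t. ((\<lambda>t. u (tproj (g t))) has_real_derivative (L (tproj (g t)) (V t) + c)) (at t)"
  shows "calibrated u L c (\<lambda>t. tproj (g t))" "has_velocity (\<lambda>t. tproj (g t)) (V t) t"
proof -
  have hv: "has_velocity (\<lambda>t. tproj (g t)) (V t) t" for t
    unfolding has_velocity_def using g by blast
  then show "has_velocity (\<lambda>t. tproj (g t)) (V t) t" .
  have vel: "velocity (\<lambda>t. tproj (g t)) t = V t" for t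
    unfolding velocity_def by (rule the_equality) (use hv has_velocity_unique in blast)+
  have R0: "R \<ge> 0" using R[of 0] norm_ge_zero order_trans by blast
  have glip: "dist (tproj (g s)) (tproj (g t)) \<le> R * \<bar>t - s\<bar>" for s t
  proof -
    have "norm (g s - g t) \<le> R * norm (s - t)"
    proof (rule differentiable_bound[of UNIV g "\<lambda>t x. x *\<^sub>R V t"])
      fix x show "(g has_derivative (\<lambda>h. h *\<^sub>R V x)) (at x within UNIV)"
        using g[of x] by (simp add: has_vector_derivative_def)
      show "onorm (\<lambda>h. h *\<^sub>R V x) \<le> R"
        by (rule onorm_bound[OF R0]) (use R[of x] in \<open>auto simp: mult.commute[of R] intro: mult_left_mono\<close>)
    qed auto
    then show ?thesis using dist_torus_le[of "g s" "g t"] by (simp add: dist_norm abs_minus_commute)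
  qed
  have gcont: "continuous_on UNIV g"
    using g has_vector_derivative_continuous by (metis continuous_at_imp_continuous_on)
  have Lcont: "continuous_on UNIV (\<lambda>t. L (tproj (g t)) (V t))"
  proof (rule continuous_on_sequentiallyI)
    fix s :: "nat \<Rightarrow> real" and t assume s: "s \<longlonglongrightarrow> t"
    have "(\<lambda>n. g (s n)) \<longlonglongrightarrow> g t" "(\<lambda>n. V (s n)) \<longlonglongrightarrow> V t"
      by (rule continuous_on_tendsto_compose[OF gcont s] continuous_on_tendsto_compose[OF cV s]; simp)+
    then show "(\<lambda>n. L (tproj (g (s n))) (V (s n))) \<longlonglongrightarrow> L (tproj (g t)) (V t)"
      by (intro L_tendsto tproj_tendsto)
  qed
  show "calibrated u L c (\<lambda>t. tproj (g t))"
    unfolding calibrated_def vel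
  proof (intro allI impI conjI)
    fix a b :: real assume ab: "a \<le> b"
    show "abs_cont_on a b (\<lambda>t. tproj (g t))"
      unfolding abs_cont_on_def
    proof (intro allI impI)
      fix e :: real assume e: "e > 0"
      show "\<exists>\<delta>>0. \<forall>(m::nat) s t. (\<forall>k<m. a \<le> s k \<and> s k \<le> t k \<and> t k \<le> b) \<and> (\<forall>k. Suc k < m \<longrightarrow> t k \<le> s (Suc k)) \<and>
        (\<Sum>k<m. t k - s k) < \<delta> \<longrightarrow> (\<Sum>k<m. dist (tproj (g (s k))) (tproj (g (t k)))) < e"
      proof (intro exI[of _ "e / (R + 1)"] conjI allI impI)
        show "0 < e / (R + 1)" using e R0 by simp
        fix m :: nat and s t :: "nat \<Rightarrow> real"
        assume *: "(\<forall>k<m. a \<le> s k \<and> s k \<le> t k \<and> t k \<le> b) \<and> (\<forall>k. Suc k < m \<longrightarrow> t k \<le> s (Suc k)) \<and>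
          (\<Sum>k<m. t k - s k) < e / (R + 1)"
        have "(\<Sum>k<m. dist (tproj (g (s k))) (tproj (g (t k)))) \<le> (\<Sum>k<m. R * (t k - s k))"
        proof (rule sum_mono)
          fix k assume "k \<in> {..<m}"
          then show "dist (tproj (g (s k))) (tproj (g (t k))) \<le> R * (t k - s k)"
            using glip[of "s k" "t k"] * by auto
        qed
        also have "\<dots> = R * (\<Sum>k<m. t k - s k)" by (simp add: sum_distrib_left)
        also have "\<dots> \<le> R * (e / (R + 1))" using * R0 by (intro mult_left_mono) auto
        also have "\<dots> < e" using e R0 by (simp add: field_simps)
        finally show "(\<Sum>k<m. dist (tproj (g (s k))) (tproj (g (t k)))) < e" .
      qed
    qed
    have cab: "continuous_on {a..b} (\<lambda>t. L (tproj (g t)) (V t))" using Lcont continuous_on_subset by blast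
    then show "(\<lambda>s. L (tproj (g s)) (V s)) absolutely_integrable_on {a..b}"
      by (rule absolutely_integrable_continuous_real)
    have "((\<lambda>t. L (tproj (g t)) (V t) + c) has_integral (u (tproj (g b)) - u (tproj (g a)))) {a..b}"
      by (rule fundamental_theorem_of_calculus[OF ab])
        (use du in \<open>auto simp flip: has_real_derivative_iff_has_vector_derivative intro: has_field_derivative_at_within\<close>)
    moreover have "((\<lambda>t. L (tproj (g t)) (V t) + c) has_integral (integral {a..b} (\<lambda>t. L (tproj (g t)) (V t)) + c * (b - a))) {a..b}"
      using has_integral_add[OF integrable_integral[OF integrable_continuous_real[OF cab]] has_integral_const_real[of c a b]] ab
      by (simp add: mult.commute)
    ultimately show "u (tproj (g b)) - u (tproj (g a)) = integral {a..b} (\<lambda>t. L (tproj (g t)) (V t)) + c * (b - a)"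
      by (rule has_integral_unique)
  qed
qed

end

context weak_kam_limit
begin

text \<open>The pair of a chain point and its value of \<open>U\<close> is itself a chain whose
  velocity, the pair of \<open>v\<close> and the Lagrangian plus \<open>c\<close>, varies slowly.
  Its limit is C^1: the first component is the curve, while the second is \<open>u\<close> along the
  curve up to a constant, with derivative the limit Lagrangian plus \<alpha>.\<close>

lemma calibrated_chain_limit:
  assumes grid: "\<And>n k. x n k \<in> grid (N n)"
    and cal: "\<And>n k. calibrated_step L (\<tau> n) (c n) (U n) (x n k) (x n (k + 1 :: int))"
    and x0: "(\<lambda>n. x n 0) \<longlonglongrightarrow> a0" and v0: "(\<lambda>n. (x n 1 - x n 0) /\<^sub>R \<tau> n) \<longlonglongrightarrow> v0"
  shows "\<exists>\<gamma>. calibrated u L \<alpha> \<gamma> \<and> \<gamma> 0 = tproj a0 \<and> has_velocity \<gamma> v0 0"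
proof -
  obtain R where R: "R > 0" "\<And>N \<tau> c U a b. N \<ge> 1 \<Longrightarrow> \<tau> > 0 \<Longrightarrow> 1 / real N \<le> \<tau> \<Longrightarrow> weak_kam_grid L N \<tau> c U \<Longrightarrow>
     a \<in> grid N \<Longrightarrow> b \<in> grid N \<Longrightarrow> calibrated_step L \<tau> c U a b \<Longrightarrow> norm ((b - a) /\<^sub>R \<tau>) \<le> R"
    using calibrated_step_bounded by blast
  obtain M where M: "M \<ge> 0" "\<And>N \<tau> c U a b e. N \<ge> 1 \<Longrightarrow> \<tau> > 0 \<Longrightarrow> \<tau> \<le> 1 \<Longrightarrow> 1 / real N \<le> \<tau> \<Longrightarrow> 1 / real N \<le> C * \<tau>\<^sup>2 \<Longrightarrow>
     weak_kam_grid L N \<tau> c U \<Longrightarrow> a \<in> grid N \<Longrightarrow> b \<in> grid N \<Longrightarrow> e \<in> grid N \<Longrightarrow>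
     calibrated_step L \<tau> c U a b \<Longrightarrow> calibrated_step L \<tau> c U b e \<Longrightarrow>
       norm ((b - a) /\<^sub>R \<tau> - (e - b) /\<^sub>R \<tau>) \<le> M * \<tau>"
    using calibrated_velocity_lipschitz[OF C] by blast
  obtain B where B: "B \<ge> 0" "\<And>x v. norm v \<le> R \<Longrightarrow> \<bar>L x v\<bar> \<le> B" using L_bounded[of R] by blast
  obtain Bc where Bc: "Bc \<ge> 0" "\<And>N \<tau> c U. N \<ge> 1 \<Longrightarrow> \<tau> > 0 \<Longrightarrow> weak_kam_grid L N \<tau> c U \<Longrightarrow> \<bar>c\<bar> \<le> Bc"
    using weak_kam_constant_bounded by blast
  obtain KL where KL: "KL \<ge> 0" "\<And>a b v w. norm v \<le> R \<Longrightarrow> norm w \<le> R \<Longrightarrow>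
     \<bar>L (tproj a) v - L (tproj b) w\<bar> \<le> KL * (norm (a - b) + norm (v - w))"
    using L_lipschitz[of R] by meson
  define v where "v n k = (x n (k + 1) - x n k) /\<^sub>R \<tau> n" for n k
  define \<ll> where "\<ll> n k = L (tproj (x n k)) (v n k) + c n" for n k
  have vR: "norm (v n k) \<le> R" for n k
    unfolding v_def by (rule R(2)[OF N \<tau>_pos mesh wk grid grid cal])
  have vM: "norm (v n (k + 1) - v n k) \<le> M * \<tau> n" for n k
    using M(2)[OF N \<tau>_pos \<tau>_le_1 mesh mesh2 wk grid grid grid cal[of n k] cal[of n "k + 1"]]
    unfolding v_def by (subst norm_minus_commute)
  have xs: "x n (k + 1) = x n k + \<tau> n *\<^sub>R v n k" for n k using \<tau>_pos[of n] by (simp add: v_def)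
  have Us: "U n (x n (k + 1)) = U n (x n k) + \<tau> n * \<ll> n k" for n k
    using cal[of n k] by (simp add: calibrated_step_def \<ll>_def v_def)
  have lb: "\<bar>\<ll> n k\<bar> \<le> B + Bc" for n k
    using B(2)[OF vR, of "tproj (x n k)" n k] Bc(2)[OF N \<tau>_pos wk, of n] by (simp add: \<ll>_def abs_le_iff)
  have lM: "\<bar>\<ll> n (k + 1) - \<ll> n k\<bar> \<le> KL * (R + M) * \<tau> n" for n k
  proof -
    have "\<bar>\<ll> n (k + 1) - \<ll> n k\<bar> \<le> KL * (norm (x n (k + 1) - x n k) + norm (v n (k + 1) - v n k))"
      using KL(2)[OF vR vR, of "x n (k + 1)" n "k + 1" "x n k" n k] by (simp add: \<ll>_def)
    also have "\<dots> \<le> KL * (\<tau> n * R + M * \<tau> n)"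
      using vR[of n k] vM[of n k] \<tau>_pos[of n] KL(1) by (intro mult_left_mono add_mono) (simp_all add: xs)
    finally show ?thesis by (simp add: algebra_simps)
  qed
  define Y where "Y n k = (x n k, U n (x n k))" for n k
  define W where "W n k = (v n k, \<ll> n k)" for n k
  have "Y n (k + 1) = Y n k + \<tau> n *\<^sub>R W n k" for n k by (simp add: Y_def W_def xs[symmetric] Us)
  moreover have "norm (W n k) \<le> R + (B + Bc)" for n k
    using norm_Pair_le[of "v n k" "\<ll> n k"] vR[of n k] lb[of n k] by (simp add: W_def)
  moreover have "norm (W n (k + 1) - W n k) \<le> (M + KL * (R + M)) * \<tau> n" for n k
    using norm_Pair_le[of "v n (k + 1) - v n k" "\<ll> n (k + 1) - \<ll> n k"] vM[of n k] lM[of n k]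
    by (simp add: W_def distrib_right)
  moreover have "0 \<le> M + KL * (R + M)" using M(1) KL(1) R(1) by simp
  ultimately obtain r y w where r: "strict_mono (r :: nat \<Rightarrow> nat)"
    and y: "\<And>t. (\<lambda>n. Y (r n) \<lfloor>t / \<tau> (r n)\<rfloor> - Y (r n) 0) \<longlonglongrightarrow> y t"
    and w: "\<And>t. (\<lambda>n. W (r n) \<lfloor>t / \<tau> (r n)\<rfloor>) \<longlonglongrightarrow> w t"
    and yw: "\<And>t. (y has_vector_derivative w t) (at t)" and cw: "continuous_on UNIV w"
    using difference_chain_limit[of \<tau> Y W "R + (B + Bc)" "M + KL * (R + M)"] \<tau>_pos \<tau>_lim by blast
  define g where "g t = a0 + fst (y t)" for t
  define V where "V t = fst (w t)" for t
  have x0r: "(\<lambda>n. x (r n) 0) \<longlonglongrightarrow> a0" using LIMSEQ_subseq_LIMSEQ[OF x0 r] by (simp add: o_def)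
  have glim: "(\<lambda>n. x (r n) \<lfloor>t / \<tau> (r n)\<rfloor>) \<longlonglongrightarrow> g t" for t
    using tendsto_add[OF x0r tendsto_fst[OF y[of t]]] by (simp add: Y_def g_def)
  have Vlim: "(\<lambda>n. v (r n) \<lfloor>t / \<tau> (r n)\<rfloor>) \<longlonglongrightarrow> V t" for t
    using tendsto_fst[OF w[of t]] by (simp add: W_def V_def)
  have cr: "(\<lambda>n. c (r n)) \<longlonglongrightarrow> \<alpha>" using LIMSEQ_subseq_LIMSEQ[OF c_lim r] by (simp add: o_def)
  have ell: "snd (w t) = L (tproj (g t)) (V t) + \<alpha>" for t
  proof (rule LIMSEQ_unique)
    show "(\<lambda>n. \<ll> (r n) \<lfloor>t / \<tau> (r n)\<rfloor>) \<longlonglongrightarrow> snd (w t)"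
      using tendsto_snd[OF w[of t]] by (simp add: W_def)
    show "(\<lambda>n. \<ll> (r n) \<lfloor>t / \<tau> (r n)\<rfloor>) \<longlonglongrightarrow> L (tproj (g t)) (V t) + \<alpha>"
      unfolding \<ll>_def by (intro tendsto_add cr L_tendsto tproj_tendsto glim Vlim)
  qed
  \<comment> \<open>The chain points move with \<open>n\<close> and are available only along
    \<open>r\<close>, hence continuous convergence along a subsequence; rounding does not change
    points of the grid.\<close>
  have Ug: "(\<lambda>n. U (r n) (x (r n) \<lfloor>t / \<tau> (r n)\<rfloor>) - U (r n) (round_down (N (r n)) 0)) \<longlonglongrightarrow> u (tproj (g t))" for t
  proof -
    have "(\<lambda>n. U (r n) (round_down (N (r n)) (x (r n) \<lfloor>t / \<tau> (r n)\<rfloor>)) - U (r n) (round_down (N (r n)) 0)) \<longlonglongrightarrow> u (tproj (g t))"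
      by (rule continuous_convergence_subseq[where F = "\<lambda>n a. U n (round_down (N n) a) - U n (round_down (N n) 0)",
            OF _ r glim[of t]]) (rule U_lim)
    then show ?thesis by (simp only: round_down_of_grid[OF N grid])
  qed
  have yu: "snd (y t) = u (tproj (g t)) - u (tproj (g 0))" for t
  proof (rule LIMSEQ_unique)
    show "(\<lambda>n. U (r n) (x (r n) \<lfloor>t / \<tau> (r n)\<rfloor>) - U (r n) (x (r n) 0)) \<longlonglongrightarrow> snd (y t)"
      using tendsto_snd[OF y[of t]] by (simp add: Y_def)
    show "(\<lambda>n. U (r n) (x (r n) \<lfloor>t / \<tau> (r n)\<rfloor>) - U (r n) (x (r n) 0)) \<longlonglongrightarrow> u (tproj (g t)) - u (tproj (g 0))"
      using tendsto_diff[OF Ug[of t] Ug[of 0]] by simp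
  qed
  have d1: "(g has_vector_derivative V t) (at t)" for t
    unfolding g_def[abs_def] V_def
    using has_vector_derivative_add[OF has_vector_derivative_const bounded_linear.has_vector_derivative[OF bounded_linear_fst yw[of t]]]
    by simp
  have d2: "((\<lambda>t. u (tproj (g t))) has_real_derivative (L (tproj (g t)) (V t) + \<alpha>)) (at t)" for t
  proof -
    have "((\<lambda>t. snd (y t)) has_vector_derivative snd (w t)) (at t)"
      by (rule bounded_linear.has_vector_derivative[OF bounded_linear_snd yw])
    then have "((\<lambda>t. u (tproj (g t)) - u (tproj (g 0))) has_real_derivative (L (tproj (g t)) (V t) + \<alpha>)) (at t)"
      by (simp add: has_real_derivative_iff_has_vector_derivative yu ell)
    from DERIV_add[OF this DERIV_const[of "u (tproj (g 0))"]] show ?thesis by simp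
  qed
  have VR: "norm (V t) \<le> R" for t
    by (rule LIMSEQ_le_const2[OF tendsto_norm[OF Vlim[of t]]]) (use vR in blast)
  have cV: "continuous_on UNIV V" unfolding V_def[abs_def] by (intro continuous_intros cw)
  have "(\<lambda>n. x (r n) 0) \<longlonglongrightarrow> g 0" using glim[of 0] by simp
  then have g0: "g 0 = a0" using x0r LIMSEQ_unique by blast
  have "(\<lambda>n. v (r n) 0) \<longlonglongrightarrow> v0" using LIMSEQ_subseq_LIMSEQ[OF v0 r] by (simp add: o_def v_def)
  moreover have "(\<lambda>n. v (r n) 0) \<longlonglongrightarrow> V 0" using Vlim[of 0] by simp
  ultimately have "V 0 = v0" using LIMSEQ_unique by blast
  then show ?thesis
    using calibrated_C1_curve[OF d1 cV VR d2] g0 by (intro exI[of _ "\<lambda>t. tproj (g t)"]) metis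
qed

end

section \<open>Weak limits of discrete Mather measures\<close>

context weak_kam_limit
begin

text \<open>Averaging the subsolution estimate over nearby base points keeps it up to the variation
  of the Lagrangian in the position, which is uniform only for bounded velocities. Large velocities
  are covered by the Lipschitz constant of \<open>u\<close> together with superlinearity.\<close>

lemma approximate_subsolution:
  assumes e: "e > 0"
  obtains \<phi> D\<phi> where "C1_gradient \<phi> D\<phi>" "\<And>x v. v \<bullet> D\<phi> x \<le> L x v + \<alpha> + e"
proof -
  obtain K where K: "K \<ge> 0" "\<And>a b. \<bar>u (tproj a) - u (tproj b)\<bar> \<le> K * norm (a - b)"
    using u_lipschitz by blast
  have K1: "K + 1 > 0" using K(1) by simp
  obtain A where A: "\<And>x v. L x v \<ge> (K + 1) * norm v - A" using L_superlinear[OF K1] by blast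
  \<comment> \<open>For speeds above this radius the slope \<open>K + 1\<close> leaves the surplus
    \<open>norm v - A\<close>, which is at least \<open>- \<alpha>\<close>; hence
    \<open>K * norm v \<le> L x v + \<alpha>\<close>.\<close>
  define R where "R = max 0 (A - \<alpha>)"
  obtain KL where KL: "KL \<ge> 0" "\<And>a b v w. norm v \<le> R \<Longrightarrow> norm w \<le> R \<Longrightarrow>
     \<bar>L (tproj a) v - L (tproj b) w\<bar> \<le> KL * (norm (a - b) + norm (v - w))"
    using L_lipschitz[of R] by meson
  define \<epsilon> where "\<epsilon> = e / (KL + 1)"
  have \<epsilon>: "\<epsilon> > 0" using e KL(1) by (simp add: \<epsilon>_def)
  have KLe: "KL * \<epsilon> \<le> e"
  proof -
    have "KL * \<epsilon> \<le> (KL + 1) * \<epsilon>" using \<epsilon> by simp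
    also have "\<dots> = e" using KL(1) by (simp add: \<epsilon>_def)
    finally show ?thesis .
  qed
  obtain \<phi> D\<phi> where \<phi>: "C1_gradient \<phi> D\<phi>"
    "\<And>a v M \<kappa>. (\<And>y s. norm y \<le> \<epsilon> \<Longrightarrow> 0 \<le> s \<Longrightarrow>
        u (tproj (a + y + s *\<^sub>R v)) - u (tproj (a + y)) \<le> s * M + \<kappa> * s\<^sup>2) \<Longrightarrow> D\<phi> (tproj a) \<bullet> v \<le> M"
    using mollification[of u K \<epsilon>, OF K(2) \<epsilon>] by blast
  have "v \<bullet> D\<phi> x \<le> L x v + \<alpha> + e" for x v
  proof -
    obtain a where a: "tproj a = x" using tproj_surj by blast
    have "D\<phi> (tproj a) \<bullet> v \<le> L x v + \<alpha> + e"
    proof (cases "norm v \<le> R")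
      case True
      obtain \<kappa> where \<kappa>: "\<And>b s. s \<ge> 0 \<Longrightarrow>
         u (tproj (b + s *\<^sub>R v)) - u (tproj b) \<le> s * (L (tproj b) v + \<alpha>) + \<kappa> * s\<^sup>2"
        using subsolution_estimate[of v] by blast
      show ?thesis
      proof (rule \<phi>(2)[where \<kappa> = \<kappa>])
        fix y :: "real ^ 'd" and s :: real assume y: "norm y \<le> \<epsilon>" and s: "0 \<le> s"
        have "L (tproj (a + y)) v \<le> L x v + KL * norm y"
          using KL(2)[OF True True, of "a + y" a] a by (simp add: abs_le_iff)
        also have "\<dots> \<le> L x v + e"
          using mult_left_mono[OF y KL(1)] KLe by simp
        finally have "s * (L (tproj (a + y)) v + \<alpha>) \<le> s * (L x v + \<alpha> + e)"
          using s by (intro mult_left_mono) auto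
        then show "u (tproj (a + y + s *\<^sub>R v)) - u (tproj (a + y)) \<le> s * (L x v + \<alpha> + e) + \<kappa> * s\<^sup>2"
          using \<kappa>[OF s, of "a + y"] by linarith
      qed
    next
      case False
      have "D\<phi> (tproj a) \<bullet> v \<le> K * norm v"
      proof (rule \<phi>(2)[where \<kappa> = 0])
        fix y :: "real ^ 'd" and s :: real assume s: "0 \<le> s"
        show "u (tproj (a + y + s *\<^sub>R v)) - u (tproj (a + y)) \<le> s * (K * norm v) + 0 * s\<^sup>2"
          using K(2)[of "a + y + s *\<^sub>R v" "a + y"] s by (simp add: abs_le_iff mult_ac)
      qed
      moreover have "(K + 1) * norm v = K * norm v + norm v" by (simp add: algebra_simps)
      moreover have "A - \<alpha> \<le> norm v" using False by (simp add: R_def)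
      ultimately show ?thesis using A[of v x] e by linarith
    qed
    then show ?thesis by (simp add: a inner_commute)
  qed
  with \<phi>(1) show ?thesis by (rule that)
qed

text \<open>Integrating the approximate subsolution inequality against a closed measure annihilates
  its left-hand side, and the error is arbitrary. A nonintegrable Lagrangian has action
  \<infinity>.\<close>

lemma closed_measure_action_ge:
  assumes \<nu>: "closed_measure \<nu>"
  shows "ereal (- \<alpha>) \<le> action L \<nu>"
proof (cases "integrable \<nu> (\<lambda>(x, v). L x v)")
  case True
  interpret prob_space \<nu> using \<nu> by (simp add: closed_measure_def)
  have "- \<alpha> \<le> (\<integral>(x, v). L x v \<partial>\<nu>)"
  proof (rule field_le_epsilon)
    fix e :: real assume "e > 0"
    then obtain \<phi> D\<phi> where \<phi>: "C1_gradient \<phi> D\<phi>" "\<And>x v. v \<bullet> D\<phi> x \<le> L x v + \<alpha> + e"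
      using approximate_subsolution by blast
    have h: "has_bochner_integral \<nu> (\<lambda>(x, v). v \<bullet> D\<phi> x) 0" using \<nu> \<phi>(1) by (simp add: closed_measure_def)
    then have i: "integrable \<nu> (\<lambda>(x, v). v \<bullet> D\<phi> x)" and z: "(\<integral>(x, v). v \<bullet> D\<phi> x \<partial>\<nu>) = 0"
      by (simp_all add: has_bochner_integral_iff)
    have "0 \<le> (\<integral>z. (case z of (x, v) \<Rightarrow> L x v) + (\<alpha> + e) \<partial>\<nu>)"
      unfolding z[symmetric]
      by (rule integral_mono) (use i True \<phi>(2) in \<open>auto simp: add.assoc[symmetric]\<close>)
    also have "\<dots> = (\<integral>(x, v). L x v \<partial>\<nu>) + (\<alpha> + e)"
      using True by (simp add: prob_space)
    finally show "- \<alpha> \<le> (\<integral>(x, v). L x v \<partial>\<nu>) + e" by linarith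
  qed
  then show ?thesis using True by (simp add: action_def)
qed (simp add: action_def)

end


text \<open>Compactness of the torus makes the gradient uniformly continuous, so the first-order
  expansion is uniform in the base point. The discrete measures need this, since their base points
  vary with the mesh.\<close>

lemma C1_gradient_uniform:
  assumes C1: "C1_gradient \<phi> D\<phi>" and e: "e > 0"
  shows "\<exists>d>0. \<forall>a w. norm w < d \<longrightarrow> \<bar>\<phi> (tproj (a + w)) - \<phi> (tproj a) - D\<phi> (tproj a) \<bullet> w\<bar> \<le> e * norm w"
proof -
  have der: "((\<lambda>b. \<phi> (tproj b)) has_derivative (\<lambda>w. D\<phi> (tproj a) \<bullet> w)) (at a)" for a
    using C1 by (simp add: C1_gradient_def)
  have "uniformly_continuous_on UNIV D\<phi>"
    using C1 compact_torus by (intro compact_uniformly_continuous) (auto simp: C1_gradient_def)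
  then obtain d where d: "d > 0" "\<And>x y. dist x y < d \<Longrightarrow> dist (D\<phi> x) (D\<phi> y) < e"
    using e unfolding uniformly_continuous_on_def by (metis UNIV_I)
  have "\<bar>\<phi> (tproj (a + w)) - \<phi> (tproj a) - D\<phi> (tproj a) \<bullet> w\<bar> \<le> e * norm w" if w: "norm w < d" for a w
  proof -
    define F where "F b = \<phi> (tproj b) - D\<phi> (tproj a) \<bullet> b" for b
    have "norm (F (a + w) - F a) \<le> e * norm ((a + w) - a)"
    proof (rule differentiable_bound[of "ball a d" F "\<lambda>b h. D\<phi> (tproj b) \<bullet> h - D\<phi> (tproj a) \<bullet> h"])
      fix b assume b: "b \<in> ball a d"
      have "(F has_derivative (\<lambda>h. D\<phi> (tproj b) \<bullet> h - D\<phi> (tproj a) \<bullet> h)) (at b)"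
        unfolding F_def[abs_def]
        by (intro has_derivative_diff der bounded_linear_imp_has_derivative bounded_linear_inner_right)
      then show "(F has_derivative (\<lambda>h. D\<phi> (tproj b) \<bullet> h - D\<phi> (tproj a) \<bullet> h)) (at b within ball a d)"
        by (rule has_derivative_at_withinI)
      have "dist (tproj b) (tproj a) < d" using b dist_torus_le[of b a] by (simp add: dist_commute)
      then have ne: "norm (D\<phi> (tproj b) - D\<phi> (tproj a)) \<le> e" using d(2) by (metis dist_norm less_imp_le)
      show "onorm (\<lambda>h. D\<phi> (tproj b) \<bullet> h - D\<phi> (tproj a) \<bullet> h) \<le> e"
      proof (rule onorm_bound)
        fix h
        have "norm (D\<phi> (tproj b) \<bullet> h - D\<phi> (tproj a) \<bullet> h) \<le> norm (D\<phi> (tproj b) - D\<phi> (tproj a)) * norm h"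
          by (simp only: inner_diff_left[symmetric] real_norm_def Cauchy_Schwarz_ineq2)
        also have "\<dots> \<le> e * norm h" using ne by (intro mult_right_mono) auto
        finally show "norm (D\<phi> (tproj b) \<bullet> h - D\<phi> (tproj a) \<bullet> h) \<le> e * norm h" .
      qed (use e in simp)
    qed (use w d(1) in \<open>auto simp: dist_norm\<close>)
    then show ?thesis by (simp add: F_def inner_add_right algebra_simps)
  qed
  then show ?thesis using d(1) by blast
qed

text \<open>Bridge from families with sums over infinitely many edges to probability mass functions,
  where integrals are finite sums and the weak limit theorem applies.\<close>

lemma finitely_supported_pmf:
  fixes w :: "'e \<Rightarrow> real"
  assumes fin: "finite F" and F: "F \<subseteq> A" and out: "\<And>e. e \<in> A \<Longrightarrow> e \<notin> F \<Longrightarrow> w e = 0" and pos: "\<And>e. e \<in> F \<Longrightarrow> w e > 0"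
    and one: "(w has_sum 1) A"
  obtains p where "set_pmf p = F"
    "\<And>g S. ((\<lambda>e. g e * w e) has_sum S) A \<Longrightarrow> (\<integral>e. g e \<partial>measure_pmf p) = S"
proof -
  define W where "W e = (if e \<in> F then w e else 0)" for e
  have restrict: "((\<lambda>e. g e * w e) has_sum S) A \<Longrightarrow> S = (\<Sum>e\<in>F. g e * w e)" for g and S :: real
  proof -
    assume "((\<lambda>e. g e * w e) has_sum S) A"
    then have "((\<lambda>e. g e * w e) has_sum S) F"
      by (subst has_sum_cong_neutral[of A F]) (use F out in auto)
    then show ?thesis using has_sum_finite[OF fin] has_sum_unique by blast
  qed
  have sum1: "(\<Sum>e\<in>F. w e) = 1" using restrict[of "\<lambda>_. 1" 1] one by simp
  have W0: "W e \<ge> 0" for e using pos by (auto simp: W_def less_imp_le)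
  have "(\<integral>\<^sup>+e. ennreal (W e) \<partial>count_space UNIV) = (\<Sum>e\<in>F. ennreal (W e))"
    by (rule nn_integral_count_space'[OF fin]) (auto simp: W_def)
  also have "\<dots> = ennreal (\<Sum>e\<in>F. W e)" using W0 by (simp add: sum_ennreal)
  also have "\<dots> = 1" using sum1 by (simp add: W_def)
  finally have nn: "(\<integral>\<^sup>+e. ennreal (W e) \<partial>count_space UNIV) = 1" .
  define p where "p = embed_pmf W"
  have pmf: "pmf p e = W e" for e unfolding p_def by (rule pmf_embed_pmf[OF W0 nn])
  have set: "set_pmf p = F" using pos by (auto simp: set_pmf_eq pmf W_def) (metis less_irrefl)
  have "(\<integral>e. g e \<partial>measure_pmf p) = S" if "((\<lambda>e. g e * w e) has_sum S) A" for g S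
  proof -
    have "(\<integral>e. g e \<partial>measure_pmf p) = (\<Sum>e\<in>F. g e * pmf p e)"
      by (rule integral_measure_pmf_real[OF fin]) (simp add: set)
    also have "\<dots> = S" using restrict[OF that] by (simp add: pmf W_def)
    finally show ?thesis .
  qed
  with set show ?thesis by (rule that)
qed

context weak_kam_limit
begin

text \<open>Charged edges are calibrated, so their speeds have a common bound. This confines the
  measures to a fixed compact set, makes their supports finite and renders continuous integrands
  admissible, the Lagrangian included: the discrete actions are exactly \<open>- c n\<close>, so the
  limit action is \<open>- \<alpha>\<close>. The second conclusion is the lower bound for open sets
  in weak convergence, reduced to the existence of a charged edge.\<close>

lemma discrete_mather_weak_limit:
  assumes m: "\<And>n. discrete_mather_measure L (N n) (\<tau> n) (\<mu> n)"
  obtains \<mu>0 where "mather_measure L \<mu>0"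
    "\<And>O'. open O' \<Longrightarrow> emeasure \<mu>0 O' > 0 \<Longrightarrow> \<exists>n. \<exists>i\<in>grid_index (N n). \<exists>j\<in>grid_index (N n). \<exists>l. \<mu> n i j l > 0 \<and>
      (tproj (grid_point (N n) i), discrete_velocity (N n) (\<tau> n) i j l) \<in> O'"
proof -
  obtain R where R: "R > 0" "\<And>N \<tau> c U a b. N \<ge> 1 \<Longrightarrow> \<tau> > 0 \<Longrightarrow> 1 / real N \<le> \<tau> \<Longrightarrow> weak_kam_grid L N \<tau> c U \<Longrightarrow>
     a \<in> grid N \<Longrightarrow> b \<in> grid N \<Longrightarrow> calibrated_step L \<tau> c U a b \<Longrightarrow> norm ((b - a) /\<^sub>R \<tau>) \<le> R"
    using calibrated_step_bounded by blast
  define A where "A n = (edges (N n) :: ((nat ^ 'd) \<times> (nat ^ 'd) \<times> (int ^ 'd)) set)" for n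
  define w where "w n = (\<lambda>(i :: nat ^ 'd, j, l). \<mu> n i j l)" for n
  define X where "X n = (\<lambda>(i :: nat ^ 'd, j :: nat ^ 'd, l :: int ^ 'd). tproj (grid_point (N n) i) :: 'd torus)" for n
  define V where "V n = (\<lambda>(i :: nat ^ 'd, j, l). discrete_velocity (N n) (\<tau> n) i j l)" for n
  have h: "holonomic (N n) (\<mu> n)" for n using m by (simp add: discrete_mather_measure_def)
  have V: "norm (V n e) \<le> R" if "e \<in> A n" "w n e > 0" for n e
  proof -
    obtain i j l where e: "e = (i, j, l)" by (metis surj_pair)
    have ij: "i \<in> grid_index (N n)" "j \<in> grid_index (N n)" "\<mu> n i j l > 0" using that by (auto simp: e A_def w_def)
    obtain x where x: "\<And>k. x k \<in> grid (N n)" "\<And>k. calibrated_step L (\<tau> n) (c n) (U n) (x k) (x (k + 1 :: int))"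
      "x 0 = grid_point (N n) i" "x 1 = grid_point (N n) j + lattice_vec l"
      using discrete_mather_chain[OF N \<tau>_pos wk m ij] by blast
    have "norm ((x (0 + 1) - x 0) /\<^sub>R \<tau> n) \<le> R" by (rule R(2)[OF N \<tau>_pos mesh wk x(1) x(1) x(2)])
    then show ?thesis by (simp add: e V_def discrete_velocity_eq x)
  qed
  define F where "F n = {e \<in> A n. w n e > 0}" for n
  have fin: "finite (F n)" for n
  proof -
    define D where "D i j = {l :: int ^ 'd. norm (lattice_vec l + (grid_point (N n) j - grid_point (N n) i)) \<le> \<tau> n * R}" for i j
    have "F n \<subseteq> (\<Union>i\<in>grid_index (N n). \<Union>j\<in>grid_index (N n). (\<lambda>l. (i, j, l)) ` D i j)"
    proof
      fix e assume eF: "e \<in> F n"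
      obtain i j l where e: "e = (i, j, l)" by (metis surj_pair)
      have "norm (V n e) \<le> R" using V eF by (simp add: F_def)
      then have "norm (grid_point (N n) j + lattice_vec l - grid_point (N n) i) \<le> \<tau> n * R"
      proof -
        have "V n e = (grid_point (N n) j + lattice_vec l - grid_point (N n) i) /\<^sub>R \<tau> n"
          unfolding e V_def case_prod_conv by (rule discrete_velocity_eq)
        then have "norm (V n e) = norm (grid_point (N n) j + lattice_vec l - grid_point (N n) i) / \<tau> n"
          using \<tau>_pos[of n] by (simp only: norm_scaleR) (simp add: divide_inverse_commute)
        then show ?thesis using \<open>norm (V n e) \<le> R\<close> \<tau>_pos[of n] by (simp add: pos_divide_le_eq mult.commute)
      qed
      then have "l \<in> D i j" by (simp add: D_def algebra_simps)
      then show "e \<in> (\<Union>i\<in>grid_index (N n). \<Union>j\<in>grid_index (N n). (\<lambda>l. (i, j, l)) ` D i j)"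
        using eF by (auto simp: e F_def A_def)
    qed
    moreover have "finite (\<Union>i\<in>grid_index (N n). \<Union>j\<in>grid_index (N n). (\<lambda>l. (i, j, l)) ` D i j)"
      unfolding D_def by (intro finite_UN_I finite_grid_index finite_imageI finite_lattice_ball)
    ultimately show ?thesis by (rule finite_subset)
  qed
  have "\<exists>p. set_pmf p = F n \<and> (\<forall>g S. ((\<lambda>e. g e * w n e) has_sum S) (A n) \<longrightarrow> (\<integral>e. g e \<partial>measure_pmf p) = S)" for n
  proof (rule finitely_supported_pmf[OF fin[of n], of "A n" "w n"])
    show "F n \<subseteq> A n" by (auto simp: F_def)
    show "w n e = 0" if "e \<in> A n" "e \<notin> F n" for e
      using that holonomic_nonneg[OF h] by (auto simp: F_def A_def w_def intro: antisym)
    show "w n e > 0" if "e \<in> F n" for e using that by (simp add: F_def)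
    show "(w n has_sum 1) (A n)" using h[of n] by (simp add: holonomic_def A_def w_def)
  qed blast
  then obtain p where p: "\<And>n. set_pmf (p n) = F n"
    "\<And>n g S. ((\<lambda>e. g e * w n e) has_sum S) (A n) \<Longrightarrow> (\<integral>e. g e \<partial>measure_pmf (p n)) = S" by metis
  obtain \<Phi> :: "real \<Rightarrow> 'd torus \<times> (real ^ 'd)" and K where \<Phi>: "continuous_on UNIV \<Phi>" "compact K" "range \<Phi> \<subseteq> K"
    "\<And>x v. norm v \<le> R \<Longrightarrow> (x, v) \<in> \<Phi> ` {0..1}"
    using phase_space_curve[OF R(1)] by blast
  have f\<Phi>: "(X n e, V n e) \<in> \<Phi> ` {0..1}" if "e \<in> set_pmf (p n)" for n e
    using that by (intro \<Phi>(4) V) (auto simp: p F_def)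
  obtain r \<mu>0 where r: "strict_mono (r :: nat \<Rightarrow> nat)" and prob: "prob_space \<mu>0" and sets: "sets \<mu>0 = sets borel"
    and int: "\<And>g :: _ \<Rightarrow> real. continuous_on UNIV g \<Longrightarrow> integrable \<mu>0 g"
    and lim: "\<And>g :: _ \<Rightarrow> real. continuous_on UNIV g \<Longrightarrow>
       (\<lambda>n. \<integral>e. g (X (r n) e, V (r n) e) \<partial>measure_pmf (p (r n))) \<longlonglongrightarrow> (\<integral>z. g z \<partial>\<mu>0)"
    using pmf_weak_limit[of \<Phi> K p "\<lambda>n e. (X n e, V n e)", OF \<Phi>(1-3) f\<Phi>] by blast
  have \<tau>r: "(\<lambda>n. \<tau> (r n)) \<longlonglongrightarrow> 0" using LIMSEQ_subseq_LIMSEQ[OF \<tau>_lim r] by (simp add: o_def)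
  have finmeas: "integrable (measure_pmf (p n)) g" for n and g :: "_ \<Rightarrow> real"
    by (rule integrable_measure_pmf_finite) (simp add: p fin)
  have closed: "closed_measure \<mu>0"
    unfolding closed_measure_def
  proof (intro conjI sets prob allI impI)
    fix \<phi> :: "'d torus \<Rightarrow> real" and D\<phi> assume C1: "C1_gradient \<phi> D\<phi>"
    define g where "g = (\<lambda>(x, v). v \<bullet> D\<phi> x)"
    have cg: "continuous_on UNIV g"
      unfolding g_def case_prod_unfold using C1
      by (intro continuous_on_inner continuous_on_snd continuous_on_id continuous_on_compose2[of UNIV D\<phi> _ fst] continuous_on_fst)
        (auto simp: C1_gradient_def)
    \<comment> \<open>The discrete difference quotient has mean exactly 0 by holonomy and differs
      from the integrand \<open>v \<bullet> D\<phi> x\<close> by a uniformly small amount on charged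
      edges.\<close>
    define Dq where "Dq n = (\<lambda>(i, j, l :: int ^ 'd). (\<phi> (tproj (grid_point (N n) j)) - \<phi> (tproj (grid_point (N n) i))) / \<tau> n)" for n
    have zero: "(\<integral>e. Dq n e \<partial>measure_pmf (p n)) = 0" for n
    proof (rule p(2))
      obtain S where S: "((\<lambda>(i, j, l). \<phi> (tproj (grid_point (N n) i)) / \<tau> n * \<mu> n i j l) has_sum S) (edges (N n))"
        "((\<lambda>(i, j, l). \<phi> (tproj (grid_point (N n) j)) / \<tau> n * \<mu> n i j l) has_sum S) (edges (N n))"
        using holonomic_flow[OF h[of n], of "\<lambda>i. \<phi> (tproj (grid_point (N n) i)) / \<tau> n"] by blast
      have "((\<lambda>e. (case e of (i, j, l) \<Rightarrow> \<phi> (tproj (grid_point (N n) j)) / \<tau> n * \<mu> n i j l)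
         + (- 1) * (case e of (i, j, l) \<Rightarrow> \<phi> (tproj (grid_point (N n) i)) / \<tau> n * \<mu> n i j l)) has_sum (S + (- 1) * S)) (edges (N n))"
        by (intro has_sum_add has_sum_cmult_right S)
      moreover have "(\<lambda>e. (case e of (i, j, l) \<Rightarrow> \<phi> (tproj (grid_point (N n) j)) / \<tau> n * \<mu> n i j l)
         + (- 1) * (case e of (i, j, l) \<Rightarrow> \<phi> (tproj (grid_point (N n) i)) / \<tau> n * \<mu> n i j l)) = (\<lambda>e. Dq n e * w n e)"
        by (auto simp: Dq_def w_def diff_divide_distrib left_diff_distrib)
      ultimately show "((\<lambda>e. Dq n e * w n e) has_sum 0) (A n)" by (simp add: A_def)
    qed
    have "(\<lambda>n. \<integral>e. g (X (r n) e, V (r n) e) \<partial>measure_pmf (p (r n))) \<longlonglongrightarrow> 0"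
    proof (rule LIMSEQ_I)
      fix e :: real assume e: "e > 0"
      define e' where "e' = e / (2 * R)"
      have e': "e' > 0" using e R(1) by (simp add: e'_def)
      obtain d where d: "d > 0" "\<And>a w. norm w < d \<Longrightarrow> \<bar>\<phi> (tproj (a + w)) - \<phi> (tproj a) - D\<phi> (tproj a) \<bullet> w\<bar> \<le> e' * norm w"
        using C1_gradient_uniform[OF C1 e'] by blast
      have "\<forall>\<^sub>F n in sequentially. \<tau> (r n) < d / R" using order_tendstoD(2)[OF \<tau>r] d(1) R(1) by simp
      then obtain M where M: "\<And>n. n \<ge> M \<Longrightarrow> \<tau> (r n) < d / R" unfolding eventually_sequentially by blast
      have "norm ((\<integral>e. g (X (r n) e, V (r n) e) \<partial>measure_pmf (p (r n))) - 0) < e" if n: "n \<ge> M" for n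
      proof -
        have pt: "\<bar>g (X (r n) e, V (r n) e) - Dq (r n) e\<bar> \<le> e' * R" if eF: "e \<in> F (r n)" for e
        proof -
          obtain i j l where ijl: "e = (i, j, l)" by (metis surj_pair)
          define v where "v = discrete_velocity (N (r n)) (\<tau> (r n)) i j l"
          define a where "a = (grid_point (N (r n)) i :: real ^ 'd)"
          have v: "norm v \<le> R" using V[of e "r n"] eF by (simp add: F_def ijl V_def v_def)
          have \<tau>p: "\<tau> (r n) > 0" by (rule \<tau>_pos)
          have end': "a + \<tau> (r n) *\<^sub>R v = grid_point (N (r n)) j + lattice_vec l"
            using \<tau>p by (simp add: a_def v_def discrete_velocity_eq)
          have t: "tproj (a + \<tau> (r n) *\<^sub>R v) = tproj (grid_point (N (r n)) j)"
            unfolding end' by (rule tproj_add_int_vec[OF int_vec_lattice_vec])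
          have "norm (\<tau> (r n) *\<^sub>R v) \<le> \<tau> (r n) * R" using v \<tau>p by simp
          also have "\<dots> < d" using M[OF n] R(1) by (simp add: pos_less_divide_eq)
          finally have "\<bar>\<phi> (tproj (a + \<tau> (r n) *\<^sub>R v)) - \<phi> (tproj a) - D\<phi> (tproj a) \<bullet> (\<tau> (r n) *\<^sub>R v)\<bar> \<le> e' * norm (\<tau> (r n) *\<^sub>R v)"
            by (rule d(2))
          also have "\<dots> \<le> \<tau> (r n) * (e' * R)" using v \<tau>p e' by simp
          finally have le: "\<bar>\<phi> (tproj (grid_point (N (r n)) j)) - \<phi> (tproj a) - D\<phi> (tproj a) \<bullet> (\<tau> (r n) *\<^sub>R v)\<bar>
              \<le> \<tau> (r n) * (e' * R)" unfolding t .
          have "\<tau> (r n) * Dq (r n) e = \<phi> (tproj (grid_point (N (r n)) j)) - \<phi> (tproj a)"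
            using \<tau>p by (simp add: ijl Dq_def a_def)
          moreover have "g (X (r n) e, V (r n) e) = D\<phi> (tproj a) \<bullet> v"
            by (simp add: ijl g_def X_def V_def a_def v_def inner_commute)
          ultimately have "\<tau> (r n) * (Dq (r n) e - g (X (r n) e, V (r n) e))
              = \<phi> (tproj (grid_point (N (r n)) j)) - \<phi> (tproj a) - D\<phi> (tproj a) \<bullet> (\<tau> (r n) *\<^sub>R v)"
            by (simp add: right_diff_distrib)
          with le have "\<bar>\<tau> (r n) * (Dq (r n) e - g (X (r n) e, V (r n) e))\<bar> \<le> \<tau> (r n) * (e' * R)" by simp
          then have "\<bar>Dq (r n) e - g (X (r n) e, V (r n) e)\<bar> \<le> e' * R"
            using \<tau>p by (simp add: abs_mult)
          then show ?thesis by (simp add: abs_minus_commute)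
        qed
        have "(\<integral>e. g (X (r n) e, V (r n) e) \<partial>measure_pmf (p (r n)))
            = (\<integral>e. g (X (r n) e, V (r n) e) - Dq (r n) e \<partial>measure_pmf (p (r n)))"
          using zero[of "r n"] by (subst Bochner_Integration.integral_diff) (auto intro: finmeas)
        also have "\<bar>\<dots>\<bar> \<le> (\<integral>e. e' * R \<partial>measure_pmf (p (r n)))"
        proof (rule order_trans[OF integral_abs_bound], rule integral_mono_AE)
          show "AE e in measure_pmf (p (r n)). \<bar>g (X (r n) e, V (r n) e) - Dq (r n) e\<bar> \<le> e' * R"
            unfolding AE_measure_pmf_iff p using pt by blast
        qed (rule finmeas)+
        also have "\<dots> = e / 2" using R(1) by (simp add: e'_def)
        also have "\<dots> < e" using e by simp
        finally show ?thesis by simp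
      qed
      then show "\<exists>M. \<forall>n\<ge>M. norm ((\<integral>e. g (X (r n) e, V (r n) e) \<partial>measure_pmf (p (r n))) - 0) < e" by blast
    qed
    from LIMSEQ_unique[OF lim[OF cg] this] int[OF cg]
    show "has_bochner_integral \<mu>0 (\<lambda>(x, v). v \<bullet> D\<phi> x) 0"
      by (simp add: has_bochner_integral_iff g_def)
  qed
  have cL: "continuous_on UNIV (\<lambda>(x, v). L x v)"
    unfolding case_prod_unfold
    by (rule continuous_on_sequentiallyI) (intro L_tendsto tendsto_fst tendsto_snd)
  have "(\<integral>e. L (X n e) (V n e) \<partial>measure_pmf (p n)) = - c n" for n
  proof (rule p(2))
    have "(\<lambda>(i, j, l). L (tproj (grid_point (N n) i)) (discrete_velocity (N n) (\<tau> n) i j l) * \<mu> n i j l)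
       = (\<lambda>e. L (X n e) (V n e) * w n e)" by (auto simp: X_def V_def w_def)
    then show "((\<lambda>e. L (X n e) (V n e) * w n e) has_sum (- c n)) (A n)"
      using discrete_mather_action[OF N \<tau>_pos wk m, of n] by (simp add: A_def)
  qed
  then have "(\<lambda>n. - c (r n)) \<longlonglongrightarrow> (\<integral>(x, v). L x v \<partial>\<mu>0)" using lim[OF cL] by simp
  moreover have "(\<lambda>n. - c (r n)) \<longlonglongrightarrow> - \<alpha>"
    using tendsto_minus[OF LIMSEQ_subseq_LIMSEQ[OF c_lim r]] by (simp add: o_def)
  ultimately have "(\<integral>(x, v). L x v \<partial>\<mu>0) = - \<alpha>" by (rule LIMSEQ_unique)
  then have act: "action L \<mu>0 = ereal (- \<alpha>)" using int[OF cL] by (simp add: action_def)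
  have mm: "mather_measure L \<mu>0"
    unfolding mather_measure_def using closed act closed_measure_action_ge by simp
  have "\<exists>n. \<exists>i\<in>grid_index (N n). \<exists>j\<in>grid_index (N n). \<exists>l. \<mu> n i j l > 0 \<and>
      (tproj (grid_point (N n) i), discrete_velocity (N n) (\<tau> n) i j l) \<in> O'"
    if O: "open O'" and pos: "emeasure \<mu>0 O' > 0" for O'
  proof -
    \<comment> \<open>A continuous function positive exactly on the open set. The whole space is
      treated separately because \<open>infdist\<close> to the empty set is 0 by convention.\<close>
    define g where "g z = (if O' = UNIV then 1 else min 1 (infdist z (- O')))" for z
    have cg: "continuous_on UNIV g" unfolding g_def[abs_def]
      by (cases "O' = UNIV") (auto intro!: continuous_intros)
    have g0: "g z \<ge> 0" for z by (simp add: g_def infdist_nonneg)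
    have gO: "g z > 0 \<longleftrightarrow> z \<in> O'" for z
    proof (cases "O' = UNIV")
      case False
      then have ne: "- O' \<noteq> {}" by blast
      have "closed (- O')" by (rule closed_Compl[OF O])
      then have "infdist z (- O') = 0 \<longleftrightarrow> z \<in> - O'" using in_closed_iff_infdist_zero[OF _ ne] by blast
      then show ?thesis using False infdist_nonneg[of z "- O'"] by (auto simp: g_def)
    qed (simp add: g_def)
    have "(\<integral>z. g z \<partial>\<mu>0) > 0"
    proof (rule ccontr)
      assume "\<not> ?thesis"
      moreover have "(\<integral>z. g z \<partial>\<mu>0) \<ge> 0" using g0 by (simp add: integral_nonneg_AE)
      ultimately have "(\<integral>z. g z \<partial>\<mu>0) = 0" by simp
      then have "AE z in \<mu>0. g z = 0"
        using integral_nonneg_eq_0_iff_AE[OF int[OF cg]] g0 by simp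
      then have ae: "AE z in \<mu>0. z \<notin> O'" by (rule eventually_mono) (metis gO less_irrefl)
      have OS: "O' \<in> sets \<mu>0" using O sets by simp
      have sp: "{z \<in> space \<mu>0. \<not> z \<notin> O'} = O'" using sets_eq_imp_space_eq[OF sets] by auto
      have "emeasure \<mu>0 O' = 0" using AE_iff_measurable[OF OS sp] ae by simp
      with pos show False by simp
    qed
    from order_tendstoD(1)[OF lim[OF cg] this]
    obtain n where n: "(\<integral>e. g (X (r n) e, V (r n) e) \<partial>measure_pmf (p (r n))) > 0"
      unfolding eventually_sequentially by blast
    have "\<exists>e\<in>F (r n). g (X (r n) e, V (r n) e) > 0"
    proof (rule ccontr)
      assume "\<not> ?thesis"
      then have "AE e in measure_pmf (p (r n)). g (X (r n) e, V (r n) e) = 0"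
        unfolding AE_measure_pmf_iff p using g0 by (metis antisym not_less)
      then have "(\<integral>e. g (X (r n) e, V (r n) e) \<partial>measure_pmf (p (r n))) = 0"
        by (subst integral_cong_AE[of _ _ "\<lambda>_. 0"]) auto
      with n show False by simp
    qed
    then obtain e where e: "e \<in> F (r n)" "(X (r n) e, V (r n) e) \<in> O'" using gO by blast
    obtain i j l where "e = (i, j, l)" by (metis surj_pair)
    with e show ?thesis by (intro exI[of _ "r n"]) (auto simp: F_def A_def w_def X_def V_def)
  qed
  with mm show ?thesis by (rule that)
qed

end

section \<open>Kuratowski convergence\<close>

context tonelli_lift
begin

lemma weak_kam_limit_subsequence:
  assumes N: "\<And>n. N n \<ge> 1" and \<tau>: "\<And>n. \<tau> n > 0" "\<tau> \<longlonglongrightarrow> 0" and C: "C > 0"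
    and mesh: "\<And>n. 1 / real (N n) \<le> C * (\<tau> n)\<^sup>2"
  shows "\<exists>s c U u \<alpha>. strict_mono s \<and> weak_kam_limit H Hp (N \<circ> s) (\<tau> \<circ> s) c U C u \<alpha>"
proof -
  \<comment> \<open>On this tail \<open>C * \<tau> n \<le> 1\<close>, so the quadratic mesh
    condition also gives the linear one \<open>1 / N \<le> \<tau>\<close>.\<close>
  have "\<forall>\<^sub>F n in sequentially. \<tau> n < min 1 (1 / C)" by (rule order_tendstoD(2)[OF \<tau>(2)]) (use C in simp)
  then obtain n0 where n0: "\<And>n. n \<ge> n0 \<Longrightarrow> \<tau> n < min 1 (1 / C)" unfolding eventually_sequentially by blast
  define s where "s n = n + n0" for n
  have s: "strict_mono s" by (simp add: s_def strict_mono_def)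
  have \<tau>s: "\<tau> (s n) \<le> 1" "C * \<tau> (s n) \<le> 1" for n
    using n0[of "s n"] C by (auto simp: s_def field_simps)
  have "\<exists>c U. weak_kam_grid L (N (s n)) (\<tau> (s n)) c U" for n
    by (rule weak_kam_grid_exists[OF N \<tau>(1)])
  then obtain c U where cU: "\<And>n. weak_kam_grid L (N (s n)) (\<tau> (s n)) (c n) (U n)" by metis
  interpret S: weak_kam_sequence H Hp "N \<circ> s" "\<tau> \<circ> s" c U C
  proof unfold_locales
    show "(\<tau> \<circ> s) \<longlonglongrightarrow> 0" using LIMSEQ_subseq_LIMSEQ[OF \<tau>(2) s] .
    show "1 / real ((N \<circ> s) n) \<le> (\<tau> \<circ> s) n" for n
    proof -
      have "C * (\<tau> (s n))\<^sup>2 = (C * \<tau> (s n)) * \<tau> (s n)" by (simp add: power2_eq_square)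
      also have "\<dots> \<le> 1 * \<tau> (s n)" using \<tau>s(2)[of n] \<tau>(1)[of "s n"] by (intro mult_right_mono) auto
      finally show ?thesis using mesh[of "s n"] by simp
    qed
  qed (use N \<tau> \<tau>s mesh C cU in \<open>auto simp: less_imp_le\<close>)
  obtain r u \<alpha> where r: "strict_mono r" "weak_kam_limit H Hp (N \<circ> s \<circ> r) (\<tau> \<circ> s \<circ> r) (c \<circ> r) (U \<circ> r) C u \<alpha>"
    using S.weak_kam_limit_exists by blast
  have "strict_mono (s \<circ> r)" using s r(1) by (rule strict_mono_o)
  with r(2) show ?thesis unfolding comp_assoc by blast
qed

text \<open>Every discrete Mather measure is calibrated by every grid solution. The chains through
  the chosen edges can therefore be built after the subsequence along which the solutions converge
  has been fixed, and they are calibrated by those very solutions.\<close>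

lemma discrete_mather_limit_in_mane_set:
  assumes N: "\<And>n. N n \<ge> 1" and \<tau>: "\<And>n. \<tau> n > 0" "\<tau> \<longlonglongrightarrow> 0" and C: "C > 0"
    and mesh: "\<And>n. 1 / real (N n) \<le> C * (\<tau> n)\<^sup>2"
    and z: "\<And>n. z n \<in> discrete_mather_set L (N n) (\<tau> n)" and zlim: "z \<longlonglongrightarrow> z0"
  shows "z0 \<in> mane_set H"
proof -
  define S where "S n = {(\<mu>, i, j, l). discrete_mather_measure L (N n) (\<tau> n) \<mu> \<and>
      i \<in> grid_index (N n) \<and> j \<in> grid_index (N n) \<and> \<mu> i j l > 0}" for n
  define pt where "pt n = (\<lambda>(\<mu> :: nat ^ 'd \<Rightarrow> nat ^ 'd \<Rightarrow> int ^ 'd \<Rightarrow> real, i, j, l).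
      (tproj (grid_point (N n) i) :: 'd torus, discrete_velocity (N n) (\<tau> n) i j l))" for n
  \<comment> \<open>The discrete Mather set is a closure, so its points are replaced by genuinely
    charged edges at a vanishing distance.\<close>
  have "\<forall>n. \<exists>Q. Q \<in> S n \<and> dist (pt n Q) (z n) < 1 / real (Suc n)"
  proof
    fix n
    have "1 / real (Suc n) > 0" by simp
    from z[of n, unfolded discrete_mather_set_def closure_approachable, rule_format, OF this]
    obtain \<mu> i j l where "discrete_mather_measure L (N n) (\<tau> n) \<mu>" "i \<in> grid_index (N n)" "j \<in> grid_index (N n)" "\<mu> i j l > 0"
      "dist (tproj (grid_point (N n) i), discrete_velocity (N n) (\<tau> n) i j l) (z n) < 1 / real (Suc n)"
      by blast
    then show "\<exists>Q. Q \<in> S n \<and> dist (pt n Q) (z n) < 1 / real (Suc n)"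
      by (intro exI[of _ "(\<mu>, i, j, l)"]) (simp add: S_def pt_def)
  qed
  from choice[OF this] obtain Q where Q: "\<And>n. Q n \<in> S n" "\<And>n. dist (pt n (Q n)) (z n) < 1 / real (Suc n)"
    by blast
  define \<mu> i j l y where "\<mu> n = fst (Q n)" and "i n = fst (snd (Q n))" and "j n = fst (snd (snd (Q n)))"
    and "l n = snd (snd (snd (Q n)))" and "y n = pt n (Q n)" for n
  have y: "dist (y n) (z n) < 1 / real (Suc n)" "discrete_mather_measure L (N n) (\<tau> n) (\<mu> n)"
    "i n \<in> grid_index (N n)" "j n \<in> grid_index (N n)" "\<mu> n (i n) (j n) (l n) > 0"
    "y n = (tproj (grid_point (N n) (i n)), discrete_velocity (N n) (\<tau> n) (i n) (j n) (l n))" for n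
    using Q[of n] by (auto simp: S_def pt_def \<mu>_def i_def j_def l_def y_def split: prod.splits)
  have ylim: "y \<longlonglongrightarrow> z0"
  proof (rule tendsto_dist_iff[THEN iffD2],
      rule real_tendsto_sandwich[where f = "\<lambda>_. 0" and h = "\<lambda>n. 1 / real (Suc n) + dist (z n) z0"])
    have "(\<lambda>n. 1 / real (Suc n) + dist (z n) z0) \<longlonglongrightarrow> 0 + dist z0 z0"
      by (rule tendsto_add[OF LIMSEQ_Suc[OF lim_1_over_n] tendsto_dist[OF zlim tendsto_const]])
    then show "(\<lambda>n. 1 / real (Suc n) + dist (z n) z0) \<longlonglongrightarrow> 0" by simp
    show "\<forall>\<^sub>F n in sequentially. dist (y n) z0 \<le> 1 / real (Suc n) + dist (z n) z0"
    proof (intro always_eventually allI)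
      fix n show "dist (y n) z0 \<le> 1 / real (Suc n) + dist (z n) z0"
        using dist_triangle[of "y n" z0 "z n"] y(1)[of n] by linarith
    qed
  qed auto
  define g where "g n = (grid_point (N n) (i n) :: real ^ 'd)" for n
  have "g n \<in> cbox 0 1" for n
    using y(3)[of n] N[of n] by (auto simp: g_def grid_point_def grid_index_def mem_box_cart less_imp_le)
  \<comment> \<open>Convergence on the torus does not give convergence of lifts; the representatives
    in the unit cube do converge along a subsequence.\<close>
  then have "bounded (range g)" by (intro bounded_subset[OF bounded_cbox]) auto
  then obtain a0 q where q: "strict_mono (q :: nat \<Rightarrow> nat)" "(g \<circ> q) \<longlonglongrightarrow> a0"
    using bounded_imp_convergent_subsequence by blast
  obtain s c U u \<alpha> where s: "strict_mono (s :: nat \<Rightarrow> nat)"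
    and lim: "weak_kam_limit H Hp (N \<circ> q \<circ> s) (\<tau> \<circ> q \<circ> s) c U C u \<alpha>"
    using weak_kam_limit_subsequence[of "N \<circ> q" "\<tau> \<circ> q" C] N \<tau> C mesh LIMSEQ_subseq_LIMSEQ[OF \<tau>(2) q(1)]
    by (auto simp: comp_assoc)
  define k where "k n = q (s n)" for n
  interpret W: weak_kam_limit H Hp "N \<circ> q \<circ> s" "\<tau> \<circ> q \<circ> s" c U C u \<alpha> by (rule lim)
  have wk: "weak_kam_grid L (N (k n)) (\<tau> (k n)) (c n) (U n)" for n using W.wk[of n] by (simp add: k_def)
  have sk: "strict_mono k" using strict_mono_o[OF q(1) s] by (simp add: k_def[abs_def] o_def)
  have "\<forall>n. \<exists>x :: int \<Rightarrow> real ^ 'd. (\<forall>m. x m \<in> grid (N (k n))) \<and>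
      (\<forall>m. calibrated_step L (\<tau> (k n)) (c n) (U n) (x m) (x (m + 1))) \<and>
      x 0 = g (k n) \<and> x 1 = grid_point (N (k n)) (j (k n)) + lattice_vec (l (k n))"
    unfolding g_def by (intro allI discrete_mather_chain[OF N \<tau>(1) wk y(2) y(3) y(4) y(5)])
  from choice[OF this] obtain x where x: "\<And>n m. x n m \<in> grid (N (k n))"
    "\<And>n m. calibrated_step L (\<tau> (k n)) (c n) (U n) (x n m) (x n (m + 1 :: int))"
    "\<And>n. x n 0 = g (k n)" "\<And>n. x n 1 = grid_point (N (k n)) (j (k n)) + lattice_vec (l (k n))" by blast
  have x0: "(\<lambda>n. x n 0) \<longlonglongrightarrow> a0" using LIMSEQ_subseq_LIMSEQ[OF q(2) s] by (simp add: x(3) k_def o_def)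
  have yk: "(\<lambda>n. y (k n)) \<longlonglongrightarrow> z0" using LIMSEQ_subseq_LIMSEQ[OF ylim sk] by (simp add: o_def)
  have "(x n 1 - x n 0) /\<^sub>R \<tau> (k n) = snd (y (k n))" for n
    by (simp add: x(3) x(4) y(6) discrete_velocity_eq g_def)
  then have v0: "(\<lambda>n. (x n 1 - x n 0) /\<^sub>R \<tau> (k n)) \<longlonglongrightarrow> snd z0" using tendsto_snd[OF yk] by simp
  have "(\<lambda>n. tproj (x n 0)) \<longlonglongrightarrow> fst z0" using tendsto_fst[OF yk] by (simp add: x(3) y(6) g_def)
  then have a0: "tproj a0 = fst z0" using tproj_tendsto[OF x0] LIMSEQ_unique by blast
  obtain \<gamma> where \<gamma>: "calibrated u L \<alpha> \<gamma>" "\<gamma> 0 = tproj a0" "has_velocity \<gamma> (snd z0) 0"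
    using W.calibrated_chain_limit[of x a0 "snd z0"] x(1,2) x0 v0 by (auto simp: k_def)
  have "z0 = (\<gamma> 0, snd z0)" using \<gamma>(2) a0 by simp
  then have "z0 \<in> mane_I H u"
    using \<gamma>(1,3) unfolding mane_I_def W.critical_value_u by blast
  then show ?thesis
    unfolding mane_set_def using W.viscosity_solution_u W.critical_value_u by auto
qed

lemma discrete_mather_set_nonempty:
  assumes N: "N \<ge> 1" and \<tau>: "\<tau> > 0" shows "discrete_mather_set L N \<tau> \<noteq> {}"
proof -
  obtain c U where wk: "weak_kam_grid L N \<tau> c U" using weak_kam_grid_exists[OF N \<tau>] by blast
  obtain \<mu> where m: "discrete_mather_measure L N \<tau> \<mu>" using discrete_mather_exists[OF N \<tau> wk] by blast
  have h: "holonomic N \<mu>" using m by (simp add: discrete_mather_measure_def)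
  have "\<exists>i\<in>grid_index N. \<exists>j\<in>grid_index N. \<exists>l. \<mu> i j l > 0"
  proof (rule ccontr)
    assume no: "\<not> ?thesis"
    have "((\<lambda>(i, j, l). \<mu> i j l) has_sum 0) (edges N)"
    proof (rule has_sum_0, clarify)
      fix i j :: "nat ^ 'd" and l assume "i \<in> grid_index N" "j \<in> grid_index N"
      then have "\<mu> i j l \<ge> 0" "\<not> \<mu> i j l > 0" using no holonomic_nonneg[OF h] by auto
      then show "\<mu> i j l = 0" by simp
    qed
    moreover have "((\<lambda>(i, j, l). \<mu> i j l) has_sum 1) (edges N)" using h by (simp add: holonomic_def)
    ultimately show False using has_sum_unique by fastforce
  qed
  then show ?thesis
    using m closure_subset unfolding discrete_mather_set_def by blast
qed

text \<open>By uniqueness, the Mather measure whose support comes close to \<open>z\<close> is the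
  weak limit of the discrete ones, so nearby open sets contain charged edges. Only a single index
  \<open>n\<close> is produced; since the hypotheses pass to subsequences, this is as strong as
  approximation for all large \<open>n\<close>.\<close>

lemma mather_set_approximated:
  assumes N: "\<And>n. N n \<ge> 1" and \<tau>: "\<And>n. \<tau> n > 0" "\<tau> \<longlonglongrightarrow> 0" and C: "C > 0"
    and mesh: "\<And>n. 1 / real (N n) \<le> C * (\<tau> n)\<^sup>2"
    and unique: "\<And>\<mu> \<nu>. mather_measure L \<mu> \<Longrightarrow> mather_measure L \<nu> \<Longrightarrow> \<mu> = \<nu>"
    and z: "z \<in> mather_set L" and e: "e > 0"
  shows "\<exists>n. \<exists>w\<in>discrete_mather_set L (N n) (\<tau> n). dist w z < e"
proof -
  obtain s c U u \<alpha> where s: "strict_mono (s :: nat \<Rightarrow> nat)"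
    and lim: "weak_kam_limit H Hp (N \<circ> s) (\<tau> \<circ> s) c U C u \<alpha>"
    using weak_kam_limit_subsequence[OF N \<tau> C mesh] by blast
  interpret W: weak_kam_limit H Hp "N \<circ> s" "\<tau> \<circ> s" c U C u \<alpha> by (rule lim)
  have "\<exists>\<mu>. discrete_mather_measure L ((N \<circ> s) n) ((\<tau> \<circ> s) n) \<mu>" for n
    by (rule discrete_mather_exists[OF W.N W.\<tau>_pos W.wk])
  then obtain \<mu> where \<mu>: "\<And>n. discrete_mather_measure L ((N \<circ> s) n) ((\<tau> \<circ> s) n) (\<mu> n)" by metis
  obtain \<mu>0 where \<mu>0: "mather_measure L \<mu>0"
    "\<And>O'. open O' \<Longrightarrow> emeasure \<mu>0 O' > 0 \<Longrightarrow> \<exists>n. \<exists>i\<in>grid_index ((N \<circ> s) n). \<exists>j\<in>grid_index ((N \<circ> s) n). \<exists>l. \<mu> n i j l > 0 \<and>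
      (tproj (grid_point ((N \<circ> s) n) i), discrete_velocity ((N \<circ> s) n) ((\<tau> \<circ> s) n) i j l) \<in> O'"
    using W.discrete_mather_weak_limit[OF \<mu>] by blast
  obtain z' \<nu> where z': "mather_measure L \<nu>" "z' \<in> measure_support \<nu>" "dist z' z < e"
    using z e unfolding mather_set_def closure_approachable by blast
  have "\<nu> = \<mu>0" using unique z'(1) \<mu>0(1) by blast
  moreover have "z' \<in> ball z e" using z'(3) by (simp add: dist_commute)
  ultimately have "emeasure \<mu>0 (ball z e) > 0"
    using z'(2) open_ball unfolding measure_support_def by blast
  from \<mu>0(2)[OF open_ball this] obtain n i j l where w: "i \<in> grid_index (N (s n))" "j \<in> grid_index (N (s n))" "\<mu> n i j l > 0"
    "(tproj (grid_point (N (s n)) i), discrete_velocity (N (s n)) (\<tau> (s n)) i j l) \<in> ball z e" by auto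
  have "discrete_mather_measure L (N (s n)) (\<tau> (s n)) (\<mu> n)" using \<mu>[of n] by simp
  with w have "(tproj (grid_point (N (s n)) i), discrete_velocity (N (s n)) (\<tau> (s n)) i j l)
      \<in> (\<Union>\<mu>\<in>{\<mu>. discrete_mather_measure L (N (s n)) (\<tau> (s n)) \<mu>}.
       {(tproj (grid_point (N (s n)) i), discrete_velocity (N (s n)) (\<tau> (s n)) i j l) | i j l.
          i \<in> grid_index (N (s n)) \<and> j \<in> grid_index (N (s n)) \<and> \<mu> i j l > 0})"
    by blast
  then have "(tproj (grid_point (N (s n)) i), discrete_velocity (N (s n)) (\<tau> (s n)) i j l)
      \<in> discrete_mather_set L (N (s n)) (\<tau> (s n))"
    unfolding discrete_mather_set_def by (rule subsetD[OF closure_subset])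
  moreover have "dist (tproj (grid_point (N (s n)) i), discrete_velocity (N (s n)) (\<tau> (s n)) i j l) z < e"
    using w(4) by (simp add: dist_commute)
  ultimately show ?thesis by blast
qed

end

text \<open>Take almost nearest points of each set: within \<open>1 / (n + 1)\<close> of the
  distance, so that one sequence works for every \<open>e\<close>.\<close>

lemma kuratowski_liminf_infdist:
  fixes A :: "nat \<Rightarrow> 'a::metric_space set"
  assumes ne: "\<And>n. A n \<noteq> {}" and ev: "\<And>e. e > 0 \<Longrightarrow> \<forall>\<^sub>F n in sequentially. \<exists>w\<in>A n. dist w z < e"
  shows "z \<in> kuratowski_liminf A"
proof -
  have "\<exists>w\<in>A n. dist z w < infdist z (A n) + 1 / real (Suc n)" for n
  proof -
    have "(INF w\<in>A n. dist z w) < infdist z (A n) + 1 / real (Suc n)" using ne[of n] by (simp add: infdist_def)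
    from cInf_lessD[OF _ this] ne[of n] show ?thesis by auto
  qed
  then obtain w where w: "\<And>n. w n \<in> A n" "\<And>n. dist z (w n) < infdist z (A n) + 1 / real (Suc n)" by metis
  have "w \<longlonglongrightarrow> z"
  proof (rule tendstoI)
    fix e :: real assume e: "e > 0"
    have "\<forall>\<^sub>F n in sequentially. 1 / real (Suc n) < e / 2"
      using order_tendstoD(2)[OF LIMSEQ_Suc[OF lim_1_over_n[where 'a = real]], of "e / 2"] e by simp
    then show "\<forall>\<^sub>F n in sequentially. dist (w n) z < e"
      using ev[OF half_gt_zero[OF e]]
    proof eventually_elim
      case (elim n)
      then obtain v where v: "v \<in> A n" "dist v z < e / 2" by blast
      have "infdist z (A n) \<le> dist z v" by (rule infdist_le[OF v(1)])
      with v(2) elim(1) w(2)[of n] show ?case by (simp add: dist_commute)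
    qed
  qed
  with w(1) show ?thesis unfolding kuratowski_liminf_def by blast
qed

lemma kuratowski_liminf_subset_limsup: "kuratowski_liminf A \<subseteq> kuratowski_limsup A"
  unfolding kuratowski_liminf_def kuratowski_limsup_def
  using filterlim_ident by (intro subsetI CollectI) fastforce

theorem corollary5p5:
  fixes H :: "'d::finite torus \<Rightarrow> real ^ 'd \<Rightarrow> real"
    and N :: "nat \<Rightarrow> nat" and h \<tau> :: "nat \<Rightarrow> real" and C :: real
  assumes "tonelli H"
    and "\<And>n. N n \<ge> 1" and "\<And>n. h n = 1 / real (N n)"
    and "\<And>n. \<tau> n > 0" and "\<tau> \<longlonglongrightarrow> 0"
    and "C > 0" and "\<And>n. h n \<le> C * (\<tau> n)\<^sup>2"
    and "\<exists>!\<mu>. mather_measure (lagrangian H) \<mu>"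
    and "mane_set H = mather_set (lagrangian H)"
  shows "kuratowski_converges (\<lambda>n. discrete_mather_set (lagrangian H) (N n) (\<tau> n))
           (mather_set (lagrangian H))"
proof -
  obtain Hp where "tonelli_lift H Hp"
    using tonelli_regular[OF assms(1)] unfolding tonelli_lift_def by metis
  then interpret tonelli_lift H Hp .
  define A where "A n = discrete_mather_set L (N n) (\<tau> n)" for n
  have mesh: "1 / real (N n) \<le> C * (\<tau> n)\<^sup>2" for n using assms(3,7) by metis
  have unique: "\<mu> = \<nu>" if "mather_measure L \<mu>" "mather_measure L \<nu>" for \<mu> \<nu> using assms(8) that by blast
  have "kuratowski_limsup A \<subseteq> mather_set L"
  proof
    fix z assume "z \<in> kuratowski_limsup A"
    then obtain k w where k: "filterlim k at_top sequentially" and w: "\<And>j. w j \<in> A (k j)" "w \<longlonglongrightarrow> z"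
      unfolding kuratowski_limsup_def by blast
    \<comment> \<open>The indices \<open>k j\<close> tend to infinity without being monotone; this
      suffices for the time steps along them to tend to 0.\<close>
    have "z \<in> mane_set H"
    proof (rule discrete_mather_limit_in_mane_set[of "\<lambda>j. N (k j)" "\<lambda>j. \<tau> (k j)" C w])
      show "(\<lambda>j. \<tau> (k j)) \<longlonglongrightarrow> 0" using assms(5) k by (rule filterlim_compose)
    qed (use assms(2,4,6) mesh w in \<open>auto simp: A_def\<close>)
    then show "z \<in> mather_set L" using assms(9) by simp
  qed
  moreover have "mather_set L \<subseteq> kuratowski_liminf A"
  proof
    fix z assume z: "z \<in> mather_set L"
    show "z \<in> kuratowski_liminf A"
    proof (rule kuratowski_liminf_infdist)
      show "A n \<noteq> {}" for n unfolding A_def by (rule discrete_mather_set_nonempty[OF assms(2,4)])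
      fix e :: real assume e: "e > 0"
      show "\<forall>\<^sub>F n in sequentially. \<exists>w\<in>A n. dist w z < e"
      proof (rule ccontr)
        \<comment> \<open>Failure at infinitely many indices yields a subsequence none of whose sets
          comes within \<open>e\<close> of \<open>z\<close>, contradicting the approximation along
          that subsequence.\<close>
        assume "\<not> ?thesis"
        then have "\<exists>\<^sub>F n in sequentially. \<not> (\<exists>w\<in>A n. dist w z < e)" by (simp add: not_eventually)
        then have "infinite {n. \<not> (\<exists>w\<in>A n. dist w z < e)}"
          by (simp add: frequently_cofinite flip: cofinite_eq_sequentially)
        then obtain q :: "nat \<Rightarrow> nat" where q: "strict_mono q" "\<And>n. q n \<in> {n. \<not> (\<exists>w\<in>A n. dist w z < e)}"
          using infinite_enumerate by blast
        have "\<exists>n. \<exists>w\<in>discrete_mather_set L ((N \<circ> q) n) ((\<tau> \<circ> q) n). dist w z < e"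
          by (rule mather_set_approximated[OF _ _ LIMSEQ_subseq_LIMSEQ[OF assms(5) q(1)] assms(6) _ unique z e])
            (use assms(2,4) mesh in auto)
        then show False using q(2) by (auto simp: A_def)
      qed
    qed
  qed
  ultimately have "kuratowski_limsup A = mather_set L \<and> kuratowski_liminf A = mather_set L"
    using kuratowski_liminf_subset_limsup[of A] by blast
  then show ?thesis unfolding kuratowski_converges_def A_def[abs_def] by simp
qed

end
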